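(* There is an algorithm that, when given a positive integer $k$, a list of $k$ distinct linear polynomials over the integers with positive leading coefficients, $P=(f_1(x),\ldots,f_k(x))$ (the pattern), and a search bound $n$, finds all integers $x$ such that $\max\{f_i(x)\}\le n$ and all the values $f_1(x),\ldots,f_k(x)$ are prime. This algorithm uses at most $O_P\big(n/(\log\log n)^k\big)$ arithmetic operations and $O(k\sqrt{n})$ bits of space.
   Context: Model of computation: a random access machine with direct-access memory addressable at the bit or word level, with word size $\Theta(\log n)$ bits; arithmetic operations on integers of $O(\log n)$ bits, memory accesses, comparisons and other basic operations each cost constant time. Space is counted in bits and does not include the space of the output. The notation $O_P(\cdot)$ means the implied constant may depend on the pattern $P$ (including $k$). *)

theory Defs
  imports
    Complex_Main
    "HOL-Library.Log_Nat"
    "HOL-Computational_Algebra.Polynomial"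
    "HOL-Computational_Algebra.Primes"
begin

section \<open>A random access machine with words of \<open>w\<close> bits\<close>

datatype arith_op = Add | Sub | Mul | Div | Mod

datatype comparison = Equal | Less_Than

text \<open>
  The type parameter stands for registers, so that the set function \<open>registers\<close> of the datatype
  yields the registers named by an instruction. In the memory instructions, the register holding
  the address is the second argument of a load and the first argument of a store.
\<close>

datatype (registers: 'r) instr =
    Const 'r int
  | Move 'r 'r
  | Arith arith_op 'r 'r 'r
  | Load_Word 'r 'r
  | Store_Word 'r 'r
  | Load_Bit 'r 'r
  | Store_Bit 'r 'r
  | Jump nat
  | Branch comparison 'r 'r nat
  | Output 'r
  | Halt

type_synonym program = "nat instr list"

text \<open>
  The memory is an array of bits. Word \<open>j\<close> consists of the bits \<open>w * j, \<dots>, w * j + w - 1\<close>, least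
  significant bit first, and is read as an integer in two's complement. The field \<open>used\<close> is one
  more than the largest bit address that holds input or has been accessed. The output is write-only.
\<close>

record config =
  pc :: nat
  reg :: "nat \<Rightarrow> int"
  mem :: "nat \<Rightarrow> bool"
  used :: nat
  out :: "int list"

definition fits :: "nat \<Rightarrow> int \<Rightarrow> bool" where
  "fits w v \<longleftrightarrow> - (2 ^ (w - 1)) \<le> v \<and> v < 2 ^ (w - 1)"

definition get_word :: "nat \<Rightarrow> (nat \<Rightarrow> bool) \<Rightarrow> nat \<Rightarrow> int" where
  "get_word w m j = signed_take_bit (w - 1) (horner_sum of_bool 2 (map m [w * j..<w * j + w]))"

definition put_word :: "nat \<Rightarrow> (nat \<Rightarrow> bool) \<Rightarrow> nat \<Rightarrow> int \<Rightarrow> nat \<Rightarrow> bool" where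
  "put_word w m j v = (\<lambda>i. if i div w = j then bit v (i mod w) else m i)"

definition init :: "nat \<Rightarrow> int list \<Rightarrow> config" where
  "init w xs =
    \<lparr>pc = 0, reg = (\<lambda>_. 0),
     mem = (\<lambda>i. i div w < length xs \<and> bit (xs ! (i div w)) (i mod w)),
     used = w * length xs, out = []\<rparr>"

fun arith :: "arith_op \<Rightarrow> int \<Rightarrow> int \<Rightarrow> int option" where
  "arith Add x y = Some (x + y)"
| "arith Sub x y = Some (x - y)"
| "arith Mul x y = Some (x * y)"
| "arith Div x y = (if y = 0 then None else Some (x div y))"
| "arith Mod x y = (if y = 0 then None else Some (x mod y))"

fun holds :: "comparison \<Rightarrow> int \<Rightarrow> int \<Rightarrow> bool" where
  "holds Equal x y \<longleftrightarrow> x = y"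
| "holds Less_Than x y \<longleftrightarrow> x < y"

definition next_pc :: "config \<Rightarrow> config" where
  "next_pc s = s\<lparr>pc := Suc (pc s)\<rparr>"

definition assign :: "nat \<Rightarrow> nat \<Rightarrow> int \<Rightarrow> config \<Rightarrow> config option" where
  "assign w r v s = (if fits w v then Some (next_pc (s\<lparr>reg := (reg s)(r := v)\<rparr>)) else None)"

definition touch :: "nat \<Rightarrow> config \<Rightarrow> config" where
  "touch b s = s\<lparr>used := max (used s) b\<rparr>"

text \<open>
  \<open>None\<close> means that the machine cannot proceed: it has halted, or a fault has occurred (a value
  that does not fit into a word, a division by zero, a negative address, or a jump out of the
  program).
\<close>

fun exec :: "nat \<Rightarrow> nat instr \<Rightarrow> config \<Rightarrow> config option" where
  "exec w (Const r v) s = assign w r v s"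
| "exec w (Move r q) s = assign w r (reg s q) s"
| "exec w (Arith f r p q) s = Option.bind (arith f (reg s p) (reg s q)) (\<lambda>v. assign w r v s)"
| "exec w (Load_Word r a) s =
    (if reg s a < 0 then None
     else let j = nat (reg s a) in assign w r (get_word w (mem s) j) (touch (w * Suc j) s))"
| "exec w (Store_Word a r) s =
    (if reg s a < 0 then None
     else let j = nat (reg s a) in
       Some (next_pc (touch (w * Suc j) (s\<lparr>mem := put_word w (mem s) j (reg s r)\<rparr>))))"
| "exec w (Load_Bit r a) s =
    (if reg s a < 0 then None
     else let i = nat (reg s a) in assign w r (of_bool (mem s i)) (touch (Suc i) s))"
| "exec w (Store_Bit a r) s =
    (if reg s a < 0 then None
     else let i = nat (reg s a) in
       Some (next_pc (touch (Suc i) (s\<lparr>mem := (mem s)(i := (reg s r \<noteq> 0))\<rparr>))))"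
| "exec w (Jump l) s = Some (s\<lparr>pc := l\<rparr>)"
| "exec w (Branch c p q l) s =
    Some (if holds c (reg s p) (reg s q) then s\<lparr>pc := l\<rparr> else next_pc s)"
| "exec w (Output r) s = Some (next_pc (s\<lparr>out := out s @ [reg s r]\<rparr>))"
| "exec w Halt s = None"

definition step :: "nat \<Rightarrow> program \<Rightarrow> config \<Rightarrow> config option" where
  "step w p s = (if pc s < length p then exec w (p ! pc s) s else None)"

definition halts :: "nat \<Rightarrow> program \<Rightarrow> int list \<Rightarrow> nat \<Rightarrow> config \<Rightarrow> bool" where
  "halts w p xs t s \<longleftrightarrow>
    ((\<lambda>c. Option.bind c (step w p)) ^^ t) (Some (init w xs)) = Some s \<and>
    pc s < length p \<and> p ! pc s = Halt"

text \<open>The space in bits: the memory, including the input, and the registers.\<close>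

definition space_bits :: "nat \<Rightarrow> program \<Rightarrow> config \<Rightarrow> nat" where
  "space_bits w p s = used s + w * card (\<Union> (registers ` set p))"


section \<open>Primes in patterns\<close>

definition is_pattern :: "nat \<Rightarrow> int poly list \<Rightarrow> bool" where
  "is_pattern k P \<longleftrightarrow>
    0 < k \<and> length P = k \<and> distinct P \<and> (\<forall>f\<in>set P. degree f = 1 \<and> 0 < lead_coeff f)"

definition pattern_primes :: "int poly list \<Rightarrow> nat \<Rightarrow> int set" where
  "pattern_primes P n =
    {x. Max ((\<lambda>f. poly f x) ` set P) \<le> int n \<and> (\<forall>f\<in>set P. prime (poly f x))}"

definition pattern_input :: "nat \<Rightarrow> int poly list \<Rightarrow> nat \<Rightarrow> int list" where
  "pattern_input k P n = int n # int k # concat (map (\<lambda>f. [coeff f 1, coeff f 0]) P)"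

text \<open>
  \<open>c\<close> times the largest binary length of an input integer. For a fixed pattern this is
  \<open>\<Theta>(log n)\<close>; taking the maximum over all input integers makes the input fit into words
  also when \<open>n\<close> is small compared with the coefficients.
\<close>

definition word_size :: "nat \<Rightarrow> int list \<Rightarrow> nat" where
  "word_size c xs = c * Max ((\<lambda>v. floorlog 2 (nat \<bar>v\<bar>)) ` set xs)"

end

theory Submission
 imports
  "HOL-Number_Theory.Number_Theory"
  "HOL-Computational_Algebra.Squarefree"
  "HOL-Computational_Algebra.Polynomial"
  Defs
begin

text \<open>
 An Atkin--Bernstein style segmented sieve. An odd squarefree \<open>m > 1\<close> is prime iff the number of
 representations of \<open>m\<close> by a binary quadratic form chosen by \<open>m mod 8\<close> is odd; so on a segment of
 about \<open>sqrt n\<close> candidates one bit per candidate is flipped for every lattice point, and the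
 multiples of squares are cleared. The candidates are restricted to the residue classes modulo a
 wheel \<open>W\<close>, eight times the product of the odd primes below \<open>d\<close>, on which no \<open>f\<^sub>i\<close> has a common
 factor with \<open>W\<close>; within such a class only the lattice points in a matching class modulo \<open>W\<close> are
 visited. Euler products bound the number of admissible classes, weighted by the number of lattice
 points classes per value, by \<open>O(W\<^sup>2 / (log d)^k)\<close>. With \<open>W\<close> about \<open>n^(1/16)\<close> one has \<open>log d\<close> of
 order \<open>log log n\<close>. The program is written in a small structured language, whose compilation to
 the machine preserves time, space and the absence of overflow.
\<close>

section \<open>Square roots modulo an odd number\<close>

text \<open>The parity criterion holds because the representations of \<open>m\<close> are half as
  many as the square roots of \<open>-1\<close>, \<open>-2\<close> or \<open>2\<close> modulo
  \<open>m\<close>, and root counts multiply over coprime factors, each of them even. The form for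
  \<open>m mod 8 = 7\<close> comes from the indefinite \<open>2 y^2 - x^2\<close>; a shear makes its
  coefficients nonnegative, so that all three forms increase in both coordinates and can be swept
  alike. The obstacle is the number of lattice point classes per value, about \<open>W\<close> times
  the product of \<open>1 - \<chi>(p) / p\<close>. It is never bounded alone: one of the
  \<open>k\<close> products of \<open>1 - 1 / p\<close> is paired with it, and the nonnegativity of
  the convolution of 1 with \<chi> bounds the pair by \<open>5 / ln d\<close>. The exponent 16
  leaves room: with \<open>H\<close> about \<open>n^(1/16)\<close>, \<open>W \<le> H\<close> and
  segments of \<open>T = H^8\<close> candidates, work of order \<open>W^2\<close> per segment
  disappears in \<open>T\<close>. The program cannot read off the word size, so its bit array begins
  at an address computed from \<open>H\<close> and \<open>k\<close> that is certain to lie behind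
  the input.\<close>

definition roots_mod :: "int \<Rightarrow> int \<Rightarrow> int set" where
 "roots_mod c m = {h \<in> {0..<m}. m dvd h\<^sup>2 - c}"

lemma finite_roots_mod [simp]: "finite (roots_mod c m)"
 by (rule finite_subset[of _ "{0..<m}"]) (auto simp: roots_mod_def)

lemma mod_square_dvd_iff: "m dvd (h mod m)\<^sup>2 - c \<longleftrightarrow> m dvd h\<^sup>2 - (c :: int)"
 by (simp add: mod_eq_dvd_iff[symmetric] power_mod)

lemma roots_mod_mod: "0 < m \<Longrightarrow> m dvd h\<^sup>2 - c \<Longrightarrow> h mod m \<in> roots_mod c m"
 unfolding roots_mod_def by (simp add: mod_square_dvd_iff)

lemma roots_mod_minus:
 assumes "0 < m" "h \<in> roots_mod c m"
 shows "(- h) mod m \<in> roots_mod c m"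
 using assms by (intro roots_mod_mod) (auto simp: roots_mod_def)

lemma minus_not_cong:
 fixes h m :: int
 assumes "odd m" "1 < m" "coprime c m" "m dvd h\<^sup>2 - c"
 shows "\<not> m dvd h - (- h)"
proof
 assume "m dvd h - (- h)"
 then have "m dvd 2 * h"
  by simp
 with \<open>odd m\<close> have "m dvd h"
  by (simp add: coprime_dvd_mult_right_iff coprime_commute)
 then have "m dvd h\<^sup>2"
  by (simp add: power2_eq_square)
 from dvd_diff[OF this assms(4)] have "m dvd c"
  by simp
 from coprime_common_divisor[OF assms(3) this dvd_refl] have "is_unit m" .
 with assms(2) show False
  by simp
qed

lemma even_card_involution:
 assumes "finite A" "\<And>x. x \<in> A \<Longrightarrow> f x \<in> A" "\<And>x. x \<in> A \<Longrightarrow> f (f x) = x"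
  and "\<And>x. x \<in> A \<Longrightarrow> f x \<noteq> x"
 shows "even (card A)"
 using assms
proof (induction "card A" arbitrary: A rule: less_induct)
 case less
 show ?case
 proof (cases "A = {}")
  case False
  then obtain x where x: "x \<in> A" by blast
  let ?A = "A - {x, f x}"
  have fx: "f x \<in> A" "f x \<noteq> x"
   using less.prems x by blast+
  have two: "card {x, f x} = 2" "{x, f x} \<subseteq> A"
   using fx x by auto
  then have card: "card ?A + 2 = card A"
   using less.prems(1) card_mono[OF less.prems(1) two(2)] by (simp add: card_Diff_subset)
  have "even (card ?A)"
  proof (rule less.hyps)
   show "f y \<in> ?A" if "y \<in> ?A" for y
    using that less.prems(2,3) x fx by (metis DiffE DiffI insertCI insertE singletonD)
  qed (use less.prems card in auto)
  with card show ?thesis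
   by (metis even_add even_numeral)
 qed simp
qed

text \<open>Negation pairs the roots without fixed points: a root with \<open>m\<close> dividing
  \<open>2 * h\<close> would make \<open>m\<close> divide \<open>c\<close>. Applied to two coprime
  factors, this evenness gives a root count divisible by 4.\<close>

lemma even_card_roots_mod:
 assumes "odd m" "1 < m" "coprime c m"
 shows "even (card (roots_mod c m))"
proof (rule even_card_involution[where f = "\<lambda>h. (- h) mod m"])
 fix h assume h: "h \<in> roots_mod c m"
 then show "(- h) mod m \<in> roots_mod c m"
  using assms by (intro roots_mod_minus) auto
 show "(- ((- h) mod m)) mod m = h"
  using h by (simp add: mod_minus_eq roots_mod_def)
 show "(- h) mod m \<noteq> h"
 proof
  assume "(- h) mod m = h"
  then have "h mod m = (- h) mod m"
   by (metis mod_mod_trivial)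
  then have "m dvd h - (- h)"
   by (simp only: mod_eq_dvd_iff)
  with minus_not_cong[OF assms] h show False
   by (auto simp: roots_mod_def)
 qed
qed simp

text \<open>By the Chinese remainder theorem, reduction modulo \<open>a\<close> and \<open>b\<close>
  is a bijection onto pairs of roots.\<close>

lemma card_roots_mod_mult:
 assumes "coprime a b" "0 < a" "0 < b"
 shows "card (roots_mod c (a * b)) = card (roots_mod c a) * card (roots_mod c b)"
proof -
 have "bij_betw (\<lambda>h. (h mod a, h mod b)) (roots_mod c (a * b)) (roots_mod c a \<times> roots_mod c b)"
  unfolding bij_betw_def
 proof
  show "inj_on (\<lambda>h. (h mod a, h mod b)) (roots_mod c (a * b))"
  proof (rule inj_onI)
   fix h h' assume h: "h \<in> roots_mod c (a * b)" "h' \<in> roots_mod c (a * b)"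
    "(h mod a, h mod b) = (h' mod a, h' mod b)"
   then have "a dvd h - h'" "b dvd h - h'"
    by (auto simp: mod_eq_dvd_iff)
   with assms(1) have "a * b dvd h - h'"
    by (simp add: divides_mult)
   then have "h mod (a * b) = h' mod (a * b)"
    by (simp add: mod_eq_dvd_iff)
   with h show "h = h'"
    by (simp add: roots_mod_def)
  qed
  show "(\<lambda>h. (h mod a, h mod b)) ` roots_mod c (a * b) = roots_mod c a \<times> roots_mod c b"
  proof (intro equalityI subsetI)
   fix q assume "q \<in> (\<lambda>h. (h mod a, h mod b)) ` roots_mod c (a * b)"
   then obtain h where h: "q = (h mod a, h mod b)" "a * b dvd h\<^sup>2 - c"
    by (auto simp: roots_mod_def)
   then have "a dvd h\<^sup>2 - c" "b dvd h\<^sup>2 - c"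
    using dvd_mult_left dvd_mult_right by blast+
   with h(1) assms show "q \<in> roots_mod c a \<times> roots_mod c b"
    by (simp add: roots_mod_mod)
  next
   fix q assume "q \<in> roots_mod c a \<times> roots_mod c b"
   then obtain x y where q: "q = (x, y)" "x \<in> roots_mod c a" "y \<in> roots_mod c b"
    by blast
   obtain z where z: "[z = x] (mod a)" "[z = y] (mod b)"
    using binary_chinese_remainder_int[OF assms(1)] by blast
   let ?h = "z mod (a * b)"
   have ha: "?h mod a = x" "?h mod b = y"
    using z q assms by (auto simp: cong_def roots_mod_def mod_mod_cancel)
   have "a dvd ?h\<^sup>2 - c"
    using q(2) mod_square_dvd_iff[of a ?h c] by (simp add: ha roots_mod_def)
   moreover have "b dvd ?h\<^sup>2 - c"
    using q(3) mod_square_dvd_iff[of b ?h c] by (simp add: ha roots_mod_def)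
   ultimately have "a * b dvd ?h\<^sup>2 - c"
    using assms(1) by (simp add: divides_mult)
   then have "?h \<in> roots_mod c (a * b)"
    using assms by (simp add: roots_mod_def)
   with ha q(1) show "q \<in> (\<lambda>h. (h mod a, h mod b)) ` roots_mod c (a * b)"
    by (intro image_eqI[of _ _ ?h]) auto
  qed
 qed
 then show ?thesis
  using bij_betw_same_card card_cartesian_product by metis
qed

lemma card_roots_mod_prime:
 assumes "prime m" "odd m" "coprime c m" "QuadRes m c"
 shows "card (roots_mod c m) = 2"
proof -
 have m: "1 < m"
  using assms(1) by (simp add: prime_gt_1_int)
 obtain y where "[y\<^sup>2 = c] (mod m)"
  using assms(4) by (auto simp: QuadRes_def)
 then have y: "m dvd y\<^sup>2 - c"
  by (simp add: cong_iff_dvd_diff)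
 have "roots_mod c m = {y mod m, (- y) mod m}"
 proof (intro equalityI subsetI)
  fix h assume h: "h \<in> roots_mod c m"
  then have "m dvd h\<^sup>2 - c"
   by (simp add: roots_mod_def)
  from dvd_diff[OF this y] have "m dvd (h\<^sup>2 - c) - (y\<^sup>2 - c)" .
  then have "m dvd (h - y) * (h + y)"
   by (simp add: algebra_simps power2_eq_square)
  then have "m dvd h - y \<or> m dvd h - (- y)"
   using assms(1) by (auto simp: prime_dvd_mult_iff)
  then have "h mod m = y mod m \<or> h mod m = (- y) mod m"
   by (simp only: mod_eq_dvd_iff)
  with h show "h \<in> {y mod m, (- y) mod m}"
   by (auto simp: roots_mod_def)
 qed (use y m in \<open>auto intro!: roots_mod_mod\<close>)
 moreover have "y mod m \<noteq> (- y) mod m"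
  using minus_not_cong[OF assms(2) m assms(3) y] by (metis mod_eq_dvd_iff)
 ultimately show ?thesis
  by simp
qed

text \<open>Thue's lemma, by the pigeonhole principle: the \<open>(s + 1)^2\<close> pairs in the
  square outnumber the residues, so two of them agree in \<open>i - h * j\<close>, and their
  difference is the required pair.\<close>

lemma thue:
 fixes m s h :: int
 assumes "1 < m" "m < (s + 1)\<^sup>2" "0 \<le> s"
 shows "\<exists>x y. \<bar>x\<bar> \<le> s \<and> \<bar>y\<bar> \<le> s \<and> (x, y) \<noteq> (0, 0) \<and> m dvd x - h * y"
proof -
 let ?A = "{0..s} \<times> {0..s}" and ?f = "\<lambda>(i, j). (i - h * j) mod m"
 have "?f ` ?A \<subseteq> {0..<m}"
  using assms(1) by auto
 then have "card (?f ` ?A) \<le> nat m"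
  using card_mono[of "{0..<m}" "?f ` ?A"] by simp
 also have "nat m < nat ((s + 1)\<^sup>2)"
  using assms(1,2) by (subst nat_less_eq_zless) auto
 also have "\<dots> = card ?A"
  using assms(3) by (simp add: card_cartesian_product power2_eq_square nat_mult_distrib)
 finally have "\<not> inj_on ?f ?A"
  using pigeonhole by blast
 then obtain i j i' j' where ij: "(i, j) \<in> ?A" "(i', j') \<in> ?A" "(i, j) \<noteq> (i', j')"
   "(i - h * j) mod m = (i' - h * j') mod m"
  unfolding inj_on_def by fastforce
 have "m dvd (i - i') - h * (j - j')"
  using ij(4) by (simp add: mod_eq_dvd_iff algebra_simps)
 with ij show ?thesis
  by (intro exI[of _ "i - i'"] exI[of _ "j - j'"]) auto
qed

text \<open>
 Each pair \<open>(x, y)\<close> of \<open>G\<close> belongs to the two roots \<open>\<plusminus> x / y\<close> modulo \<open>m\<close>, and conversely.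
\<close>

lemma card_roots_mod_eq_twice:
 fixes m c :: int and G :: "(int \<times> int) set"
 assumes m: "odd m" "1 < m" "coprime c m"
  and G: "\<And>x y. (x, y) \<in> G \<Longrightarrow> m dvd x\<^sup>2 - c * y\<^sup>2 \<and> coprime y m"
  and ex: "\<And>h. m dvd h\<^sup>2 - c \<Longrightarrow> \<exists>(x, y) \<in> G. m dvd x - h * y \<or> m dvd x + h * y"
  and diff: "\<And>x y x' y'. (x, y) \<in> G \<Longrightarrow> (x', y') \<in> G \<Longrightarrow> m dvd x * y' - x' * y \<Longrightarrow> (x, y) = (x', y')"
  and sum: "\<And>x y x' y'. (x, y) \<in> G \<Longrightarrow> (x', y') \<in> G \<Longrightarrow> \<not> m dvd x * y' + x' * y"
 shows "card (roots_mod c m) = 2 * card G"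
proof -
 define F where "F q = {h \<in> roots_mod c m. m dvd fst q - h * snd q \<or> m dvd fst q + h * snd q}" for q
 have F2: "card (F q) = 2" if q: "q \<in> G" for q
 proof -
  obtain x y where xy: "q = (x, y)"
   by (cases q)
  have xyG: "m dvd x\<^sup>2 - c * y\<^sup>2" "coprime y m"
   using G q xy by auto
  \<comment> \<open>\<open>z\<close> inverts \<open>y\<close>, so that \<open>x * z\<close> is a
    root and, up to sign, the only one belonging to \<open>(x, y)\<close>.\<close>
  obtain z where z: "[y * z = 1] (mod m)"
   using cong_solve_coprime_int[OF xyG(2)] by blast
  let ?h = "x * z"
  have z1: "m dvd y * z - 1"
   using z by (simp add: cong_iff_dvd_diff)
  have xh: "m dvd x - ?h * y"
   using dvd_mult[OF z1, of "- x"] by (simp add: algebra_simps)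
  have "?h\<^sup>2 - c = (x\<^sup>2 - c * y\<^sup>2) * z\<^sup>2 + (c * (y * z + 1)) * (y * z - 1)"
   by (simp add: power2_eq_square algebra_simps)
  then have h: "m dvd ?h\<^sup>2 - c"
   using xyG(1) z1 by (metis dvd_add dvd_mult dvd_mult2)
  have "F q = {?h mod m, (- ?h) mod m}"
  proof (intro equalityI subsetI)
   fix g assume "g \<in> F q"
   then have g: "g \<in> roots_mod c m" "m dvd x - g * y \<or> m dvd x + g * y"
    by (auto simp: F_def xy)
   have "m dvd (g - ?h) * y \<or> m dvd (g - (- ?h)) * y"
    using g(2)
   proof
    assume "m dvd x - g * y"
    from dvd_diff[OF xh this] show ?thesis
     by (simp add: algebra_simps)
   next
    assume "m dvd x + g * y"
    from dvd_diff[OF this xh] show ?thesis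
     by (simp add: algebra_simps)
   qed
   then have "m dvd g - ?h \<or> m dvd g - (- ?h)"
    using xyG(2) by (simp add: coprime_dvd_mult_left_iff coprime_commute)
   then have "g mod m = ?h mod m \<or> g mod m = (- ?h) mod m"
    by (simp only: mod_eq_dvd_iff)
   with g show "g \<in> {?h mod m, (- ?h) mod m}"
    by (auto simp: roots_mod_def)
  next
   fix g assume g: "g \<in> {?h mod m, (- ?h) mod m}"
   then have "g \<in> roots_mod c m"
    using h m by (auto intro!: roots_mod_mod)
   moreover have "m dvd x - g * y \<or> m dvd x + g * y"
   proof (cases "g = ?h mod m")
    case True
    then have "m dvd g - ?h"
     by (metis mod_eq_dvd_iff mod_mod_trivial)
    from dvd_diff[OF xh dvd_mult[OF this, of y]] show ?thesis
     by (simp add: algebra_simps)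
   next
    case False
    then have "m dvd g - (- ?h)"
     using g by (metis insertE mod_eq_dvd_iff mod_mod_trivial singletonD)
    from dvd_add[OF xh dvd_mult[OF this, of y]] show ?thesis
     by (simp add: algebra_simps)
   qed
   ultimately show "g \<in> F q"
    by (simp add: F_def xy)
  qed
  moreover have "?h mod m \<noteq> (- ?h) mod m"
   using minus_not_cong[OF m h] by (metis mod_eq_dvd_iff)
  ultimately show ?thesis
   by simp
 qed
 have disj: "F q \<inter> F q' = {}" if "q \<in> G" "q' \<in> G" "q \<noteq> q'" for q q'
 proof (rule ccontr)
  obtain x y x' y' where xy: "q = (x, y)" "q' = (x', y')"
   by (cases q, cases q')
  assume "F q \<inter> F q' \<noteq> {}"
  then obtain h where h: "m dvd x - h * y \<or> m dvd x + h * y" "m dvd x' - h * y' \<or> m dvd x' + h * y'"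
   by (auto simp: F_def xy)
  have "m dvd x * y' - x' * y \<or> m dvd x * y' + x' * y"
   using h
  proof (elim disjE)
   assume "m dvd x - h * y" "m dvd x' - h * y'"
   from dvd_diff[OF dvd_mult[OF this(1), of y'] dvd_mult[OF this(2), of y]] show ?thesis
    by (simp add: algebra_simps)
  next
   assume "m dvd x - h * y" "m dvd x' + h * y'"
   from dvd_add[OF dvd_mult[OF this(1), of y'] dvd_mult[OF this(2), of y]] show ?thesis
    by (simp add: algebra_simps)
  next
   assume "m dvd x + h * y" "m dvd x' - h * y'"
   from dvd_add[OF dvd_mult[OF this(1), of y'] dvd_mult[OF this(2), of y]] show ?thesis
    by (simp add: algebra_simps)
  next
   assume "m dvd x + h * y" "m dvd x' + h * y'"
   from dvd_diff[OF dvd_mult[OF this(1), of y'] dvd_mult[OF this(2), of y]] show ?thesis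
    by (simp add: algebra_simps)
  qed
  with diff sum that xy show False
   by blast
 qed
 have un: "(\<Union>q\<in>G. F q) = roots_mod c m"
 proof (intro equalityI subsetI)
  fix h assume h: "h \<in> roots_mod c m"
  then obtain x y where "(x, y) \<in> G" "m dvd x - h * y \<or> m dvd x + h * y"
   using ex[of h] by (auto simp: roots_mod_def)
  with h show "h \<in> (\<Union>q\<in>G. F q)"
   by (intro UN_I[of "(x, y)"]) (simp_all add: F_def)
 qed (simp add: F_def)
 \<comment> \<open>Infinitely many nonempty, pairwise disjoint sets \<open>F q\<close> cannot lie in
   the finite set of roots.\<close>
 have "finite G"
 proof (rule ccontr)
  assume "infinite G"
  have "F q \<noteq> {}" if "q \<in> G" for q
   using F2[OF that] by auto
  then have "inj_on F G"
   using disj by (metis Int_absorb inj_onI)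
  with \<open>infinite G\<close> have "infinite (F ` G)"
   using finite_imageD by blast
  moreover have "F ` G \<subseteq> Pow (roots_mod c m)"
   by (auto simp: F_def)
  ultimately show False
   by (meson finite_Pow_iff finite_roots_mod finite_subset)
 qed
 then have "card (\<Union>q\<in>G. F q) = (\<Sum>q\<in>G. card (F q))"
  using disj by (intro card_UN_disjoint) (auto simp: F_def)
 then show ?thesis
  using F2 un by simp
qed

section \<open>The quadratic characters of -1, 2 and -2\<close>

text \<open>Gauss's lemma with multiplier 2: the doubles of \<open>1, ..., (p - 1) div 2\<close> are
  already reduced modulo \<open>p\<close>, and those beyond the half are the doubles of the numbers
  above \<open>(p - 1) div 4\<close>.\<close>

lemma Legendre_2:
 assumes "prime p" "odd p"
 shows "Legendre 2 (int p) = (- 1) ^ ((p - 1) div 2 - (p - 1) div 4)"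
proof -
 have p: "2 < p"
  using assms by (metis even_numeral nat_less_le prime_ge_2_nat)
 interpret GAUSS p 2
 proof
  show "[2 \<noteq> 0] (mod int p)"
   using p by (auto simp: cong_def)
 qed (use assms p in auto)
 have "E = (\<lambda>x. 2 * x) ` {int ((p - 1) div 4) <.. int ((p - 1) div 2)}"
 proof (intro equalityI subsetI)
  fix x assume "x \<in> E"
  then obtain y where y: "0 < y" "y \<le> (int p - 1) div 2" "x = (y * 2) mod int p" "(int p - 1) div 2 < x"
   by (auto simp: E_def C_def B_def A_def)
  then have x: "x = 2 * y"
   by simp
  with y assms(2) show "x \<in> (\<lambda>x. 2 * x) ` {int ((p - 1) div 4) <.. int ((p - 1) div 2)}"
   by (intro image_eqI[of _ _ y]) (auto simp: zdiv_int of_nat_diff elim!: oddE)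
 next
  fix x assume "x \<in> (\<lambda>x. 2 * x) ` {int ((p - 1) div 4) <.. int ((p - 1) div 2)}"
  then obtain y where y: "x = 2 * y" "int ((p - 1) div 4) < y" "y \<le> int ((p - 1) div 2)"
   by auto
  then have "0 < y" "y \<le> (int p - 1) div 2" "x = (y * 2) mod int p" "(int p - 1) div 2 < x"
   using p by (auto simp: zdiv_int of_nat_diff)
  then have "y \<in> A" "x = (y * 2) mod int p" "x \<in> {(int p - 1) div 2 <..}"
   by (simp_all add: A_def)
  then show "x \<in> E"
   unfolding E_def C_def B_def by blast
 qed
 then have "card E = nat (int ((p - 1) div 2) - int ((p - 1) div 4))"
  by (simp add: card_image inj_on_def)
 also have "\<dots> = (p - 1) div 2 - (p - 1) div 4"
  by linarith
 finally show ?thesis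
  using gauss_lemma by simp
qed

text \<open>Euler's criterion; the values 0 and -1 of the Legendre symbol are excluded because
  \<open>p > 2\<close> divides neither 1 nor 2.\<close>

lemma QuadRes_if_power_cong_1:
 assumes "prime p" "odd p" "[a ^ ((p - 1) div 2) = 1] (mod int p)"
 shows "QuadRes (int p) a"
proof -
 have p: "2 < p"
  using assms by (metis even_numeral nat_less_le prime_ge_2_nat)
 have "[Legendre a (int p) = 1] (mod int p)"
  using euler_criterion[OF assms(1) p] assms(3) cong_trans by blast
 then have "int p dvd Legendre a (int p) - 1"
  by (simp add: cong_iff_dvd_diff)
 moreover have "\<not> int p dvd - 1" "\<not> int p dvd - 2"
  using p by (auto dest!: zdvd_imp_le)
 ultimately show ?thesis
  by (auto simp: Legendre_def split: if_splits)
qed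

lemma QuadRes_minus_1:
 assumes "prime p" "p mod 4 = 1"
 shows "QuadRes (int p) (- 1)"
proof (rule QuadRes_if_power_cong_1)
 show "odd p"
  using assms(2) by presburger
 have "even ((p - 1) div 2)"
  using assms(2) by presburger
 then show "[(- 1) ^ ((p - 1) div 2) = 1] (mod int p)"
  by simp
qed fact

lemma QuadRes_2:
 assumes "prime p" "p mod 8 = 1 \<or> p mod 8 = 7"
 shows "QuadRes (int p) 2"
proof -
 consider q where "p = 8 * q + 1" | q where "p = 8 * q + 7"
  using assms(2) by (metis mult_div_mod_eq)
 then have "odd p \<and> even ((p - 1) div 2 - (p - 1) div 4)"
 proof cases
  case 1
  then have "(p - 1) div 2 = 4 * q" "(p - 1) div 4 = 2 * q" "odd p"
   by simp_all
  then show ?thesis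
   by simp
 next
  case 2
  then have "(p - 1) div 2 = 4 * q + 3" "(p - 1) div 4 = 2 * q + 1" "odd p"
   by simp_all
  then show ?thesis
   by simp
 qed
 then have "Legendre 2 (int p) = 1"
  using Legendre_2 assms(1) by simp
 then show ?thesis
  by (auto simp: Legendre_def split: if_splits)
qed

text \<open>In both classes \<open>(p - 1) div 4\<close> is even, so 2 has the same symbol
  \<open>(-1)^((p - 1) div 2)\<close> as -1, and the product of the two powers is 1.\<close>

lemma QuadRes_minus_2:
 assumes "prime p" "p mod 8 = 1 \<or> p mod 8 = 3"
 shows "QuadRes (int p) (- 2)"
proof (rule QuadRes_if_power_cong_1)
 show odd: "odd p"
  using assms(2) by presburger
 with assms(1) have p: "2 < p"
  by (metis even_numeral nat_less_le prime_ge_2_nat)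
 let ?h = "(p - 1) div 2"
 consider q where "p = 8 * q + 1" | q where "p = 8 * q + 3"
  using assms(2) by (metis mult_div_mod_eq)
 then have "even (?h - (p - 1) div 4) = even ?h"
 proof cases
  case 1
  then have "(p - 1) div 2 = 4 * q" "(p - 1) div 4 = 2 * q"
   by simp_all
  then show ?thesis
   by simp
 next
  case 2
  then have "(p - 1) div 2 = 4 * q + 1" "(p - 1) div 4 = 2 * q"
   by simp_all
  then show ?thesis
   by simp
 qed
 then have "Legendre 2 (int p) = (- 1) ^ ?h"
  using Legendre_2[OF assms(1) odd] by (metis minus_one_power_iff)
 then have "[2 ^ ?h = (- 1) ^ ?h] (mod int p)"
  using euler_criterion[OF assms(1) p, of 2] cong_sym by metis
 from cong_mult[OF cong_refl[of "(- 1) ^ ?h"] this]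
 show "[(- 2) ^ ?h = 1] (mod int p)"
  by (simp flip: power_mult_distrib)
qed fact

section \<open>Primality from the parity of representation counts\<close>

text \<open>The three instances have nonnegative coefficients, so the values increase in both
  coordinates on the quadrant to which \<open>reps\<close> is restricted. The discriminant is
  \<open>\<gamma>^2 - 4 \<epsilon>\<close>.\<close>

definition form :: "int \<Rightarrow> int \<Rightarrow> int \<Rightarrow> int \<Rightarrow> int" where
 "form \<gamma> \<epsilon> x y = x * x + \<gamma> * x * y + \<epsilon> * y * y"

definition reps :: "int \<Rightarrow> int \<Rightarrow> int \<Rightarrow> (int \<times> int) set" where
 "reps \<gamma> \<epsilon> m = {(x, y). 0 \<le> x \<and> 0 \<le> y \<and> form \<gamma> \<epsilon> x y = m}"

lemma squarefree_not_square:
 assumes "squarefree m" "1 < m"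
 shows "x * x \<noteq> (m :: int)"
proof
 assume x: "x * x = m"
 then have "is_unit x"
  using assms(1) unfolding squarefree_def by (metis dvd_refl power2_eq_square)
 then have "\<bar>x\<bar> = 1"
  by simp
 with x assms(2) show False
  by (metis abs_mult_self_eq less_irrefl mult_1)
qed

text \<open>A prime dividing both \<open>y\<close> and \<open>m\<close> divides \<open>x\<close> by
  the congruence, so its square divides the squarefree \<open>m\<close>. The last hypothesis is what
  each of the three forms supplies.\<close>

lemma coprime_of_form:
 fixes x y m c :: int
 assumes "squarefree m" "1 < m" "m dvd x\<^sup>2 - c * y\<^sup>2" "\<And>d. d dvd x \<Longrightarrow> d dvd y \<Longrightarrow> d\<^sup>2 dvd m"
 shows "coprime y m"
proof (rule ccontr)
 assume "\<not> coprime y m"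
 then have "\<not> is_unit (gcd y m)" "gcd y m \<noteq> 0"
  using assms(2) by (auto simp: is_unit_gcd_iff)
 then obtain p where "prime p" "p dvd gcd y m"
  using prime_divisor_exists by blast
 then have p: "prime p" "p dvd y" "p dvd m"
  by auto
 then have "p dvd x\<^sup>2 - c * y\<^sup>2" "p dvd c * y\<^sup>2"
  using assms(3) dvd_trans by (blast, simp add: power2_eq_square)
 from dvd_add[OF this] have "p dvd x\<^sup>2"
  by simp
 with p(1) have "p dvd x"
  using prime_dvd_power by blast
 with p assms(4) have "p\<^sup>2 dvd m"
  by blast
 with assms(1) have "is_unit p"
  by (simp add: squarefree_def)
 with p(1) show False
  using not_prime_unit by blast
qed

text \<open>A squarefree \<open>m > 1\<close> is not a square, so the integer part \<open>s\<close>
  of its root satisfies \<open>s * s < m\<close> strictly. This strictness pins down which multiples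
  of \<open>m\<close> the forms can take.\<close>

lemma thue_squarefree:
 fixes m h :: int
 assumes "squarefree m" "1 < m"
 obtains x y where "x * x < m" "y * y < m" "(x, y) \<noteq> (0, 0)" "m dvd x - h * y"
proof -
 define s where "s = \<lfloor>sqrt (of_int m)\<rfloor>"
 have s: "0 \<le> s" "real_of_int s \<le> sqrt (of_int m)" "sqrt (of_int m) < real_of_int s + 1"
  using assms(2) by (simp_all add: s_def)
 have "(sqrt (of_int m))\<^sup>2 < (real_of_int s + 1)\<^sup>2"
  using s assms(2) by (intro power_strict_mono) auto
 then have "real_of_int m < real_of_int ((s + 1)\<^sup>2)"
  using assms(2) by simp
 then have lt: "m < (s + 1)\<^sup>2"
  by linarith
 have "(real_of_int s)\<^sup>2 \<le> (sqrt (of_int m))\<^sup>2"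
  using s by (intro power_mono) auto
 then have "real_of_int (s * s) \<le> real_of_int m"
  using assms(2) by (simp add: power2_eq_square)
 then have "s * s < m"
  using squarefree_not_square[OF assms, of s] by linarith
 moreover obtain x y where xy: "\<bar>x\<bar> \<le> s" "\<bar>y\<bar> \<le> s" "(x, y) \<noteq> (0, 0)" "m dvd x - h * y"
  using thue[OF assms(2) lt s(1)] by blast
 moreover have "x * x \<le> s * s" "y * y \<le> s * s"
  using xy(1,2) by (metis abs_ge_zero abs_mult_self_eq mult_mono s(1))+
 ultimately show ?thesis
  using that by (meson order.strict_trans1)
qed

lemma cross_eq_imp_eq:
 fixes x y x' y' :: int
 assumes "x * y' = x' * y" "coprime x y" "coprime x' y'" "0 < y" "0 < y'"
 shows "(x, y) = (x', y')"
proof -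
 have "y dvd y'"
  using assms(1,2) by (metis coprime_commute coprime_dvd_mult_right_iff dvd_triv_right)
 moreover have "y' dvd y"
  using assms(1,3) by (metis coprime_commute coprime_dvd_mult_right_iff dvd_triv_right)
 ultimately have "y = y'"
  using assms(4,5) by (simp add: zdvd_antisym_nonneg)
 with assms show ?thesis
  by simp
qed

lemma dvd_square_form:
 fixes x y h m c :: int
 assumes "m dvd h\<^sup>2 - c" "m dvd x - h * y"
 shows "m dvd x * x - c * (y * y)"
proof -
 have "x * x - c * (y * y) = (x - h * y) * (x + h * y) + (h\<^sup>2 - c) * (y * y)"
  by (simp add: algebra_simps power2_eq_square)
 with assms show ?thesis
  by (metis dvd_add dvd_mult2)
qed

text \<open>Changing the sign of \<open>x\<close> or \<open>y\<close> only exchanges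
  \<open>h\<close> and \<open>-h\<close>, which belong to the same pair of roots.\<close>

lemma dvd_abs_form:
 fixes x y h m :: int
 assumes "m dvd x - h * y \<or> m dvd x + h * y"
 shows "m dvd \<bar>x\<bar> - h * \<bar>y\<bar> \<or> m dvd \<bar>x\<bar> + h * \<bar>y\<bar>"
proof -
 have "m dvd - (x - h * y) \<or> m dvd - (x + h * y)"
  using assms by (metis dvd_minus_iff)
 moreover have "- (x - h * y) = - x + h * y" "- (x + h * y) = - x - h * y"
  by simp_all
 ultimately have "m dvd - x - h * y \<or> m dvd - x + h * y"
  by metis
 with assms show ?thesis
  by (cases "0 \<le> x"; cases "0 \<le> y") auto
qed

lemma small_multiple:
 fixes m z :: int
 assumes "m dvd z" "0 < z" "z < 2 * m"
 shows "z = m"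
proof -
 obtain q where q: "z = m * q"
  using assms(1) by blast
 have m: "0 < m"
  using assms by linarith
 then have "0 < q"
  using assms(2) q by (simp add: zero_less_mult_iff)
 moreover have "q < 2"
  using assms(3) q m by (simp add: mult.commute[of m])
 ultimately have "q = 1"
  by linarith
 with q show ?thesis
  by simp
qed

lemma mult_less_of_squares:
 fixes x y m :: int
 assumes "x * x < m" "y * y < m" "0 \<le> x" "0 \<le> y"
 shows "x * y < m"
 by (metis assms linorder_le_cases mult_left_mono mult_right_mono order.strict_trans1)

text \<open>As \<open>(x / y)^2 = -1\<close>, exchanging \<open>x\<close> and \<open>y\<close>
  negates the quotient, so both orders of a sum of two squares belong to the same pair of roots.
  Requiring the second term to be even, which is the form \<open>x^2 + 4 y^2\<close>, keeps exactly
  one order.\<close>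

lemma card_roots_minus_1:
 assumes m: "odd m" "1 < m" "squarefree m"
 shows "card (roots_mod (- 1) m) = 2 * card (reps 0 4 m)"
proof -
 let ?f = "\<lambda>(x, y). (x, 2 * y)" and ?G = "{(x, y). 0 < x \<and> 0 < y \<and> even y \<and> x * x + y * y = m}"
 have G: "?f ` reps 0 4 m = ?G"
 proof (intro equalityI subsetI)
  fix q assume "q \<in> ?f ` reps 0 4 m"
  then obtain x y where xy: "q = (x, 2 * y)" "0 \<le> x" "0 \<le> y" "x * x + 4 * y * y = m"
   by (auto simp: reps_def form_def)
  have "x \<noteq> 0"
   using xy(4) m(1) by (cases "x = 0") auto
  moreover have "y \<noteq> 0"
   using xy(4) squarefree_not_square[OF m(3,2), of x] by (cases "y = 0") auto
  ultimately show "q \<in> ?G"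
   using xy by auto
 next
  fix q assume "q \<in> ?G"
  then obtain x z where xz: "q = (x, z)" "0 < x" "0 < z" "even z" "x * x + z * z = m"
   by auto
  then obtain y where "z = 2 * y"
   by auto
  with xz have "q = (x, 2 * y)" "0 < x" "0 < y" "x * x + 4 * y * y = m"
   by auto
  then show "q \<in> ?f ` reps 0 4 m"
   by (intro image_eqI[of _ _ "(x, y)"]) (auto simp: reps_def form_def)
 qed
 have "inj_on ?f (reps 0 4 m)"
  by (auto simp: inj_on_def)
 from card_image[OF this] have "card (reps 0 4 m) = card ?G"
  by (simp only: G)
 moreover have "card (roots_mod (- 1) m) = 2 * card ?G"
 proof (rule card_roots_mod_eq_twice)
  have dvd2: "d\<^sup>2 dvd m" if "d dvd x" "d dvd y" "x * x + y * y = m" for d x y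
   using that by (metis dvd_add mult_dvd_mono power2_eq_square)
  have cop: "coprime y m" if "(x, y) \<in> ?G" for x y
   by (rule coprime_of_form[OF m(3,2), of x "- 1"]) (use that dvd2 in \<open>auto simp: power2_eq_square\<close>)
  have cop': "coprime x y" if "(x, y) \<in> ?G" for x y
  proof (rule coprimeI)
   fix d assume "d dvd x" "d dvd y"
   then have "d dvd m"
    using that by auto
   with \<open>d dvd y\<close> cop[OF that] show "is_unit d"
    using coprime_common_divisor by blast
  qed
  show "odd m" "1 < m" "coprime (- 1) m"
   using m by auto
  show "m dvd x\<^sup>2 - - 1 * y\<^sup>2 \<and> coprime y m" if "(x, y) \<in> ?G" for x y
   using cop[OF that] that by (auto simp: power2_eq_square)
  have lt: "x * x < m" "y * y < m" "0 \<le> x" "0 \<le> y" if "(x, y) \<in> ?G" for x y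
   using that by (auto simp: mult_pos_pos)
  show "(x, y) = (x', y')" if q: "(x, y) \<in> ?G" "(x', y') \<in> ?G" and d: "m dvd x * y' - x' * y" for x y x' y'
  proof (rule cross_eq_imp_eq)
   have "x * y' < m" "x' * y < m" "0 \<le> x * y'" "0 \<le> x' * y"
    using lt[OF q(1)] lt[OF q(2)] mult_less_of_squares by auto
   then have "\<bar>x * y' - x' * y\<bar> < m"
    by linarith
   with d show "x * y' = x' * y"
    using zdvd_not_zless[of "\<bar>x * y' - x' * y\<bar>" m] by (cases "x * y' = x' * y") auto
  qed (use q cop' in auto)
  show "\<not> m dvd x * y' + x' * y" if q: "(x, y) \<in> ?G" "(x', y') \<in> ?G" for x y x' y'
  proof
   assume d: "m dvd x * y' + x' * y"
   have "0 < x * y' + x' * y"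
    using q by (simp add: add_pos_pos)
   moreover have "x * y' + x' * y < 2 * m"
    using lt[OF q(1)] lt[OF q(2)] mult_less_of_squares by (smt (verit))
   ultimately have "x * y' + x' * y = m"
    using small_multiple[OF d] by blast
   \<comment> \<open>With the sum equal to \<open>m\<close>, twice it is
     \<open>x^2 + y^2 + x'^2 + y'^2\<close>, so both squares vanish; then \<open>x = y'\<close> is
     even as well, against \<open>m\<close> odd.\<close>
   then have "(x - y') * (x - y') + (y - x') * (y - x') = 0"
    using q by (simp add: algebra_simps)
   then have "x = y'"
    by (simp add: sum_squares_eq_zero_iff)
   with q have "even x" "even y" "x * x + y * y = m"
    by auto
   with m(1) show False
    by auto
  qed
  show "\<exists>(x, y)\<in>?G. m dvd x - h * y \<or> m dvd x + h * y" if h: "m dvd h\<^sup>2 - - 1" for h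
  proof -
   obtain x y where xy: "x * x < m" "y * y < m" "(x, y) \<noteq> (0, 0)" "m dvd x - h * y"
    using thue_squarefree[OF m(3,2)] by blast
   have "m dvd x * x + y * y"
    using dvd_square_form[OF h xy(4)] by simp
   moreover have "0 < x * x + y * y"
    using xy(3) by (simp add: sum_squares_gt_zero_iff)
   ultimately have sum: "x * x + y * y = m"
    using xy(1,2) by (intro small_multiple) auto
   have nz: "x \<noteq> 0" "y \<noteq> 0"
    using sum squarefree_not_square[OF m(3,2), of x] squarefree_not_square[OF m(3,2), of y] by auto
   show ?thesis
   proof (cases "even y")
    case True
    with nz sum have "(\<bar>x\<bar>, \<bar>y\<bar>) \<in> ?G"
     by simp
    with dvd_abs_form xy(4) show ?thesis
     by blast
   next
    case False
    \<comment> \<open>The even term is \<open>x\<close>, so the exchanged pair is used; multiplying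
      \<open>x - h * y\<close> by \<open>h\<close> and replacing \<open>h^2\<close> by
      \<open>-1\<close> gives \<open>y + h * x\<close>.\<close>
    then have "even x"
     using sum m(1) by (metis even_add even_mult_iff)
    with nz sum have "(\<bar>y\<bar>, \<bar>x\<bar>) \<in> ?G"
     by (simp add: add.commute)
    moreover have "y + h * x = h * (x - h * y) + (h\<^sup>2 - - 1) * y"
     by (simp add: algebra_simps power2_eq_square)
    then have "m dvd y + h * x"
     using h xy(4) by (metis dvd_add dvd_mult dvd_mult2)
    ultimately show ?thesis
     using dvd_abs_form by blast
   qed
  qed
 qed
 ultimately show ?thesis
  by simp
qed

text \<open>Thue's pair gives a value of \<open>x^2 + 2 y^2\<close> that is a positive multiple of
  \<open>m\<close> below \<open>3 m\<close>. The value \<open>2 m\<close> forces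
  \<open>x = 2 z\<close>, and halving yields \<open>y^2 + 2 z^2 = m\<close> for the same root up to
  sign.\<close>

lemma card_roots_minus_2:
 assumes m: "odd m" "1 < m" "squarefree m"
 shows "card (roots_mod (- 2) m) = 2 * card (reps 0 2 m)"
proof -
 let ?G = "{(x, y). 0 < x \<and> 0 < y \<and> x * x + 2 * (y * y) = m}"
 have G: "reps 0 2 m = ?G"
 proof (intro equalityI subsetI)
  fix q assume "q \<in> reps 0 2 m"
  then obtain x y where xy: "q = (x, y)" "0 \<le> x" "0 \<le> y" "x * x + 2 * (y * y) = m"
   by (auto simp: reps_def form_def)
  have "x \<noteq> 0"
   using xy(4) m(1) by (cases "x = 0") auto
  moreover have "y \<noteq> 0"
   using xy(4) squarefree_not_square[OF m(3,2), of x] by (cases "y = 0") auto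
  ultimately show "q \<in> ?G"
   using xy by auto
 qed (auto simp: reps_def form_def)
 have "card (roots_mod (- 2) m) = 2 * card ?G"
 proof (rule card_roots_mod_eq_twice)
  have dvd2: "d\<^sup>2 dvd m" if "d dvd x" "d dvd y" "x * x + 2 * (y * y) = m" for d x y
   using that by (metis dvd_add dvd_mult mult_dvd_mono power2_eq_square)
  have cop: "coprime y m" if "(x, y) \<in> ?G" for x y
   by (rule coprime_of_form[OF m(3,2), of x "- 2"]) (use that dvd2 in \<open>auto simp: power2_eq_square\<close>)
  have cop': "coprime x y" if "(x, y) \<in> ?G" for x y
  proof (rule coprimeI)
   fix d assume "d dvd x" "d dvd y"
   then have "d dvd m"
    using that by auto
   with \<open>d dvd y\<close> cop[OF that] show "is_unit d"
    using coprime_common_divisor by blast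
  qed
  show "odd m" "1 < m" "coprime (- 2) m"
   using m by auto
  show "m dvd x\<^sup>2 - - 2 * y\<^sup>2 \<and> coprime y m" if "(x, y) \<in> ?G" for x y
   using cop[OF that] that by (auto simp: power2_eq_square)
  have lt: "x * x < m" "2 * (y * y) < m" "0 \<le> x" "0 \<le> y" if "(x, y) \<in> ?G" for x y
   using that by (auto simp: mult_pos_pos)
  show "(x, y) = (x', y')" if q: "(x, y) \<in> ?G" "(x', y') \<in> ?G" and d: "m dvd x * y' - x' * y" for x y x' y'
  proof (rule cross_eq_imp_eq)
   have "y * y < m" "y' * y' < m"
    using lt[OF q(1)] lt[OF q(2)] zero_le_square[of y] zero_le_square[of y'] by linarith+
   then have "x * y' < m" "x' * y < m" "0 \<le> x * y'" "0 \<le> x' * y"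
    using lt[OF q(1)] lt[OF q(2)] mult_less_of_squares by auto
   then have "\<bar>x * y' - x' * y\<bar> < m"
    by linarith
   with d show "x * y' = x' * y"
    using zdvd_not_zless[of "\<bar>x * y' - x' * y\<bar>" m] by (cases "x * y' = x' * y") auto
  qed (use q cop' in auto)
  show "\<not> m dvd x * y' + x' * y" if q: "(x, y) \<in> ?G" "(x', y') \<in> ?G" for x y x' y'
  proof
   assume d: "m dvd x * y' + x' * y"
   have pos: "0 < x * y' + x' * y"
    using q by (simp add: add_pos_pos)
   \<comment> \<open>The inequality of the arithmetic and geometric mean keeps the sum strictly
     below \<open>m\<close>, because \<open>x^2 + y^2\<close> is smaller than
     \<open>x^2 + 2 y^2 = m\<close>.\<close>
   have "0 \<le> (x - y') * (x - y') + (x' - y) * (x' - y)"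
    by simp
   then have "2 * (x * y' + x' * y) \<le> (x * x + y * y) + (x' * x' + y' * y')"
    by (simp add: algebra_simps)
   moreover have "x * x + y * y < m" "x' * x' + y' * y' < m"
   proof -
    have "0 < y * y" "0 < y' * y'" "x * x + 2 * (y * y) = m" "x' * x' + 2 * (y' * y') = m"
     using q by auto
    then show "x * x + y * y < m" "x' * x' + y' * y' < m"
     by linarith+
   qed
   ultimately have "2 * (x * y' + x' * y) < m + m"
    using add_strict_mono order.strict_trans1 by blast
   then have "x * y' + x' * y < m"
    by simp
   with d pos show False
    using zdvd_not_zless by blast
  qed
  show "\<exists>(x, y)\<in>?G. m dvd x - h * y \<or> m dvd x + h * y" if h: "m dvd h\<^sup>2 - - 2" for h
  proof -
   obtain x y where xy: "x * x < m" "y * y < m" "(x, y) \<noteq> (0, 0)" "m dvd x - h * y"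
    using thue_squarefree[OF m(3,2)] by blast
   have d: "m dvd x * x + 2 * (y * y)"
    using dvd_square_form[OF h xy(4)] by simp
   then obtain q where q: "x * x + 2 * (y * y) = m * q"
    by blast
   have pos: "0 < x * x + 2 * (y * y)"
    using xy(3) zero_le_square[of x] zero_le_square[of y] mult_eq_0_iff[of x x] mult_eq_0_iff[of y y]
    by (metis Pair_inject add_nonneg_eq_0_iff mult_2 add_nonneg_nonneg less_le)
   then have "0 < q"
    using q m by (simp add: zero_less_mult_iff)
   moreover have "m * q < m * 3"
    using q xy by linarith
   then have "q < 3"
    using m(2) by simp
   ultimately consider "q = 1" | "q = 2"
    by linarith
   then show ?thesis
   proof cases
    case 1
    then have sum: "x * x + 2 * (y * y) = m"
     using q by simp
    have nz: "x \<noteq> 0" "y \<noteq> 0"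
     using sum m(1) squarefree_not_square[OF m(3,2), of x] by auto
    with sum have "(\<bar>x\<bar>, \<bar>y\<bar>) \<in> ?G"
     by simp
    with dvd_abs_form xy(4) show ?thesis
     by blast
   next
    case 2
    then have "even (x * x)"
     using q by (metis dvd_add_left_iff dvd_triv_left dvd_triv_right)
    then obtain z where z: "x = 2 * z"
     by auto
    have sum: "y * y + 2 * (z * z) = m"
     using q 2 z by simp
    have nz: "y \<noteq> 0" "z \<noteq> 0"
     using sum m(1) squarefree_not_square[OF m(3,2), of y] by auto
    with sum have "(\<bar>y\<bar>, \<bar>z\<bar>) \<in> ?G"
     by simp
    moreover have "2 * (y + h * z) = h * (x - h * y) + (h\<^sup>2 - - 2) * y"
     by (simp add: algebra_simps power2_eq_square z)
    then have "m dvd 2 * (y + h * z)"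
     using h xy(4) by (metis dvd_add dvd_mult dvd_mult2)
    then have "m dvd y + h * z"
     using m(1) coprime_dvd_mult_right_iff[of m 2 "y + h * z"] by simp
    ultimately show ?thesis
     using dvd_abs_form by blast
   qed
  qed
 qed
 with G show ?thesis
  by simp
qed

text \<open>The exponent of 3 is even on the left and odd on the right unless
  \<open>b = 0\<close>.\<close>

lemma square_eq_3_times_square:
 fixes a b :: int
 assumes "a * a = 3 * (b * b)"
 shows "b = 0"
proof (rule ccontr)
 assume b: "b \<noteq> 0"
 then have a: "a \<noteq> 0"
  using assms by auto
 have p: "prime (3 :: int)"
  by simp
 have "multiplicity 3 (a * a) = multiplicity 3 (3 * (b * b))"
  using assms by simp
 then have "2 * multiplicity 3 a = 1 + 2 * multiplicity 3 b"
  using a b p by (simp add: prime_elem_multiplicity_mult_distrib)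
 then show False
  by presburger
qed

text \<open>The form \<open>2 y^2 - x^2\<close> is indefinite, so representations come in infinite
  families; \<open>0 < x < y\<close> is a fundamental domain that keeps one per pair of roots.
  Substituting \<open>x + y\<close> for \<open>y\<close> turns the domain into the positive quadrant
  and the form into \<open>x^2 + 4 x y + 2 y^2\<close>.\<close>

lemma card_roots_2:
 assumes m: "odd m" "1 < m" "squarefree m"
 shows "card (roots_mod 2 m) = 2 * card (reps 4 2 m)"
proof -
 let ?f = "\<lambda>(x, y). (x, x + y)" and ?G = "{(x, y). 0 < x \<and> x < y \<and> 2 * (y * y) - x * x = m}"
 have G: "?f ` reps 4 2 m = ?G"
 proof (intro equalityI subsetI)
  fix q assume "q \<in> ?f ` reps 4 2 m"
  then obtain x y where xy: "q = (x, x + y)" "0 \<le> x" "0 \<le> y" "x * x + 4 * x * y + 2 * (y * y) = m"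
   by (auto simp: reps_def form_def)
  have "x \<noteq> 0"
   using xy(4) m(1) by (cases "x = 0") auto
  moreover have "y \<noteq> 0"
   using xy(4) squarefree_not_square[OF m(3,2), of x] by (cases "y = 0") auto
  ultimately show "q \<in> ?G"
   using xy by (auto simp: algebra_simps)
 next
  fix q assume "q \<in> ?G"
  then obtain x y where "q = (x, y)" "0 < x" "x < y" "2 * (y * y) - x * x = m"
   by auto
  then show "q \<in> ?f ` reps 4 2 m"
   by (intro image_eqI[of _ _ "(x, y - x)"]) (auto simp: reps_def form_def algebra_simps)
 qed
 have "inj_on ?f (reps 4 2 m)"
  by (auto simp: inj_on_def)
 from card_image[OF this] have "card (reps 4 2 m) = card ?G"
  by (simp only: G)
 moreover have "card (roots_mod 2 m) = 2 * card ?G"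
 proof (rule card_roots_mod_eq_twice)
  have dvd2: "d\<^sup>2 dvd m" if "d dvd x" "d dvd y" "2 * (y * y) - x * x = m" for d x y
   using that by (metis dvd_diff dvd_mult mult_dvd_mono power2_eq_square)
  have eq: "x\<^sup>2 - 2 * y\<^sup>2 = - m" if "(x, y) \<in> ?G" for x y
   using that by (auto simp: power2_eq_square)
  have cop: "coprime y m" if "(x, y) \<in> ?G" for x y
   by (rule coprime_of_form[OF m(3,2), of x 2]) (use that dvd2 eq[OF that] in auto)
  have cop': "coprime x y" if "(x, y) \<in> ?G" for x y
  proof (rule coprimeI)
   fix d assume "d dvd x" "d dvd y"
   then have "d dvd m"
    using that by auto
   with \<open>d dvd y\<close> cop[OF that] show "is_unit d"
    using coprime_common_divisor by blast
  qed
  show "odd m" "1 < m" "coprime 2 m"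
   using m by auto
  show "m dvd x\<^sup>2 - 2 * y\<^sup>2 \<and> coprime y m" if "(x, y) \<in> ?G" for x y
   using cop[OF that] eq[OF that] by simp
  have lt: "x * x < m" "y * y < m" "0 \<le> x" "0 \<le> y" if "(x, y) \<in> ?G" for x y
  proof -
   have "x * x < y * y"
    using that by (auto intro: mult_strict_mono)
   then show "x * x < m" "y * y < m" "0 \<le> x" "0 \<le> y"
    using that by auto
  qed
  show "(x, y) = (x', y')" if q: "(x, y) \<in> ?G" "(x', y') \<in> ?G" and d: "m dvd x * y' - x' * y" for x y x' y'
  proof (rule cross_eq_imp_eq)
   have "x * y' < m" "x' * y < m" "0 \<le> x * y'" "0 \<le> x' * y"
    using lt[OF q(1)] lt[OF q(2)] mult_less_of_squares by auto
   then have "\<bar>x * y' - x' * y\<bar> < m"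
    by linarith
   with d show "x * y' = x' * y"
    using zdvd_not_zless[of "\<bar>x * y' - x' * y\<bar>" m] by (cases "x * y' = x' * y") auto
  qed (use q cop' in auto)
  show "\<not> m dvd x * y' + x' * y" if q: "(x, y) \<in> ?G" "(x', y') \<in> ?G" for x y x' y'
  proof
   assume d: "m dvd x * y' + x' * y"
   have "0 < x * y' + x' * y"
    using q by (simp add: add_pos_pos)
   moreover have "x * y' < m" "x' * y < m"
    using lt[OF q(1)] lt[OF q(2)] mult_less_of_squares by auto
   ultimately have S: "x * y' + x' * y = m"
    using small_multiple[OF d] by linarith
   \<comment> \<open>Brahmagupta's identity for \<open>2 y^2 - x^2\<close>: a sum equal to
     \<open>m\<close> would make a square equal to \<open>3 m^2\<close>.\<close>
   have "(2 * (y * y') + x * x') * (2 * (y * y') + x * x') =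
     (2 * (y * y) - x * x) * (2 * (y' * y') - x' * x') + 2 * ((x * y' + x' * y) * (x * y' + x' * y))"
    by (simp add: algebra_simps)
   also have "\<dots> = 3 * (m * m)"
    using q S by auto
   finally show False
    using square_eq_3_times_square[of _ m] m(2) by auto
  qed
  show "\<exists>(x, y)\<in>?G. m dvd x - h * y \<or> m dvd x + h * y" if h: "m dvd h\<^sup>2 - 2" for h
  proof -
   obtain x y where xy: "x * x < m" "y * y < m" "(x, y) \<noteq> (0, 0)" "m dvd x - h * y"
    using thue_squarefree[OF m(3,2)] by blast
   have "m dvd x * x - 2 * (y * y)"
    using dvd_square_form[OF h xy(4)] by simp
   then obtain q where q: "x * x - 2 * (y * y) = m * q"
    by blast
   \<comment> \<open>\<open>q = 0\<close> would make 2 the square of a rational number; the bounds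
     \<open>-2 < q < 1\<close> then leave only \<open>q = -1\<close>.\<close>
   have "q \<noteq> 0"
   proof
    assume "q = 0"
    then have e: "x * x = 2 * (y * y)"
     using q by simp
    then have "x \<noteq> 0" "y \<noteq> 0"
     using xy(3) by auto
    then have "2 * multiplicity 2 x = 1 + 2 * multiplicity 2 y"
     using arg_cong[OF e, of "multiplicity 2"] by (simp add: prime_elem_multiplicity_mult_distrib)
    then show False
     by presburger
   qed
   moreover have "m * q < m * 1"
    using q xy zero_le_square[of y] by linarith
   then have "q < 1"
    using m(2) by simp
   moreover have "m * - 2 < m * q"
    using q xy zero_le_square[of x] by linarith
   then have "- 2 < q"
    using m(2) mult_less_cancel_left_pos[of m "- 2" q] by linarith
   ultimately have "q = - 1"
    by linarith
   then have sum: "2 * (y * y) - x * x = m"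
    using q by simp
   then have "x * x < y * y"
    using xy(2) by linarith
   then have "\<bar>x\<bar> < \<bar>y\<bar>"
    by (metis abs_ge_zero abs_mult_self_eq linorder_not_less mult_mono)
   moreover have "x \<noteq> 0"
    using sum m(1) by (cases "x = 0") auto
   ultimately have "(\<bar>x\<bar>, \<bar>y\<bar>) \<in> ?G"
    using sum by simp
   with dvd_abs_form xy(4) show ?thesis
    by blast
  qed
 qed
 ultimately show ?thesis
  by simp
qed

definition form_gamma :: "int \<Rightarrow> int" where
 "form_gamma m = (if m mod 8 = 7 then 4 else 0)"

definition form_epsilon :: "int \<Rightarrow> int" where
 "form_epsilon m = (if m mod 8 = 7 \<or> m mod 8 = 3 then 2 else 4)"

text \<open>The class of \<open>m\<close> modulo 8 is chosen so that \<open>c\<close> is a quadratic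
  residue of every prime in it. A prime then has two roots and one representation; a composite
  squarefree \<open>m\<close> splits into coprime factors above 1 with even root counts, so its
  roots come in multiples of 4 and its representations in multiples of 2.\<close>

theorem prime_iff_odd_reps:
 assumes m: "odd m" "1 < m" "squarefree m"
 shows "prime m \<longleftrightarrow> odd (card (reps (form_gamma m) (form_epsilon m) m))"
proof -
 define c :: int where "c = (if m mod 8 = 7 then 2 else if m mod 8 = 3 then - 2 else - 1)"
 have card: "card (roots_mod c m) = 2 * card (reps (form_gamma m) (form_epsilon m) m)"
  using m by (simp add: c_def form_gamma_def form_epsilon_def card_roots_2 card_roots_minus_2 card_roots_minus_1)
 have cop: "coprime c q" if "odd q" for q
  using that by (simp add: c_def)
 show ?thesis
 proof (cases "prime m")
  case True
  have mn: "int (nat m) = m"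
   using m(2) by simp
  have prime: "prime (nat m)"
   using True by (subst (asm) prime_int_nat_transfer) (rule conjunct2)
  have "QuadRes m c"
  proof (cases "m mod 8 = 7 \<or> m mod 8 = 3")
   case True
   then have "nat m mod 8 = 7 \<or> nat m mod 8 = 3"
    using m(2) by (auto simp: nat_mod_as_int)
   with True mn prime QuadRes_2[of "nat m"] QuadRes_minus_2[of "nat m"] show ?thesis
    by (auto simp: c_def nat_mod_as_int)
  next
   case False
   have "m mod 4 = 1"
    using m(1) False by presburger
   then have "nat m mod 4 = 1"
    using m(2) by (simp add: nat_mod_as_int)
   with False mn prime QuadRes_minus_1[of "nat m"] show ?thesis
    by (auto simp: c_def)
  qed
  then have "card (roots_mod c m) = 2"
   using card_roots_mod_prime True m cop by blast
  with True card show ?thesis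
   by simp
 next
  case False
  then obtain a where a: "0 \<le> a" "a dvd m" "a \<noteq> 1" "a \<noteq> m"
   using m(2) by (auto simp: prime_int_iff)
  then obtain b where b: "m = a * b"
   by blast
  have "0 < a"
   using a b m(2) by (cases "a = 0") auto
  then have "0 < b"
   using b m(2) by (metis less_trans zero_less_mult_pos zero_less_one)
  have "b \<noteq> 1"
   using a b by auto
  with \<open>0 < a\<close> \<open>0 < b\<close> a b have ab: "m = a * b" "1 < a" "1 < b"
   by auto
  have "coprime a b"
  proof (rule coprimeI)
   fix d assume "d dvd a" "d dvd b"
   then have "d\<^sup>2 dvd m"
    by (simp add: ab power2_eq_square mult_dvd_mono)
   with m(3) show "is_unit d"
    by (simp add: squarefree_def)
  qed
  then have "card (roots_mod c m) = card (roots_mod c a) * card (roots_mod c b)"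
   using card_roots_mod_mult ab by simp
  moreover have "even (card (roots_mod c a))" "even (card (roots_mod c b))"
   using m(1) ab cop by (auto intro!: even_card_roots_mod)
  ultimately have "even (card (reps (form_gamma m) (form_epsilon m) m))"
   using card by (auto elim!: evenE)
  with False show ?thesis
   by simp
 qed
qed

section \<open>Representations modulo a wheel\<close>

lemma dvd_mult_cancel_prime:
 "prime (p :: int) \<Longrightarrow> \<not> p dvd a \<Longrightarrow> p dvd a * b \<Longrightarrow> p dvd b"
 by (simp add: prime_dvd_mult_iff)

lemma eq_if_dvd_diff:
 fixes x y p :: int
 assumes "x \<in> {0..<p}" "y \<in> {0..<p}" "p dvd x - y"
 shows "x = y"
 using assms by (metis atLeastLessThan_iff mod_eq_dvd_iff mod_pos_pos_trivial)

text \<open>Stereographic projection: once one point of the conic is known, every other point is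
  determined by the slope of its line through a centre. Slopes with
  \<open>\<Delta> * t^2 = 1\<close> are asymptotic directions and do not occur; the extra 1 counts
  the centre itself.\<close>

lemma card_conic_le:
 fixes p \<kappa> \<Delta> :: int
 assumes p: "prime p" "odd p" and \<kappa>: "\<not> p dvd \<kappa>" and \<Delta>: "\<not> p dvd \<Delta>"
 defines "S \<equiv> {(x, y) \<in> {0..<p} \<times> {0..<p}. p dvd x * x - \<Delta> * (y * y) - \<kappa>}"
 shows "card S \<le> 1 + card {t \<in> {0..<p}. \<not> p dvd \<Delta> * (t * t) - 1}"
proof (cases "S = {}")
 case False
 then obtain a b where ab: "p dvd a * a - \<Delta> * (b * b) - \<kappa>"
  by (auto simp: S_def)
 have p2: "\<not> p dvd 2"
 proof
  assume "p dvd 2"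
  then have "p \<le> 2"
   by (simp add: zdvd_imp_le)
  with p prime_ge_2_int[OF p(1)] have "p = 2"
   by linarith
  with p(2) show False
   by simp
 qed
 \<comment> \<open>Reading \<open>(x, y)\<close> as \<open>x + y sqrt \<Delta>\<close>, these are,
   up to the sign of \<open>?D\<close>, the coordinates of its product with the conjugate of
   \<open>a + b sqrt \<Delta>\<close>. Norms multiply to \<open>\<kappa>^2\<close>, and the
   projection is from \<open>(-\<kappa>, 0)\<close>.\<close>
 let ?I = "\<lambda>(x, y). x * a - \<Delta> * (y * b)" and ?D = "\<lambda>(x, y). x * b - y * a"
 have eq: "z = z'" if z: "z \<in> S" "z' \<in> S" and I: "p dvd ?I z - ?I z'" and D: "p dvd ?D z - ?D z'" for z z'
 proof -
  obtain x y x' y' where xy: "z = (x, y)" "z' = (x', y')"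
   by (cases z, cases z')
  have "p dvd \<kappa> * (x - x')"
  proof -
   have "\<kappa> * (x - x') = a * (?I z - ?I z') - \<Delta> * b * (?D z - ?D z')
     - (x - x') * (a * a - \<Delta> * (b * b) - \<kappa>)"
    by (simp add: xy algebra_simps)
   with I D ab show ?thesis
    by (metis dvd_diff dvd_mult)
  qed
  moreover have "p dvd \<kappa> * (y - y')"
  proof -
   have "\<kappa> * (y - y') = b * (?I z - ?I z') - a * (?D z - ?D z')
     - (y - y') * (a * a - \<Delta> * (b * b) - \<kappa>)"
    by (simp add: xy algebra_simps)
   with I D ab show ?thesis
    by (metis dvd_diff dvd_mult)
  qed
  ultimately have "p dvd x - x'" "p dvd y - y'"
   using dvd_mult_cancel_prime[OF p(1) \<kappa>] by blast+
  with z show ?thesis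
   by (auto simp: S_def xy intro: eq_if_dvd_diff)
 qed
 have id: "p dvd ?I z * ?I z - \<Delta> * (?D z * ?D z) - \<kappa> * \<kappa>" if "z \<in> S" for z
 proof -
  obtain x y where xy: "z = (x, y)"
   by (cases z)
  have d: "p dvd x * x - \<Delta> * (y * y) - \<kappa>"
   using that by (simp add: S_def xy)
  have "?I z * ?I z - \<Delta> * (?D z * ?D z) - \<kappa> * \<kappa> =
    (a * a - \<Delta> * (b * b)) * (x * x - \<Delta> * (y * y) - \<kappa>) + \<kappa> * (a * a - \<Delta> * (b * b) - \<kappa>)"
   by (simp add: xy algebra_simps)
  with d ab show ?thesis
   by (metis dvd_add dvd_mult)
 qed
 let ?S0 = "{z \<in> S. p dvd ?I z + \<kappa>}" and ?S1 = "{z \<in> S. \<not> p dvd ?I z + \<kappa>}"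
 let ?T = "{t \<in> {0..<p}. \<not> p dvd \<Delta> * (t * t) - 1}"
 have finS: "finite S"
  by (rule finite_subset[of _ "{0..<p} \<times> {0..<p}"]) (auto simp: S_def)
 have finT: "finite ?T"
  by (rule finite_subset[of _ "{0..<p}"]) auto
 have D0: "p dvd \<Delta> * (?D z * ?D z)" if "z \<in> ?S0" for z
 proof -
  have "\<Delta> * (?D z * ?D z) = (?I z + \<kappa>) * (?I z - \<kappa>) - (?I z * ?I z - \<Delta> * (?D z * ?D z) - \<kappa> * \<kappa>)"
   by (simp add: algebra_simps)
  with id that show ?thesis
   by (metis (no_types, lifting) dvd_diff dvd_mult2 mem_Collect_eq)
 qed
 have card0: "card ?S0 \<le> 1"
 proof -
  have "z = z'" if z: "z \<in> ?S0" "z' \<in> ?S0" for z z'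
  proof (rule eq)
   have "p dvd ?D z * ?D z" "p dvd ?D z' * ?D z'"
    using D0[OF z(1)] D0[OF z(2)] dvd_mult_cancel_prime[OF p(1) \<Delta>] by blast+
   then have "p dvd ?D z" "p dvd ?D z'"
    using p(1) prime_dvd_mult_iff by blast+
   then show "p dvd ?D z - ?D z'"
    by (rule dvd_diff)
   have "p dvd (?I z + \<kappa>) - (?I z' + \<kappa>)"
    by (rule dvd_diff) (use z in blast)+
   then show "p dvd ?I z - ?I z'"
    by simp
  qed (use z in auto)
  then show ?thesis
   using card_le_Suc0_iff_eq[of ?S0] finS by auto
 qed
 define slope where "slope z = (SOME t. t \<in> {0..<p} \<and> p dvd ?D z - t * (?I z + \<kappa>))" for z
 have slope: "slope z \<in> {0..<p} \<and> p dvd ?D z - slope z * (?I z + \<kappa>)" if "z \<in> ?S1" for z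
 proof -
  have "coprime (?I z + \<kappa>) p"
   using that p(1) by (metis (mono_tags, lifting) coprime_commute mem_Collect_eq prime_imp_coprime)
  then obtain q where "[(?I z + \<kappa>) * q = 1] (mod p)"
   using cong_solve_coprime_int by blast
  then have q: "p dvd (?I z + \<kappa>) * q - 1"
   by (simp add: cong_iff_dvd_diff)
  let ?t = "(?D z * q) mod p"
  have "p dvd ?t - ?D z * q"
   by (simp add: mod_eq_dvd_iff[symmetric])
  moreover have "?D z - ?t * (?I z + \<kappa>) =
    - (?D z * ((?I z + \<kappa>) * q - 1)) - (?t - ?D z * q) * (?I z + \<kappa>)"
   by (simp add: algebra_simps)
  ultimately have "p dvd ?D z - ?t * (?I z + \<kappa>)"
   using q by (metis dvd_diff dvd_minus_iff dvd_mult dvd_mult2)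
  moreover have "?t \<in> {0..<p}"
   using p(1) by (simp add: prime_gt_0_int)
  ultimately show ?thesis
   unfolding slope_def by (metis (mono_tags, lifting) someI)
 qed
 \<comment> \<open>\<open>?I^2 - \<kappa>^2 = \<Delta> * ?D^2\<close> with
   \<open>?D = t * (?I + \<kappa>)\<close>, divided by the unit \<open>?I + \<kappa>\<close>. The
   result is linear in \<open>?I\<close>, which makes the slope determine the point.\<close>
 have key: "p dvd ?I z - \<kappa> - \<Delta> * (t * t) * (?I z + \<kappa>)"
  if z: "z \<in> ?S1" and t: "t = slope z" for z t
 proof -
  have d: "p dvd ?D z - t * (?I z + \<kappa>)"
   using slope[OF z] t by blast
  have "(?I z + \<kappa>) * (?I z - \<kappa> - \<Delta> * (t * t) * (?I z + \<kappa>)) =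
    (?I z * ?I z - \<Delta> * (?D z * ?D z) - \<kappa> * \<kappa>) +
    \<Delta> * (?D z + t * (?I z + \<kappa>)) * (?D z - t * (?I z + \<kappa>))"
   by (simp add: algebra_simps)
  with id[of z] d z have "p dvd (?I z + \<kappa>) * (?I z - \<kappa> - \<Delta> * (t * t) * (?I z + \<kappa>))"
   by (metis (no_types, lifting) dvd_add dvd_mult mem_Collect_eq)
  then show ?thesis
   using dvd_mult_cancel_prime[OF p(1)] z by blast
 qed
 have "card ?S1 \<le> card ?T"
 proof (rule card_inj_on_le[where f = slope])
  show "slope ` ?S1 \<subseteq> ?T"
  proof
   fix t assume "t \<in> slope ` ?S1"
   then obtain z where z: "z \<in> ?S1" "t = slope z"
    by blast
   have "\<not> p dvd \<Delta> * (t * t) - 1"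
   proof
    assume d: "p dvd \<Delta> * (t * t) - 1"
    \<comment> \<open>If \<open>\<Delta> * t^2 = 1\<close>, the linear relation loses
      \<open>?I\<close> and reads \<open>-2 \<kappa> = 0\<close>, while \<open>p\<close> divides
      neither 2 nor \<open>\<kappa>\<close>.\<close>
    have "- (2 * \<kappa>) = (?I z - \<kappa> - \<Delta> * (t * t) * (?I z + \<kappa>)) + (\<Delta> * (t * t) - 1) * (?I z + \<kappa>)"
     by (simp add: algebra_simps)
    with key[OF z] d have "p dvd 2 * \<kappa>"
     by (metis dvd_add dvd_minus_iff dvd_mult2)
    with p(1) p2 \<kappa> show False
     by (simp add: prime_dvd_mult_iff)
   qed
   with slope z show "t \<in> ?T"
    by blast
  qed
  show "inj_on slope ?S1"
  proof (rule inj_onI)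
   fix z z' assume z: "z \<in> ?S1" "z' \<in> ?S1" and s: "slope z = slope z'"
   let ?t = "slope z"
   have nd: "\<not> p dvd \<Delta> * (?t * ?t) - 1"
    using \<open>slope ` ?S1 \<subseteq> ?T\<close> z(1) by blast
   have "(1 - \<Delta> * (?t * ?t)) * (?I z - ?I z') =
     (?I z - \<kappa> - \<Delta> * (?t * ?t) * (?I z + \<kappa>)) - (?I z' - \<kappa> - \<Delta> * (?t * ?t) * (?I z' + \<kappa>))"
    by (simp add: algebra_simps)
   then have "p dvd (1 - \<Delta> * (?t * ?t)) * (?I z - ?I z')"
    using key[OF z(1) refl] key[OF z(2) s] by (metis dvd_diff)
   moreover have "\<not> p dvd 1 - \<Delta> * (?t * ?t)"
    using nd by (metis dvd_minus_iff minus_diff_eq)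
   ultimately have I: "p dvd ?I z - ?I z'"
    using dvd_mult_cancel_prime[OF p(1)] by blast
   have d: "p dvd ?D z - ?t * (?I z + \<kappa>)" "p dvd ?D z' - ?t * (?I z' + \<kappa>)"
    using slope[OF z(1)] slope[OF z(2)] s by simp_all
   have "?D z - ?D z' = (?D z - ?t * (?I z + \<kappa>)) - (?D z' - ?t * (?I z' + \<kappa>)) + ?t * (?I z - ?I z')"
    by (simp add: algebra_simps)
   then have "p dvd ?D z - ?D z'"
    using d I by (metis dvd_add dvd_diff dvd_mult)
   with I z show "z = z'"
    by (intro eq) auto
  qed
 qed (rule finT)
 moreover have "S = ?S0 \<union> ?S1"
  by blast
 then have "card S \<le> card ?S0 + card ?S1"
  by (metis (no_types, lifting) card_Un_le)
 ultimately show ?thesis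
  using card0 by linarith
qed simp

definition reps_mod :: "int \<Rightarrow> int \<Rightarrow> int \<Rightarrow> int \<Rightarrow> (int \<times> int) set" where
 "reps_mod \<gamma> \<epsilon> \<rho> M = {(x, y) \<in> {0..<M} \<times> {0..<M}. M dvd form \<gamma> \<epsilon> x y - \<rho>}"

lemma finite_reps_mod: "finite (reps_mod \<gamma> \<epsilon> \<rho> M)"
 by (rule finite_subset[of _ "{0..<M} \<times> {0..<M}"]) (auto simp: reps_mod_def)

lemma form_cong:
 assumes "x mod M = x' mod M" "y mod M = y' mod M"
 shows "form \<gamma> \<epsilon> x y mod M = form \<gamma> \<epsilon> x' y' mod M"
proof -
 have "[x = x'] (mod M)" "[y = y'] (mod M)"
  using assms by (simp_all add: cong_def)
 then have "[form \<gamma> \<epsilon> x y = form \<gamma> \<epsilon> x' y'] (mod M)"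
  unfolding form_def by (intro cong_add cong_mult cong_refl)
 then show ?thesis
  by (simp add: cong_def)
qed

lemma card_reps_mod_le_square: "0 < M \<Longrightarrow> card (reps_mod \<gamma> \<epsilon> \<rho> M) \<le> nat M * nat M"
proof -
 have "reps_mod \<gamma> \<epsilon> \<rho> M \<subseteq> {0..<M} \<times> {0..<M}"
  by (auto simp: reps_mod_def)
 from card_mono[OF _ this] show ?thesis
  by (simp add: card_cartesian_product)
qed

lemma card_reps_mod_mult_le:
 assumes "coprime a b" "0 < a" "0 < b"
 shows "card (reps_mod \<gamma> \<epsilon> \<rho> (a * b)) \<le> card (reps_mod \<gamma> \<epsilon> \<rho> a) * card (reps_mod \<gamma> \<epsilon> \<rho> b)"
proof -
 let ?f = "\<lambda>(x, y). ((x mod a, y mod a), (x mod b, y mod b))"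
 have "?f ` reps_mod \<gamma> \<epsilon> \<rho> (a * b) \<subseteq> reps_mod \<gamma> \<epsilon> \<rho> a \<times> reps_mod \<gamma> \<epsilon> \<rho> b"
 proof (rule image_subsetI, clarify)
  fix x y assume "(x, y) \<in> reps_mod \<gamma> \<epsilon> \<rho> (a * b)"
  then have "a * b dvd form \<gamma> \<epsilon> x y - \<rho>"
   by (simp add: reps_mod_def)
  then have "a dvd form \<gamma> \<epsilon> x y - \<rho>" "b dvd form \<gamma> \<epsilon> x y - \<rho>"
   using dvd_mult_left dvd_mult_right by blast+
  then have "form \<gamma> \<epsilon> x y mod a = \<rho> mod a" "form \<gamma> \<epsilon> x y mod b = \<rho> mod b"
   by (simp_all add: mod_eq_dvd_iff)
  then have "a dvd form \<gamma> \<epsilon> (x mod a) (y mod a) - \<rho>" "b dvd form \<gamma> \<epsilon> (x mod b) (y mod b) - \<rho>"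
   using form_cong[of "x mod a" a x "y mod a" y] form_cong[of "x mod b" b x "y mod b" y]
   by (simp_all add: mod_eq_dvd_iff[symmetric])
  then show "((x mod a, y mod a) \<in> reps_mod \<gamma> \<epsilon> \<rho> a) \<and> ((x mod b, y mod b) \<in> reps_mod \<gamma> \<epsilon> \<rho> b)"
   using assms by (simp add: reps_mod_def)
 qed
 moreover have "inj_on ?f (reps_mod \<gamma> \<epsilon> \<rho> (a * b))"
 proof (rule inj_onI, clarify)
  fix x y x' y' assume xy: "(x, y) \<in> reps_mod \<gamma> \<epsilon> \<rho> (a * b)" "(x', y') \<in> reps_mod \<gamma> \<epsilon> \<rho> (a * b)"
   and e: "x mod a = x' mod a" "y mod a = y' mod a" "x mod b = x' mod b" "y mod b = y' mod b"
  have "a * b dvd x - x'" "a * b dvd y - y'"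
   using e assms(1) by (simp_all add: divides_mult mod_eq_dvd_iff)
  with xy show "x = x' \<and> y = y'"
   by (auto simp: reps_mod_def intro: eq_if_dvd_diff)
 qed
 ultimately show ?thesis
  using card_inj_on_le[of ?f "reps_mod \<gamma> \<epsilon> \<rho> (a * b)" "reps_mod \<gamma> \<epsilon> \<rho> a \<times> reps_mod \<gamma> \<epsilon> \<rho> b"]
  by (simp add: card_cartesian_product finite_reps_mod)
qed

text \<open>Completing the square: 4 times the form is
  \<open>(2 x + \<gamma> y)^2 - (\<gamma>^2 - 4 \<epsilon>) y^2\<close>, and 2 is invertible modulo
  an odd prime.\<close>

lemma card_reps_mod_prime_le_conic:
 assumes p: "prime p" "odd p" and \<rho>: "\<not> p dvd \<rho>" and \<Delta>: "\<not> p dvd \<gamma> * \<gamma> - 4 * \<epsilon>"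
 shows "card (reps_mod \<gamma> \<epsilon> \<rho> p) \<le> 1 + card {t \<in> {0..<p}. \<not> p dvd (\<gamma> * \<gamma> - 4 * \<epsilon>) * (t * t) - 1}"
proof -
 let ?S = "{(x, y) \<in> {0..<p} \<times> {0..<p}. p dvd x * x - (\<gamma> * \<gamma> - 4 * \<epsilon>) * (y * y) - 4 * \<rho>}"
 let ?f = "\<lambda>(x, y). ((2 * x + \<gamma> * y) mod p, y)"
 have p0: "0 < p"
  using p(1) by (simp add: prime_gt_0_int)
 have p2: "coprime p 2"
  using p(2) by simp
 have "?f ` reps_mod \<gamma> \<epsilon> \<rho> p \<subseteq> ?S"
 proof (rule image_subsetI)
  fix z assume "z \<in> reps_mod \<gamma> \<epsilon> \<rho> p"
  then obtain x y where z: "z = (x, y)" and xy: "(x, y) \<in> reps_mod \<gamma> \<epsilon> \<rho> p"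
   by (cases z) auto
  have d: "p dvd form \<gamma> \<epsilon> x y - \<rho>"
   using xy by (simp add: reps_mod_def)
  let ?z = "2 * x + \<gamma> * y"
  have "p dvd ?z mod p - ?z"
   by (simp add: mod_eq_dvd_iff[symmetric])
  moreover have "(?z mod p) * (?z mod p) - (\<gamma> * \<gamma> - 4 * \<epsilon>) * (y * y) - 4 * \<rho> =
    4 * (form \<gamma> \<epsilon> x y - \<rho>) + (?z mod p + ?z) * (?z mod p - ?z)"
   by (simp add: form_def algebra_simps)
  ultimately have "p dvd (?z mod p) * (?z mod p) - (\<gamma> * \<gamma> - 4 * \<epsilon>) * (y * y) - 4 * \<rho>"
   using d by (metis dvd_add dvd_mult)
  with xy p0 show "?f z \<in> ?S"
   by (simp add: reps_mod_def z)
 qed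
 moreover have "inj_on ?f (reps_mod \<gamma> \<epsilon> \<rho> p)"
 proof (rule inj_onI)
  fix z z' assume z: "z \<in> reps_mod \<gamma> \<epsilon> \<rho> p" "z' \<in> reps_mod \<gamma> \<epsilon> \<rho> p" "?f z = ?f z'"
  obtain x y x' y' where zz: "z = (x, y)" "z' = (x', y')"
   by (cases z, cases z')
  with z have xy: "(x, y) \<in> reps_mod \<gamma> \<epsilon> \<rho> p" "(x', y) \<in> reps_mod \<gamma> \<epsilon> \<rho> p" "y = y'"
   and e: "(2 * x + \<gamma> * y) mod p = (2 * x' + \<gamma> * y) mod p"
   by auto
  have "p dvd 2 * (x - x')"
   using e by (simp add: mod_eq_dvd_iff algebra_simps)
  then have "p dvd x - x'"
   using coprime_dvd_mult_right_iff[OF p2] by blast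
  with xy show "z = z'"
   by (auto simp: reps_mod_def zz intro: eq_if_dvd_diff)
 qed
 moreover have "finite ?S"
  by (rule finite_subset[of _ "{0..<p} \<times> {0..<p}"]) auto
 ultimately have "card (reps_mod \<gamma> \<epsilon> \<rho> p) \<le> card ?S"
  by (intro card_inj_on_le)
 moreover have "\<not> p dvd 4 * \<rho>"
 proof -
  have "coprime p (2 * 2)"
   using p2 by (simp only: coprime_mult_right_iff)
  then show ?thesis
   using coprime_dvd_mult_right_iff[of p 4 \<rho>] \<rho> by simp
 qed
 ultimately show ?thesis
  using card_conic_le[OF p _ \<Delta>, of "4 * \<rho>"] by linarith
qed

lemma card_reps_mod_prime_le:
 assumes "prime p" "odd p" "\<not> p dvd \<rho>" "\<not> p dvd \<gamma> * \<gamma> - 4 * \<epsilon>"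
 shows "card (reps_mod \<gamma> \<epsilon> \<rho> p) \<le> nat p + 1"
proof -
 have "card {t \<in> {0..<p}. \<not> p dvd (\<gamma> * \<gamma> - 4 * \<epsilon>) * (t * t) - 1} \<le> card {0..<p}"
  by (intro card_mono) auto
 with card_reps_mod_prime_le_conic[OF assms] show ?thesis
  by simp
qed

text \<open>When the discriminant is a nonzero square \<open>y^2\<close>, the two slopes
  \<open>1 / y\<close> and \<open>-1 / y\<close> are excluded on the conic, which lowers the bound
  from \<open>p + 1\<close> to \<open>p - 1\<close>.\<close>

lemma card_reps_mod_prime_le_QuadRes:
 assumes p: "prime p" "odd p" "\<not> p dvd \<rho>" "\<not> p dvd \<gamma> * \<gamma> - 4 * \<epsilon>"
  and "QuadRes p (\<gamma> * \<gamma> - 4 * \<epsilon>)"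
 shows "card (reps_mod \<gamma> \<epsilon> \<rho> p) \<le> nat p - 1"
proof -
 let ?\<Delta> = "\<gamma> * \<gamma> - 4 * \<epsilon>" and ?T = "{t \<in> {0..<p}. \<not> p dvd (\<gamma> * \<gamma> - 4 * \<epsilon>) * (t * t) - 1}"
 have p1: "1 < p"
  using p(1) by (simp add: prime_gt_1_int)
 obtain y where "[y\<^sup>2 = ?\<Delta>] (mod p)"
  using assms(5) by (auto simp: QuadRes_def)
 then have y: "p dvd y * y - ?\<Delta>"
  by (simp add: cong_iff_dvd_diff power2_eq_square)
 have "\<not> p dvd y"
 proof
  assume "p dvd y"
  then have "p dvd y * y"
   by simp
  from dvd_diff[OF this y] p(4) show False
   by simp
 qed
 then have "coprime y p"
  using p(1) by (metis coprime_commute prime_imp_coprime)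
 then obtain q where "[y * q = 1] (mod p)"
  using cong_solve_coprime_int by blast
 then have q: "p dvd y * q - 1"
  by (simp add: cong_iff_dvd_diff)
 have root: "p dvd ?\<Delta> * (t * t) - 1" if t: "p dvd t - q \<or> p dvd t - (- q)" for t
 proof -
  have "?\<Delta> * (t * t) - 1 = (y * q + 1) * (y * q - 1) + ?\<Delta> * ((t - q) * (t - (- q))) - q * q * (y * y - ?\<Delta>)"
   by (simp add: algebra_simps)
  with q y t show ?thesis
   by (metis (no_types, lifting) dvd_add dvd_diff dvd_mult dvd_mult2)
 qed
 have qn: "\<not> p dvd q - (- q)"
 proof
  assume "p dvd q - (- q)"
  then have "p dvd 2 * q"
   by simp
  then have "p dvd q"
   using p(2) coprime_dvd_mult_right_iff[of p 2 q] by simp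
  then have "p dvd y * q"
   by simp
  from dvd_diff[OF this q] p1 show False
   by simp
 qed
 have ne: "q mod p \<noteq> (- q) mod p"
  using qn by (metis mod_eq_dvd_iff)
 have "p dvd ?\<Delta> * ((q mod p) * (q mod p)) - 1"
  by (rule root) (simp add: mod_eq_dvd_iff[symmetric])
 moreover have "p dvd ?\<Delta> * (((- q) mod p) * ((- q) mod p)) - 1"
  by (rule root, rule disjI2) (simp only: mod_eq_dvd_iff[symmetric] mod_mod_trivial)
 ultimately have "?T \<subseteq> {0..<p} - {q mod p, (- q) mod p}"
  by blast
 then have "card ?T \<le> card ({0..<p} - {q mod p, (- q) mod p})"
  by (intro card_mono) auto
 also have "\<dots> = nat p - 2"
  using ne p1 by (subst card_Diff_subset) auto
 finally show ?thesis
  using card_reps_mod_prime_le_conic[OF p] p1 prime_ge_2_int[OF p(1)] by linarith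
qed

section \<open>Euler products of real characters\<close>

text \<open>Complete multiplicativity and the values -1, 0, 1 carry the Euler products; the
  arithmetic of a particular character enters only as a lower bound on its partial sums.\<close>

locale real_character =
 fixes \<chi> :: "nat \<Rightarrow> real"
 assumes one: "\<chi> 1 = 1"
  and mult: "\<And>a b. \<chi> (a * b) = \<chi> a * \<chi> b"
  and range: "\<And>a. \<chi> a \<in> {- 1, 0, 1}"
begin

definition divisor_sum :: "nat \<Rightarrow> real" where
 "divisor_sum m = (\<Sum>d | d dvd m. \<chi> d)"

lemma power: "\<chi> (a ^ i) = \<chi> a ^ i"
 using one by (induction i) (simp_all add: mult)

lemma geometric_nonneg: "0 \<le> (\<Sum>i\<le>e. \<chi> a ^ i)"
proof -
 have "(\<Sum>i\<le>e. (- 1) ^ i) = (of_bool (even e) :: real)" for e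
  by (induction e) auto
 then show ?thesis
  using range[of a] by (auto intro: sum_nonneg)
qed

lemma divisor_sum_prime_power_mult:
 assumes p: "prime p" "\<not> p dvd m" "0 < m"
 shows "divisor_sum (p ^ e * m) = (\<Sum>i\<le>e. \<chi> p ^ i) * divisor_sum m"
proof -
 let ?f = "\<lambda>(i, d). p ^ i * d"
 have "bij_betw ?f ({..e} \<times> {d. d dvd m}) {d. d dvd p ^ e * m}"
  unfolding bij_betw_def
 proof
  show "inj_on ?f ({..e} \<times> {d. d dvd m})"
  proof (rule inj_onI)
   fix z z' assume z: "z \<in> {..e} \<times> {d. d dvd m}" "z' \<in> {..e} \<times> {d. d dvd m}" "?f z = ?f z'"
   obtain i d i' d' where zz: "z = (i, d)" "z' = (i', d')"
    by (cases z, cases z')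
   have nd: "\<not> p dvd d" "\<not> p dvd d'"
    using z zz p(2) dvd_trans by blast+
   have eq: "p ^ i * d = p ^ i' * d'"
    using z zz by simp
   have "multiplicity p (p ^ i * d) = i" "multiplicity p (p ^ i' * d') = i'"
    using nd p(1) by (auto intro!: multiplicity_eqI simp: prime_gt_0_nat)
   with eq have "i = i'"
    by simp
   with eq p(1) show "z = z'"
    by (simp add: zz prime_gt_0_nat)
  qed
  show "?f ` ({..e} \<times> {d. d dvd m}) = {d. d dvd p ^ e * m}"
  proof (intro equalityI subsetI)
   fix d assume "d \<in> {d. d dvd p ^ e * m}"
   then obtain b c where bc: "d = b * c" "b dvd p ^ e" "c dvd m"
    by (auto elim: dvd_productE)
   then obtain i where "i \<le> e" "b = p ^ i"
    using divides_primepow_nat p(1) by blast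
   with bc show "d \<in> ?f ` ({..e} \<times> {d. d dvd m})"
    by (intro image_eqI[of _ _ "(i, c)"]) auto
  qed (auto intro!: mult_dvd_mono le_imp_power_dvd)
 qed
 from sum.reindex_bij_betw[OF this, of \<chi>]
 have "divisor_sum (p ^ e * m) = (\<Sum>z\<in>{..e} \<times> {d. d dvd m}. \<chi> (?f z))"
  by (simp add: divisor_sum_def)
 also have "\<dots> = (\<Sum>z\<in>{..e} \<times> {d. d dvd m}. \<chi> p ^ fst z * \<chi> (snd z))"
  by (intro sum.cong) (auto simp: mult power)
 also have "\<dots> = (\<Sum>i\<le>e. \<chi> p ^ i) * divisor_sum m"
  by (simp add: divisor_sum_def sum_product sum.cartesian_product case_prod_unfold)
 finally show ?thesis .
qed

lemma divisor_sum_nonneg: "0 < m \<Longrightarrow> 0 \<le> divisor_sum m"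
proof (induction m rule: less_induct)
 case (less m)
 show ?case
 proof (cases "m = 1")
  case True
  then show ?thesis
   using one by (simp add: divisor_sum_def)
 next
  case False
  then obtain p where p: "prime p" "p dvd m"
   using prime_factor_nat by blast
  define n where "n = m div p ^ multiplicity p m"
  have n: "m = p ^ multiplicity p m * n" "\<not> p dvd n"
   using less.prems prime_gt_1_nat[OF p(1)] multiplicity_decompose[of m p]
   by (simp_all add: n_def multiplicity_dvd)
  have "0 < multiplicity p m"
   using p less.prems by (simp add: prime_multiplicity_gt_zero_iff)
  then have "1 < p ^ multiplicity p m"
   using prime_gt_1_nat[OF p(1)] one_less_power by blast
  moreover have n0: "0 < n"
   using n less.prems by (cases n) auto
  ultimately have "n < m"
   using n(1) n_less_m_mult_n[of n "p ^ multiplicity p m"] by simp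
  with less.IH n0 have "0 \<le> divisor_sum n"
   by blast
  moreover have "divisor_sum m = (\<Sum>i\<le>multiplicity p m. \<chi> p ^ i) * divisor_sum n"
   using divisor_sum_prime_power_mult[OF p(1) n(2) n0, of "multiplicity p m"] n(1) by simp
  ultimately show ?thesis
   using geometric_nonneg by simp
 qed
qed

definition smooth :: "nat set \<Rightarrow> nat \<Rightarrow> nat set" where
 "smooth S X = {m \<in> {1..X}. \<forall>p. prime p \<and> p dvd m \<longrightarrow> p \<in> S}"

text \<open>The reciprocal of the local factor at 1 of the zeta function times the L-series of
  \<open>\<chi>\<close>, whose Dirichlet coefficients are \<open>divisor_sum\<close>.\<close>

definition euler_factor :: "nat \<Rightarrow> real" where
 "euler_factor p = (1 - 1 / real p) * (1 - \<chi> p / real p)"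

lemma euler_factor_pos: "prime p \<Longrightarrow> 0 < euler_factor p"
proof -
 assume "prime p"
 then have "1 < real p"
  using prime_gt_1_nat by simp
 then have "1 / real p < 1" "0 < 1 / real p"
  by simp_all
 then show ?thesis
  using range[of p] unfolding euler_factor_def by (intro mult_pos_pos) (auto simp: add_pos_pos simp del: zero_less_divide_iff)
qed

text \<open>The full local series times its Euler factor is 1; for the truncated series the
  induction exhibits the missing tail explicitly, and it has the right sign.\<close>

lemma euler_factor_sum:
 assumes "prime p"
 shows "(\<Sum>e\<le>E. (\<Sum>i\<le>e. \<chi> p ^ i) / real p ^ e) * euler_factor p \<le> 1"
proof -
 define x c where "x = 1 / real p" and "c = \<chi> p"
 define g where "g e = (\<Sum>i\<le>e. c ^ i)" for e
 have x: "0 < x" "x < 1"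
  using prime_gt_1_nat[OF assms] by (simp_all add: x_def)
 have "(\<Sum>e\<le>E. g e * x ^ e) * ((1 - x) * (1 - c * x)) = 1 - x ^ (E + 1) * (c ^ (E + 1) + (1 - c * x) * g E)"
 proof (induction E)
  case 0
  show ?case
   by (simp add: g_def algebra_simps)
 next
  case (Suc E)
  have "g (Suc E) = g E + c ^ (E + 1)"
   by (simp add: g_def)
  moreover have "(\<Sum>e\<le>Suc E. g e * x ^ e) * ((1 - x) * (1 - c * x)) =
    (\<Sum>e\<le>E. g e * x ^ e) * ((1 - x) * (1 - c * x)) + g (Suc E) * x ^ (E + 1) * ((1 - x) * (1 - c * x))"
   by (simp add: algebra_simps)
  ultimately show ?case
   unfolding Suc.IH by (simp add: algebra_simps)
 qed
 \<comment> \<open>For \<open>c = -1\<close> the sum \<open>g E\<close> alternates between 1 and 0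
   while \<open>c ^ (E + 1)\<close> alternates between -1 and 1, which leaves \<open>x\<close> or
   1.\<close>
 moreover have "0 \<le> c ^ (E + 1) + (1 - c * x) * g E"
 proof -
  have g: "0 \<le> g E"
   unfolding g_def c_def by (rule geometric_nonneg)
  consider "c = 1" | "c = 0" | "c = - 1"
   using range[of p] by (auto simp: c_def)
  then show ?thesis
  proof cases
   case 3
   have "g E = of_bool (even E)"
    unfolding g_def 3 by (induction E) auto
   with 3 x show ?thesis
    by auto
  qed (use g x in auto)
 qed
 ultimately have "(\<Sum>e\<le>E. g e * x ^ e) * ((1 - x) * (1 - c * x)) \<le> 1"
  using x by simp
 then show ?thesis
  by (simp add: g_def x_def c_def euler_factor_def power_one_over divide_inverse power_inverse)
qed

text \<open>Splitting off the power of one prime maps the smooth numbers injectively into pairs of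
  an exponent and a number without that prime. As all coefficients are nonnegative, passing to the
  full product only enlarges the sum, so truncation at \<open>X\<close> costs nothing.\<close>

lemma smooth_sum_le:
 assumes "finite S" "\<And>p. p \<in> S \<Longrightarrow> prime p"
 shows "(\<Sum>m\<in>smooth S X. divisor_sum m / real m) * (\<Prod>p\<in>S. euler_factor p) \<le> 1"
 using assms
proof (induction S)
 case empty
 have "smooth {} X \<subseteq> {1}"
  using prime_factor_nat by (auto simp: smooth_def)
 then have "(\<Sum>m\<in>smooth {} X. divisor_sum m / real m) \<le> (\<Sum>m\<in>{1}. divisor_sum m / real m)"
  by (intro sum_mono2) (auto simp: divisor_sum_def one[simplified])
 then show ?case
  by (simp add: divisor_sum_def one[simplified])
next
 case (insert p S)
 have p: "prime p"
  using insert by blast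
 let ?a = "\<lambda>m. divisor_sum m / real m"
 let ?f = "\<lambda>m. (multiplicity p m, m div p ^ multiplicity p m)"
 let ?g = "\<lambda>e. (\<Sum>i\<le>e. \<chi> p ^ i) / real p ^ e"
 have dec: "m = p ^ multiplicity p m * (m div p ^ multiplicity p m)" for m
  by (simp add: multiplicity_dvd)
 have nd: "\<not> p dvd m div p ^ multiplicity p m" if "0 < m" for m
  using that p multiplicity_decompose[of m p] not_prime_unit by auto
 have pos: "0 < m div p ^ multiplicity p m" if "0 < m" for m
  using nd[OF that] by (metis dvd_0_right gr0I)
 have inj: "inj_on ?f (smooth (insert p S) X)"
  by (rule inj_onI) (metis Pair_inject dec)
 have a: "?a m = ?g (multiplicity p m) * ?a (m div p ^ multiplicity p m)" if "0 < m" for m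
 proof -
  define e n where "e = multiplicity p m" and "n = m div p ^ multiplicity p m"
  have "m = p ^ e * n" "\<not> p dvd n" "0 < n"
   using dec[of m] nd[OF that] pos[OF that] by (simp_all add: e_def n_def)
  then have "?a m = ?g e * ?a n"
   by (simp add: divisor_sum_prime_power_mult[OF p])
  then show ?thesis
   by (simp only: e_def n_def)
 qed
 have img: "?f ` smooth (insert p S) X \<subseteq> {..X} \<times> smooth S X"
 proof (rule image_subsetI)
  fix m assume m: "m \<in> smooth (insert p S) X"
  then have m0: "0 < m" "m \<le> X"
   by (auto simp: smooth_def)
  have dvd: "m div p ^ multiplicity p m dvd m"
   using dec[of m] by (metis dvd_triv_right)
  have "multiplicity p m < p ^ multiplicity p m"
   using power_gt_expt prime_gt_1_nat[OF p] by simp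
  also have "\<dots> \<le> m"
   using m0 by (simp add: dvd_imp_le multiplicity_dvd)
  finally have "multiplicity p m \<le> X"
   using m0 by simp
  moreover have "m div p ^ multiplicity p m \<in> smooth S X"
  proof -
   have "q \<in> S" if "prime q" "q dvd m div p ^ multiplicity p m" for q
   proof -
    have "q dvd m"
     using that(2) dvd by (rule dvd_trans)
    then have "q \<in> insert p S"
     using m that(1) by (simp add: smooth_def)
    with nd[OF m0(1)] that(2) show ?thesis
     by blast
   qed
   then show ?thesis
    using pos[OF m0(1)] le_trans[OF dvd_imp_le[OF dvd m0(1)] m0(2)] by (simp add: smooth_def)
  qed
  ultimately show "?f m \<in> {..X} \<times> smooth S X"
   by simp
 qed
 have fin: "finite (smooth S X)"
  by (simp add: smooth_def)
 have nn: "0 \<le> ?a m" if "m \<in> smooth S X" for m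
  using that divisor_sum_nonneg by (auto simp: smooth_def)
 have gn: "0 \<le> ?g e" for e
  using geometric_nonneg by simp
 have "(\<Sum>m\<in>smooth (insert p S) X. ?a m) =
   (\<Sum>m\<in>smooth (insert p S) X. (\<lambda>(e, n). ?g e * ?a n) (?f m))"
  by (intro sum.cong) (auto simp: a smooth_def)
 also have "\<dots> = (\<Sum>z\<in>?f ` smooth (insert p S) X. (\<lambda>(e, n). ?g e * ?a n) z)"
  using inj by (simp add: sum.reindex)
 also have "\<dots> \<le> (\<Sum>z\<in>{..X} \<times> smooth S X. (\<lambda>(e, n). ?g e * ?a n) z)"
 proof (rule sum_mono2)
  fix z assume "z \<in> {..X} \<times> smooth S X - ?f ` smooth (insert p S) X"
  then show "0 \<le> (\<lambda>(e, n). ?g e * ?a n) z"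
   by (cases z) (simp only: prod.case, intro mult_nonneg_nonneg gn nn, auto)
 qed (use img fin in auto)
 also have "\<dots> = (\<Sum>e\<le>X. ?g e) * (\<Sum>m\<in>smooth S X. ?a m)"
  by (simp add: sum_product sum.cartesian_product)
 finally have le: "(\<Sum>m\<in>smooth (insert p S) X. ?a m) \<le> (\<Sum>e\<le>X. ?g e) * (\<Sum>m\<in>smooth S X. ?a m)" .
 have ef: "0 < euler_factor p" "0 < (\<Prod>q\<in>S. euler_factor q)"
  using insert.prems p by (auto intro!: euler_factor_pos prod_pos)
 have "(\<Sum>m\<in>smooth (insert p S) X. ?a m) * (\<Prod>q\<in>insert p S. euler_factor q)
   \<le> ((\<Sum>e\<le>X. ?g e) * (\<Sum>m\<in>smooth S X. ?a m)) * (\<Prod>q\<in>insert p S. euler_factor q)"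
  using le ef insert.hyps by (intro mult_right_mono) auto
 also have "\<dots> = ((\<Sum>e\<le>X. ?g e) * euler_factor p) * ((\<Sum>m\<in>smooth S X. ?a m) * (\<Prod>q\<in>S. euler_factor q))"
  using insert.hyps by simp
 also have "\<dots> \<le> 1 * 1"
  using insert.IH insert.prems euler_factor_sum[OF p, of X] ef nn
  by (intro mult_mono mult_nonneg_nonneg sum_nonneg) auto
 finally show ?case
  by simp
qed

lemma sum_divisor_sum:
 "(\<Sum>m = 1..X. divisor_sum m / real m) = (\<Sum>e = 1..X. (\<Sum>d = 1..X div e. \<chi> d / real d) / real e)"
proof -
 let ?A = "SIGMA m:{1..X}. {d. d dvd m}" and ?B = "SIGMA e:{1..X}. {1..X div e}"
 have "(\<Sum>m = 1..X. divisor_sum m / real m) = (\<Sum>z\<in>?A. \<chi> (snd z) / real (fst z))"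
  by (simp add: divisor_sum_def sum_divide_distrib sum.Sigma case_prod_unfold)
 also have "\<dots> = (\<Sum>z\<in>?B. \<chi> (snd z) / real (snd z) / real (fst z))"
 proof (rule sum.reindex_bij_witness[where i = "\<lambda>(e, d). (d * e, d)" and j = "\<lambda>(m, d). (m div d, d)"])
  fix z assume "z \<in> ?A"
  then obtain m d where z: "z = (m, d)" "1 \<le> m" "m \<le> X" "d dvd m"
   by auto
  then obtain e where e: "m = d * e"
   by blast
  then have de: "0 < d" "0 < e"
   using z(2) by (auto intro: Nat.gr0I)
  with z e show "(case case z of (m, d) \<Rightarrow> (m div d, d) of (e, d) \<Rightarrow> (d * e, d)) = z"
   by simp
  have "d \<le> X div e"
   using z(3) e de by (simp add: less_eq_div_iff_mult_less_eq)
  moreover have "e \<le> X"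
   using z(3) e de by (metis One_nat_def Suc_leI le_trans mult.commute mult_le_mono1 mult_1)
  ultimately show "(case z of (m, d) \<Rightarrow> (m div d, d)) \<in> ?B"
   using z e de by simp
  show "\<chi> (snd (case z of (m, d) \<Rightarrow> (m div d, d))) / real (snd (case z of (m, d) \<Rightarrow> (m div d, d))) /
    real (fst (case z of (m, d) \<Rightarrow> (m div d, d))) = \<chi> (snd z) / real (fst z)"
   using z e de by simp
 next
  fix z assume "z \<in> ?B"
  then obtain e d where z: "z = (e, d)" "1 \<le> e" "e \<le> X" "1 \<le> d" "d \<le> X div e"
   by auto
  then show "(case case z of (e, d) \<Rightarrow> (d * e, d) of (m, d) \<Rightarrow> (m div d, d)) = z"
   by simp
  have "d * e \<le> X"
   using z by (simp add: less_eq_div_iff_mult_less_eq)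
  with z show "(case z of (e, d) \<Rightarrow> (d * e, d)) \<in> ?A"
   by simp
 qed
 also have "\<dots> = (\<Sum>e = 1..X. (\<Sum>d = 1..X div e. \<chi> d / real d) / real e)"
  by (simp add: sum_divide_distrib sum.Sigma case_prod_unfold)
 finally show ?thesis .
qed

lemma ln_le_harmonic: "ln (real X + 1) \<le> (\<Sum>e = 1..X. 1 / real e)"
proof (induction X)
 case (Suc X)
 have "ln (real (Suc X) + 1) = ln (real X + 1) + ln (1 + 1 / (real X + 1))"
 proof -
  have "real (Suc X) + 1 = (real X + 1) * (1 + 1 / (real X + 1))"
   by (simp add: field_simps)
  then show ?thesis
   by (simp only:) (rule ln_mult_pos; simp add: add_pos_nonneg)
 qed
 also have "ln (1 + 1 / (real X + 1)) \<le> 1 / (real X + 1)"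
  by (rule ln_add_one_self_le_self) simp
 finally show ?case
  using Suc.IH by (simp add: add.commute)
qed simp

text \<open>Every \<open>m \<le> X\<close> is smooth for the primes up to \<open>X\<close>, so the
  product is at most the inverse of a sum which, by \<open>m = d e\<close>, is a harmonic sum
  weighted with partial sums of \<open>\<chi> d / d\<close>. Their uniform lower bound replaces any
  statement about the value of the L-series at 1.\<close>

lemma prod_euler_factor_le:
 assumes partial: "\<And>D. 1 \<le> D \<Longrightarrow> 2 / 5 \<le> (\<Sum>d = 1..D. \<chi> d / real d)" and "1 \<le> X"
 shows "(\<Prod>p | prime p \<and> p \<le> X. euler_factor p) \<le> 5 / (2 * ln (real X + 1))"
proof -
 let ?S = "{p. prime p \<and> p \<le> X}"
 have fin: "finite ?S"
  by simp
 have "p \<le> X" if "p dvd m" "m \<in> {1..X}" for p m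
  using dvd_imp_le[OF that(1)] that(2) by simp
 then have sm: "smooth ?S X = {1..X}"
  unfolding smooth_def by blast
 have "2 / 5 * ln (real X + 1) \<le> 2 / 5 * (\<Sum>e = 1..X. 1 / real e)"
  using ln_le_harmonic by simp
 also have "\<dots> = (\<Sum>e = 1..X. 2 / 5 / real e)"
  by (simp add: sum_distrib_left)
 also have "\<dots> \<le> (\<Sum>e = 1..X. (\<Sum>d = 1..X div e. \<chi> d / real d) / real e)"
  by (intro sum_mono divide_right_mono partial) (auto simp: Suc_le_eq div_greater_zero_iff)
 finally have le: "2 / 5 * ln (real X + 1) \<le> (\<Sum>m\<in>smooth ?S X. divisor_sum m / real m)"
  by (simp only: sm sum_divisor_sum)
 have pos: "0 \<le> (\<Prod>p\<in>?S. euler_factor p)"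
  by (intro prod_nonneg) (auto intro: less_imp_le euler_factor_pos)
 have "2 / 5 * ln (real X + 1) * (\<Prod>p\<in>?S. euler_factor p) \<le>
   (\<Sum>m\<in>smooth ?S X. divisor_sum m / real m) * (\<Prod>p\<in>?S. euler_factor p)"
  using le pos by (rule mult_right_mono)
 also have "\<dots> \<le> 1"
  by (rule smooth_sum_le[OF fin]) simp
 finally show ?thesis
  using assms(2) by (simp add: field_simps)
qed

end

text \<open>It vanishes at every prime, so its Euler factor is \<open>1 - 1 / p\<close> and the
  general bound becomes Mertens' product estimate.\<close>

interpretation trivial_character: real_character "\<lambda>d. of_bool (d = 1)"
 by standard auto

section \<open>Real characters modulo 8 and their partial sums\<close>

definition chi_mod_8 :: "real list \<Rightarrow> nat \<Rightarrow> real" where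
 "chi_mod_8 cs d = cs ! (d mod 8)"

lemma less_8_cases: "(a :: nat) < 8 \<Longrightarrow> a \<in> {0, 1, 2, 3, 4, 5, 6, 7}"
 by auto

text \<open>The values at 3 and 5 are free, and \<open>3 * 5\<close> is 7 modulo 8, which fixes the
  value at 7. The three nontrivial choices are the characters of -1, -2 and 2.\<close>

lemma real_character_mod_8:
 assumes "s \<in> {- 1, 1}" "t \<in> {- 1, 1}"
 shows "real_character (chi_mod_8 [0, 1, 0, s, 0, t, 0, s * t])"
proof
 let ?cs = "[0, 1, 0, s, 0, t, 0, s * t]"
 show "chi_mod_8 ?cs 1 = 1"
  by (simp add: chi_mod_8_def)
 fix a b :: nat
 have ab: "a mod 8 \<in> {0, 1, 2, 3, 4, 5, 6, 7}" "b mod 8 \<in> {0, 1, 2, 3, 4, 5, 6, 7}"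
  by (rule less_8_cases, simp)+
 show "chi_mod_8 ?cs a \<in> {- 1, 0, 1}"
  using ab assms by (auto simp: chi_mod_8_def)
 have "(a * b) mod 8 = ((a mod 8) * (b mod 8)) mod 8"
  by (simp add: mod_mult_eq)
 then show "chi_mod_8 ?cs (a * b) = chi_mod_8 ?cs a * chi_mod_8 ?cs b"
  using ab assms unfolding chi_mod_8_def by auto
qed

abbreviation "chi_minus_1 \<equiv> chi_mod_8 [0, 1, 0, - 1, 0, 1, 0, - 1]"
abbreviation "chi_minus_2 \<equiv> chi_mod_8 [0, 1, 0, 1, 0, - 1, 0, - 1]"
abbreviation "chi_2 \<equiv> chi_mod_8 [0, 1, 0, - 1, 0, - 1, 0, 1]"

interpretation chi_minus_1: real_character chi_minus_1
 using real_character_mod_8[of "- 1" 1] by simp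

interpretation chi_minus_2: real_character chi_minus_2
 using real_character_mod_8[of 1 "- 1"] by simp

interpretation chi_2: real_character chi_2
 using real_character_mod_8[of "- 1" "- 1"] by simp

text \<open>
 The signs come in groups that leave all partial sums above the initial value; \<open>w\<close> counts how many
 positive terms are still to be cancelled.
\<close>

lemma partial_sum_ge:
 fixes w :: "nat \<Rightarrow> real" and c :: real
 assumes "D0 \<le> D"
  and base: "c + w (D0 mod 8) / (real D0 + 1) \<le> (\<Sum>d = 1..D0. chi_mod_8 cs d / real d)"
  and step: "\<And>r. r < 8 \<Longrightarrow> w (Suc r mod 8) \<le> w r + cs ! (Suc r mod 8)"
  and pos: "\<And>r. r < 8 \<Longrightarrow> 0 \<le> w r"
 shows "c + w (D mod 8) / (real D + 1) \<le> (\<Sum>d = 1..D. chi_mod_8 cs d / real d)"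
 using assms(1)
proof (induction D rule: dec_induct)
 case base
 show ?case
  by (rule assms(2))
next
 case (step D)
 let ?r = "D mod 8"
 have r: "Suc D mod 8 = Suc ?r mod 8"
  by (simp add: mod_Suc_eq)
 have "w (Suc D mod 8) / (real (Suc D) + 1) \<le> w (Suc D mod 8) / (real D + 1)"
  using pos[of "Suc D mod 8"] by (intro divide_left_mono) auto
 also have "\<dots> \<le> (w ?r + cs ! (Suc D mod 8)) / (real D + 1)"
  using assms(3)[of ?r] by (intro divide_right_mono) (auto simp: r)
 also have "\<dots> = w ?r / (real D + 1) + chi_mod_8 cs (Suc D) / real (Suc D)"
  by (simp add: chi_mod_8_def add_divide_distrib add.commute)
 finally show ?case
  using step.IH by simp
qed

lemma nat_less_8: "(r :: nat) < 8 \<Longrightarrow> r = 0 \<or> r = 1 \<or> r = 2 \<or> r = 3 \<or> r = 4 \<or> r = 5 \<or> r = 6 \<or> r = 7"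
 by linarith

lemma partial_sum_chi_minus_1:
 assumes "1 \<le> D"
 shows "2 / 5 \<le> (\<Sum>d = 1..D. chi_minus_1 d / real d)"
proof -
 let ?w = "\<lambda>r. [0, 1, 1, 0, 0, 1, 1, 0 :: real] ! r"
 have "1 / 2 + ?w (D mod 8) / (real D + 1) \<le> (\<Sum>d = 1..D. chi_minus_1 d / real d)"
 proof (rule partial_sum_ge[OF assms])
 qed (auto simp: chi_mod_8_def dest!: nat_less_8)
 moreover have "0 \<le> ?w (D mod 8)"
  using nat_less_8[of "D mod 8"] by auto
 then have "0 \<le> ?w (D mod 8) / (real D + 1)"
  by simp
 ultimately show ?thesis
  by linarith
qed

lemma partial_sum_chi_minus_2:
 assumes "1 \<le> D"
 shows "2 / 5 \<le> (\<Sum>d = 1..D. chi_minus_2 d / real d)"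
proof -
 let ?w = "\<lambda>r. [0, 1, 1, 2, 2, 1, 1, 0 :: real] ! r"
 have "1 / 2 + ?w (D mod 8) / (real D + 1) \<le> (\<Sum>d = 1..D. chi_minus_2 d / real d)"
 proof (rule partial_sum_ge[OF assms])
 qed (auto simp: chi_mod_8_def dest!: nat_less_8)
 moreover have "0 \<le> ?w (D mod 8)"
  using nat_less_8[of "D mod 8"] by auto
 then have "0 \<le> ?w (D mod 8) / (real D + 1)"
  by simp
 ultimately show ?thesis
  by linarith
qed

text \<open>From 7 on, two positive terms precede two negative ones, but the term at 1 is followed
  by negative ones at 3 and 5. Hence the grouping starts at \<open>D = 5\<close>, where the sum is
  7/15; this lies below 1/2, whence the weaker common bound 2/5.\<close>

lemma partial_sum_chi_2:
 assumes "1 \<le> D"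
 shows "2 / 5 \<le> (\<Sum>d = 1..D. chi_2 d / real d)"
proof (cases "D < 5")
 case True
 with assms have "D \<in> {1, 2, 3, 4}"
  by auto
 moreover have "{1..2} = {1, 2 :: nat}" "{1..3} = {1, 2, 3 :: nat}" "{1..4} = {1, 2, 3, 4 :: nat}"
  by auto
 ultimately show ?thesis
  by (elim insertE) (simp_all add: chi_mod_8_def)
next
 case False
 let ?w = "\<lambda>r. [1, 2, 2, 1, 1, 0, 0, 1 :: real] ! r"
 have "2 / 5 + ?w (D mod 8) / (real D + 1) \<le> (\<Sum>d = 1..D. chi_2 d / real d)"
 proof (rule partial_sum_ge[of 5])
  have "{1..5} = {1, 2, 3, 4, 5 :: nat}"
   by auto
  then show "2 / 5 + ?w (5 mod 8) / (real 5 + 1) \<le> (\<Sum>d = 1..5. chi_2 d / real d)"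
   by (simp add: chi_mod_8_def)
 qed (use False in \<open>auto dest!: nat_less_8\<close>)
 moreover have "0 \<le> ?w (D mod 8)"
  using nat_less_8[of "D mod 8"] by auto
 then have "0 \<le> ?w (D mod 8) / (real D + 1)"
  by simp
 ultimately show ?thesis
  by linarith
qed

lemma partial_sum_trivial:
 assumes "1 \<le> D"
 shows "2 / 5 \<le> (\<Sum>d = 1..D. of_bool (d = 1) / real d)"
proof -
 have "(\<Sum>d = 1..D. of_bool (d = 1) / real d) = (\<Sum>d\<in>{1}. of_bool (d = 1) / real d)"
  using assms by (intro sum.mono_neutral_right) auto
 then show ?thesis
  by simp
qed

section \<open>The wheel\<close>

definition wheel_primes :: "nat \<Rightarrow> nat set" where
 "wheel_primes y = {p. prime p \<and> 3 \<le> p \<and> p < y}"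

text \<open>The factor 8 makes the residue modulo 8, and with it the quadratic form, constant on
  each class.\<close>

definition wheel :: "nat \<Rightarrow> int" where
 "wheel y = 8 * (\<Prod>p\<in>wheel_primes y. int p)"

lemma finite_wheel_primes [simp]: "finite (wheel_primes y)"
 by (rule finite_subset[of _ "{..<y}"]) (auto simp: wheel_primes_def)

lemma wheel_primesD:
 assumes "p \<in> wheel_primes y"
 shows "prime p" "prime (int p)" "odd p" "odd (int p)" "2 \<le> p"
proof -
 show p: "prime p" "2 \<le> p"
  using assms by (simp_all add: wheel_primes_def)
 then show "prime (int p)"
  by simp
 show "odd p"
  using p(1) prime_odd_nat[of p] assms by (simp add: wheel_primes_def)
 then show "odd (int p)"
  by simp
qed

lemma wheel_pos: "0 < wheel y"
proof -
 have "0 < (\<Prod>p\<in>wheel_primes y. int p)"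
  by (rule prod_pos) (auto simp: wheel_primes_def)
 then show ?thesis
  by (simp add: wheel_def)
qed

text \<open>Shared by the two counts modulo the wheel, that of lattice point classes and that of
  admissible residues, which are both estimated prime by prime.\<close>

lemma submultiplicative_wheel:
 fixes F :: "int \<Rightarrow> nat"
 assumes "\<And>a b. coprime a b \<Longrightarrow> 0 < a \<Longrightarrow> 0 < b \<Longrightarrow> F (a * b) \<le> F a * F b"
 shows "F (wheel y) \<le> F 8 * (\<Prod>p\<in>wheel_primes y. F (int p))"
proof -
 have "F (8 * (\<Prod>p\<in>S. int p)) \<le> F 8 * (\<Prod>p\<in>S. F (int p))"
  if "finite S" "S \<subseteq> wheel_primes y" for S
  using that
 proof (induction S)
  case (insert q S)
  have q: "prime (int q)" "odd (int q)" "2 \<le> q"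
   using insert.prems wheel_primesD[of q y] by auto
  have "coprime (int q) (int p)" if "p \<in> S" for p
  proof -
   have "prime p" "prime q" "p \<noteq> q"
    using that insert wheel_primesD by blast+
   then show ?thesis
    by (metis coprime_int_iff primes_coprime)
  qed
  then have "coprime (int q) (\<Prod>p\<in>S. int p)"
   by (rule prod_coprime_right)
  moreover have "coprime (int q) 8"
  proof -
   have "coprime (int q) (2 ^ 3)"
    using q(2) by (simp only: coprime_power_right_iff) simp
   then show ?thesis
    by simp
  qed
  ultimately have "coprime (8 * (\<Prod>p\<in>S. int p)) (int q)"
   by (simp add: coprime_commute)
  moreover have "0 < 8 * (\<Prod>p\<in>S. int p)"
   using insert.prems by (auto intro!: prod_pos simp: wheel_primes_def)
  ultimately have "F (8 * (\<Prod>p\<in>S. int p) * int q) \<le> F (8 * (\<Prod>p\<in>S. int p)) * F (int q)"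
   using assms q(3) by simp
  also have "\<dots> \<le> F 8 * (\<Prod>p\<in>S. F (int p)) * F (int q)"
   using insert by (intro mult_right_mono) auto
  finally show ?case
   using insert.hyps by (simp add: mult_ac)
 qed simp
 from this[of "wheel_primes y"] show ?thesis
  by (simp add: wheel_def)
qed

text \<open>The prime 2 is missing from the product over the wheel; with \<open>\<chi> 2 = 0\<close>
  its Euler factor is 1/2, which doubles the constant.\<close>

lemma (in real_character) prod_wheel_le:
 assumes "\<And>D. 1 \<le> D \<Longrightarrow> 2 / 5 \<le> (\<Sum>d = 1..D. \<chi> d / real d)" "3 \<le> y" "\<chi> 2 = 0"
 shows "(\<Prod>p\<in>wheel_primes y. euler_factor p) \<le> 5 / ln (real y)"
proof -
 have eq: "{p. prime p \<and> p \<le> y - 1} = insert 2 (wheel_primes y)"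
 proof (intro equalityI subsetI)
  fix p assume "p \<in> {p. prime p \<and> p \<le> y - 1}"
  then have "prime p" "2 \<le> p" "p < y"
   using assms(2) prime_ge_2_nat by auto
  then show "p \<in> insert 2 (wheel_primes y)"
   by (cases "p = 2") (auto simp: wheel_primes_def)
 qed (use assms(2) in \<open>auto simp: wheel_primes_def\<close>)
 have "2 \<notin> wheel_primes y"
  by (simp add: wheel_primes_def)
 then have "(\<Prod>p | prime p \<and> p \<le> y - 1. euler_factor p) = euler_factor 2 * (\<Prod>p\<in>wheel_primes y. euler_factor p)"
  unfolding eq by simp
 moreover have "(\<Prod>p | prime p \<and> p \<le> y - 1. euler_factor p) \<le> 5 / (2 * ln (real (y - 1) + 1))"
  by (rule prod_euler_factor_le[OF assms(1)]) (use assms(2) in auto)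
 moreover have "euler_factor 2 = 1 / 2"
  using assms(3) by (simp add: euler_factor_def)
 moreover have "real (y - 1) + 1 = real y"
  using assms(2) by simp
 ultimately show ?thesis
  by simp
qed

section \<open>The three forms and their characters\<close>

definition forms :: "(int \<times> int) set" where
 "forms = {(0, 4), (0, 2), (4, 2)}"

definition form_char :: "int \<times> int \<Rightarrow> nat \<Rightarrow> real" where
 "form_char q = (if q = (0, 4) then chi_minus_1 else if q = (0, 2) then chi_minus_2 else chi_2)"

lemma QuadRes_scale: "QuadRes p c \<Longrightarrow> QuadRes p (k * k * c)"
proof -
 assume "QuadRes p c"
 then obtain y where "[y\<^sup>2 = c] (mod p)"
  by (auto simp: QuadRes_def)
 then have "[k * k * y\<^sup>2 = k * k * c] (mod p)"
  by (rule cong_mult[OF cong_refl])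
 then have "[(k * y)\<^sup>2 = k * k * c] (mod p)"
  by (simp add: power2_eq_square mult_ac)
 then show ?thesis
  by (auto simp: QuadRes_def)
qed

text \<open>The discriminants -16, -8 and 8 are -1, -2 and 2 times a square.\<close>

lemma form_char_QuadRes:
 assumes "(\<gamma>, \<epsilon>) \<in> forms" "prime p" "form_char (\<gamma>, \<epsilon>) p = 1"
 shows "QuadRes (int p) (\<gamma> * \<gamma> - 4 * \<epsilon>)"
proof -
 have r: "p mod 8 \<in> {0, 1, 2, 3, 4, 5, 6, 7}"
  by (rule less_8_cases) simp
 consider "(\<gamma>, \<epsilon>) = (0, 4)" | "(\<gamma>, \<epsilon>) = (0, 2)" | "(\<gamma>, \<epsilon>) = (4, 2)"
  using assms(1) by (auto simp: forms_def)
 then show ?thesis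
 proof cases
  case 1
  then have "p mod 8 = 1 \<or> p mod 8 = 5"
   using assms(3) r by (auto simp: form_char_def chi_mod_8_def)
  then have "p mod 4 = 1"
   by presburger
  from QuadRes_scale[OF QuadRes_minus_1[OF assms(2) this], of 4] 1 show ?thesis
   by simp
 next
  case 2
  then have "p mod 8 = 1 \<or> p mod 8 = 3"
   using assms(3) r by (auto simp: form_char_def chi_mod_8_def)
  from QuadRes_scale[OF QuadRes_minus_2[OF assms(2) this], of 2] 2 show ?thesis
   by simp
 next
  case 3
  then have "p mod 8 = 1 \<or> p mod 8 = 7"
   using assms(3) r by (auto simp: form_char_def chi_mod_8_def)
  from QuadRes_scale[OF QuadRes_2[OF assms(2) this], of 2] 3 show ?thesis
   by simp
 qed
qed

lemma form_char:
 assumes "(\<gamma>, \<epsilon>) \<in> forms"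
 shows "real_character (form_char (\<gamma>, \<epsilon>))" "form_char (\<gamma>, \<epsilon>) 2 = 0"
  and "1 \<le> D \<Longrightarrow> 2 / 5 \<le> (\<Sum>d = 1..D. form_char (\<gamma>, \<epsilon>) d / real d)"
 using assms partial_sum_chi_minus_1[of D] partial_sum_chi_minus_2[of D] partial_sum_chi_2[of D]
  chi_minus_1.real_character_axioms chi_minus_2.real_character_axioms chi_2.real_character_axioms
 by (auto simp: forms_def form_char_def) (simp_all add: chi_mod_8_def)

text \<open>The two conic bounds \<open>p - 1\<close> and \<open>p + 1\<close> are both
  \<open>p - \<chi>(p)\<close>: the discriminant divides 16, so an odd prime never divides it, and
  the character does not vanish there.\<close>

lemma card_reps_mod_le_char:
 assumes f: "(\<gamma>, \<epsilon>) \<in> forms" and p: "p \<in> wheel_primes y" and \<rho>: "\<not> int p dvd \<rho>"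
 shows "real (card (reps_mod \<gamma> \<epsilon> \<rho> (int p))) \<le> real p * (1 - form_char (\<gamma>, \<epsilon>) p / real p)"
proof -
 note pp = wheel_primesD[OF p]
 interpret real_character "form_char (\<gamma>, \<epsilon>)"
  using form_char(1)[OF f] .
 have nd: "\<not> int p dvd \<gamma> * \<gamma> - 4 * \<epsilon>"
 proof
  assume "int p dvd \<gamma> * \<gamma> - 4 * \<epsilon>"
  moreover have "\<gamma> * \<gamma> - 4 * \<epsilon> dvd 2 ^ 4"
   using f by (auto simp: forms_def)
  ultimately have "int p dvd 2 ^ 4"
   by (rule dvd_trans)
  then have "int p dvd 2"
   using pp(2) prime_dvd_power by blast
  then have "p dvd 2"
   by (metis int_dvd_int_iff of_nat_numeral)
  then have "p \<le> 2"
   by (simp add: dvd_imp_le)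
  with p show False
   by (simp add: wheel_primes_def)
 qed
 have "real p * (1 - form_char (\<gamma>, \<epsilon>) p / real p) = real p - form_char (\<gamma>, \<epsilon>) p"
  using pp by (simp add: algebra_simps)
 moreover have "real (card (reps_mod \<gamma> \<epsilon> \<rho> (int p))) \<le> real p - form_char (\<gamma>, \<epsilon>) p"
 proof (cases "form_char (\<gamma>, \<epsilon>) p = 1")
  case True
  from card_reps_mod_prime_le_QuadRes[OF pp(2,4) \<rho> nd form_char_QuadRes[OF f pp(1) True]]
  show ?thesis
   using True pp(5) by (simp add: le_diff_conv of_nat_diff)
 next
  case False
  have odd: "form_char (\<gamma>, \<epsilon>) p \<noteq> 0"
  proof -
   have "p mod 8 \<in> {0, 1, 2, 3, 4, 5, 6, 7}"
    by (rule less_8_cases) simp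
   moreover have "odd (p mod 8)"
    using pp(3) by presburger
   ultimately show ?thesis
    by (auto simp: form_char_def chi_mod_8_def)
  qed
  with False range[of p] have "form_char (\<gamma>, \<epsilon>) p = - 1"
   by auto
  with card_reps_mod_prime_le[OF pp(2,4) \<rho> nd] show ?thesis
   by simp
 qed
 ultimately show ?thesis
  by simp
qed

definition form_prod :: "int \<times> int \<Rightarrow> nat \<Rightarrow> real" where
 "form_prod q y = (\<Prod>p\<in>wheel_primes y. 1 - form_char q p / real p)"

lemma form_prod_nonneg:
 assumes f: "(\<gamma>, \<epsilon>) \<in> forms"
 shows "0 \<le> form_prod (\<gamma>, \<epsilon>) y"
 unfolding form_prod_def
proof (rule prod_nonneg)
 fix p assume "p \<in> wheel_primes y"
 then have "1 \<le> real p"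
  using wheel_primesD[of p y] by simp
 moreover have "form_char (\<gamma>, \<epsilon>) p \<le> 1"
  using real_character.range[OF form_char(1)[OF f], of p] by auto
 ultimately show "0 \<le> 1 - form_char (\<gamma>, \<epsilon>) p / real p"
  by (simp add: divide_le_eq)
qed

lemma card_reps_mod_wheel_le:
 assumes f: "(\<gamma>, \<epsilon>) \<in> forms" and \<rho>: "coprime \<rho> (wheel y)"
 shows "real (card (reps_mod \<gamma> \<epsilon> \<rho> (wheel y))) \<le> 8 * real_of_int (wheel y) * form_prod (\<gamma>, \<epsilon>) y"
proof -
 let ?F = "\<lambda>M. card (reps_mod \<gamma> \<epsilon> \<rho> M)"
 have "?F (wheel y) \<le> ?F 8 * (\<Prod>p\<in>wheel_primes y. ?F (int p))"
  by (rule submultiplicative_wheel) (rule card_reps_mod_mult_le)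
 then have "real (?F (wheel y)) \<le> real (?F 8 * (\<Prod>p\<in>wheel_primes y. ?F (int p)))"
  by (rule of_nat_mono)
 also have "\<dots> = real (?F 8) * (\<Prod>p\<in>wheel_primes y. real (?F (int p)))"
  by simp
 \<comment> \<open>The modulus 8 contributes at most all 64 pairs, and one factor 8 of these is part
   of \<open>wheel y\<close>.\<close>
 also have "\<dots> \<le> 64 * (\<Prod>p\<in>wheel_primes y. real p * (1 - form_char (\<gamma>, \<epsilon>) p / real p))"
 proof (intro mult_mono prod_mono conjI)
  show "real (?F 8) \<le> 64"
   using card_reps_mod_le_square[of 8 \<gamma> \<epsilon> \<rho>] by simp
  fix p assume p: "p \<in> wheel_primes y"
  have "int p dvd wheel y"
   unfolding wheel_def using p by (intro dvd_mult dvd_prodI) auto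
  have "\<not> int p dvd \<rho>"
  proof
   assume "int p dvd \<rho>"
   from coprime_common_divisor[OF \<rho> this \<open>int p dvd wheel y\<close>] have "is_unit (int p)" .
   with wheel_primesD(5)[OF p] show False
    by simp
  qed
  then show "real (?F (int p)) \<le> real p * (1 - form_char (\<gamma>, \<epsilon>) p / real p)"
   by (rule card_reps_mod_le_char[OF f p])
 qed (auto intro: prod_nonneg)
 also have "\<dots> = 8 * real_of_int (wheel y) * form_prod (\<gamma>, \<epsilon>) y"
  by (simp add: prod.distrib form_prod_def wheel_def)
 finally show ?thesis .
qed

definition prime_prod :: "nat \<Rightarrow> real" where
 "prime_prod y = (\<Prod>p\<in>wheel_primes y. 1 - 1 / real p)"

lemma prime_prod_nonneg: "0 \<le> prime_prod y"
 unfolding prime_prod_def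
 by (rule prod_nonneg) (auto simp: wheel_primes_def divide_le_eq)

lemma prime_prod_le: "3 \<le> y \<Longrightarrow> prime_prod y \<le> 5 / ln (real y)"
proof -
 assume y: "3 \<le> y"
 have "prime_prod y = (\<Prod>p\<in>wheel_primes y. trivial_character.euler_factor p)"
  unfolding prime_prod_def trivial_character.euler_factor_def
  by (intro prod.cong refl) (auto simp: wheel_primes_def)
 also have "\<dots> \<le> 5 / ln (real y)"
  by (rule trivial_character.prod_wheel_le[OF partial_sum_trivial y]) auto
 finally show ?thesis .
qed

lemma prime_prod_form_prod_le:
 assumes "(\<gamma>, \<epsilon>) \<in> forms" "3 \<le> y"
 shows "prime_prod y * form_prod (\<gamma>, \<epsilon>) y \<le> 5 / ln (real y)"
proof -
 interpret real_character "form_char (\<gamma>, \<epsilon>)"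
  using form_char(1)[OF assms(1)] .
 have "prime_prod y * form_prod (\<gamma>, \<epsilon>) y = (\<Prod>p\<in>wheel_primes y. euler_factor p)"
  by (simp add: prime_prod_def form_prod_def euler_factor_def prod.distrib)
 also have "\<dots> \<le> 5 / ln (real y)"
  by (rule prod_wheel_le[OF form_char(3)[OF assms(1)] assms(2) form_char(2)[OF assms(1)]])
 finally show ?thesis .
qed

section \<open>Residues that avoid the small primes\<close>

definition allowed :: "int poly set \<Rightarrow> int \<Rightarrow> int set" where
 "allowed P M = {r \<in> {0..<M}. \<forall>f\<in>P. coprime (poly f r) M}"

lemma finite_allowed: "finite (allowed P M)"
 by (rule finite_subset[of _ "{0..<M}"]) (auto simp: allowed_def)

lemma poly_mod_cong: "x mod M = y mod M \<Longrightarrow> poly (f :: int poly) x mod M = poly f y mod M"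
proof (induction f)
 case (pCons a f)
 then have "[x = y] (mod M)" "[poly f x = poly f y] (mod M)"
  by (auto simp: cong_def)
 then have "[a + x * poly f x = a + y * poly f y] (mod M)"
  by (intro cong_add cong_mult cong_refl)
 then show ?case
  by (simp add: cong_def)
qed simp

lemma coprime_poly_mod:
 fixes f :: "int poly"
 shows "coprime (poly f (x mod M)) M \<longleftrightarrow> coprime (poly f x) M"
proof -
 have "poly f (x mod M) mod M = poly f x mod M"
  by (rule poly_mod_cong) simp
 then show ?thesis
  by (metis coprime_iff_gcd_eq_1 gcd_red_int gcd.commute)
qed

lemma card_allowed_mult_le:
 assumes "coprime a b" "0 < a" "0 < b"
 shows "card (allowed P (a * b)) \<le> card (allowed P a) * card (allowed P b)"
proof -
 let ?f = "\<lambda>r. (r mod a, r mod b)"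
 have "?f ` allowed P (a * b) \<subseteq> allowed P a \<times> allowed P b"
  using assms by (auto simp: allowed_def coprime_poly_mod)
 moreover have "inj_on ?f (allowed P (a * b))"
 proof (rule inj_onI)
  fix r s assume rs: "r \<in> allowed P (a * b)" "s \<in> allowed P (a * b)" "?f r = ?f s"
  then have "a * b dvd r - s"
   using assms(1) by (simp add: divides_mult mod_eq_dvd_iff)
  with rs show "r = s"
   by (auto simp: allowed_def intro: eq_if_dvd_diff)
 qed
 ultimately show ?thesis
  using card_inj_on_le[of ?f "allowed P (a * b)" "allowed P a \<times> allowed P b"]
  by (simp add: card_cartesian_product finite_allowed)
qed

lemma card_allowed_le: "0 < M \<Longrightarrow> card (allowed P M) \<le> nat M"
proof -
 have "allowed P M \<subseteq> {0..<M}"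
  by (auto simp: allowed_def)
 from card_mono[OF _ this] show ?thesis
  by simp
qed

lemma poly_degree_1: "degree f = 1 \<Longrightarrow> poly (f :: int poly) x = coeff f 1 * x + coeff f 0"
 by (subst poly_altdef) (simp add: algebra_simps)

text \<open>Each polynomial has a root modulo \<open>p\<close>, and a common root of two of them
  would make their resultant divisible by \<open>p\<close>; so \<open>card P\<close> distinct
  residues are excluded.\<close>

lemma card_allowed_prime_le:
 assumes p: "prime (int p)" and P: "finite P" "\<And>f. f \<in> P \<Longrightarrow> degree f = 1"
  and lead: "\<And>f. f \<in> P \<Longrightarrow> \<not> int p dvd coeff f 1"
  and res: "\<And>f g. f \<in> P \<Longrightarrow> g \<in> P \<Longrightarrow> f \<noteq> g \<Longrightarrow> \<not> int p dvd coeff f 1 * coeff g 0 - coeff g 1 * coeff f 0"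
 shows "card (allowed P (int p)) + card P \<le> p"
proof -
 have p0: "0 < int p"
  using p by (rule prime_gt_0_int)
 have "\<exists>r\<in>{0..<int p}. int p dvd poly f r" if f: "f \<in> P" for f
 proof -
  have "coprime (coeff f 1) (int p)"
   using p lead[OF f] by (metis coprime_commute prime_imp_coprime)
  then obtain z where "[coeff f 1 * z = 1] (mod int p)"
   using cong_solve_coprime_int by blast
  then have z: "int p dvd coeff f 1 * z - 1"
   by (simp add: cong_iff_dvd_diff)
  let ?x = "- (z * coeff f 0)"
  have "poly f ?x = - coeff f 0 * (coeff f 1 * z - 1)"
   using poly_degree_1[OF P(2)[OF f]] by (simp add: algebra_simps)
  then have "int p dvd poly f ?x"
   using z by simp
  then have "poly f ?x mod int p = 0"
   by simp
  then have "poly f (?x mod int p) mod int p = 0"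
   using poly_mod_cong[of "?x mod int p" "int p" ?x f] by simp
  then have "int p dvd poly f (?x mod int p)"
   by (simp add: dvd_eq_mod_eq_0)
  with p0 show ?thesis
   by (intro bexI[of _ "?x mod int p"]) auto
 qed
 then obtain r where r: "\<And>f. f \<in> P \<Longrightarrow> r f \<in> {0..<int p} \<and> int p dvd poly f (r f)"
  by metis
 have "inj_on r P"
 proof (rule inj_onI, rule ccontr)
  fix f g assume fg: "f \<in> P" "g \<in> P" "r f = r g" "f \<noteq> g"
  have "int p dvd coeff f 1 * r f + coeff f 0" "int p dvd coeff g 1 * r f + coeff g 0"
   using r[OF fg(1)] r[OF fg(2)] poly_degree_1[OF P(2)[OF fg(1)]] poly_degree_1[OF P(2)[OF fg(2)]] fg(3)
   by simp_all
  from dvd_diff[OF dvd_mult[OF this(2), of "coeff f 1"] dvd_mult[OF this(1), of "coeff g 1"]]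
  have "int p dvd coeff f 1 * coeff g 0 - coeff g 1 * coeff f 0"
   by (simp add: algebra_simps)
  with res fg show False
   by blast
 qed
 then have "card (r ` P) = card P"
  by (rule card_image)
 moreover have "allowed P (int p) \<inter> r ` P = {}"
 proof (rule ccontr)
  assume "allowed P (int p) \<inter> r ` P \<noteq> {}"
  then obtain f where f: "f \<in> P" "r f \<in> allowed P (int p)"
   by blast
  then have "coprime (poly f (r f)) (int p)" "int p dvd poly f (r f)"
   using r by (auto simp: allowed_def)
  from coprime_common_divisor[OF this dvd_refl] have "is_unit (int p)" .
  with p show False
   using not_prime_unit by blast
 qed
 then have "card (allowed P (int p) \<union> r ` P) = card (allowed P (int p)) + card (r ` P)"
  using P(1) by (intro card_Un_disjoint) (auto simp: finite_allowed)
 moreover have "allowed P (int p) \<union> r ` P \<subseteq> {0..<int p}"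
  using r by (auto simp: allowed_def)
 then have "card (allowed P (int p) \<union> r ` P) \<le> p"
  using card_mono[of "{0..<int p}"] by fastforce
 ultimately show ?thesis
  by simp
qed

definition proportional :: "int poly set \<Rightarrow> bool" where
 "proportional P \<longleftrightarrow> (\<exists>f\<in>P. \<exists>g\<in>P. f \<noteq> g \<and> coeff f 1 * coeff g 0 = coeff g 1 * coeff f 0)"

text \<open>
 Two proportional polynomials satisfy \<open>c f = a g\<close> for coprime \<open>a\<close> and \<open>c\<close> that are not both 1, so
 that every prime factor of \<open>a c\<close> divides all values of \<open>f\<close> or all values of \<open>g\<close>.
\<close>

lemma allowed_proportional:
 assumes "proportional P" and P: "\<And>f. f \<in> P \<Longrightarrow> degree f = 1 \<and> 0 < coeff f 1"
 shows "\<exists>y0. \<forall>y\<ge>y0. allowed P (wheel y) = {}"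
proof -
 obtain f g where fg: "f \<in> P" "g \<in> P" "f \<noteq> g" "coeff f 1 * coeff g 0 = coeff g 1 * coeff f 0"
  using assms(1) unfolding proportional_def by blast
 define h where "h = gcd (coeff f 1) (coeff g 1)"
 have pos: "0 < coeff f 1" "0 < coeff g 1"
  using P fg by auto
 then have h: "0 < h"
  by (simp add: h_def)
 obtain a c where ac: "coeff f 1 = h * a" "coeff g 1 = h * c" "coprime a c"
  using gcd_coprime_exists[of "coeff f 1" "coeff g 1"] h by (auto simp: h_def mult.commute)
 have apos: "0 < a" "0 < c"
  using pos ac h by (simp_all add: zero_less_mult_iff)
 have "h * (a * coeff g 0) = h * (c * coeff f 0)"
  using fg(4) ac by (simp add: mult_ac)
 then have bd: "a * coeff g 0 = c * coeff f 0"
  using h by simp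
 have eq: "c * poly f x = a * poly g x" for x
 proof -
  have "c * poly f x = h * a * c * x + c * coeff f 0" "a * poly g x = h * a * c * x + a * coeff g 0"
   using poly_degree_1[of f x] poly_degree_1[of g x] P[OF fg(1)] P[OF fg(2)] ac(1,2)
   by (simp_all add: algebra_simps)
  with bd show ?thesis
   by simp
 qed
 \<comment> \<open>With both equal to 1 all coefficients agree, against
   \<open>f \<noteq> g\<close>.\<close>
 have "\<not> (a = 1 \<and> c = 1)"
 proof
  assume a1: "a = 1 \<and> c = 1"
  have "f = g"
  proof (rule poly_eqI)
   fix i
   show "coeff f i = coeff g i"
    using a1 ac bd P[OF fg(1)] P[OF fg(2)]
    by (cases "i = 0"; cases "i = 1") (auto simp: coeff_eq_0)
  qed
  with fg show False
   by blast
 qed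
 then have "1 < a \<or> 1 < c"
  using apos by linarith
 then obtain q u where q: "prime q" "u \<in> P" "\<And>x. q dvd poly u x"
 proof
  assume "1 < a"
  then obtain q where q: "prime q" "q dvd a"
   using prime_factor_int[of a] by auto
  have nd: "\<not> q dvd c"
   using coprime_common_divisor[OF ac(3) q(2)] not_prime_unit[of q] q(1) by blast
  have "q dvd poly f x" for x
  proof -
   have "q dvd c * poly f x"
    using eq[of x] q(2) by simp
   with q(1) nd show ?thesis
    by (simp add: prime_dvd_mult_iff)
  qed
  with q fg that show thesis
   by blast
 next
  assume "1 < c"
  then obtain q where q: "prime q" "q dvd c"
   using prime_factor_int[of c] by auto
  have nd: "\<not> q dvd a"
   using coprime_common_divisor[OF ac(3) _ q(2)] not_prime_unit[of q] q(1) by blast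
  have "q dvd poly g x" for x
  proof -
   have "q dvd a * poly g x"
    using eq[of x, symmetric] q(2) by simp
   with q(1) nd show ?thesis
    by (simp add: prime_dvd_mult_iff)
  qed
  with q fg that show thesis
   by blast
 qed
 have q2: "2 \<le> q"
  using q(1) by (rule prime_ge_2_int)
 have "allowed P (wheel y) = {}" if "nat q + 1 \<le> y" for y
 proof -
  have "q dvd wheel y"
  proof (cases "q = 2")
   case True
   then show ?thesis
    by (simp add: wheel_def)
  next
   case False
   then have "nat q \<in> wheel_primes y"
    using that q2 q(1) by (simp add: wheel_primes_def prime_nat_iff_prime)
   then have "int (nat q) dvd wheel y"
    unfolding wheel_def by (intro dvd_mult dvd_prodI) auto
   then show ?thesis
    using q2 by simp
  qed
  then have "\<not> coprime (poly u r) (wheel y)" for r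
   using coprime_common_divisor[of "poly u r" "wheel y" q] q(3)[of r] not_prime_unit[of q] q(1) by blast
  then show ?thesis
   using q(2) by (auto simp: allowed_def)
 qed
 then show ?thesis
  by blast
qed

text \<open>Off the finitely many primes that divide a leading coefficient or a resultant,
  \<open>k = card P\<close> residues are lost, and Bernoulli's inequality gives
  \<open>1 - k / p \<le> (1 - 1 / p)^k\<close>. At the remaining primes the trivial bound is paid
  for by a factor \<open>2^k\<close>, since \<open>2 * (1 - 1 / p)\<close> is at least 1.\<close>

lemma allowed_not_proportional:
 assumes np: "\<not> proportional P" and fin: "finite P"
  and P: "\<And>f. f \<in> P \<Longrightarrow> degree f = 1 \<and> 0 < coeff f 1"
 shows "\<exists>C\<ge>1. \<forall>y. real (card (allowed P (wheel y))) \<le> C * real_of_int (wheel y) * prime_prod y ^ card P"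
proof -
 define E where "E = (\<Prod>f\<in>P. coeff f 1) *
  (\<Prod>z\<in>{(f, g) \<in> P \<times> P. f \<noteq> g}. coeff (fst z) 1 * coeff (snd z) 0 - coeff (snd z) 1 * coeff (fst z) 0)"
 have finz: "finite {(f, g) \<in> P \<times> P. f \<noteq> g}"
  by (rule finite_subset[of _ "P \<times> P"]) (use fin in auto)
 have E0: "E \<noteq> 0"
  using np P fin finz unfolding E_def proportional_def by (fastforce simp: prod_zero_iff)
 define B where "B = {p. int p dvd E}"
 have finB: "finite B"
 proof (rule finite_subset)
  show "B \<subseteq> {..nat \<bar>E\<bar>}"
   using E0 by (auto simp: B_def dest!: dvd_imp_le_int)
 qed simp
 let ?k = "card P"
 define b where "b p = (if p \<in> B then 2 ^ ?k else 1 :: real)" for p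
 have one: "real (card (allowed P (int p))) \<le> real p * ((1 - 1 / real p) ^ ?k * b p)"
  if p: "p \<in> wheel_primes y" for p y
 proof (cases "p \<in> B")
  case True
  have "2 \<le> real p"
   using wheel_primesD(5)[OF p] by simp
  then have "1 \<le> (1 - 1 / real p) * 2"
   by (simp add: field_simps)
  then have "1 \<le> ((1 - 1 / real p) * 2) ^ ?k"
   by (rule one_le_power)
  then have "1 \<le> (1 - 1 / real p) ^ ?k * b p"
   using True by (simp only: b_def if_True power_mult_distrib)
  then have "real p * 1 \<le> real p * ((1 - 1 / real p) ^ ?k * b p)"
   by (intro mult_left_mono) auto
  moreover have "real (card (allowed P (int p))) \<le> real p * 1"
   using card_allowed_le[of "int p" P] \<open>2 \<le> real p\<close> by simp
  ultimately show ?thesis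
   by linarith
 next
  case False
  have "card (allowed P (int p)) + ?k \<le> p"
  proof (rule card_allowed_prime_le)
   show "prime (int p)"
    using wheel_primesD[OF p] by simp
   have nd: "\<not> int p dvd E"
    using False by (simp add: B_def)
   show "\<not> int p dvd coeff f 1" if "f \<in> P" for f
   proof
    assume "int p dvd coeff f 1"
    then have "int p dvd (\<Prod>f\<in>P. coeff f 1)"
     using that fin by (meson dvd_prodI dvd_trans)
    with nd show False
     by (simp add: E_def)
   qed
   show "\<not> int p dvd coeff f 1 * coeff g 0 - coeff g 1 * coeff f 0" if "f \<in> P" "g \<in> P" "f \<noteq> g" for f g
   proof
    let ?z = "\<lambda>z. coeff (fst z) 1 * coeff (snd z) 0 - coeff (snd z) 1 * coeff (fst z) 0"
    assume "int p dvd coeff f 1 * coeff g 0 - coeff g 1 * coeff f 0"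
    then have "int p dvd ?z (f, g)"
     by simp
    moreover have "?z (f, g) dvd (\<Prod>z\<in>{(f, g) \<in> P \<times> P. f \<noteq> g}. ?z z)"
     using that finz by (intro dvd_prodI) auto
    ultimately have "int p dvd (\<Prod>z\<in>{(f, g) \<in> P \<times> P. f \<noteq> g}. ?z z)"
     by (rule dvd_trans)
    with nd show False
     by (simp add: E_def)
   qed
  qed (use fin P in auto)
  then have le: "real (card (allowed P (int p))) \<le> real p - real ?k"
   by linarith
  have p1: "1 \<le> real p"
   using wheel_primesD(5)[OF p] by simp
  have "1 + real ?k * (- 1 / real p) \<le> (1 + - 1 / real p) ^ ?k"
   using p1 by (intro Bernoulli_inequality) (simp add: field_simps)
  then have "real p * (1 - real ?k / real p) \<le> real p * (1 - 1 / real p) ^ ?k"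
   by (intro mult_left_mono) auto
  then show ?thesis
   using le p1 False by (simp add: b_def algebra_simps)
 qed
 have bprod: "(\<Prod>p\<in>wheel_primes y. b p) \<le> (2 ^ ?k) ^ card B" for y
 proof -
  have "(\<Prod>p\<in>wheel_primes y. b p) = (\<Prod>p\<in>wheel_primes y \<inter> B. 2 ^ ?k)"
   unfolding b_def by (simp add: prod.inter_restrict[symmetric])
  also have "\<dots> = (2 ^ ?k) ^ card (wheel_primes y \<inter> B)"
   by simp
  also have "\<dots> \<le> (2 ^ ?k) ^ card B"
   using finB by (intro power_increasing card_mono) auto
  finally show ?thesis .
 qed
 have "real (card (allowed P (wheel y))) \<le> (2 ^ ?k) ^ card B * real_of_int (wheel y) * prime_prod y ^ ?k" for y
 proof -
  let ?F = "\<lambda>M. card (allowed P M)"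
  have "?F (wheel y) \<le> ?F 8 * (\<Prod>p\<in>wheel_primes y. ?F (int p))"
   by (rule submultiplicative_wheel) (rule card_allowed_mult_le)
  then have "real (?F (wheel y)) \<le> real (?F 8 * (\<Prod>p\<in>wheel_primes y. ?F (int p)))"
   by (rule of_nat_mono)
  also have "\<dots> = real (?F 8) * (\<Prod>p\<in>wheel_primes y. real (?F (int p)))"
   by simp
  also have "\<dots> \<le> 8 * (\<Prod>p\<in>wheel_primes y. real p * ((1 - 1 / real p) ^ ?k * b p))"
   using card_allowed_le[of 8 P] one by (intro mult_mono prod_mono conjI) (auto intro: prod_nonneg)
  also have "\<dots> = real_of_int (wheel y) * prime_prod y ^ ?k * (\<Prod>p\<in>wheel_primes y. b p)"
   by (simp add: prod.distrib prime_prod_def wheel_def prod_power_distrib)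
  also have "\<dots> \<le> real_of_int (wheel y) * prime_prod y ^ ?k * (2 ^ ?k) ^ card B"
   using bprod[of y] wheel_pos[of y] prime_prod_nonneg[of y] by (intro mult_left_mono) auto
  finally show ?thesis
   by (simp add: mult_ac)
 qed
 moreover have "1 \<le> ((2 :: real) ^ ?k) ^ card B"
  by (intro one_le_power) auto
 ultimately show ?thesis
  by blast
qed

text \<open>One of the \<open>k\<close> factors \<open>prime_prod\<close> is paired with
  \<open>form_prod\<close>, and the two together form an Euler product of order
  \<open>1 / ln y\<close>; the other \<open>k - 1\<close> factors are Mertens products. For a
  proportional pattern no class is admissible once the wheel is large, so \<open>C = 0\<close>
  serves.\<close>

theorem wheel_density:
 assumes "finite P" "P \<noteq> {}" and P: "\<And>f. f \<in> P \<Longrightarrow> degree f = 1 \<and> 0 < coeff f 1"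
 shows "\<exists>C\<ge>0. \<exists>y0\<ge>3. \<forall>y\<ge>y0.
  real (card (allowed P (wheel y))) \<le> C * real_of_int (wheel y) / ln (real y) ^ card P \<and>
  (\<forall>\<gamma> \<epsilon> \<rho>. (\<gamma>, \<epsilon>) \<in> forms \<longrightarrow> coprime \<rho> (wheel y) \<longrightarrow>
   real (card (allowed P (wheel y))) * real (card (reps_mod \<gamma> \<epsilon> \<rho> (wheel y)))
    \<le> C * real_of_int (wheel y) * real_of_int (wheel y) / ln (real y) ^ card P)"
proof (cases "proportional P")
 case True
 then obtain y0 where "\<forall>y\<ge>y0. allowed P (wheel y) = {}"
  using allowed_proportional P by blast
 then show ?thesis
  by (intro exI[of _ 0] conjI exI[of _ "max 3 y0"]) auto
next
 case False
 let ?k = "card P"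
 obtain C where C: "1 \<le> C"
   "\<And>y. real (card (allowed P (wheel y))) \<le> C * real_of_int (wheel y) * prime_prod y ^ ?k"
  using allowed_not_proportional[OF False assms(1) P] by blast
 have k: "?k = Suc (?k - 1)"
  using assms(1,2) by (simp add: card_gt_0_iff)
 let ?D = "8 * C * 5 ^ ?k"
 show ?thesis
 proof (intro exI[of _ ?D] exI[of _ 3] conjI allI impI)
  fix y :: nat assume y: "3 \<le> y"
  define A W L where "A = real (card (allowed P (wheel y)))" and "W = real_of_int (wheel y)" and "L = ln (real y)"
  have L: "0 < L"
   using y by (simp add: L_def)
  have W: "0 < W"
   using wheel_pos by (simp add: W_def)
  have A: "A \<le> C * W * prime_prod y ^ ?k"
   using C(2) by (simp add: A_def W_def)
  have pp: "prime_prod y ^ m \<le> (5 / L) ^ m" for m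
   using prime_prod_le[OF y] prime_prod_nonneg by (intro power_mono) (auto simp: L_def)
  have "A \<le> C * W * (5 / L) ^ ?k"
   using A by (rule order_trans) (use pp[of ?k] C W in \<open>intro mult_left_mono, auto\<close>)
  also have "\<dots> \<le> 8 * (C * W * (5 / L) ^ ?k)"
  proof -
   have "0 \<le> C * W * (5 / L) ^ ?k"
    using C(1) W L by simp
   then show ?thesis
    by linarith
  qed
  finally show "A \<le> ?D * W / L ^ ?k"
   by (simp add: power_divide mult_ac)
  fix \<gamma> \<epsilon> \<rho> assume f: "(\<gamma>, \<epsilon>) \<in> forms" and \<rho>: "coprime \<rho> (wheel y)"
  define M where "M = real (card (reps_mod \<gamma> \<epsilon> \<rho> (wheel y)))"
  have M: "M \<le> 8 * W * form_prod (\<gamma>, \<epsilon>) y"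
   using card_reps_mod_wheel_le[OF f \<rho>] by (simp add: M_def W_def)
  have "A * M \<le> (C * W * prime_prod y ^ ?k) * (8 * W * form_prod (\<gamma>, \<epsilon>) y)"
   using A M C W prime_prod_nonneg by (intro mult_mono) (auto simp: A_def M_def)
  also have "\<dots> = 8 * C * W * W * (prime_prod y ^ (?k - 1) * (prime_prod y * form_prod (\<gamma>, \<epsilon>) y))"
   by (subst k) simp
  also have "\<dots> \<le> 8 * C * W * W * ((5 / L) ^ (?k - 1) * (5 / L))"
   using pp prime_prod_form_prod_le[OF f y] C W L prime_prod_nonneg[of y] form_prod_nonneg[OF f, of y]
   by (intro mult_left_mono mult_mono) (auto simp: L_def)
  also have "\<dots> = 8 * C * W * W * (5 / L) ^ ?k"
   by (subst (2) k) simp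
  finally show "A * M \<le> ?D * W * W / L ^ ?k"
   by (simp add: power_divide mult_ac)
 qed (use C in auto)
qed

section \<open>A structured language with time and value bounds\<close>

datatype exp = V nat | N int | Bin arith_op exp exp

type_synonym bexp = "(comparison \<times> exp \<times> exp) list"

datatype com =
  Skip
 | Asg nat exp
 | Input nat exp
 | Get_Bit nat exp
 | Put_Bit exp exp
 | Print exp
 | Seq com com (infixr ";;" 60)
 | If bexp com com
 | While bexp com

record state =
 var :: "nat \<Rightarrow> int"
 bits :: "nat \<Rightarrow> bool"
 outs :: "int list"
 clock :: nat

fun eval :: "(nat \<Rightarrow> int) \<Rightarrow> exp \<Rightarrow> int" where
 "eval \<sigma> (V x) = \<sigma> x"
| "eval \<sigma> (N v) = v"
| "eval \<sigma> (Bin f a b) = the (arith f (eval \<sigma> a) (eval \<sigma> b))"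

fun defined :: "(nat \<Rightarrow> int) \<Rightarrow> exp \<Rightarrow> bool" where
 "defined \<sigma> (V x) \<longleftrightarrow> True"
| "defined \<sigma> (N v) \<longleftrightarrow> True"
| "defined \<sigma> (Bin f a b) \<longleftrightarrow>
  defined \<sigma> a \<and> defined \<sigma> b \<and> (f = Div \<or> f = arith_op.Mod \<longrightarrow> eval \<sigma> b \<noteq> 0)"

fun size_of :: "exp \<Rightarrow> nat" where
 "size_of (V x) = 1"
| "size_of (N v) = 1"
| "size_of (Bin f a b) = size_of a + size_of b + 1"

fun btrue :: "(nat \<Rightarrow> int) \<Rightarrow> bexp \<Rightarrow> bool" where
 "btrue \<sigma> [] \<longleftrightarrow> True"
| "btrue \<sigma> ((c, a, b) # bs) \<longleftrightarrow> holds c (eval \<sigma> a) (eval \<sigma> b) \<and> btrue \<sigma> bs"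

fun bdefined :: "(nat \<Rightarrow> int) \<Rightarrow> bexp \<Rightarrow> bool" where
 "bdefined \<sigma> [] \<longleftrightarrow> True"
| "bdefined \<sigma> ((c, a, b) # bs) \<longleftrightarrow> defined \<sigma> a \<and> defined \<sigma> b \<and> bdefined \<sigma> bs"

fun bsize :: "bexp \<Rightarrow> nat" where
 "bsize [] = 0"
| "bsize ((c, a, b) # bs) = size_of a + size_of b + 2 + bsize bs"

fun assigned :: "com \<Rightarrow> nat set" where
 "assigned Skip = {}"
| "assigned (Asg x e) = {x}"
| "assigned (Input x e) = {x}"
| "assigned (Get_Bit x e) = {x}"
| "assigned (Put_Bit a b) = {}"
| "assigned (Print e) = {}"
| "assigned (Seq c d) = assigned c \<union> assigned d"
| "assigned (If b c d) = assigned c \<union> assigned d"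
| "assigned (While b c) = assigned c"

fun puts_bits :: "com \<Rightarrow> bool" where
 "puts_bits (Put_Bit a b) \<longleftrightarrow> True"
| "puts_bits (Seq c d) \<longleftrightarrow> puts_bits c \<or> puts_bits d"
| "puts_bits (If b c d) \<longleftrightarrow> puts_bits c \<or> puts_bits d"
| "puts_bits (While b c) \<longleftrightarrow> puts_bits c"
| "puts_bits _ \<longleftrightarrow> False"

fun prints :: "com \<Rightarrow> bool" where
 "prints (Print e) \<longleftrightarrow> True"
| "prints (Seq c d) \<longleftrightarrow> prints c \<or> prints d"
| "prints (If b c d) \<longleftrightarrow> prints c \<or> prints d"
| "prints (While b c) \<longleftrightarrow> prints c"
| "prints _ \<longleftrightarrow> False"

definition tick :: "nat \<Rightarrow> state \<Rightarrow> state" where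
 "tick t s = s\<lparr>clock := clock s + t\<rparr>"

definition set_var :: "nat \<Rightarrow> int \<Rightarrow> state \<Rightarrow> state" where
 "set_var x v s = s\<lparr>var := (var s)(x := v)\<rparr>"

lemma tick_simps [simp]:
 "var (tick t s) = var s" "bits (tick t s) = bits s" "outs (tick t s) = outs s"
 "clock (tick t s) = clock s + t"
 by (simp_all add: tick_def)

lemma set_var_simps [simp]:
 "var (set_var x v s) = (var s)(x := v)" "bits (set_var x v s) = bits s"
 "outs (set_var x v s) = outs s" "clock (set_var x v s) = clock s"
 by (simp_all add: set_var_def)

text \<open>
 The size check on assigned values is what keeps the compiled program from overflowing: the size
 of the intermediate values then follows from the syntactic degree of the expressions. The input
 is read-only and the bits may be stored between the addresses \<open>l\<close> and \<open>u\<close>.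
\<close>

locale limits =
 fixes xs :: "int list" and big :: int and l u :: nat
begin

inductive run :: "com \<Rightarrow> state \<Rightarrow> state \<Rightarrow> bool" where
 Skip: "run Skip s s"
| Asg: "defined (var s) e \<Longrightarrow> \<bar>eval (var s) e\<bar> \<le> big \<Longrightarrow>
  run (Asg x e) s (tick (size_of e + 1) (set_var x (eval (var s) e) s))"
| Input: "defined (var s) e \<Longrightarrow> 0 \<le> eval (var s) e \<Longrightarrow> eval (var s) e < int (length xs) \<Longrightarrow>
  run (Input x e) s (tick (size_of e + 1) (set_var x (xs ! nat (eval (var s) e)) s))"
| Get_Bit: "defined (var s) e \<Longrightarrow> int l \<le> eval (var s) e \<Longrightarrow> eval (var s) e < int u \<Longrightarrow>
  run (Get_Bit x e) s
   (tick (size_of e + 1) (set_var x (of_bool (bits s (nat (eval (var s) e)))) s))"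
| Put_Bit: "defined (var s) a \<Longrightarrow> int l \<le> eval (var s) a \<Longrightarrow> eval (var s) a < int u \<Longrightarrow>
  defined (var s) b \<Longrightarrow>
  run (Put_Bit a b) s (tick (size_of a + size_of b + 1)
   (s\<lparr>bits := (bits s)(nat (eval (var s) a) := (eval (var s) b \<noteq> 0))\<rparr>))"
| Print: "defined (var s) e \<Longrightarrow>
  run (Print e) s (tick (size_of e + 1) (s\<lparr>outs := outs s @ [eval (var s) e]\<rparr>))"
| Seq: "run c s s' \<Longrightarrow> run d s' s'' \<Longrightarrow> run (c ;; d) s s''"
| If_True: "bdefined (var s) b \<Longrightarrow> btrue (var s) b \<Longrightarrow> run c (tick (bsize b + 1) s) s' \<Longrightarrow>
  run (If b c d) s s'"
| If_False: "bdefined (var s) b \<Longrightarrow> \<not> btrue (var s) b \<Longrightarrow> run d (tick (bsize b + 1) s) s' \<Longrightarrow>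
  run (If b c d) s s'"
| While_True: "bdefined (var s) b \<Longrightarrow> btrue (var s) b \<Longrightarrow> run c (tick (bsize b + 1) s) s' \<Longrightarrow>
  run (While b c) s' s'' \<Longrightarrow> run (While b c) s s''"
| While_False: "bdefined (var s) b \<Longrightarrow> \<not> btrue (var s) b \<Longrightarrow>
  run (While b c) s (tick (bsize b + 1) s)"

text \<open>The postcondition may speak of \<open>clock\<close>, so that one derivation covers
  termination, result and running time.\<close>

definition total :: "com \<Rightarrow> (state \<Rightarrow> bool) \<Rightarrow> state \<Rightarrow> bool" where
 "total c Q s \<longleftrightarrow> (\<exists>s'. run c s s' \<and> Q s')"

definition frame :: "com \<Rightarrow> state \<Rightarrow> state \<Rightarrow> bool" where
 "frame c s s' \<longleftrightarrow> (\<forall>x. x \<notin> assigned c \<longrightarrow> var s' x = var s x) \<and>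
  (\<not> puts_bits c \<longrightarrow> bits s' = bits s) \<and> (\<not> prints c \<longrightarrow> outs s' = outs s)"

lemma run_frame: "run c s s' \<Longrightarrow> frame c s s'"
 by (induction rule: run.induct) (auto simp: frame_def)

lemma frame_refl: "frame c s s"
 by (simp add: frame_def)

lemma frame_trans: "frame c s s' \<Longrightarrow> frame c s' s'' \<Longrightarrow> frame c s s''"
 by (auto simp: frame_def)

lemma total_conseq:
 assumes "total c Q s" and "\<And>s'. Q s' \<Longrightarrow> frame c s s' \<Longrightarrow> R s'"
 shows "total c R s"
 using assms run_frame unfolding total_def by blast

lemma total_Skip: "Q s \<Longrightarrow> total Skip Q s"
 unfolding total_def using run.Skip by blast

lemma total_Asg:
 "defined (var s) e \<Longrightarrow> \<bar>eval (var s) e\<bar> \<le> big \<Longrightarrow>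
  Q (tick (size_of e + 1) (set_var x (eval (var s) e) s)) \<Longrightarrow> total (Asg x e) Q s"
 unfolding total_def using run.Asg by blast

lemma total_Input:
 "defined (var s) e \<Longrightarrow> 0 \<le> eval (var s) e \<Longrightarrow> eval (var s) e < int (length xs) \<Longrightarrow>
  Q (tick (size_of e + 1) (set_var x (xs ! nat (eval (var s) e)) s)) \<Longrightarrow> total (Input x e) Q s"
 unfolding total_def using run.Input by blast

lemma total_Get_Bit:
 "defined (var s) e \<Longrightarrow> int l \<le> eval (var s) e \<Longrightarrow> eval (var s) e < int u \<Longrightarrow>
  Q (tick (size_of e + 1) (set_var x (of_bool (bits s (nat (eval (var s) e)))) s)) \<Longrightarrow>
  total (Get_Bit x e) Q s"
 unfolding total_def using run.Get_Bit by blast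

lemma total_Put_Bit:
 "defined (var s) a \<Longrightarrow> int l \<le> eval (var s) a \<Longrightarrow> eval (var s) a < int u \<Longrightarrow>
  defined (var s) b \<Longrightarrow>
  Q (tick (size_of a + size_of b + 1)
   (s\<lparr>bits := (bits s)(nat (eval (var s) a) := (eval (var s) b \<noteq> 0))\<rparr>)) \<Longrightarrow>
  total (Put_Bit a b) Q s"
 unfolding total_def using run.Put_Bit by blast

lemma total_Print:
 "defined (var s) e \<Longrightarrow> Q (tick (size_of e + 1) (s\<lparr>outs := outs s @ [eval (var s) e]\<rparr>)) \<Longrightarrow>
  total (Print e) Q s"
 unfolding total_def using run.Print by blast

lemma total_Seq: "total c (total d Q) s \<Longrightarrow> total (c ;; d) Q s"
 unfolding total_def using run.Seq by blast

lemma total_If: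
 assumes "bdefined (var s) b"
  and "btrue (var s) b \<Longrightarrow> total c Q (tick (bsize b + 1) s)"
  and "\<not> btrue (var s) b \<Longrightarrow> total d Q (tick (bsize b + 1) s)"
 shows "total (If b c d) Q s"
 using assms run.If_True run.If_False unfolding total_def by blast

text \<open>Every state met at the loop head is related to the initial one by \<open>frame\<close>,
  so invariants mention only what the body assigns.\<close>

lemma total_While:
 fixes m :: "state \<Rightarrow> nat"
 assumes "I s"
  and body: "\<And>s'. I s' \<Longrightarrow> frame c s s' \<Longrightarrow> btrue (var s') b \<Longrightarrow>
   total c (\<lambda>s''. I s'' \<and> m s'' < m s') (tick (bsize b + 1) s')"
  and exit: "\<And>s'. I s' \<Longrightarrow> frame c s s' \<Longrightarrow> \<not> btrue (var s') b \<Longrightarrow> Q (tick (bsize b + 1) s')"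
  and def: "\<And>s'. I s' \<Longrightarrow> frame c s s' \<Longrightarrow> bdefined (var s') b"
 shows "total (While b c) Q s"
proof -
 have "total (While b c) Q s'" if "I s'" "frame c s s'" for s'
  using that
 proof (induction "m s'" arbitrary: s' rule: less_induct)
  case less
  show ?case
  proof (cases "btrue (var s') b")
   case False
   with less.prems def exit show ?thesis
    unfolding total_def using run.While_False by blast
  next
   case True
   obtain s'' where s'': "run c (tick (bsize b + 1) s') s''" "I s''" "m s'' < m s'"
    using body[OF less.prems True] unfolding total_def by blast
   have "frame c s' s''"
    using run_frame[OF s''(1)] by (auto simp: frame_def)
   then have "total (While b c) Q s''"
    using less.hyps[of s''] s'' less.prems frame_trans by blast
   then show ?thesis
    using run.While_True[OF def[OF less.prems] True s''(1)] unfolding total_def by blast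
  qed
 qed
 with assms(1) frame_refl show ?thesis
  by blast
qed

end

section \<open>Compilation\<close>

text \<open>The registers from 60 on hold intermediate values.\<close>

abbreviation (input) "tmp \<equiv> 60 :: nat"

fun exp_code :: "nat \<Rightarrow> exp \<Rightarrow> nat instr list" where
 "exp_code r (V x) = [Move r x]"
| "exp_code r (N v) = [Const r v]"
| "exp_code r (Bin f a b) = exp_code r a @ exp_code (r + 1) b @ [Arith f r r (r + 1)]"

text \<open>A true comparison branches over the \<open>Jump\<close> that leaves the conjunction,
  hence two control instructions per conjunct.\<close>

fun bexp_code :: "nat \<Rightarrow> nat \<Rightarrow> bexp \<Rightarrow> nat instr list" where
 "bexp_code i t [] = []"
| "bexp_code i t ((c, a, b) # bs) =
  exp_code tmp a @ exp_code (tmp + 1) b @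
  [Branch c tmp (tmp + 1) (i + size_of a + size_of b + 2), Jump t] @
  bexp_code (i + size_of a + size_of b + 2) t bs"

fun code_size :: "com \<Rightarrow> nat" where
 "code_size Skip = 0"
| "code_size (Asg x e) = size_of e + 1"
| "code_size (Input x e) = size_of e + 1"
| "code_size (Get_Bit x e) = size_of e + 1"
| "code_size (Put_Bit a b) = size_of a + size_of b + 1"
| "code_size (Print e) = size_of e + 1"
| "code_size (Seq c d) = code_size c + code_size d"
| "code_size (If b c d) = bsize b + code_size c + 1 + code_size d"
| "code_size (While b c) = bsize b + code_size c + 1"

fun code :: "nat \<Rightarrow> com \<Rightarrow> nat instr list" where
 "code i Skip = []"
| "code i (Asg x e) = exp_code tmp e @ [Move x tmp]"
| "code i (Input x e) = exp_code tmp e @ [Load_Word x tmp]"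
| "code i (Get_Bit x e) = exp_code tmp e @ [Load_Bit x tmp]"
| "code i (Put_Bit a b) = exp_code tmp a @ exp_code (tmp + 1) b @ [Store_Bit tmp (tmp + 1)]"
| "code i (Print e) = exp_code tmp e @ [Output tmp]"
| "code i (Seq c d) = code i c @ code (i + code_size c) d"
| "code i (If b c d) =
  bexp_code i (i + bsize b + code_size c + 1) b @ code (i + bsize b) c @
  [Jump (i + bsize b + code_size c + 1 + code_size d)] @ code (i + bsize b + code_size c + 1) d"
| "code i (While b c) =
  bexp_code i (i + bsize b + code_size c + 1) b @ code (i + bsize b) c @ [Jump i]"

lemma length_exp_code [simp]: "length (exp_code r e) = size_of e"
 by (induction e arbitrary: r) auto

lemma length_bexp_code [simp]: "length (bexp_code i t b) = bsize b"
 by (induction i t b rule: bexp_code.induct) auto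

lemma length_code [simp]: "length (code i c) = code_size c"
 by (induction c arbitrary: i) auto

text \<open>With variables bounded by \<open>B^g\<close>, this is an exponent of \<open>B\<close>
  that bounds the value. A sum adds one because \<open>2 \<le> B\<close>; a quotient is bounded by
  its dividend and a remainder by its divisor.\<close>

fun exp_degree :: "nat \<Rightarrow> exp \<Rightarrow> nat" where
 "exp_degree g (V x) = g"
| "exp_degree g (N v) = floorlog 2 (nat \<bar>v\<bar>)"
| "exp_degree g (Bin f a b) = (case f of
   Add \<Rightarrow> max (exp_degree g a) (exp_degree g b) + 1
  | Sub \<Rightarrow> max (exp_degree g a) (exp_degree g b) + 1
  | Mul \<Rightarrow> exp_degree g a + exp_degree g b
  | Div \<Rightarrow> max (exp_degree g a) (exp_degree g b)
  | arith_op.Mod \<Rightarrow> max (exp_degree g a) (exp_degree g b))"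

fun small_exp :: "nat \<Rightarrow> nat \<Rightarrow> exp \<Rightarrow> bool" where
 "small_exp g h (V x) \<longleftrightarrow> x < tmp"
| "small_exp g h (N v) \<longleftrightarrow> floorlog 2 (nat \<bar>v\<bar>) \<le> h"
| "small_exp g h (Bin f a b) \<longleftrightarrow>
  small_exp g h a \<and> small_exp g h b \<and> exp_degree g (Bin f a b) \<le> h"

fun small :: "nat \<Rightarrow> nat \<Rightarrow> com \<Rightarrow> bool" where
 "small g h Skip \<longleftrightarrow> True"
| "small g h (Asg x e) \<longleftrightarrow> x < tmp \<and> small_exp g h e"
| "small g h (Input x e) \<longleftrightarrow> x < tmp \<and> small_exp g h e"
| "small g h (Get_Bit x e) \<longleftrightarrow> x < tmp \<and> small_exp g h e"
| "small g h (Put_Bit a b) \<longleftrightarrow> small_exp g h a \<and> small_exp g h b"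
| "small g h (Print e) \<longleftrightarrow> small_exp g h e"
| "small g h (Seq c d) \<longleftrightarrow> small g h c \<and> small g h d"
| "small g h (If b c d) \<longleftrightarrow>
  (\<forall>(_, e, e') \<in> set b. small_exp g h e \<and> small_exp g h e') \<and> small g h c \<and> small g h d"
| "small g h (While b c) \<longleftrightarrow>
  (\<forall>(_, e, e') \<in> set b. small_exp g h e \<and> small_exp g h e') \<and> small g h c"

definition block :: "program \<Rightarrow> nat \<Rightarrow> nat instr list \<Rightarrow> bool" where
 "block p i is \<longleftrightarrow> (\<exists>ys zs. p = ys @ is @ zs \<and> length ys = i)"

lemma block_append [simp]:
 "block p i (is @ js) \<longleftrightarrow> block p i is \<and> block p (i + length is) js"
proof
 assume "block p i (is @ js)"
 then obtain ys zs where p: "p = ys @ (is @ js) @ zs" "length ys = i"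
  unfolding block_def by blast
 have "p = ys @ is @ (js @ zs)" "p = (ys @ is) @ js @ zs" "length (ys @ is) = i + length is"
  using p by simp_all
 with p show "block p i is \<and> block p (i + length is) js"
  unfolding block_def by blast
next
 assume "block p i is \<and> block p (i + length is) js"
 then obtain ys zs ys' zs' where "p = ys @ is @ zs" "length ys = i"
   "p = ys' @ js @ zs'" "length ys' = i + length is"
  unfolding block_def by blast
 then have "p = (ys @ is) @ js @ zs'"
  by (metis append.assoc append_eq_append_conv length_append)
 with \<open>length ys = i\<close> show "block p i (is @ js)"
  unfolding block_def by (metis append.assoc)
qed

lemma block_Nil: "block p i [] \<longleftrightarrow> i \<le> length p"
proof
 assume "i \<le> length p"
 then show "block p i []"
  unfolding block_def by (intro exI[of _ "take i p"] exI[of _ "drop i p"]) auto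
qed (auto simp: block_def)

lemma block_Cons: "block p i (x # is) \<longleftrightarrow> i < length p \<and> p ! i = x \<and> block p (Suc i) is"
proof -
 have "block p i [x] \<longleftrightarrow> i < length p \<and> p ! i = x"
 proof
  assume "i < length p \<and> p ! i = x"
  then have "p = take i p @ [x] @ drop (Suc i) p" "length (take i p) = i"
   by (auto simp: Cons_nth_drop_Suc)
  then show "block p i [x]"
   unfolding block_def by blast
 qed (auto simp: block_def)
 then show ?thesis
  using block_append[of p i "[x]" "is"] by simp
qed

definition steps :: "nat \<Rightarrow> program \<Rightarrow> nat \<Rightarrow> config \<Rightarrow> config option" where
 "steps w p t s = ((\<lambda>c. Option.bind c (step w p)) ^^ t) (Some s)"

lemma steps_0 [simp]: "steps w p 0 s = Some s"
 by (simp add: steps_def)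

lemma steps_1: "steps w p (Suc 0) s = step w p s"
 by (simp add: steps_def)

lemma steps_add: "steps w p t s = Some s' \<Longrightarrow> steps w p (t + t') s = steps w p t' s'"
 unfolding steps_def by (simp add: funpow_add add.commute[of t])

definition reaches :: "nat \<Rightarrow> program \<Rightarrow> nat \<Rightarrow> config \<Rightarrow> (config \<Rightarrow> bool) \<Rightarrow> bool" where
 "reaches w p t s Q \<longleftrightarrow> (\<exists>t' s'. t' \<le> t \<and> steps w p t' s = Some s' \<and> Q s')"

lemma reaches_ex: "reaches w p t s Q \<Longrightarrow> \<exists>s'. Q s'"
 unfolding reaches_def by blast

lemma reaches_0: "Q s \<Longrightarrow> reaches w p t s Q"
 unfolding reaches_def by (metis steps_0 zero_le)

lemma reaches_trans:
 assumes "reaches w p t s R" and "\<And>s'. R s' \<Longrightarrow> reaches w p t' s' Q" and "t + t' \<le> t''"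
 shows "reaches w p t'' s Q"
proof -
 obtain t1 s1 where 1: "t1 \<le> t" "steps w p t1 s = Some s1" "R s1"
  using assms(1) unfolding reaches_def by blast
 obtain t2 s2 where 2: "t2 \<le> t'" "steps w p t2 s1 = Some s2" "Q s2"
  using assms(2)[OF 1(3)] unfolding reaches_def by blast
 have "steps w p (t1 + t2) s = Some s2"
  using steps_add[OF 1(2)] 2(2) by simp
 with 1 2 assms(3) show ?thesis
  unfolding reaches_def by (metis add_mono le_trans)
qed

lemma reaches_step:
 assumes "pc s < length p" and "exec w (p ! pc s) s = Some s'" and "Q s'" and "0 < t"
 shows "reaches w p t s Q"
 unfolding reaches_def using assms by (intro exI[of _ 1] exI[of _ s']) (auto simp: steps_1 step_def)

lemma reaches_exec:
 assumes "block p (pc c) [i]" and "exec w i c = Some c'" and "Q c'"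
 shows "reaches w p 1 c Q"
 using assms by (intro reaches_step) (auto simp: block_Cons)

lemma abs_div_le: "\<bar>x div y\<bar> \<le> \<bar>x :: int\<bar>"
proof (cases "y = 0")
 case False
 have "\<bar>x div y\<bar> \<le> \<bar>x\<bar>" if "0 < y" for x y :: int
 proof (cases "0 \<le> x")
  case True
  then have "x div y \<le> x"
   using zdiv_mono2[of x 1 y] that by simp
  then show ?thesis
   using True that pos_imp_zdiv_nonneg_iff[of y x] by linarith
 next
  case False
  have "x * y \<le> x * 1"
   using False that by (intro mult_left_mono_neg) auto
  then have "x \<le> x div y"
   using zdiv_mono1[of "x * y" x y] that by simp
  then show ?thesis
   using False that div_neg_pos_less0[of x y] by linarith
 qed
 from this[of y x] this[of "- y" "- x"] False show ?thesis
  by (cases "0 < y") auto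
qed auto

lemma abs_mod_le: "y \<noteq> 0 \<Longrightarrow> \<bar>x mod y\<bar> \<le> \<bar>y :: int\<bar>"
 by (smt (verit) pos_mod_bound pos_mod_sign neg_mod_bound neg_mod_sign)

lemma abs_less_power_floorlog:
 fixes B :: int
 assumes "2 \<le> B"
 shows "\<bar>v\<bar> \<le> B ^ floorlog 2 (nat \<bar>v\<bar>)"
proof -
 have "nat \<bar>v\<bar> < 2 ^ floorlog 2 (nat \<bar>v\<bar>)"
  using floorlog_bounds[of "nat \<bar>v\<bar>" 2] by (cases "v = 0") (auto simp: floorlog_def)
 then have "\<bar>v\<bar> < 2 ^ floorlog 2 (nat \<bar>v\<bar>)"
  by (simp add: nat_less_iff)
 also have "\<dots> \<le> B ^ floorlog 2 (nat \<bar>v\<bar>)"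
  using assms by (intro power_mono) auto
 finally show ?thesis
  by simp
qed

text \<open>\<open>B^g\<close> bounds what variables hold and \<open>B^h\<close> what is certain to
  fit into a word, so intermediate values have \<open>h - g\<close> spare powers of
  \<open>B\<close>. The last assumption keeps the stored bits clear of the input, which stays
  readable throughout.\<close>

locale ram = limits +
 fixes w :: nat and B :: int and g h :: nat
 assumes B: "2 \<le> B"
  and big_le: "big \<le> B ^ g"
  and input_le: "\<And>x. x \<in> set xs \<Longrightarrow> \<bar>x\<bar> \<le> big"
  and big_ge: "1 \<le> big"
  and fits: "\<And>v. \<bar>v\<bar> \<le> B ^ h \<Longrightarrow> Defs.fits w v"
  and gh: "g \<le> h"
  and w: "0 < w"
  and l: "w * length xs \<le> l"
begin

lemma exp_bound:
 assumes "\<And>x. x < tmp \<Longrightarrow> \<bar>\<sigma> x\<bar> \<le> B ^ g"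
 shows "small_exp g h e \<Longrightarrow> defined \<sigma> e \<Longrightarrow> \<bar>eval \<sigma> e\<bar> \<le> B ^ exp_degree g e"
proof (induction e)
 case (N v)
 then show ?case
  using abs_less_power_floorlog[OF B] by simp
next
 case (Bin f a b)
 define i j where "i = exp_degree g a" and "j = exp_degree g b"
 have a: "\<bar>eval \<sigma> a\<bar> \<le> B ^ i" and b: "\<bar>eval \<sigma> b\<bar> \<le> B ^ j"
  using Bin by (auto simp: i_def j_def)
 have ij: "B ^ i \<le> B ^ max i j" "B ^ j \<le> B ^ max i j"
  using B by (auto intro: power_increasing)
 have "B ^ i + B ^ j \<le> B * B ^ max i j"
 proof -
  have "0 \<le> B ^ max i j"
   using B by simp
  with mult_right_mono[OF B this] ij show ?thesis
   by linarith
 qed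
 with a b have 1: "\<bar>eval \<sigma> a + eval \<sigma> b\<bar> \<le> B * B ^ max i j" "\<bar>eval \<sigma> a - eval \<sigma> b\<bar> \<le> B * B ^ max i j"
  by linarith+
 have 2: "\<bar>eval \<sigma> a * eval \<sigma> b\<bar> \<le> B ^ i * B ^ j"
  using a b B by (simp add: abs_mult mult_mono)
 have 3: "\<bar>eval \<sigma> a div eval \<sigma> b\<bar> \<le> B ^ max i j"
  using abs_div_le[of "eval \<sigma> a" "eval \<sigma> b"] a ij by linarith
 have 4: "\<bar>eval \<sigma> a mod eval \<sigma> b\<bar> \<le> B ^ max i j" if "eval \<sigma> b \<noteq> 0"
  using abs_mod_le[OF that, of "eval \<sigma> a"] b ij by linarith
 show ?case
  using 1 2 3 4 Bin.prems
  by (cases f) (simp_all flip: i_def j_def add: power_add)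
qed (use assms in auto)

text \<open>The bound on the variables is part of the relation because it is what rules out overflow
  during the evaluation of expressions.\<close>

definition simulates :: "state \<Rightarrow> config \<Rightarrow> bool" where
 "simulates s c \<longleftrightarrow>
  (\<forall>x<tmp. reg c x = var s x) \<and> (\<forall>x<tmp. \<bar>var s x\<bar> \<le> big) \<and>
  (\<forall>i. l \<le> i \<longrightarrow> mem c i = bits s i) \<and> (\<forall>i<l. mem c i = mem (init w xs) i) \<and>
  used c \<le> max l u \<and> out c = outs s"

lemma fits_var: "\<bar>v\<bar> \<le> big \<Longrightarrow> Defs.fits w v"
proof -
 have "B ^ g \<le> B ^ h"
  using B gh by (intro power_increasing) auto
 then show "\<bar>v\<bar> \<le> big \<Longrightarrow> Defs.fits w v"
  using fits big_le by force
qed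

definition same :: "nat \<Rightarrow> config \<Rightarrow> config \<Rightarrow> bool" where
 "same r c c' \<longleftrightarrow> (\<forall>x<r. reg c' x = reg c x) \<and> mem c' = mem c \<and> used c' = used c \<and> out c' = out c"

text \<open>Evaluation into register \<open>r\<close> leaves the registers below \<open>r\<close>
  alone, so the left operand survives while the right one is computed into
  \<open>r + 1\<close>.\<close>

lemma exp_code_reaches:
 assumes "small_exp g h e" "defined \<sigma> e" "block p (pc c) (exp_code r e)"
  and "\<forall>x<tmp. reg c x = \<sigma> x" "\<forall>x<tmp. \<bar>\<sigma> x\<bar> \<le> big" "tmp \<le> r"
 shows "reaches w p (size_of e) c (\<lambda>c'. pc c' = pc c + size_of e \<and> reg c' r = eval \<sigma> e \<and> same r c c')"
 using assms
proof (induction e arbitrary: r c)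
 case (V x)
 then show ?case
  by (intro reaches_step)
   (auto simp: block_Cons assign_def next_pc_def same_def fits_var)
next
 case (N v)
 have "\<bar>v\<bar> \<le> B ^ h"
  using abs_less_power_floorlog[OF B, of v] N(1) B power_increasing[of "floorlog 2 (nat \<bar>v\<bar>)" h B]
  by (metis order_trans small_exp.simps(2) one_le_numeral)
 with N show ?case
  by (intro reaches_step)
   (auto simp: block_Cons assign_def next_pc_def same_def fits)
next
 case (Bin f a b)
 have *: "\<And>x. x < tmp \<Longrightarrow> \<bar>\<sigma> x\<bar> \<le> B ^ g"
  using Bin.prems(5) big_le by force
 have "\<bar>eval \<sigma> (Bin f a b)\<bar> \<le> B ^ exp_degree g (Bin f a b)"
  by (rule exp_bound) (use Bin.prems * in auto)
 also have "\<dots> \<le> B ^ h"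
  using Bin.prems(1) B by (intro power_increasing) auto
 finally have fit: "Defs.fits w (eval \<sigma> (Bin f a b))"
  by (rule fits)
 have ar: "arith f (eval \<sigma> a) (eval \<sigma> b) = Some (eval \<sigma> (Bin f a b))"
  using Bin.prems(2) by (cases f) auto
 show ?case
 proof (rule reaches_trans[OF Bin.IH(1)[of c r]])
  fix c1 assume c1: "pc c1 = pc c + size_of a \<and> reg c1 r = eval \<sigma> a \<and> same r c c1"
  show "reaches w p (size_of b + 1) c1 (\<lambda>c'. pc c' = pc c + size_of (Bin f a b) \<and>
    reg c' r = eval \<sigma> (Bin f a b) \<and> same r c c')"
  proof (rule reaches_trans[OF Bin.IH(2)[of c1 "r + 1"]])
   fix c2 assume c2: "pc c2 = pc c1 + size_of b \<and> reg c2 (r + 1) = eval \<sigma> b \<and> same (r + 1) c1 c2"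
   show "reaches w p 1 c2 (\<lambda>c'. pc c' = pc c + size_of (Bin f a b) \<and>
    reg c' r = eval \<sigma> (Bin f a b) \<and> same r c c')"
   proof (rule reaches_exec[where i = "Arith f r r (r + 1)"
      and c' = "next_pc (c2\<lparr>reg := (reg c2)(r := eval \<sigma> (Bin f a b))\<rparr>)"])
    show "block p (pc c2) [Arith f r r (r + 1)]"
     using Bin.prems(3) c1 c2 by (simp add: add.assoc)
    have "reg c2 r = eval \<sigma> a"
     using c1 c2 by (simp add: same_def)
    then show "exec w (Arith f r r (r + 1)) c2 =
      Some (next_pc (c2\<lparr>reg := (reg c2)(r := eval \<sigma> (Bin f a b))\<rparr>))"
     using c2 ar fit by (simp add: assign_def del: eval.simps)
   qed (use c1 c2 in \<open>simp add: same_def next_pc_def del: eval.simps\<close>)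
  qed (use Bin.prems c1 in \<open>auto simp: same_def\<close>)
 qed (use Bin.prems in auto)
qed

lemma bexp_code_reaches:
 assumes "\<forall>(_, e, e') \<in> set b. small_exp g h e \<and> small_exp g h e'" "bdefined \<sigma> b"
  and "block p (pc c) (bexp_code (pc c) t b)"
  and "\<forall>x<tmp. reg c x = \<sigma> x" "\<forall>x<tmp. \<bar>\<sigma> x\<bar> \<le> big"
 shows "reaches w p (bsize b) c
  (\<lambda>c'. pc c' = (if btrue \<sigma> b then pc c + bsize b else t) \<and> same tmp c c')"
 using assms
proof (induction b arbitrary: c)
 case Nil
 then show ?case
  by (auto intro!: reaches_0 simp: same_def)
next
 case (Cons q b)
 obtain f e e' where q: "q = (f, e, e')"
  by (cases q)
 show ?case
 proof (rule reaches_trans[OF exp_code_reaches[of e \<sigma> p c tmp]])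
  fix c1 assume c1: "pc c1 = pc c + size_of e \<and> reg c1 tmp = eval \<sigma> e \<and> same tmp c c1"
  show "reaches w p (size_of e' + 2 + bsize b) c1
    (\<lambda>c'. pc c' = (if btrue \<sigma> (q # b) then pc c + bsize (q # b) else t) \<and> same tmp c c')"
  proof (rule reaches_trans[OF exp_code_reaches[of e' \<sigma> p c1 "tmp + 1"]])
   fix c2 assume c2: "pc c2 = pc c1 + size_of e' \<and> reg c2 (tmp + 1) = eval \<sigma> e' \<and> same (tmp + 1) c1 c2"
   have bl: "block p (pc c2) [Branch f tmp (tmp + 1) (pc c2 + 2), Jump t]"
    "block p (pc c2 + 2) (bexp_code (pc c2 + 2) t b)"
    using Cons.prems(3) c1 c2 by (simp_all add: q algebra_simps block_Cons block_Nil)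
   show "reaches w p (2 + bsize b) c2
    (\<lambda>c'. pc c' = (if btrue \<sigma> (q # b) then pc c + bsize (q # b) else t) \<and> same tmp c c')"
   proof (cases "holds f (eval \<sigma> e) (eval \<sigma> e')")
    case True
    show ?thesis
    proof (rule reaches_trans[of w p 1 c2 "\<lambda>c'. c' = c2\<lparr>pc := pc c2 + 2\<rparr>" "bsize b"])
     show "reaches w p 1 c2 (\<lambda>c'. c' = c2\<lparr>pc := pc c2 + 2\<rparr>)"
      using bl(1) c1 c2 True by (intro reaches_step) (auto simp: block_Cons same_def)
    next
     fix c3 assume c3: "c3 = c2\<lparr>pc := pc c2 + 2\<rparr>"
     show "reaches w p (bsize b) c3
      (\<lambda>c'. pc c' = (if btrue \<sigma> (q # b) then pc c + bsize (q # b) else t) \<and> same tmp c c')"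
      by (rule reaches_trans[OF Cons.IH[of c3], where t' = 0])
       (use Cons.prems bl True c1 c2 c3 in \<open>auto simp: q same_def algebra_simps intro!: reaches_0\<close>)
    qed simp
   next
    case False
    show ?thesis
    proof (rule reaches_trans[of w p 1 c2 "\<lambda>c'. c' = next_pc c2" 1])
     show "reaches w p 1 c2 (\<lambda>c'. c' = next_pc c2)"
      using bl(1) c1 c2 False by (intro reaches_step) (auto simp: block_Cons same_def)
    next
     fix c3 assume c3: "c3 = next_pc c2"
     show "reaches w p 1 c3
      (\<lambda>c'. pc c' = (if btrue \<sigma> (q # b) then pc c + bsize (q # b) else t) \<and> same tmp c c')"
      using bl(1) c1 c2 c3 False
      by (intro reaches_step) (auto simp: q block_Cons same_def next_pc_def)
    qed simp
   qed
  qed (use Cons.prems c1 in \<open>auto simp: q same_def\<close>)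
 qed (use Cons.prems in \<open>auto simp: q\<close>)
qed

lemma simulates_same: "simulates s c \<Longrightarrow> same tmp c c' \<Longrightarrow> simulates s c'"
 by (auto simp: simulates_def same_def)

lemma simulates_tick [simp]: "simulates (tick t s) c \<longleftrightarrow> simulates s c"
 by (simp add: simulates_def)

lemma simulates_pc [simp]: "simulates s (c\<lparr>pc := i\<rparr>) \<longleftrightarrow> simulates s c"
 by (simp add: simulates_def)

text \<open>The word holds the lowest \<open>w\<close> bits of the input integer; sign extension
  restores the integer because it fits into \<open>w\<close> bits in two's complement.\<close>

lemma get_word_input:
 assumes "\<forall>i<l. m i = mem (init w xs) i" "j < length xs"
 shows "get_word w m j = xs ! j"
proof -
 have "w * j + w \<le> w * length xs"
  using assms(2) by (metis Suc_leI mult_Suc_right add.commute mult_le_mono2)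
 then have "map m [w * j..<w * j + w] = map (\<lambda>i. bit (xs ! j) (i - w * j)) [w * j..<w * j + w]"
 proof (intro map_cong refl)
  fix i assume le: "w * j + w \<le> w * length xs" and "i \<in> set [w * j..<w * j + w]"
  then obtain r where "i = w * j + r" "r < w"
   by (metis atLeastLessThan_iff atLeastLessThan_upt le_Suc_ex nat_add_left_cancel_less)
  with le show "m i = bit (xs ! j) (i - w * j)"
   using assms l w by (simp add: init_def)
 qed
 also have "\<dots> = map (bit (xs ! j)) [0..<w]"
  by (rule nth_equalityI) auto
 finally have "get_word w m j = signed_take_bit (w - 1) (take_bit w (xs ! j))"
  by (simp add: get_word_def horner_sum_bit_eq_take_bit)
 also have "\<dots> = signed_take_bit (w - 1) (xs ! j)"
  using w by (simp add: signed_take_bit_take_bit)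
 also have "\<dots> = xs ! j"
  using fits_var[OF input_le[of "xs ! j"]] assms(2)
  by (auto simp: Defs.fits_def signed_take_bit_int_eq_self)
 finally show ?thesis .
qed

lemma code_reaches_Asg:
 assumes "defined (var s) e" "\<bar>eval (var s) e\<bar> \<le> big"
  and "small g h (Asg x e)" "block p (pc m) (code (pc m) (Asg x e))" "simulates s m"
 shows "reaches w p (size_of e + 1) m (\<lambda>m'. pc m' = pc m + code_size (Asg x e) \<and>
  simulates (set_var x (eval (var s) e) s) m')"
proof (rule reaches_trans[OF exp_code_reaches[of e "var s" p m tmp]])
 fix m1 assume m1: "pc m1 = pc m + size_of e \<and> reg m1 tmp = eval (var s) e \<and> same tmp m m1"
 then have "simulates s m1"
  using assms simulates_same by blast
 with m1 assms show "reaches w p 1 m1 (\<lambda>m'. pc m' = pc m + code_size (Asg x e) \<and>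
   simulates (set_var x (eval (var s) e) s) m')"
  by (intro reaches_exec[where i = "Move x tmp"])
   (simp_all add: assign_def fits_var, simp_all add: next_pc_def simulates_def)
qed (use assms in \<open>auto simp: simulates_def\<close>)

lemma code_reaches_Input:
 assumes "defined (var s) e" "0 \<le> eval (var s) e" "eval (var s) e < int (length xs)"
  and "small g h (Input x e)" "block p (pc m) (code (pc m) (Input x e))" "simulates s m"
 shows "reaches w p (size_of e + 1) m (\<lambda>m'. pc m' = pc m + code_size (Input x e) \<and>
  simulates (set_var x (xs ! nat (eval (var s) e)) s) m')"
proof (rule reaches_trans[OF exp_code_reaches[of e "var s" p m tmp]])
 define j where "j = nat (eval (var s) e)"
 have j: "j < length xs" "eval (var s) e = int j"
  using assms(2,3) by (auto simp: j_def)
 have le: "w * Suc j \<le> l"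
  using l j(1) by (metis Suc_leI mult_le_mono2 le_trans)
 fix m1 assume m1: "pc m1 = pc m + size_of e \<and> reg m1 tmp = eval (var s) e \<and> same tmp m m1"
 then have sim: "simulates s m1"
  using assms simulates_same by blast
 then have get: "get_word w (mem m1) j = xs ! j"
  by (intro get_word_input) (use j in \<open>simp_all add: simulates_def\<close>)
 have bd: "\<bar>xs ! j\<bar> \<le> big"
  using input_le j by simp
 define m2 where "m2 = next_pc ((touch (w * Suc j) m1)\<lparr>reg := (reg m1)(x := xs ! j)\<rparr>)"
 show "reaches w p 1 m1 (\<lambda>m'. pc m' = pc m + code_size (Input x e) \<and>
   simulates (set_var x (xs ! nat (eval (var s) e)) s) m')"
 proof (rule reaches_exec[where i = "Load_Word x tmp" and c' = m2])
  show "block p (pc m1) [Load_Word x tmp]"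
   using assms(5) m1 by simp
  show "exec w (Load_Word x tmp) m1 = Some m2"
   using m1 j get fits_var[OF bd] by (simp add: assign_def m2_def touch_def)
  have "used m2 \<le> max l u"
   using sim le by (simp add: m2_def next_pc_def touch_def simulates_def)
  then show "pc m2 = pc m + code_size (Input x e) \<and>
   simulates (set_var x (xs ! nat (eval (var s) e)) s) m2"
   using sim m1 bd by (simp add: simulates_def m2_def next_pc_def touch_def j)
 qed
qed (use assms in \<open>auto simp: simulates_def\<close>)

lemma code_reaches_Get_Bit:
 assumes "defined (var s) e" "int l \<le> eval (var s) e" "eval (var s) e < int u"
  and "small g h (Get_Bit x e)" "block p (pc m) (code (pc m) (Get_Bit x e))" "simulates s m"
 shows "reaches w p (size_of e + 1) m (\<lambda>m'. pc m' = pc m + code_size (Get_Bit x e) \<and>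
  simulates (set_var x (of_bool (bits s (nat (eval (var s) e)))) s) m')"
proof (rule reaches_trans[OF exp_code_reaches[of e "var s" p m tmp]])
 define j where "j = nat (eval (var s) e)"
 have j: "eval (var s) e = int j" "l \<le> j" "j < u"
  using assms(2,3) by (auto simp: j_def)
 fix m1 assume m1: "pc m1 = pc m + size_of e \<and> reg m1 tmp = eval (var s) e \<and> same tmp m m1"
 then have sim: "simulates s m1"
  using assms simulates_same by blast
 then have get: "mem m1 j = bits s j"
  using j by (simp add: simulates_def)
 have bd: "\<bar>of_bool (bits s j)\<bar> \<le> big"
  using big_ge by simp
 define m2 where "m2 = next_pc ((touch (Suc j) m1)\<lparr>reg := (reg m1)(x := of_bool (bits s j))\<rparr>)"
 show "reaches w p 1 m1 (\<lambda>m'. pc m' = pc m + code_size (Get_Bit x e) \<and>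
   simulates (set_var x (of_bool (bits s (nat (eval (var s) e)))) s) m')"
 proof (rule reaches_exec[where i = "Load_Bit x tmp" and c' = m2])
  show "block p (pc m1) [Load_Bit x tmp]"
   using assms(5) m1 by simp
  show "exec w (Load_Bit x tmp) m1 = Some m2"
   using m1 j get fits_var[OF bd] by (simp add: assign_def m2_def touch_def)
  have "used m2 \<le> max l u"
   using sim j by (simp add: m2_def next_pc_def touch_def simulates_def)
  then show "pc m2 = pc m + code_size (Get_Bit x e) \<and>
   simulates (set_var x (of_bool (bits s (nat (eval (var s) e)))) s) m2"
   using sim m1 bd by (simp add: simulates_def m2_def next_pc_def touch_def j)
 qed
qed (use assms in \<open>auto simp: simulates_def\<close>)

lemma code_reaches_Put_Bit:
 assumes "defined (var s) a" "int l \<le> eval (var s) a" "eval (var s) a < int u" "defined (var s) b"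
  and "small g h (Put_Bit a b)" "block p (pc m) (code (pc m) (Put_Bit a b))" "simulates s m"
 shows "reaches w p (size_of a + size_of b + 1) m (\<lambda>m'. pc m' = pc m + code_size (Put_Bit a b) \<and>
  simulates (s\<lparr>bits := (bits s)(nat (eval (var s) a) := (eval (var s) b \<noteq> 0))\<rparr>) m')"
  (is "reaches _ _ _ _ ?Q")
proof (rule reaches_trans[OF exp_code_reaches[of a "var s" p m tmp]])
 define j where "j = nat (eval (var s) a)"
 have j: "eval (var s) a = int j" "l \<le> j" "j < u"
  using assms(2,3) by (auto simp: j_def)
 fix m1 assume m1: "pc m1 = pc m + size_of a \<and> reg m1 tmp = eval (var s) a \<and> same tmp m m1"
 then have sim1: "simulates s m1"
  using assms simulates_same by blast
 show "reaches w p (size_of b + 1) m1 ?Q"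
 proof (rule reaches_trans[OF exp_code_reaches[of b "var s" p m1 "tmp + 1"]])
  fix m2 assume m2: "pc m2 = pc m1 + size_of b \<and> reg m2 (tmp + 1) = eval (var s) b \<and> same (tmp + 1) m1 m2"
  then have "same tmp m1 m2"
   by (auto simp: same_def)
  then have sim: "simulates s m2"
   using sim1 simulates_same by blast
  have reg: "reg m2 tmp = int j"
   using m1 m2 j by (simp add: same_def)
  define m3 where "m3 = next_pc (touch (Suc j) (m2\<lparr>mem := (mem m2)(j := (eval (var s) b \<noteq> 0))\<rparr>))"
  show "reaches w p 1 m2 ?Q"
  proof (rule reaches_exec[where i = "Store_Bit tmp (tmp + 1)" and c' = m3])
   show "block p (pc m2) [Store_Bit tmp (tmp + 1)]"
    using assms(6) m1 m2 by (simp add: add.assoc)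
   show "exec w (Store_Bit tmp (tmp + 1)) m2 = Some m3"
    using m2 reg by (simp add: m3_def)
   have "used m3 \<le> max l u"
    using sim j by (simp add: m3_def next_pc_def touch_def simulates_def)
   then show "?Q m3"
    using sim m1 m2 j(2) by (simp add: simulates_def m3_def next_pc_def touch_def j(1))
  qed
 qed (use assms m1 sim1 in \<open>auto simp: simulates_def\<close>)
qed (use assms in \<open>auto simp: simulates_def\<close>)

lemma code_reaches_Print:
 assumes "defined (var s) e"
  and "small g h (Print e)" "block p (pc m) (code (pc m) (Print e))" "simulates s m"
 shows "reaches w p (size_of e + 1) m (\<lambda>m'. pc m' = pc m + code_size (Print e) \<and>
  simulates (s\<lparr>outs := outs s @ [eval (var s) e]\<rparr>) m')"
proof (rule reaches_trans[OF exp_code_reaches[of e "var s" p m tmp]])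
 fix m1 assume m1: "pc m1 = pc m + size_of e \<and> reg m1 tmp = eval (var s) e \<and> same tmp m m1"
 then have "simulates s m1"
  using assms simulates_same by blast
 with m1 assms show "reaches w p 1 m1 (\<lambda>m'. pc m' = pc m + code_size (Print e) \<and>
   simulates (s\<lparr>outs := outs s @ [eval (var s) e]\<rparr>) m')"
  by (intro reaches_exec[where i = "Output tmp"])
   (simp_all, simp_all add: next_pc_def simulates_def)
qed (use assms in \<open>auto simp: simulates_def\<close>)

text \<open>The inequality between the clocks is carried through the induction because the number of
  steps is a truncated difference.\<close>

lemma code_reaches:
 assumes "run c s s'" "small g h c" "block p (pc m) (code (pc m) c)" "simulates s m"
 shows "clock s \<le> clock s' \<and> reaches w p (clock s' - clock s) m
  (\<lambda>m'. pc m' = pc m + code_size c \<and> simulates s' m')"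
 using assms
proof (induction arbitrary: m rule: run.induct)
 case (Skip s)
 then show ?case
  by (auto intro: reaches_0)
next
 case (Asg s e x)
 from code_reaches_Asg[OF Asg.hyps Asg.prems] show ?case
  by simp
next
 case (Input s e x)
 from code_reaches_Input[OF Input.hyps Input.prems] show ?case
  by simp
next
 case (Get_Bit s e x)
 from code_reaches_Get_Bit[OF Get_Bit.hyps Get_Bit.prems] show ?case
  by simp
next
 case (Put_Bit s a b)
 from code_reaches_Put_Bit[OF Put_Bit.hyps Put_Bit.prems] show ?case
  by simp
next
 case (Print s e)
 from code_reaches_Print[OF Print.hyps Print.prems] show ?case
  by simp
next
 case (Seq c s s' d s'')
 have 1: "clock s \<le> clock s' \<and> reaches w p (clock s' - clock s) m
  (\<lambda>m'. pc m' = pc m + code_size c \<and> simulates s' m')"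
  using Seq.IH(1)[of m] Seq.prems by simp
 have 2: "clock s' \<le> clock s'' \<and> reaches w p (clock s'' - clock s') m'
  (\<lambda>m''. pc m'' = pc m' + code_size d \<and> simulates s'' m'')"
  if "pc m' = pc m + code_size c \<and> simulates s' m'" for m'
  using Seq.IH(2)[of m'] that Seq.prems by simp
 have 3: "clock s' \<le> clock s''"
  using reaches_ex[OF conjunct2[OF 1]] 2 by blast
 have "reaches w p (clock s'' - clock s) m
  (\<lambda>m'. pc m' = pc m + code_size (c ;; d) \<and> simulates s'' m')"
 proof (rule reaches_trans[OF conjunct2[OF 1]])
  fix m' assume m': "pc m' = pc m + code_size c \<and> simulates s' m'"
  show "reaches w p (clock s'' - clock s') m'
   (\<lambda>m'. pc m' = pc m + code_size (c ;; d) \<and> simulates s'' m')"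
   using 2[OF m'] m' by (simp add: add.assoc)
 qed (use 1 3 in simp)
 with 1 3 show ?case
  by simp
next
 case (If_True s b c s' d)
 let ?t = "pc m + bsize b + code_size c + 1"
 have 1: "reaches w p (bsize b) m (\<lambda>m'. pc m' = pc m + bsize b \<and> same tmp m m')"
  using bexp_code_reaches[of b "var s" p m ?t] If_True.hyps(1,2) If_True.prems by (auto simp: simulates_def add.assoc)
 have 2: "clock s + bsize b + 1 \<le> clock s' \<and> reaches w p (clock s' - (clock s + bsize b + 1)) m'
  (\<lambda>m''. pc m'' = pc m' + code_size c \<and> simulates s' m'')"
  if "pc m' = pc m + bsize b \<and> same tmp m m'" for m'
  using If_True.IH[of m'] that If_True.prems simulates_same[OF If_True.prems(3), of m'] by (simp add: add.assoc)
 have 3: "clock s + bsize b + 1 \<le> clock s'"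
  using reaches_ex[OF 1] 2 by blast
 have "reaches w p (clock s' - clock s) m
  (\<lambda>m'. pc m' = pc m + code_size (If b c d) \<and> simulates s' m')"
 proof (rule reaches_trans[OF 1])
  fix m' assume m': "pc m' = pc m + bsize b \<and> same tmp m m'"
  show "reaches w p (clock s' - clock s - bsize b) m'
   (\<lambda>m'. pc m' = pc m + code_size (If b c d) \<and> simulates s' m')"
  \<comment> \<open>The jump over the other branch is paid by the extra unit charged together with
    the condition.\<close>
  proof (rule reaches_trans[OF conjunct2[OF 2[OF m']], where t' = 1])
   fix m'' assume m'': "pc m'' = pc m' + code_size c \<and> simulates s' m''"
   show "reaches w p 1 m'' (\<lambda>m'. pc m' = pc m + code_size (If b c d) \<and> simulates s' m')"
    using m' m'' If_True.prems by (intro reaches_step) (auto simp: block_Cons add.assoc)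
  qed (use 3 in simp)
 qed (use 3 in simp)
 with 3 show ?case
  by simp
next
 case (If_False s b d s' c)
 let ?t = "pc m + bsize b + code_size c + 1"
 have 1: "reaches w p (bsize b) m (\<lambda>m'. pc m' = ?t \<and> same tmp m m')"
  using bexp_code_reaches[of b "var s" p m ?t] If_False.hyps(1,2) If_False.prems by (auto simp: simulates_def add.assoc)
 have 2: "clock s + bsize b + 1 \<le> clock s' \<and> reaches w p (clock s' - (clock s + bsize b + 1)) m'
  (\<lambda>m''. pc m'' = pc m' + code_size d \<and> simulates s' m'')"
  if "pc m' = ?t \<and> same tmp m m'" for m'
  using If_False.IH[of m'] that If_False.prems simulates_same[OF If_False.prems(3), of m'] by (simp add: add.assoc block_Cons)
 have 3: "clock s + bsize b + 1 \<le> clock s'"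
  using reaches_ex[OF 1] 2 by blast
 have "reaches w p (clock s' - clock s) m
  (\<lambda>m'. pc m' = pc m + code_size (If b c d) \<and> simulates s' m')"
 proof (rule reaches_trans[OF 1])
  fix m' assume m': "pc m' = ?t \<and> same tmp m m'"
  show "reaches w p (clock s' - (clock s + bsize b + 1)) m'
   (\<lambda>m'. pc m' = pc m + code_size (If b c d) \<and> simulates s' m')"
   using 2[OF m'] m' by (simp add: add.assoc)
 qed (use 3 in simp)
 with 3 show ?case
  by simp
next
 case (While_True s b c s' s'')
 let ?t = "pc m + bsize b + code_size c + 1"
 have 1: "reaches w p (bsize b) m (\<lambda>m'. pc m' = pc m + bsize b \<and> same tmp m m')"
  using bexp_code_reaches[of b "var s" p m ?t] While_True.hyps(1,2) While_True.prems by (auto simp: simulates_def add.assoc)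
 have 2: "clock s + bsize b + 1 \<le> clock s' \<and> reaches w p (clock s' - (clock s + bsize b + 1)) m'
  (\<lambda>m''. pc m'' = pc m' + code_size c \<and> simulates s' m'')"
  if "pc m' = pc m + bsize b \<and> same tmp m m'" for m'
  using While_True.IH(1)[of m'] that While_True.prems simulates_same[OF While_True.prems(3), of m'] by (simp add: add.assoc)
 have 3: "clock s + bsize b + 1 \<le> clock s'"
  using reaches_ex[OF 1] 2 by blast
 have 4: "clock s' \<le> clock s'' \<and> reaches w p (clock s'' - clock s') m'
  (\<lambda>m''. pc m'' = pc m' + code_size (While b c) \<and> simulates s'' m'')"
  if "pc m' = pc m \<and> simulates s' m'" for m'
  using While_True.IH(2)[of m'] that While_True.prems by metis
 have 5: "reaches w p (clock s' - clock s) m (\<lambda>m'. pc m' = pc m \<and> simulates s' m')"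
 proof (rule reaches_trans[OF 1])
  fix m' assume m': "pc m' = pc m + bsize b \<and> same tmp m m'"
  show "reaches w p (clock s' - clock s - bsize b) m' (\<lambda>m'. pc m' = pc m \<and> simulates s' m')"
  proof (rule reaches_trans[OF conjunct2[OF 2[OF m']], where t' = 1])
   fix m'' assume m'': "pc m'' = pc m' + code_size c \<and> simulates s' m''"
   show "reaches w p 1 m'' (\<lambda>m'. pc m' = pc m \<and> simulates s' m')"
    using m' m'' While_True.prems by (intro reaches_step) (auto simp: block_Cons add.assoc)
  qed (use 3 in simp)
 qed (use 3 in simp)
 have 6: "clock s' \<le> clock s''"
  using reaches_ex[OF 5] 4 by blast
 have "reaches w p (clock s'' - clock s) m
  (\<lambda>m'. pc m' = pc m + code_size (While b c) \<and> simulates s'' m')"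
 proof (rule reaches_trans[OF 5])
  fix m' assume m': "pc m' = pc m \<and> simulates s' m'"
  show "reaches w p (clock s'' - clock s') m'
   (\<lambda>m'. pc m' = pc m + code_size (While b c) \<and> simulates s'' m')"
   using 4[OF m'] m' by metis
 qed (use 3 6 in linarith)
 with 3 6 show ?case
  by linarith
next
 case (While_False s b c)
 let ?t = "pc m + bsize b + code_size c + 1"
 have "reaches w p (bsize b) m (\<lambda>m'. pc m' = ?t \<and> same tmp m m')"
  using bexp_code_reaches[of b "var s" p m ?t] While_False.hyps(1,2) While_False.prems by (auto simp: simulates_def add.assoc)
 then have "reaches w p (bsize b + 1) m
  (\<lambda>m'. pc m' = pc m + code_size (While b c) \<and> simulates s m')"
  using simulates_same[OF While_False.prems(3)] unfolding reaches_def
  by (metis code_size.simps(9) add.assoc trans_le_add1)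
 then show ?case
  by simp
qed

lemma total_halts:
 assumes "total c Q \<lparr>var = \<lambda>_. 0, bits = mem (init w xs), outs = [], clock = 0\<rparr>" "small g h c"
 shows "\<exists>t m s. halts w (code 0 c @ [Halt]) xs t m \<and> Q s \<and> out m = outs s \<and> t \<le> clock s \<and>
  used m \<le> max l u"
proof -
 let ?s = "\<lparr>var = \<lambda>_. 0, bits = mem (init w xs), outs = [], clock = 0\<rparr>"
 let ?p = "code 0 c @ [Halt]"
 obtain s where s: "run c ?s s" "Q s"
  using assms(1) unfolding total_def by blast
 have sim: "simulates ?s (init w xs)"
  using l big_ge by (auto simp: simulates_def init_def)
 have "block ?p 0 (code 0 c @ [Halt])"
  unfolding block_def by (intro exI[of _ "[]"]) simp
 then have bl: "block ?p (pc (init w xs)) (code (pc (init w xs)) c)"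
  by (simp add: init_def)
 from code_reaches[OF s(1) assms(2) bl sim]
 obtain t m where "t \<le> clock s" "steps w ?p t (init w xs) = Some m"
   "pc m = code_size c" "simulates s m"
  unfolding reaches_def by (auto simp: init_def)
 then show ?thesis
  using s(2) by (intro exI[of _ t] exI[of _ m] exI[of _ s])
   (auto simp: halts_def steps_def simulates_def nth_append)
qed

end

section \<open>The program\<close>

abbreviation Plus (infixl "+." 65) where "a +. b \<equiv> Bin Add a b"
abbreviation Minus (infixl "-." 65) where "a -. b \<equiv> Bin Sub a b"
abbreviation Times (infixl "*." 70) where "a *. b \<equiv> Bin Mul a b"
abbreviation Quot (infixl "'/." 70) where "a /. b \<equiv> Bin Div a b"
abbreviation Rem (infixl "%." 70) where "a %. b \<equiv> Bin arith_op.Mod a b"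
abbreviation Lt (infix "<." 50) where "a <. b \<equiv> (Less_Than, a, b)"
abbreviation Eq (infix "=." 50) where "a =. b \<equiv> (Equal, a, b)"

abbreviation (input) "vn \<equiv> 0 :: nat"
abbreviation (input) "vk \<equiv> 1 :: nat"
abbreviation (input) "vK \<equiv> 2 :: nat"
abbreviation (input) "vH \<equiv> 3 :: nat"
abbreviation (input) "vW \<equiv> 4 :: nat"
abbreviation (input) "vX \<equiv> 5 :: nat"
abbreviation (input) "vT \<equiv> 6 :: nat"
abbreviation (input) "vbase \<equiv> 7 :: nat"
abbreviation (input) "vj \<equiv> 8 :: nat"
abbreviation (input) "vc \<equiv> 9 :: nat"
abbreviation (input) "vd \<equiv> 10 :: nat"
abbreviation (input) "ve \<equiv> 11 :: nat"
abbreviation (input) "vx \<equiv> 12 :: nat"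
abbreviation (input) "vok \<equiv> 13 :: nat"
abbreviation (input) "vi \<equiv> 14 :: nat"
abbreviation (input) "vm \<equiv> 15 :: nat"
abbreviation (input) "va \<equiv> 16 :: nat"
abbreviation (input) "vb \<equiv> 17 :: nat"
abbreviation (input) "vr \<equiv> 18 :: nat"
abbreviation (input) "vs \<equiv> 19 :: nat"
abbreviation (input) "vlo \<equiv> 20 :: nat"
abbreviation (input) "vA \<equiv> 21 :: nat"
abbreviation (input) "vhi \<equiv> 22 :: nat"
abbreviation (input) "vq \<equiv> 23 :: nat"
abbreviation (input) "vg \<equiv> 24 :: nat"
abbreviation (input) "vh \<equiv> 25 :: nat"
abbreviation (input) "vx1 \<equiv> 26 :: nat"
abbreviation (input) "vy1 \<equiv> 27 :: nat"
abbreviation (input) "vpx \<equiv> 28 :: nat"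
abbreviation (input) "vpy \<equiv> 29 :: nat"
abbreviation (input) "vz \<equiv> 30 :: nat"
abbreviation (input) "vst \<equiv> 31 :: nat"
abbreviation (input) "ve0 \<equiv> 32 :: nat"
abbreviation (input) "vadr \<equiv> 33 :: nat"
abbreviation (input) "vt \<equiv> 34 :: nat"
abbreviation (input) "vp \<equiv> 35 :: nat"

definition form_exp :: "nat \<Rightarrow> nat \<Rightarrow> exp" where
 "form_exp x y = V x *. V x +. V vg *. V x *. V y +. V vh *. V y *. V y"

lemma form_exp_simps [simp]:
 "eval \<sigma> (form_exp x y) = form (\<sigma> vg) (\<sigma> vh) (\<sigma> x) (\<sigma> y)"
 "defined \<sigma> (form_exp x y)" "size_of (form_exp x y) = 15"
 by (simp_all add: form_exp_def form_def)

abbreviation incr :: "nat \<Rightarrow> com" where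
 "incr x \<equiv> Asg x (V x +. N 1)"

text \<open>Leaves in \<open>ve\<close> the least divisor of \<open>vm\<close> that is at least 2;
  \<open>vm\<close> is prime iff this is \<open>vm\<close> itself.\<close>

definition trial_division :: com where
 "trial_division = Asg ve (N 2) ;; While [N 0 <. V vm %. V ve] (incr ve)"

definition read_poly :: com where
 "read_poly = Input va (N 2 +. N 2 *. V vi) ;; Input vb (N 3 +. N 2 *. V vi)"

definition find_bound :: com where
 "find_bound =
  Asg vK (N 8) ;; If [V vK <. V vk] (Asg vK (V vk)) Skip ;; Asg vj (N 2) ;;
  While [V vj <. N 2 +. N 2 *. V vk]
   (Input vc (V vj) ;; If [V vc <. N 0] (Asg vc (N 0 -. V vc)) Skip ;;
    If [V vK <. V vc] (Asg vK (V vc)) Skip ;; incr vj)"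

definition power_16 :: com where
 "power_16 = Asg vp (V vH +. N 1) ;; Asg vp (V vp *. V vp) ;; Asg vp (V vp *. V vp) ;;
  Asg vp (V vp *. V vp) ;; Asg vp (V vp *. V vp)"

definition find_root :: com where
 "find_root = Asg vH (N 0) ;; power_16 ;; While [V vp <. V vn +. N 1] (incr vH ;; power_16)"

text \<open>The exit test multiplies by \<open>d\<close> whether or not \<open>d\<close> is prime;
  on leaving the loop it yields \<open>H < W * d\<close>, from which the size of \<open>d\<close> is
  estimated.\<close>

definition find_wheel :: com where
 "find_wheel = Asg vW (N 8) ;; Asg vd (N 3) ;;
  While [V vW *. V vd <. V vH +. N 1]
   (Asg vm (V vd) ;; trial_division ;; If [V ve =. V vd] (Asg vW (V vW *. V vd)) Skip ;; incr vd)"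

definition naive_test :: com where
 "naive_test = Asg vok (N 1) ;; Asg vi (N 0) ;;
  While [V vi <. V vk]
   (read_poly ;; Asg vm (V va *. V vx +. V vb) ;;
    If [N 1 <. V vm, V vm <. V vn +. N 1]
     (trial_division ;; If [V ve =. V vm] Skip (Asg vok (N 0))) (Asg vok (N 0)) ;;
    incr vi)"

definition naive_search :: com where
 "naive_search = Asg vx (N 0 -. V vK) ;;
  While [V vx <. V vX +. N 1] (naive_test ;; If [V vok =. N 1] (Print (V vx)) Skip ;; incr vx)"

text \<open>Coprimality is decided by trying every common divisor up to \<open>W\<close>, which is
  affordable because \<open>W^2\<close> is at most the length of a segment.\<close>

definition residue_test :: com where
 "residue_test = Asg vok (N 1) ;; Asg vi (N 0) ;;
  While [V vi <. V vk]
   (read_poly ;; Asg vm (V va *. V vr +. V vb) ;; Asg ve (N 2) ;;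
    While [V ve <. V vW +. N 1]
     (If [V vW %. V ve =. N 0, V vm %. V ve =. N 0] (Asg vok (N 0)) Skip ;; incr ve) ;;
    incr vi)"

definition clear_bits :: com where
 "clear_bits = Asg vj (N 0) ;;
  While [V vj <. V vk *. V vT] (Put_Bit (V vbase +. V vj) (N 0) ;; incr vj)"

definition flip_column :: com where
 "flip_column = While [N (- 1) <. V vz, V vlo -. N 1 <. form_exp vpx vz]
  (If [(form_exp vpx vz -. V vlo) %. V vA =. N 0]
    (Asg vadr (V vq +. (form_exp vpx vz -. V vlo) /. V vA) ;; Get_Bit vt (V vadr) ;;
    Put_Bit (V vadr) (N 1 -. V vt)) Skip ;;
   Asg vz (V vz -. V vW))"

definition descend :: com where
 "descend = While [N (- 1) <. V vpy, V vhi -. N 1 <. form_exp vpx vpy] (Asg vpy (V vpy -. V vW))"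

definition ascend :: com where
 "ascend = While [V vpy *. V vpy <. V vhi] (Asg vpy (V vpy +. V vW))"

text \<open>The boundary where the form reaches \<open>vhi\<close> is followed as a descending
  staircase: \<open>vpy\<close> is not reset between columns, so all calls of \<open>descend\<close>
  together take about as many steps as there are rows.\<close>

definition flip_class :: com where
 "flip_class = Asg vpy (V vy1) ;; ascend ;; Asg vpx (V vx1) ;;
  While [V vpx *. V vpx <. V vhi]
   (descend ;; Asg vz (V vpy) ;; flip_column ;; Asg vpx (V vpx +. V vW))"

definition flip_points :: com where
 "flip_points = Asg vx1 (N 0) ;;
  While [V vx1 <. V vW]
   (Asg vy1 (N 0) ;;
    While [V vy1 <. V vW]
     (If [(form_exp vx1 vy1 -. V vlo) %. V vW =. N 0] flip_class Skip ;; incr vy1) ;;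
    incr vx1)"

definition clear_multiples :: com where
 "clear_multiples = While [V vd *. V vd *. V ve <. V vhi]
  (If [V vlo -. N 1 <. V vd *. V vd *. V ve, (V vd *. V vd *. V ve -. V vlo) %. V vA =. N 0]
    (Put_Bit (V vq +. (V vd *. V vd *. V ve -. V vlo) /. V vA) (N 0)) Skip ;;
   Asg ve (V ve +. V vst))"

text \<open>Instead of inverting \<open>d^2\<close> modulo the stride, all classes of cofactors are
  tried. This costs \<open>W\<close> trials only for \<open>d \<le> W\<close>, since beyond
  \<open>W\<close> the stride is 1.\<close>

definition clear_square :: com where
 "clear_square = Asg ve0 (N 0) ;;
  While [V ve0 <. V vst]
   (If [(V vd *. V vd *. V ve0 -. V vlo) %. V vst =. N 0]
     (Asg ve (V ve0 +. V vst *. ((V vlo /. (V vd *. V vd)) /. V vst)) ;; clear_multiples) Skip ;;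
    incr ve0)"

definition clear_squareful :: com where
 "clear_squareful = Asg vd (N 2) ;;
  While [V vd *. V vd <. V vhi]
   (If [V vd <. V vW +. N 1] (Asg vst (V vW)) (Asg vst (N 1)) ;; clear_square ;; incr vd)"

definition sieve_poly :: com where
 "sieve_poly = read_poly ;; Asg vlo (V va *. V vs +. V vb) ;; Asg vA (V va *. V vW) ;;
  Asg vhi (V vlo +. V vA *. V vT) ;; Asg vq (V vbase +. V vi *. V vT) ;;
  If [V vlo %. N 8 =. N 7] (Asg vg (N 4) ;; Asg vh (N 2))
   (Asg vg (N 0) ;; If [V vlo %. N 8 =. N 3] (Asg vh (N 2)) (Asg vh (N 4))) ;;
  flip_points ;; clear_squareful"

definition report :: com where
 "report = Asg vj (N 0) ;;
  While [V vj <. V vT]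
   (Asg vx (V vs +. V vW *. V vj) ;; Asg vok (N 1) ;; Asg vi (N 0) ;;
    While [V vi <. V vk]
     (read_poly ;; Get_Bit vt (V vbase +. V vi *. V vT +. V vj) ;;
     If [V vt =. N 1, V va *. V vx +. V vb <. V vn +. N 1] Skip (Asg vok (N 0)) ;; incr vi) ;;
    If [V vok =. N 1] (Print (V vx)) Skip ;; incr vj)"

definition sieve_segment :: com where
 "sieve_segment = clear_bits ;; Asg vi (N 0) ;; While [V vi <. V vk] (sieve_poly ;; incr vi) ;; report"

definition sieve_residue :: com where
 "sieve_residue = Asg vs (V vr +. V vW *. V vH) ;;
  While [V vs <. V vn +. V vK +. N 1] (sieve_segment ;; Asg vs (V vs +. V vW *. V vT))"

text \<open>The constant 1700 places the bit array behind the input: there are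
  \<open>2 * k + 2\<close> words of \<open>100 * M\<close> bits, where \<open>M\<close> is the
  largest binary length of an input, and \<open>M \<le> 17 * H\<close> whenever the sieve
  runs.\<close>

definition sieve :: com where
 "sieve = Asg vT (V vH *. V vH) ;; Asg vT (V vT *. V vT) ;; Asg vT (V vT *. V vT) ;;
  Asg vbase (N 1700 *. V vH *. (N 2 *. V vk +. N 2)) ;; Asg vr (N 0) ;;
  While [V vr <. V vW]
   (residue_test ;; If [V vok =. N 1] sieve_residue Skip ;; incr vr)"

text \<open>\<open>vW = 0\<close> marks an \<open>n\<close> too small against the pattern, where
  trial division is the entire search. Otherwise trial division stops at \<open>W * H + W\<close>,
  and the sieve starts each class \<open>r\<close> at \<open>r + W * H\<close>, where all values
  exceed \<open>W\<close>.\<close>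

definition main :: com where
 "main = Input vn (N 0) ;; Input vk (N 1) ;; find_bound ;; find_root ;;
  If [V vH <. V vK] (Asg vW (N 0) ;; Asg vX (V vn +. V vK))
   (find_wheel ;; Asg vX (V vW *. V vH +. V vW)) ;;
  naive_search ;; If [N 0 <. V vW] sieve Skip"

lemmas program_defs =
 trial_division_def read_poly_def find_bound_def power_16_def find_root_def find_wheel_def
 naive_test_def naive_search_def residue_test_def clear_bits_def flip_column_def descend_def
 ascend_def flip_class_def flip_points_def clear_multiples_def clear_square_def clear_squareful_def sieve_poly_def
 report_def sieve_segment_def sieve_residue_def sieve_def main_def form_exp_def

lemma floorlog_small: "floorlog 2 0 = 0" "floorlog 2 (Suc 0) = 1" "floorlog 2 2 = 2" "floorlog 2 3 = 2"
 "floorlog 2 4 = 3" "floorlog 2 7 = 3" "floorlog 2 8 = 4" "floorlog 2 1700 = 11"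
 by (simp_all add: compute_floorlog)

section \<open>Flipping bits\<close>

text \<open>Indexed by points rather than by addresses: distinct points may fall on the same bit,
  and what survives is the parity of their number.\<close>

definition toggled :: "(nat \<Rightarrow> bool) \<Rightarrow> 'a set \<Rightarrow> ('a \<Rightarrow> nat) \<Rightarrow> nat \<Rightarrow> bool" where
 "toggled m S f i \<longleftrightarrow> m i \<noteq> odd (card {p \<in> S. f p = i})"

lemma toggled_empty [simp]: "toggled m {} f = m"
 by (auto simp: toggled_def)

lemma toggled_Un:
 assumes "finite S" "finite S'" "S \<inter> S' = {}"
 shows "toggled (toggled m S f) S' f = toggled m (S \<union> S') f"
proof
 fix i
 have "{p \<in> S \<union> S'. f p = i} = {p \<in> S. f p = i} \<union> {p \<in> S'. f p = i}"
  by blast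
 moreover have "card ({p \<in> S. f p = i} \<union> {p \<in> S'. f p = i}) = card {p \<in> S. f p = i} + card {p \<in> S'. f p = i}"
  using assms by (intro card_Un_disjoint) auto
 ultimately show "toggled (toggled m S f) S' f i = toggled m (S \<union> S') f i"
  by (auto simp: toggled_def)
qed

lemma toggled_insert:
 assumes "finite S" "p \<notin> S"
 shows "toggled m (insert p S) f = (toggled m S f)(f p := \<not> toggled m S f (f p))"
proof
 fix i
 have "{q \<in> {p}. f q = i} = (if f p = i then {p} else {})"
  by auto
 then have "toggled (toggled m S f) {p} f i = ((toggled m S f)(f p := \<not> toggled m S f (f p))) i"
  by (auto simp: toggled_def)
 moreover have "toggled (toggled m S f) {p} f = toggled m (insert p S) f"
  using toggled_Un[of S "{p}" m f] assms by simp
 ultimately show "toggled m (insert p S) f i = ((toggled m S f)(f p := \<not> toggled m S f (f p))) i"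
  by simp
qed

definition points :: "int \<Rightarrow> int \<Rightarrow> int \<Rightarrow> int \<Rightarrow> (int \<times> int) set" where
 "points \<gamma> \<epsilon> lo hi = {(x, y). 0 \<le> x \<and> 0 \<le> y \<and> lo \<le> form \<gamma> \<epsilon> x y \<and> form \<gamma> \<epsilon> x y < hi}"

lemma form_mono:
 assumes "0 \<le> \<gamma>" "0 \<le> \<epsilon>" "0 \<le> x" "0 \<le> y" "x \<le> x'" "y \<le> y'"
 shows "form \<gamma> \<epsilon> x y \<le> form \<gamma> \<epsilon> x' y'"
 unfolding form_def using assms by (intro add_mono mult_mono mult_nonneg_nonneg) auto

lemma form_ge:
 assumes "0 \<le> \<gamma>" "1 \<le> \<epsilon>" "0 \<le> x" "0 \<le> y"
 shows "x * x \<le> form \<gamma> \<epsilon> x y" "y * y \<le> form \<gamma> \<epsilon> x y" "x \<le> form \<gamma> \<epsilon> x y" "y \<le> form \<gamma> \<epsilon> x y"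
proof -
 have "0 \<le> \<gamma> * x * y" "0 \<le> x * x" "0 \<le> y * y" "1 * (y * y) \<le> \<epsilon> * (y * y)"
  using assms by (simp, simp, simp, intro mult_right_mono, auto)
 moreover have "x \<le> x * x" "y \<le> y * y"
  using assms by (auto simp: mult_le_cancel_left1 mult_le_cancel_right1)
 ultimately show "x * x \<le> form \<gamma> \<epsilon> x y" "y * y \<le> form \<gamma> \<epsilon> x y" "x \<le> form \<gamma> \<epsilon> x y" "y \<le> form \<gamma> \<epsilon> x y"
  unfolding form_def mult.assoc[of \<epsilon>] by linarith+
qed

lemma finite_points:
 assumes "0 \<le> \<gamma>" "1 \<le> \<epsilon>"
 shows "finite (points \<gamma> \<epsilon> lo hi)"
proof (rule finite_subset)
 show "points \<gamma> \<epsilon> lo hi \<subseteq> {0..hi} \<times> {0..hi}"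
  using form_ge(3,4)[OF assms] by (fastforce simp: points_def)
qed simp

section \<open>Sieving one polynomial on one segment\<close>

lemma mod_eq_le:
 fixes W y z :: int
 assumes "0 < W" "y mod W = z mod W" "z - W < y"
 shows "z \<le> y"
proof -
 obtain t where t: "y - z = W * t"
  using assms(2) by (metis dvdE mod_eq_dvd_iff)
 then have "W * - 1 < W * t"
  using assms(3) by simp
 then have "- 1 < t"
  using assms(1) mult_less_cancel_left_pos by blast
 then have "0 \<le> W * t"
  using assms(1) by simp
 with t show ?thesis
  by linarith
qed

lemma int_div_lessI: "0 < (a :: int) \<Longrightarrow> x < t * a \<Longrightarrow> x div a < t"
proof -
 assume a: "0 < a" "x < t * a"
 have "x div a * a = x - x mod a"
  by (simp add: minus_mod_eq_div_mult)
 then have "x div a * a < t * a"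
  using a pos_mod_sign[OF a(1), of x] by linarith
 then show ?thesis
  using a(1) mult_less_cancel_right_pos by blast
qed

lemma int_le_divI: "0 < (a :: int) \<Longrightarrow> t * a \<le> x \<Longrightarrow> t \<le> x div a"
 using zdiv_mono1[of "t * a" x a] by simp

lemmas (in limits) total_intros =
 total_Seq total_Asg total_Get_Bit total_Put_Bit total_If total_Skip total_Input total_Print

text \<open>The numbers \<open>lo + A * j\<close> are the values of one polynomial along a
  progression of arguments with step \<open>W\<close>, so \<open>A\<close> is the leading
  coefficient times \<open>W\<close>. \<open>R\<close> bounds the square root of \<open>hi\<close>;
  only the analysis uses it, the program compares squares with \<open>hi\<close>.\<close>

locale segment = limits +
 fixes W lo hi A q T \<gamma> \<epsilon> R :: int
 assumes W: "0 < W" and A: "0 < A" "W dvd A" and form: "0 \<le> \<gamma>" "1 \<le> \<epsilon>"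
  and hi: "hi = lo + A * T" "0 \<le> T" and lo: "0 < lo" and R: "hi \<le> R * R" "0 \<le> R"
  and address: "int l \<le> q" "q + T \<le> int u"
  and big: "hi + 2 * W \<le> big" "int u \<le> big" "R + 2 * W \<le> big"
begin

definition env :: "state \<Rightarrow> bool" where
 "env s \<longleftrightarrow> var s vW = W \<and> var s vlo = lo \<and> var s vhi = hi \<and> var s vA = A \<and> var s vq = q \<and>
  var s vg = \<gamma> \<and> var s vh = \<epsilon>"

lemma envD: "env s \<Longrightarrow> var s vW = W" "env s \<Longrightarrow> var s vlo = lo" "env s \<Longrightarrow> var s vhi = hi"
 "env s \<Longrightarrow> var s vA = A" "env s \<Longrightarrow> var s vq = q" "env s \<Longrightarrow> var s vg = \<gamma>" "env s \<Longrightarrow> var s vh = \<epsilon>"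
 by (simp_all add: env_def)

abbreviation "form' \<equiv> form \<gamma> \<epsilon>"

abbreviation "pts \<equiv> points \<gamma> \<epsilon> lo hi"

definition slot :: "int \<Rightarrow> nat" where
 "slot v = nat (q + (v - lo) div A)"

definition slot_of :: "int \<times> int \<Rightarrow> nat" where
 "slot_of p = slot (form' (fst p) (snd p))"

definition hits :: "int \<times> int \<Rightarrow> bool" where
 "hits p \<longleftrightarrow> A dvd form' (fst p) (snd p) - lo"

lemma finite_pts [simp]: "finite {p \<in> pts. Q p}"
 using finite_points[OF form, of lo hi] by simp

lemma address_bounds:
 assumes "lo \<le> v" "v < hi"
 shows "int l \<le> q + (v - lo) div A" "q + (v - lo) div A < int u"
proof -
 have "0 \<le> (v - lo) div A"
  using assms A by (simp add: pos_imp_zdiv_nonneg_iff)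
 moreover have "(v - lo) div A < T"
  using assms A hi by (intro int_div_lessI) (auto simp: mult.commute)
 ultimately show "int l \<le> q + (v - lo) div A" "q + (v - lo) div A < int u"
  using address by linarith+
qed

text \<open>The form increases in \<open>y\<close>, so the points of a column fill an interval, and
  the downward sweep from a height below \<open>hi\<close> may stop at the first value under
  \<open>lo\<close>.\<close>

lemma total_flip_column:
 assumes env: "env s" and x: "var s vpx = x" "0 \<le> x" and z: "var s vz = z" "- W \<le> z" "z \<le> R + W"
  and top: "0 \<le> z \<Longrightarrow> form' x z < hi"
 shows "total flip_column (\<lambda>s'.
  bits s' = toggled (bits s) {p \<in> pts. hits p \<and> fst p = x \<and> snd p mod W = z mod W \<and> snd p \<le> z} slot_of \<and>
  clock s' \<le> clock s + 200 * card {p \<in> pts. fst p = x \<and> snd p mod W = z mod W \<and> snd p \<le> z} + 200) s"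
 unfolding flip_column_def
proof (rule total_While[where
   I = "\<lambda>s'. var s' vz mod W = z mod W \<and> var s' vz \<le> z \<and> - W \<le> var s' vz \<and>
    bits s' = toggled (bits s)
     {p \<in> pts. hits p \<and> fst p = x \<and> snd p mod W = z mod W \<and> snd p \<le> z \<and> var s' vz < snd p} slot_of \<and>
    clock s' \<le> clock s + 200 * card {p \<in> pts. fst p = x \<and> snd p mod W = z mod W \<and> snd p \<le> z \<and> var s' vz < snd p}"
   and m = "\<lambda>s'. nat (var s' vz + W)"], goal_cases)
 case 1
 have "{p \<in> pts. hits p \<and> fst p = x \<and> snd p mod W = z mod W \<and> snd p \<le> z \<and> z < snd p} = {}"
  by auto
 then have "toggled (bits s) {p \<in> pts. hits p \<and> fst p = x \<and> snd p mod W = z mod W \<and> snd p \<le> z \<and> z < snd p} slot_of = bits s"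
  by (simp only: toggled_empty)
 then show ?case
  using z W by simp
next
 case (2 s')
 define y where "y = var s' vz"
 have e: "env s'" "var s' vpx = x"
  using 2(2) env x by (auto simp: frame_def env_def)
 note e' = envD[OF e(1)]
 have y: "0 \<le> y" "lo \<le> form' x y" "y mod W = z mod W" "y \<le> z" "- W \<le> y"
  using 2(1,3) e e' by (auto simp: y_def)
 have "form' x y \<le> form' x z"
  using form y x by (intro form_mono) auto
 then have lt: "form' x y < hi"
  using top y by linarith
 have pt: "(x, y) \<in> pts"
  using x y lt by (simp add: points_def)
 \<comment> \<open>A step by \<open>W\<close> within the residue class adds just the height
   \<open>y\<close> itself.\<close>
 have key: "snd p mod W = z mod W \<and> snd p \<le> z \<and> y - W < snd p \<longleftrightarrow>
   snd p = y \<or> snd p mod W = z mod W \<and> snd p \<le> z \<and> y < snd p" for p :: "int \<times> int"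
  using mod_eq_le[OF W, of "snd p" y] y W by auto
 have set: "{p \<in> pts. P p \<and> fst p = x \<and> snd p mod W = z mod W \<and> snd p \<le> z \<and> y - W < snd p} =
   (if P (x, y) then insert (x, y) {p \<in> pts. P p \<and> fst p = x \<and> snd p mod W = z mod W \<and> snd p \<le> z \<and> y < snd p}
    else {p \<in> pts. P p \<and> fst p = x \<and> snd p mod W = z mod W \<and> snd p \<le> z \<and> y < snd p})" for P
  unfolding key using pt by (auto simp: prod_eq_iff)
 let ?S = "\<lambda>y. {p \<in> pts. hits p \<and> fst p = x \<and> snd p mod W = z mod W \<and> snd p \<le> z \<and> y < snd p}"
 let ?C = "\<lambda>y. {p \<in> pts. fst p = x \<and> snd p mod W = z mod W \<and> snd p \<le> z \<and> y < snd p}"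
 have C: "card (?C (y - W)) = Suc (card (?C y))"
  using set[of "\<lambda>_. True"] by simp
 have S: "?S (y - W) = (if hits (x, y) then insert (x, y) (?S y) else ?S y)"
  by (rule set)
 have T: "toggled (bits s) (?S (y - W)) slot_of =
   (if hits (x, y) then (bits s')(slot (form' x y) := \<not> bits s' (slot (form' x y))) else bits s')"
  using 2(1) toggled_insert[of "?S y" "(x, y)" "bits s" slot_of]
  by (simp add: S y_def[symmetric] slot_of_def)
 have H: "(form' x y - lo) mod A = 0 \<longleftrightarrow> hits (x, y)"
  by (simp add: hits_def dvd_eq_mod_eq_0)
 note ab = address_bounds[OF y(2) lt]
 have "clock s' \<le> clock s + 200 * card (?C y)"
  using 2(1) by (simp add: y_def)
 moreover have "(y - W) mod W = z mod W"
  using y(3) by simp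
 ultimately show ?case
  using e(2) e' y ab A W T C H big z(3) x
  by (intro total_intros) (auto simp flip: y_def simp: slot_def)
next
 case (3 s')
 define y where "y = var s' vz"
 have e: "env s'" "var s' vpx = x"
  using 3(2) env x by (auto simp: frame_def env_def)
 note e' = envD[OF e(1)]
 have y: "0 \<le> y \<Longrightarrow> form' x y < lo"
  using 3(3) e e' by (auto simp: y_def)
 have "y < snd p" if "p \<in> pts" "fst p = x" for p
 proof (rule ccontr)
  assume "\<not> y < snd p"
  moreover have p: "0 \<le> snd p" "lo \<le> form' x (snd p)"
   using that by (auto simp: points_def)
  ultimately have "form' x (snd p) \<le> form' x y"
   using form x by (intro form_mono) auto
  with y p \<open>\<not> y < snd p\<close> show False
   by linarith
 qed
 then have "{p \<in> pts. P p \<and> fst p = x \<and> snd p mod W = z mod W \<and> snd p \<le> z \<and> y < snd p} =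
   {p \<in> pts. P p \<and> fst p = x \<and> snd p mod W = z mod W \<and> snd p \<le> z}" for P
  by blast
 from this[of hits] this[of "\<lambda>_. True"] show ?case
  using 3(1) by (simp flip: y_def)
next
 case (4 s')
 then show ?case
  by simp
qed

text \<open>The number \<open>t\<close> of steps is exposed together with the drop
  \<open>W * t\<close>, so that the caller can sum the drops over all columns. The lower end
  \<open>- W\<close> allows one step below 0, where the column has no points left.\<close>

lemma total_descend:
 assumes env: "env s" and x: "var s vpx = x" "0 \<le> x" and z: "var s vpy = z" "- W \<le> z" "z \<le> R + W"
 shows "total descend (\<lambda>s'. \<exists>t. var s' vpy = z - W * int t \<and> - W \<le> var s' vpy \<and>
  (0 \<le> var s' vpy \<longrightarrow> form' x (var s' vpy) < hi) \<and>
  (\<forall>y. var s' vpy < y \<and> y \<le> z \<and> y mod W = z mod W \<and> 0 \<le> y \<longrightarrow> hi \<le> form' x y) \<and>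
  clock s' \<le> clock s + 60 * t + 60) s"
 unfolding descend_def
proof (rule total_While[where
   I = "\<lambda>s'. \<exists>t. var s' vpy = z - W * int t \<and> - W \<le> var s' vpy \<and>
    (\<forall>y. var s' vpy < y \<and> y \<le> z \<and> y mod W = z mod W \<and> 0 \<le> y \<longrightarrow> hi \<le> form' x y) \<and>
    clock s' \<le> clock s + 60 * t"
   and m = "\<lambda>s'. nat (var s' vpy + W)"], goal_cases)
 case 1
 show ?case
  using z by (intro exI[of _ 0]) auto
next
 case (2 s')
 have e: "env s'" "var s' vpx = x"
  using 2(2) env x by (auto simp: frame_def env_def)
 note e' = envD[OF e(1)]
 obtain t where t: "var s' vpy = z - W * int t" "- W \<le> var s' vpy"
   "\<forall>y. var s' vpy < y \<and> y \<le> z \<and> y mod W = z mod W \<and> 0 \<le> y \<longrightarrow> hi \<le> form' x y"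
   "clock s' \<le> clock s + 60 * t"
  using 2(1) by blast
 define y where "y = var s' vpy"
 have y: "0 \<le> y" "hi \<le> form' x y"
  using 2(3) e e' by (auto simp: y_def)
 have le: "y \<le> z"
  using t(1) W by (simp add: y_def)
 have ymod: "y mod W = z mod W"
  by (simp add: y_def t(1) mod_diff_eq[symmetric])
 have all: "hi \<le> form' x y'" if y': "y - W < y'" "y' \<le> z" "y' mod W = z mod W" "0 \<le> y'" for y'
 proof -
  have "y \<le> y'"
   using mod_eq_le[OF W _ y'(1)] y'(3) ymod by simp
  then show ?thesis
   using t(3) y' y by (cases "y = y'") (auto simp: y_def)
 qed
 have eq: "y - W = z - W * int (Suc t)"
  using t(1) by (simp add: y_def algebra_simps)
 show ?case
  using e' y le z(3) big W t(4) all eq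
  by (intro total_intros) (auto simp flip: y_def intro!: exI[of _ "Suc t"])
next
 case (3 s')
 have e: "env s'" "var s' vpx = x"
  using 3(2) env x by (auto simp: frame_def env_def)
 with 3 envD[OF e(1)] show ?case
  by auto
next
 case (4 s')
 then show ?case
  by simp
qed

lemma total_ascend:
 assumes env: "env s" and y: "var s vpy = y" "0 \<le> y" "y < W"
 shows "total ascend (\<lambda>s'. \<exists>t. var s' vpy = y + W * int t \<and> hi \<le> var s' vpy * var s' vpy \<and>
  var s' vpy \<le> R + W \<and> t \<le> nat (R div W) + 1 \<and> clock s' \<le> clock s + 60 * t + 60) s"
 unfolding ascend_def
proof (rule total_While[where
   I = "\<lambda>s'. \<exists>t. var s' vpy = y + W * int t \<and> var s' vpy \<le> R + W \<and> (0 < t \<longrightarrow> W * int (t - 1) \<le> R) \<and>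
    clock s' \<le> clock s + 60 * t"
   and m = "\<lambda>s'. nat (R + W - var s' vpy)"], goal_cases)
 case 1
 show ?case
  using y R by (intro exI[of _ 0]) auto
next
 case (2 s')
 have e: "env s'"
  using 2(2) env by (auto simp: frame_def env_def)
 note e' = envD[OF e]
 obtain t where t: "var s' vpy = y + W * int t" "clock s' \<le> clock s + 60 * t"
  using 2(1) by blast
 define z where "z = var s' vpy"
 have z: "z * z < hi"
  using 2(3) e' by (simp add: z_def)
 have z0: "0 \<le> z"
  using t(1) y W by (simp add: z_def)
 have "z < R"
 proof (rule ccontr)
  assume "\<not> z < R"
  then have "R * R \<le> z * z"
   using R by (intro mult_mono) auto
  with z R show False
   by linarith
 qed
 moreover have "W * int t \<le> z"
  using t(1) y by (simp add: z_def)
 moreover have "z + W = y + W * int (Suc t)"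
  using t(1) by (simp add: z_def algebra_simps)
 ultimately show ?case
  using e' z0 big W t(2)
  by (intro total_intros) (auto simp flip: z_def intro!: exI[of _ "Suc t"])
next
 case (3 s')
 have e: "env s'"
  using 3(2) env by (auto simp: frame_def env_def)
 obtain t where t: "var s' vpy = y + W * int t" "var s' vpy \<le> R + W" "0 < t \<longrightarrow> W * int (t - 1) \<le> R"
   "clock s' \<le> clock s + 60 * t"
  using 3(1) by blast
 have "t \<le> nat (R div W) + 1"
 proof (cases "t = 0")
  case False
  then have "int (t - 1) * W \<le> R"
   using t(3) by (simp add: mult.commute)
  then have "int (t - 1) \<le> R div W"
   using W by (intro int_le_divI)
  then show ?thesis
   by linarith
 qed simp
 with t 3(3) envD[OF e] show ?case
  by (intro exI[of _ t]) auto
next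
 case (4 s')
 then show ?case
  by simp
qed

text \<open>Amortised cost: as \<open>x\<close> grows, the largest admissible \<open>y\<close> only
  falls, so all descents together take at most \<open>R div W + 2\<close> steps. With about as many
  columns, the time is linear in \<open>R / W\<close> plus the number of visited points.\<close>

lemma total_flip_class:
 assumes env: "env s" and x1: "var s vx1 = x1" "0 \<le> x1" "x1 < W" and y1: "var s vy1 = y1" "0 \<le> y1" "y1 < W"
 shows "total flip_class (\<lambda>s'.
  bits s' = toggled (bits s) {p \<in> pts. hits p \<and> fst p mod W = x1 \<and> snd p mod W = y1} slot_of \<and>
  clock s' \<le> clock s + 1000 * (nat (R div W) + 2) + 200 * card {p \<in> pts. fst p mod W = x1 \<and> snd p mod W = y1}) s"
 unfolding flip_class_def
proof (rule total_Seq, rule total_Asg, goal_cases)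
 case 3
 let ?s1 = "tick (size_of (V vy1) + 1) (set_var vpy (eval (var s) (V vy1)) s)"
 show ?case
 proof (rule total_Seq, rule total_conseq[OF total_ascend[of ?s1 y1]], goal_cases)
  case (5 s2)
  then obtain t where t: "var s2 vpy = y1 + W * int t" "hi \<le> var s2 vpy * var s2 vpy"
    "var s2 vpy \<le> R + W" "t \<le> nat (R div W) + 1" and "clock s2 \<le> clock ?s1 + 60 * t + 60"
   by blast
  then have t5: "clock s2 \<le> clock s + 2 + 60 * t + 60"
   by simp
  define y2 where "y2 = var s2 vpy"
  have f2: "\<And>x. x \<noteq> vpy \<Longrightarrow> var s2 x = var s x" "bits s2 = bits s"
   using 5(2) by (auto simp: frame_def ascend_def)
  have e2: "env s2"
   using env f2 by (simp add: env_def)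
  have y2: "y2 = y1 + W * int t" "0 \<le> y2" "hi \<le> y2 * y2" "y2 \<le> R + W" "y2 mod W = y1"
   using t y1 W by (auto simp: y2_def)
  let ?s3 = "tick (size_of (V vx1) + 1) (set_var vpx (eval (var s2) (V vx1)) s2)"
  let ?body = "descend ;; Asg vz (V vpy) ;; flip_column ;; Asg vpx (V vpx +. V vW)"
  let ?P = "\<lambda>Q x. {p \<in> pts. Q p \<and> fst p mod W = x1 \<and> snd p mod W = y1 \<and> fst p < x}"
  \<comment> \<open>\<open>a\<close> counts the finished columns and \<open>b\<close> the descents
    in all of them; every height of the class above \<open>vpy\<close> is already known to lie
    beyond \<open>hi\<close>.\<close>
  let ?I = "\<lambda>s'. \<exists>a b. var s' vpx = x1 + W * int a \<and> W * int a \<le> R + W \<and>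
    var s' vpy = y2 - W * int b \<and> - W \<le> var s' vpy \<and>
    (\<forall>y. var s' vpy < y \<and> y mod W = y1 \<and> 0 \<le> y \<longrightarrow> hi \<le> form' (var s' vpx) y) \<and>
    bits s' = toggled (bits s) (?P hits (var s' vpx)) slot_of \<and>
    clock s' \<le> clock s2 + 2 + 60 * b + 400 * a + 200 * card (?P (\<lambda>_. True) (var s' vpx))"
  show ?case
  proof (rule total_Seq, rule total_Asg, goal_cases)
   case 3
   show ?case
   proof (rule total_While[where I = ?I and m = "\<lambda>s'. nat (R - var s' vpx)"], goal_cases)
    case 1
    have "\<not> fst p < x1" if "fst p mod W = x1" "p \<in> pts" for p
     using that pos_mod_sign[OF W] zmod_le_nonneg_dividend[of "fst p" W] by (auto simp: points_def)
    then have "?P hits x1 = {}" "?P (\<lambda>_. True) x1 = {}"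
     by blast+
    then have "toggled (bits s) (?P hits x1) slot_of = bits s" "card (?P (\<lambda>_. True) x1) = 0"
     by (simp_all only: toggled_empty card.empty)
    moreover have "hi \<le> form' x1 y" if "y2 < y" "0 \<le> y" for y
    proof -
     have "y2 * y2 \<le> y * y"
      using that y2 by (intro mult_mono) auto
     with form_ge(2)[OF form x1(2) that(2)] y2(3) show ?thesis
      by linarith
    qed
    ultimately show ?case
     using f2 x1 y2 W R by (intro exI[of _ 0]) (auto simp flip: y2_def)
   next
    case (2 s')
    have e: "env s'"
     using 2(2) e2 by (auto simp: frame_def env_def descend_def flip_column_def)
    note e' = envD[OF e]
    obtain a b where I: "var s' vpx = x1 + W * int a" "W * int a \<le> R + W"
      "var s' vpy = y2 - W * int b" "- W \<le> var s' vpy"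
      "\<forall>y. var s' vpy < y \<and> y mod W = y1 \<and> 0 \<le> y \<longrightarrow> hi \<le> form' (var s' vpx) y"
      "bits s' = toggled (bits s) (?P hits (var s' vpx)) slot_of"
      "clock s' \<le> clock s2 + 2 + 60 * b + 400 * a + 200 * card (?P (\<lambda>_. True) (var s' vpx))"
     using 2(1) by blast
    define x where "x = var s' vpx"
    have x: "0 \<le> x" "x * x < hi" "x mod W = x1" "W * int a \<le> x"
     using I(1) 2(3) e' x1 W by (auto simp: x_def)
    have xR: "x < R"
    proof (rule ccontr)
     assume "\<not> x < R"
     then have "R * R \<le> x * x"
      using R by (intro mult_mono) auto
     with x R show False
      by linarith
    qed
    have yle: "var s' vpy \<le> R + W"
     using I(3) y2(4) W mult_nonneg_nonneg[of W "int b"] by linarith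
    let ?c = "bsize [V vpx *. V vpx <. V vhi] + 1"
    have ymod: "var s' vpy mod W = y1"
     using y2(5) y1 by (simp add: I(3) mod_diff_eq[symmetric])
    show ?case
    proof (rule total_Seq, rule total_conseq[OF total_descend[of "tick ?c s'" x "var s' vpy"]], goal_cases)
     case (7 s4)
     then obtain t' where s4: "var s4 vpy = var s' vpy - W * int t'" "- W \<le> var s4 vpy"
       "0 \<le> var s4 vpy \<longrightarrow> form' x (var s4 vpy) < hi"
       "\<forall>y. var s4 vpy < y \<and> y \<le> var s' vpy \<and> y mod W = var s' vpy mod W \<and> 0 \<le> y \<longrightarrow> hi \<le> form' x y"
       "clock s4 \<le> clock (tick ?c s') + 60 * t' + 60"
      by blast
     have f4: "\<And>z. z \<noteq> vpy \<Longrightarrow> var s4 z = var s' z" "bits s4 = bits s'"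
      using 7(2) by (auto simp: frame_def descend_def)
     define y where "y = var s4 vpy"
     have top: "hi \<le> form' x y'" if "y < y'" "y' mod W = y1" "0 \<le> y'" for y'
      using s4(4) ymod I(5) that by (cases "y' \<le> var s' vpy") (auto simp: x_def y_def)
     have ymod': "y mod W = y1"
      using ymod y1 by (simp add: y_def s4(1) mod_diff_eq[symmetric])
     have yle': "y \<le> R + W"
      using s4(1) yle W mult_nonneg_nonneg[of W "int t'"] unfolding y_def by linarith
     have yb: "\<bar>y\<bar> \<le> big"
      using yle' s4(2) big R W lo by (auto simp: y_def)
     let ?s5 = "tick (size_of (V vpy) + 1) (set_var vz (eval (var s4) (V vpy)) s4)"
     have e5: "env ?s5"
      using e f4 by (simp add: env_def)
     show ?case
     proof (rule total_Seq, rule total_Asg, goal_cases)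
      case 3
      show ?case
      proof (rule total_Seq, rule total_conseq[OF total_flip_column[OF e5, of x y]], goal_cases)
       case (7 s6)
       have f6: "\<And>z. z \<notin> {vz, vadr, vt} \<Longrightarrow> var s6 z = var ?s5 z"
        using 7(2) by (auto simp: frame_def flip_column_def)
       have notle: "snd p \<le> y" if "p \<in> pts" "fst p = x" "snd p mod W = y1" for p
        using top[of "snd p"] that by (force simp: points_def)
       have col: "{p \<in> pts. Q p \<and> fst p = x \<and> snd p mod W = y mod W \<and> snd p \<le> y} =
         {p \<in> pts. Q p \<and> fst p = x \<and> snd p mod W = y1}" for Q
        using notle ymod' by auto
       have un: "?P Q (x + W) = ?P Q x \<union> {p \<in> pts. Q p \<and> fst p = x \<and> snd p mod W = y1}" for Q
       proof -
        have "fst p < x + W \<and> fst p mod W = x1 \<longleftrightarrow> fst p < x \<and> fst p mod W = x1 \<or> fst p = x" for p :: "int \<times> int"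
        proof (cases "fst p < x")
         case False
         then show ?thesis
          using mod_eq_le[OF W, of x "fst p"] x(3) W by auto
        qed (use x(3) W in auto)
        then show ?thesis
         by blast
       qed
       have disj: "?P Q x \<inter> {p \<in> pts. Q p \<and> fst p = x \<and> snd p mod W = y1} = {}" for Q
        by auto
       have bits6: "bits s6 = toggled (bits s) (?P hits (x + W)) slot_of"
        using 7(1) f4(2) I(6) toggled_Un[OF _ _ disj[of hits], of "bits s" slot_of] un[of hits]
        by (simp add: col flip: x_def)
       have card: "card (?P (\<lambda>_. True) (x + W)) = card (?P (\<lambda>_. True) x) + card {p \<in> pts. fst p = x \<and> snd p mod W = y1}"
        using card_Un_disjoint[OF _ _ disj[of "\<lambda>_. True"]] un[of "\<lambda>_. True"] by simp
       have clk: "clock s6 \<le> clock s4 + 2 + 200 * card {p \<in> pts. fst p = x \<and> snd p mod W = y1} + 200"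
        using 7(1) col[of "\<lambda>_. True"] by simp
       have v6: "var s6 vpx = x" "var s6 vW = W" "var s6 vpy = y"
        using f6[of vpx] f6[of vW] f6[of vpy] f4 e' by (auto simp: x_def y_def)
       \<comment> \<open>The bound for the current column passes to the next one because the form
         increases in \<open>x\<close>.\<close>
       have mono: "hi \<le> form' (x + W) y'" if "y < y'" "y' mod W = y1" "0 \<le> y'" for y'
        using top[OF that] form_mono[of \<gamma> \<epsilon> x y' "x + W" y'] form x(1) that W by auto
       have eqs: "x + W = x1 + W * int (Suc a)" "y = y2 - W * int (b + t')"
        using I(1,3) s4(1) by (simp_all add: x_def y_def algebra_simps)
       have aR: "W * int (Suc a) \<le> R + W"
        using x(4) xR by (simp add: algebra_simps)
       have fin: "clock s6 + (size_of (V vpx +. V vW) + 1) \<le> clock s2 + 2 + 60 * (b + t') + 400 * Suc a + 200 * card (?P (\<lambda>_. True) (x + W))"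
        using clk s4(5) I(7) card by (simp flip: x_def)
       show ?case
       proof (rule total_Asg, goal_cases)
        case 3
        show ?case
         by (rule conjI, rule exI[of _ "Suc a"], rule exI[of _ "b + t'"])
          (use v6 bits6 mono eqs fin x xR W s4(2) aR in \<open>auto simp flip: y_def x_def\<close>)
       qed (use v6 x xR big W in auto)
      qed (use s4 x yle' in \<open>auto simp: y_def x_def f4\<close>)
     qed (use yb in \<open>simp_all add: y_def\<close>)
    qed (use e I(4) x yle in \<open>auto simp: x_def env_def\<close>)
   next
    case (3 s')
    have e: "env s'"
     using 3(2) e2 by (auto simp: frame_def env_def descend_def flip_column_def)
    note e' = envD[OF e]
    obtain a b where I: "var s' vpx = x1 + W * int a" "W * int a \<le> R + W"
      "var s' vpy = y2 - W * int b" "- W \<le> var s' vpy"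
      "bits s' = toggled (bits s) (?P hits (var s' vpx)) slot_of"
      "clock s' \<le> clock s2 + 2 + 60 * b + 400 * a + 200 * card (?P (\<lambda>_. True) (var s' vpx))"
     using 3(1) by blast
    define x where "x = var s' vpx"
    have x: "0 \<le> x" "hi \<le> x * x"
     using I(1) 3(3) e' x1 W by (auto simp: x_def)
    have "fst p < x" if "p \<in> pts" for p
    proof (rule ccontr)
     assume "\<not> fst p < x"
     then have "x * x \<le> fst p * fst p"
      using x by (intro mult_mono) auto
     moreover have "fst p * fst p \<le> form' (fst p) (snd p)" "form' (fst p) (snd p) < hi"
      using that form_ge(1)[OF form] by (auto simp: points_def)
     ultimately show False
      using x by linarith
    qed
    then have all: "?P Q x = {p \<in> pts. Q p \<and> fst p mod W = x1 \<and> snd p mod W = y1}" for Q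
     by blast
    have a: "a \<le> nat (R div W) + 1"
    proof -
     have "int a * W \<le> R + W"
      using I(2) by (simp add: mult.commute)
     then have "int a \<le> (R + W) div W"
      using W by (intro int_le_divI)
     then show ?thesis
      using W by simp
    qed
    have b: "b \<le> nat (R div W) + 2"
    proof -
     \<comment> \<open>The height starts at most at \<open>R + W\<close> and ends no lower than
       \<open>- W\<close>.\<close>
     have "(int b - 2) * W \<le> R"
      using I(3,4) y2(4) by (simp add: algebra_simps)
     then have "int b - 2 \<le> R div W"
      using W by (intro int_le_divI)
     then show ?thesis
      by linarith
    qed
    show ?case
     using I(5,6) all[of hits] all[of "\<lambda>_. True"] a b t(4) t5 by (auto simp flip: x_def)
   next
    case (4 s')
    then show ?case
     by simp
   qed
  qed (use f2 x1 big lo R W hi A in \<open>auto intro: order_trans\<close>)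
 qed (use env y1 in \<open>auto simp: env_def\<close>)
qed (use y1 big W R in auto)

definition class_cost :: nat where
 "class_cost = 1000 * (nat (R div W) + 2)"

text \<open>Points are visited by their class modulo \<open>W\<close>, but only those matching
  modulo the multiple \<open>A\<close> of \<open>W\<close> reach a bit. So \<open>near\<close>
  measures time, while \<open>hits\<close> describes the result.\<close>

definition near :: "int \<times> int \<Rightarrow> bool" where
 "near p \<longleftrightarrow> W dvd form' (fst p) (snd p) - lo"

lemma hits_near: "hits p \<Longrightarrow> near p"
 using A(2) dvd_trans unfolding hits_def near_def by blast

lemma near_cong:
 assumes "fst p mod W = x" "snd p mod W = y"
 shows "near p \<longleftrightarrow> W dvd form' x y - lo"
proof -
 have "form' (fst p) (snd p) mod W = form' x y mod W"
  using assms by (intro form_cong) auto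
 then show ?thesis
  unfolding near_def by (metis mod_eq_dvd_iff)
qed

text \<open>The lexicographic order is that of the two nested loops, so this is the work done when
  they stand at \<open>(x, y)\<close>.\<close>

definition lower :: "(int \<times> int \<Rightarrow> bool) \<Rightarrow> int \<Rightarrow> int \<Rightarrow> (int \<times> int) set" where
 "lower Q x y = {p \<in> pts. Q p \<and> (fst p mod W < x \<or> fst p mod W = x \<and> snd p mod W < y)}"

definition lower_reps :: "int \<Rightarrow> int \<Rightarrow> (int \<times> int) set" where
 "lower_reps x y = {p \<in> reps_mod \<gamma> \<epsilon> lo W. fst p < x \<or> fst p = x \<and> snd p < y}"

lemma lower_step:
 "lower Q x (y + 1) = lower Q x y \<union> {p \<in> pts. Q p \<and> fst p mod W = x \<and> snd p mod W = y}"
 "lower Q x y \<inter> {p \<in> pts. Q p \<and> fst p mod W = x \<and> snd p mod W = y} = {}"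
 by (auto simp: lower_def)

lemma lower_next: "lower Q x W = lower Q (x + 1) 0" "lower_reps x W = lower_reps (x + 1) 0"
proof -
 have "\<not> snd p mod W < 0" "snd p mod W < W" for p :: "int \<times> int"
  using W by (simp_all add: not_less)
 then show "lower Q x W = lower Q (x + 1) 0"
  by (auto simp: lower_def)
 show "lower_reps x W = lower_reps (x + 1) 0"
  by (auto simp: lower_reps_def reps_mod_def)
qed

lemma finite_lower [simp]: "finite (lower Q x y)"
 by (simp add: lower_def)

lemma finite_lower_reps [simp]: "finite (lower_reps x y)"
 by (simp add: lower_reps_def finite_reps_mod)

text \<open>The cost is stated as a potential with counts on both sides, so that summing over all
  classes telescopes to the number of matching classes and of visited points.\<close>

lemma total_flip_step:
 assumes env: "env s" and x: "var s vx1 = x" "0 \<le> x" "x < W" and y: "var s vy1 = y" "0 \<le> y" "y < W"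
 shows "total (If [(form_exp vx1 vy1 -. V vlo) %. V vW =. N 0] flip_class Skip) (\<lambda>s'.
  bits s' = toggled (bits s) {p \<in> pts. hits p \<and> fst p mod W = x \<and> snd p mod W = y} slot_of \<and>
  clock s' + class_cost * card (lower_reps x y) + 200 * card (lower near x y) \<le>
   clock s + 30 + class_cost * card (lower_reps x (y + 1)) + 200 * card (lower near x (y + 1))) s"
proof (rule total_If, goal_cases)
 case 1
 show ?case
  using W envD[OF env] by simp
next
 case 2
 then have d: "W dvd form' x y - lo"
  using envD[OF env] x y by (simp add: dvd_eq_mod_eq_0)
 have "lower_reps x (y + 1) = insert (x, y) (lower_reps x y)"
  using d x y by (auto simp: lower_reps_def reps_mod_def)
 moreover have "(x, y) \<notin> lower_reps x y"
  by (simp add: lower_reps_def)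
 ultimately have 1: "card (lower_reps x (y + 1)) = Suc (card (lower_reps x y))"
  by simp
 have "{p \<in> pts. near p \<and> fst p mod W = x \<and> snd p mod W = y} = {p \<in> pts. fst p mod W = x \<and> snd p mod W = y}"
  using near_cong d by auto
 then have 2: "card (lower near x (y + 1)) = card (lower near x y) + card {p \<in> pts. fst p mod W = x \<and> snd p mod W = y}"
  using card_Un_disjoint[OF _ _ lower_step(2), of near x y] lower_step(1)[of near x y] by simp
 have e: "env (tick t s)" for t
  using env by (simp add: env_def)
 show ?case
 proof (rule total_conseq[OF total_flip_class[of "tick (bsize [(form_exp vx1 vy1 -. V vlo) %. V vW =. N 0] + 1) s" x y]], goal_cases)
  case (8 s')
  then have "clock s' \<le> clock s + 23 + class_cost + 200 * card {p \<in> pts. fst p mod W = x \<and> snd p mod W = y}"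
   by (simp add: class_cost_def)
  with 8 show ?case
   unfolding 1 2 by simp
 qed (use x y e in auto)
next
 case 3
 then have d: "\<not> W dvd form' x y - lo"
  using envD[OF env] x y by (simp add: dvd_eq_mod_eq_0)
 then have no: "{p \<in> pts. hits p \<and> fst p mod W = x \<and> snd p mod W = y} = {}"
  "{p \<in> pts. near p \<and> fst p mod W = x \<and> snd p mod W = y} = {}"
  using near_cong hits_near by blast+
 have "lower near x (y + 1) = lower near x y"
  using lower_step(1)[of near x y] no(2) by simp
 moreover have le: "card (lower_reps x y) \<le> card (lower_reps x (y + 1))"
  by (intro card_mono) (auto simp: lower_reps_def finite_reps_mod)
 define c1 c2 where "c1 = class_cost * card (lower_reps x y)" and "c2 = class_cost * card (lower_reps x (y + 1))"
 have "c1 \<le> c2"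
  using le by (simp add: c1_def c2_def)
 ultimately show ?case
  unfolding no(1) by (intro total_Skip) (simp flip: c1_def c2_def)
qed

lemma total_flip_points:
 assumes env: "env s"
 shows "total flip_points (\<lambda>s'. bits s' = toggled (bits s) {p \<in> pts. hits p} slot_of \<and>
  clock s' \<le> clock s + 100 * (nat W + 1) * (nat W + 1) +
   class_cost * card (reps_mod \<gamma> \<epsilon> lo W) + 200 * card {p \<in> pts. near p}) s"
proof -
 define cost where "cost x y = class_cost * card (lower_reps x y) + 200 * card (lower near x y)" for x y
 let ?I = "\<lambda>s'. 0 \<le> var s' vx1 \<and> var s' vx1 \<le> W \<and>
  bits s' = toggled (bits s) (lower hits (var s' vx1) 0) slot_of \<and>
  clock s' \<le> clock s + 2 + 100 * (nat (var s' vx1) * (nat W + 1)) + cost (var s' vx1) 0"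
 have all: "lower Q W 0 = {p \<in> pts. Q p}" "lower_reps W 0 = reps_mod \<gamma> \<epsilon> lo W" for Q
  using W by (auto simp: lower_def lower_reps_def reps_mod_def)
 have none: "lower Q 0 0 = {}" "lower_reps 0 0 = {}" for Q
  using pos_mod_sign[OF W] by (auto simp: lower_def lower_reps_def reps_mod_def not_less)
 show ?thesis
  unfolding flip_points_def
 proof (rule total_Seq, rule total_Asg, goal_cases)
  case 3
  show ?case
  proof (rule total_While[where I = ?I and m = "\<lambda>s'. nat (W - var s' vx1)"], goal_cases)
   case 1
   show ?case
    using W by (simp add: none cost_def)
  next
   case (2 s1)
   have e1: "env s1"
    using 2(2) env by (auto simp: frame_def env_def flip_class_def ascend_def descend_def flip_column_def)
   note e1' = envD[OF e1]
   define x where "x = var s1 vx1"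
   have x: "0 \<le> x" "x < W"
    using 2(1,3) e1' by (auto simp: x_def)
   have b1: "bits s1 = toggled (bits s) (lower hits x 0) slot_of"
    and c1: "clock s1 \<le> clock s + 2 + 100 * (nat x * (nat W + 1)) + cost x 0"
    using 2(1) by (auto simp: x_def)
   let ?J = "\<lambda>s'. 0 \<le> var s' vy1 \<and> var s' vy1 \<le> W \<and>
    bits s' = toggled (bits s) (lower hits x (var s' vy1)) slot_of \<and>
    clock s' \<le> clock s + 10 + 100 * (nat x * (nat W + 1)) + 50 * nat (var s' vy1) + cost x (var s' vy1)"
   show ?case
   proof (rule total_Seq, rule total_Asg, goal_cases)
    case 3
    show ?case
    proof (rule total_Seq, rule total_While[where I = ?J and m = "\<lambda>s'. nat (W - var s' vy1)"], goal_cases)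
     case 1
     show ?case
      using b1 c1 W by simp
    next
     case (2 s2)
     have e2: "env s2" "var s2 vx1 = x"
      using 2(2) e1 by (auto simp: frame_def env_def x_def flip_class_def ascend_def descend_def flip_column_def)
     note e2' = envD[OF e2(1)]
     define y where "y = var s2 vy1"
     have y: "0 \<le> y" "y < W"
      using 2(1,3) e2' by (auto simp: y_def)
     have b2: "bits s2 = toggled (bits s) (lower hits x y) slot_of"
      and c2: "clock s2 \<le> clock s + 10 + 100 * (nat x * (nat W + 1)) + 50 * nat y + cost x y"
      using 2(1) by (auto simp: y_def)
     have e: "env (tick t s2)" for t
      using e2 by (simp add: env_def)
     show ?case
     proof (rule total_Seq, rule total_conseq[OF total_flip_step[OF e, where x = x and y = y]], goal_cases)
      case (7 s3)
      have f: "var s3 vy1 = y" "var s3 vW = W"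
       using 7(2) e2' by (auto simp: frame_def y_def flip_class_def ascend_def descend_def flip_column_def)
      have "bits s3 = toggled (bits s) (lower hits x (y + 1)) slot_of"
       using 7(1) b2 toggled_Un[OF _ _ lower_step(2), of hits x y "bits s" slot_of] lower_step(1)[of hits x y]
       by simp
      moreover have "clock s3 \<le> clock s + 10 + 100 * (nat x * (nat W + 1)) + 50 * nat y + 36 + cost x (y + 1)"
       using 7(1) c2 by (auto simp: cost_def)
      moreover have "nat (y + 1) = nat y + 1"
       using y by simp
      ultimately show ?case
       using f y big W R
       by (intro total_Asg) (auto simp flip: y_def)
     qed (use e2 y x in \<open>auto simp: y_def\<close>)
    next
     case (3 s2)
     have e2: "env s2" "var s2 vx1 = x"
      using 3(2) e1 by (auto simp: frame_def env_def x_def flip_class_def ascend_def descend_def flip_column_def)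
     have "var s2 vy1 = W"
      using 3(1,3) envD[OF e2(1)] by auto
     then have "bits s2 = toggled (bits s) (lower hits (x + 1) 0) slot_of"
      "clock s2 \<le> clock s + 10 + 100 * (nat x * (nat W + 1)) + 50 * nat W + cost (x + 1) 0"
      using 3(1) lower_next by (auto simp: cost_def)
     moreover have "nat (x + 1) = nat x + 1" "1 \<le> nat W"
      using x W by auto
     moreover have "100 * ((nat x + 1) * (nat W + 1)) = 100 * (nat x * (nat W + 1)) + 100 * nat W + 100"
      by (simp add: algebra_simps)
     ultimately show ?case
      using e2 x big W R by (intro total_Asg) (auto simp flip: x_def simp del: mult_Suc mult_Suc_right)
    next
     case (4 s2)
     then show ?case
      by simp
    qed
   qed (use big W R in auto)
  next
   case (3 s1)
   have e1: "env s1"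
    using 3(2) env by (auto simp: frame_def env_def flip_class_def ascend_def descend_def flip_column_def)
   have "var s1 vx1 = W"
    using 3(1,3) envD[OF e1] by auto
   moreover have "100 * (nat W + 1) * (nat W + 1) = 100 * (nat W * (nat W + 1)) + 100 * (nat W + 1)"
    by (simp add: algebra_simps)
   ultimately show ?case
    using 3(1) by (auto simp: cost_def all)
  next
   case (4 s1)
   then show ?case
    by simp
  qed
 qed (use big W R in auto)
qed

end

section \<open>Clearing the multiples of squares\<close>

context segment
begin

definition marks :: "int \<Rightarrow> nat \<Rightarrow> bool" where
 "marks v i \<longleftrightarrow> lo \<le> v \<and> v < hi \<and> A dvd v - lo \<and> i = slot v"

text \<open>The number \<open>c\<close> of rounds is described by the cofactor of the last round,
  whose multiple of \<open>d^2\<close> is still below \<open>hi\<close>; the caller turns this into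
  a quotient.\<close>

lemma total_clear_multiples:
 assumes env: "env s" and d: "var s vd = d" "1 \<le> d" and e: "var s ve = e" "0 \<le> e"
  and st: "var s vst = st" "1 \<le> st" "st \<le> W"
 shows "total clear_multiples (\<lambda>s'.
  (\<forall>i. bits s' i \<longleftrightarrow> bits s i \<and> \<not> (\<exists>t. marks (d * d * (e + st * int t)) i)) \<and>
  (\<exists>c. clock s' \<le> clock s + 100 * c + 100 \<and> (c = 0 \<or> d * d * (e + st * (int c - 1)) < hi))) s"
proof -
 define v where "v t = d * d * (e + st * int t)" for t :: nat
 have v_mono: "v t \<le> v t'" if "t \<le> t'" for t t'
  unfolding v_def using that st by (intro mult_left_mono add_left_mono) auto
 have last: "c = 0 \<or> d * d * (e + st * (int c - 1)) < hi" if "c = 0 \<or> v (c - 1) < hi" for c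
  using that by (cases c) (auto simp: v_def)
 show ?thesis
  unfolding clear_multiples_def
 proof (rule total_While[where
    I = "\<lambda>s'. \<exists>c. var s' ve = e + st * int c \<and>
     (\<forall>i. bits s' i \<longleftrightarrow> bits s i \<and> \<not> (\<exists>t<c. marks (v t) i)) \<and>
     clock s' \<le> clock s + 100 * c \<and> (c = 0 \<or> v (c - 1) < hi)"
    and m = "\<lambda>s'. nat (hi - var s' ve)"], goal_cases)
  case 1
  show ?case
   using e by (intro exI[of _ 0]) auto
 next
  case (2 s')
  have e1: "env s'" "var s' vd = d" "var s' vst = st"
   using 2(2) env d st by (auto simp: frame_def env_def)
  note e' = envD[OF e1(1)]
  obtain c where c: "var s' ve = e + st * int c"
    "\<forall>i. bits s' i \<longleftrightarrow> bits s i \<and> \<not> (\<exists>t<c. marks (v t) i)" "clock s' \<le> clock s + 100 * c"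
   using 2(1) by blast
  define y where "y = var s' ve"
  have vc: "v c = d * d * y"
   using c(1) by (simp add: v_def y_def)
  have lt: "v c < hi"
   using 2(3) e1 e' by (simp add: vc flip: y_def)
  have y0: "0 \<le> y"
   using c(1) e st by (simp add: y_def)
  have "1 * y \<le> d * d * y"
   using d y0 mult_mono[of 1 d 1 d] by (intro mult_right_mono) auto
  then have yhi: "y < hi"
   using lt vc by linarith
  have nxt: "y + st = e + st * int (Suc c)"
   using c(1) by (simp add: y_def algebra_simps)
  have ex: "(\<exists>t<Suc c. marks (v t) i) \<longleftrightarrow> (\<exists>t<c. marks (v t) i) \<or> marks (v c) i" for i
   using less_Suc_eq by auto
  have m: "marks (v c) i \<longleftrightarrow> (lo - 1 < v c \<and> (v c - lo) mod A = 0) \<and> i = slot (v c)" for i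
   using lt by (auto simp: marks_def dvd_eq_mod_eq_0)
  have q: "int l \<le> q + (v c - lo) div A \<and> q + (v c - lo) div A < int u" if "lo - 1 < v c"
   using address_bounds[of "v c"] lt that by simp
  have fin: "(\<exists>c. y + st = e + st * int c \<and> (\<forall>i. B i \<longleftrightarrow> bits s i \<and> \<not> (\<exists>t<c. marks (v t) i)) \<and>
    T \<le> clock s + 100 * c \<and> (c = 0 \<or> v (c - 1) < hi))"
   if "\<And>i. B i \<longleftrightarrow> bits s' i \<and> \<not> marks (v c) i" "T \<le> clock s' + 100" for B T
   using that nxt c lt ex by (intro exI[of _ "Suc c"]) auto
  let ?s' = "tick (bsize [V vd *. V vd *. V ve <. V vhi] + 1) s'"
  have "total (If [V vlo -. N 1 <. V vd *. V vd *. V ve, (V vd *. V vd *. V ve -. V vlo) %. V vA =. N 0]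
    (Put_Bit (V vq +. (V vd *. V vd *. V ve -. V vlo) /. V vA) (N 0)) Skip)
    (\<lambda>s''. (\<forall>i. bits s'' i \<longleftrightarrow> bits s' i \<and> \<not> marks (v c) i) \<and> clock s'' \<le> clock s' + 60) ?s'"
   by (intro total_intros) (use A q in \<open>auto simp: e1 e' m slot_def simp flip: y_def vc\<close>)
  then show ?case
  proof (rule total_Seq[OF total_conseq], goal_cases)
   case (1 s'')
   have v: "var s'' ve = y" "var s'' vst = st"
    using 1(2) e1 by (auto simp: frame_def y_def)
   show ?case
   proof (rule total_Asg, goal_cases)
    case 3
    have "Suc (Suc (Suc (Suc (clock s'')))) \<le> clock s' + 100"
     using 1(1) by simp
    with 1(1) fin[of "bits s''" "Suc (Suc (Suc (Suc (clock s''))))"] show ?case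
     using v st yhi by (simp flip: y_def)
   qed (use v st big yhi y0 in auto)
  qed
 next
  case (3 s')
  have e1: "env s'" "var s' vd = d" "var s' vst = st"
   using 3(2) env d st by (auto simp: frame_def env_def)
  note e' = envD[OF e1(1)]
  obtain c where c: "var s' ve = e + st * int c"
    "\<forall>i. bits s' i \<longleftrightarrow> bits s i \<and> \<not> (\<exists>t<c. marks (v t) i)" "clock s' \<le> clock s + 100 * c"
    "c = 0 \<or> v (c - 1) < hi"
   using 3(1) by blast
  have "hi \<le> v c"
   using 3(3) e1 e' by (simp add: v_def c(1))
  then have "\<not> marks (v t) i" if "c \<le> t" for t i
   using v_mono[OF that] by (simp add: marks_def)
  then have "(\<exists>t. marks (v t) i) \<longleftrightarrow> (\<exists>t<c. marks (v t) i)" for i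
   using not_less[of _ c] by blast
  then have "bits s' i \<longleftrightarrow> bits s i \<and> \<not> (\<exists>t. marks (v t) i)" for i
   using c(2) by blast
  moreover have "clock (tick (bsize [V vd *. V vd *. V ve <. V vhi] + 1) s') \<le> clock s + 100 * c + 100"
   using c(3) by simp
  ultimately show ?case
   using last[OF c(4)] unfolding v_def tick_simps by blast
 next
  case (4 s')
  then show ?case
   by simp
 qed
qed

text \<open>For \<open>d \<le> W\<close> at most one class of cofactors modulo \<open>W\<close>
  leads into the progression, which saves a factor \<open>W\<close>. For larger \<open>d\<close> the
  multiples of \<open>d^2\<close> are so sparse that all cofactors can be tried.\<close>

definition stride :: "int \<Rightarrow> int" where
 "stride d = (if d \<le> W then W else 1)"

definition square_cost :: "int \<Rightarrow> nat" where
 "square_cost d = 100 * nat (stride d) + 100 * nat ((A * T) div (d * d * stride d)) + 1000"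

lemma stride: "1 \<le> stride d" "stride d \<le> W" "stride d dvd W"
 using W by (auto simp: stride_def)

text \<open>A product \<open>d^2 * z\<close> congruent to the unit \<open>lo\<close> makes
  \<open>d^2\<close> a unit modulo \<open>W\<close>, so \<open>z\<close> is determined.\<close>

lemma card_stride_le_1:
 assumes "coprime lo W"
 shows "card {z \<in> {0..<stride d}. stride d dvd d * d * z - lo} \<le> 1"
proof -
 let ?S = "{z \<in> {0..<stride d}. stride d dvd d * d * z - lo}"
 have "finite ?S"
  by (rule finite_subset[of _ "{0..<stride d}"]) auto
 moreover have "z = z'" if z: "z \<in> ?S" "z' \<in> ?S" for z z'
 proof (cases "d \<le> W")
  case True
  then have st: "stride d = W"
   by (simp add: stride_def)
  have "(d * d * z) mod W = lo mod W"
   using z(1) st by (simp add: mod_eq_dvd_iff)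
  then have "coprime (d * d * z) W"
   using assms by (metis coprime_iff_gcd_eq_1 gcd_red_int gcd.commute)
  then have "coprime W (d * d)"
   by (simp add: coprime_commute)
  moreover have "W dvd (d * d * z - lo) - (d * d * z' - lo)"
   by (rule dvd_diff) (use z st in auto)
  then have "W dvd (d * d) * (z - z')"
   by (simp add: algebra_simps)
  ultimately have "W dvd z - z'"
   using coprime_dvd_mult_right_iff by blast
  with z st show ?thesis
   by (auto intro: eq_if_dvd_diff)
 next
  case False
  with z show ?thesis
   by (simp add: stride_def)
 qed
 ultimately show ?thesis
  using card_le_Suc0_iff_eq[of ?S] by auto
qed

lemma total_clear_square:
 assumes env: "env s" and d: "var s vd = d" "2 \<le> d" and st: "var s vst = stride d" and cop: "coprime lo W"
 shows "total clear_square (\<lambda>s'.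
  (\<forall>i. bits s' i \<longleftrightarrow> bits s i \<and> \<not> (\<exists>v. d * d dvd v \<and> marks v i)) \<and>
  clock s' \<le> clock s + square_cost d) s"
proof -
 define t where "t = stride d"
 have t: "1 \<le> t" "t \<le> W" "t dvd W"
  using stride[of d] by (simp_all add: t_def)
 have dd: "0 < d * d"
  using d by simp
 define f where "f = lo div (d * d)"
 have f0: "0 \<le> f" "f \<le> lo"
  using lo dd abs_div_le[of lo "d * d"] by (auto simp: f_def pos_imp_zdiv_nonneg_iff)
 have f1: "lo < d * d * (f + 1)"
 proof -
  have "lo = d * d * f + lo mod (d * d)"
   by (simp add: f_def)
  then show ?thesis
   using pos_mod_bound[OF dd, of lo] by (simp add: algebra_simps)
 qed
 define Z where "Z x = {z \<in> {0..<t}. t dvd d * d * z - lo \<and> z < x}" for x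
 define C where "C = 100 * nat ((A * T) div (d * d * t)) + 500"
 define M where "M x i \<longleftrightarrow> (\<exists>y\<ge>0. y mod t < x \<and> marks (d * d * y) i)" for x i
 have finZ: "finite (Z x)" for x
  by (rule finite_subset[of _ "{0..<t}"]) (auto simp: Z_def)
 have cardZ: "card (Z t) \<le> 1"
  using card_stride_le_1[OF cop, of d] card_mono[of "{z \<in> {0..<t}. t dvd d * d * z - lo}" "Z t"]
  by (force simp: Z_def t_def intro: finite_subset[of _ "{0..<t}"])
 have ntv: "t dvd v - lo" if "A dvd v - lo" for v
  using that t(3) A(2) dvd_trans by blast
 \<comment> \<open>Starting at the member of the class near \<open>lo div d^2\<close> loses nothing,
   since smaller cofactors give values below \<open>lo\<close>.\<close>
 have start: "(\<exists>n. marks (d * d * (x + t * (f div t) + t * int n)) i) \<longleftrightarrow> (\<exists>y\<ge>0. y mod t = x \<and> marks (d * d * y) i)"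
  if x: "0 \<le> x" "x < t" for x i
 proof
  assume "\<exists>n. marks (d * d * (x + t * (f div t) + t * int n)) i"
  then obtain n where n: "marks (d * d * (x + t * (f div t) + t * int n)) i"
   by blast
  let ?y = "x + t * (f div t) + t * int n"
  have "?y = x + t * (f div t + int n)"
   by (simp add: algebra_simps)
  then have "?y mod t = x"
   using x by simp
  moreover have "0 \<le> ?y"
   using x t f0 by (simp add: pos_imp_zdiv_nonneg_iff)
  ultimately show "\<exists>y\<ge>0. y mod t = x \<and> marks (d * d * y) i"
   using n by blast
 next
  assume "\<exists>y\<ge>0. y mod t = x \<and> marks (d * d * y) i"
  then obtain y where y: "0 \<le> y" "y mod t = x" "marks (d * d * y) i"
   by blast
  have "f \<le> y"
  proof (rule ccontr)
   assume "\<not> f \<le> y"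
   then have "d * d * y < d * d * f"
    using dd by (intro mult_strict_left_mono) auto
   also have "\<dots> \<le> lo"
    using pos_mod_sign[OF dd, of lo] minus_mod_eq_mult_div[of lo "d * d"] by (simp add: f_def)
   finally show False
    using y(3) by (simp add: marks_def)
  qed
  let ?e = "x + t * (f div t)"
  have "t * (f div t) \<le> f"
   using minus_mod_eq_mult_div[of f t] pos_mod_sign[of t f] t by linarith
  then have "?e - t < y"
   using \<open>f \<le> y\<close> x by linarith
  moreover have "y mod t = ?e mod t"
   using y(2) x by simp
  ultimately have le: "?e \<le> y"
   using t by (intro mod_eq_le) auto
  have "t dvd y - ?e"
   using \<open>y mod t = ?e mod t\<close> by (simp only: mod_eq_dvd_iff)
  then obtain n where n: "y - ?e = t * n"
   by blast
  with le t have "0 \<le> n"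
   using zero_le_mult_iff[of t n] by linarith
  then have "y = ?e + t * int (nat n)"
   using n by simp
  with y(3) show "\<exists>n. marks (d * d * (x + t * (f div t) + t * int n)) i"
   by metis
 qed
 have step: "M (x + 1) i \<longleftrightarrow> M x i \<or> (\<exists>y\<ge>0. y mod t = x \<and> marks (d * d * y) i)" for x i
  unfolding M_def zless_add1_eq by blast
 have none: "\<not> (\<exists>y\<ge>0. y mod t = x \<and> marks (d * d * y) i)" if x: "\<not> t dvd d * d * x - lo" for x i
 proof
  assume "\<exists>y\<ge>0. y mod t = x \<and> marks (d * d * y) i"
  then obtain y where y: "y mod t = x" "A dvd d * d * y - lo"
   by (auto simp: marks_def)
  have "t dvd d * d * y - lo"
   using ntv y(2) by blast
  moreover have "(d * d * y) mod t = (d * d * x) mod t"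
   using y(1) by (metis mod_mult_right_eq)
  ultimately show False
   using x by (metis mod_eq_dvd_iff)
 qed
 have all: "M t i \<longleftrightarrow> (\<exists>v. d * d dvd v \<and> marks v i)" for i
 proof
  assume "\<exists>v. d * d dvd v \<and> marks v i"
  then obtain y where y: "marks (d * d * y) i"
   by blast
  then have "0 < d * d * y"
   using lo by (simp add: marks_def)
  then have "0 \<le> y"
   using dd by (simp add: zero_less_mult_iff)
  with y t show "M t i"
   unfolding M_def by (intro exI[of _ y]) auto
 next
  assume "M t i"
  then show "\<exists>v. d * d dvd v \<and> marks v i"
   unfolding M_def using dvd_triv_left by blast
 qed
 \<comment> \<open>Rounding down to a multiple of the stride begins slightly before
   \<open>lo\<close>; all but two rounds fit into the length \<open>A * T\<close> of the
   segment.\<close>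
 have cnt: "100 * c + 100 \<le> C" if "c = 0 \<or> d * d * (x + t * (f div t) + t * (int c - 1)) < hi" and x: "0 \<le> x" for c x
 proof (cases "c = 0")
  case False
  then have lt: "d * d * (x + t * (f div t) + t * (int c - 1)) < hi"
   using that by blast
  have "f - t < t * (f div t)"
   using minus_mod_eq_mult_div[of f t] pos_mod_bound[of t f] t by linarith
  then have "f + 1 \<le> x + t * (f div t) + t"
   using x by linarith
  then have "d * d * (f + 1) \<le> d * d * (x + t * (f div t) + t)"
   using dd by (intro mult_left_mono) auto
  with f1 have "lo < d * d * (x + t * (f div t) + t)"
   by linarith
  moreover have "d * d * (x + t * (f div t) + t * (int c - 1)) =
    d * d * (x + t * (f div t) + t) + (int c - 2) * (d * d * t)"
   by (simp add: algebra_simps)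
  ultimately have "(int c - 2) * (d * d * t) \<le> A * T"
   using lt hi by linarith
  then have "int c - 2 \<le> (A * T) div (d * d * t)"
   using dd t by (intro int_le_divI) auto
  then show ?thesis
   by (simp add: C_def)
 qed (simp add: C_def)
 let ?I = "\<lambda>s'. 0 \<le> var s' ve0 \<and> var s' ve0 \<le> t \<and> (\<forall>i. bits s' i \<longleftrightarrow> bits s i \<and> \<not> M (var s' ve0) i) \<and>
  clock s' \<le> clock s + 2 + 50 * nat (var s' ve0) + C * card (Z (var s' ve0))"
 show ?thesis
  unfolding clear_square_def
 proof (rule total_Seq, rule total_Asg, goal_cases)
  case 3
  show ?case
  proof (rule total_While[where I = ?I and m = "\<lambda>s'. nat (t - var s' ve0)"], goal_cases)
   case 1
   have "\<not> M 0 i" for i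
    using t by (auto simp: M_def not_less)
   then show ?case
    using t by simp
  next
   case (2 s1)
   have e1: "env s1" "var s1 vd = d" "var s1 vst = t"
    using 2(2) env d st by (auto simp: frame_def env_def t_def clear_multiples_def)
   note e1' = envD[OF e1(1)]
   define x where "x = var s1 ve0"
   have x: "0 \<le> x" "x < t"
    using 2(1,3) e1 by (auto simp: x_def)
   have b1: "\<And>i. bits s1 i \<longleftrightarrow> bits s i \<and> \<not> M x i" and c1: "clock s1 \<le> clock s + 2 + 50 * nat x + C * card (Z x)"
    using 2(1) by (auto simp: x_def)
   let ?s1 = "tick (bsize [V ve0 <. V vst] + 1) s1"
   have "total (If [(V vd *. V vd *. V ve0 -. V vlo) %. V vst =. N 0]
      (Asg ve (V ve0 +. V vst *. ((V vlo /. (V vd *. V vd)) /. V vst)) ;; clear_multiples) Skip)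
     (\<lambda>s'. (\<forall>i. bits s' i \<longleftrightarrow> bits s i \<and> \<not> M (x + 1) i) \<and>
      clock s' \<le> clock s + 40 + 50 * nat x + C * card (Z (x + 1))) ?s1"
   proof (rule total_If, goal_cases)
    case 1
    then show ?case
     using e1 t by simp
   next
    case 2
    then have dv: "t dvd d * d * x - lo"
     using e1 e1' t by (simp add: dvd_eq_mod_eq_0 split: if_splits flip: x_def)
    have "Z (x + 1) = insert x (Z x)"
     using dv x by (auto simp: Z_def)
    moreover have "x \<notin> Z x"
     by (simp add: Z_def)
    ultimately have Z: "card (Z (x + 1)) = Suc (card (Z x))"
     using finZ by simp
    let ?e = "x + t * (f div t)"
    have e: "0 \<le> ?e" "?e \<le> big"
    proof -
     show "0 \<le> ?e"
      using x t f0 by (simp add: pos_imp_zdiv_nonneg_iff)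
     have "t * (f div t) \<le> f"
      using minus_mod_eq_mult_div[of f t] pos_mod_sign[of t f] t by linarith
     moreover have "lo \<le> hi"
      using hi A by simp
     ultimately show "?e \<le> big"
      using x t f0 big W by linarith
    qed
    show ?case
    proof (rule total_Seq, rule total_Asg, goal_cases)
     case 3
     show ?case
     proof (rule total_conseq[OF total_clear_multiples[where d = d and e = ?e and st = t]], goal_cases)
      case (9 s2)
      then have "\<exists>c. clock s2 \<le> clock s1 + 30 + 100 * c + 100 \<and>
        (c = 0 \<or> d * d * (?e + t * (int c - 1)) < hi)"
       by simp
      then obtain c where c: "clock s2 \<le> clock s1 + 30 + 100 * c + 100"
        "c = 0 \<or> d * d * (?e + t * (int c - 1)) < hi"
       by blast
      have "bits s2 i \<longleftrightarrow> bits s i \<and> \<not> M (x + 1) i" for i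
       using 9(1) b1 step[of x i] start[OF x, of i] by (auto simp: e1 e1' f_def simp flip: x_def)
      moreover have "clock s2 \<le> clock s + 40 + 50 * nat x + C * card (Z (x + 1))"
       using c(1) cnt[OF c(2) x(1)] c1 by (simp add: Z)
      ultimately show ?case
       by blast
     qed (use e1 e1' d t e in \<open>auto simp: env_def f_def simp flip: x_def\<close>)
    qed (use e1 e1' d t e in \<open>auto simp: f_def simp flip: x_def\<close>)
   next
    case 3
    then have dv: "\<not> t dvd d * d * x - lo"
     using e1 e1' t by (simp add: dvd_eq_mod_eq_0 split: if_splits flip: x_def)
    have "card (Z x) \<le> card (Z (x + 1))"
     by (intro card_mono finZ) (auto simp: Z_def)
    then have "C * card (Z x) \<le> C * card (Z (x + 1))"
     by simp
    then have "clock s1 \<le> clock s + 2 + 50 * nat x + C * card (Z (x + 1))"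
     using c1 by linarith
    with b1 step none[OF dv] show ?case
     by (intro total_Skip) auto
   qed
   then show ?case
   proof (rule total_Seq[OF total_conseq], goal_cases)
    case (1 s2)
    have v2: "var s2 ve0 = x" "var s2 vst = t"
     using 1(2) e1 by (auto simp: frame_def x_def clear_multiples_def)
    have nx: "nat (x + 1) = nat x + 1"
     using x by simp
    show ?case
     using 1(1) v2 x t big W R nx by (intro total_Asg) (auto simp flip: x_def)
   qed
  next
   case (3 s1)
   have e1: "var s1 vst = t"
    using 3(2) st by (auto simp: frame_def t_def clear_multiples_def)
   then have x: "var s1 ve0 = t"
    using 3(1,3) by auto
   have "C * card (Z t) \<le> C * 1"
    using cardZ by (rule mult_le_mono2)
   moreover have "clock s1 \<le> clock s + 2 + 50 * nat t + C * card (Z t)"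
    using 3(1) by (simp add: x)
   ultimately have "clock s1 \<le> clock s + 2 + 50 * nat t + C"
    by linarith
   then have "clock s1 + 5 \<le> clock s + square_cost d"
    by (simp add: square_cost_def C_def flip: t_def)
   then show ?case
    using 3(1) all by (simp add: x)
  next
   case (4 s1)
   then show ?case
    by simp
  qed
 qed (use big W R in auto)
qed

lemma total_clear_squareful:
 assumes env: "env s" and cop: "coprime lo W"
 shows "total clear_squareful (\<lambda>s'.
  (\<forall>i. bits s' i \<longleftrightarrow> bits s i \<and> \<not> (\<exists>v d. 2 \<le> d \<and> d * d dvd v \<and> marks v i)) \<and>
  clock s' \<le> clock s + 20 + (\<Sum>d = 2..<R + 2. square_cost d + 50)) s"
 unfolding clear_squareful_def
proof (rule total_Seq, rule total_Asg, goal_cases)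
 case 3
 let ?I = "\<lambda>s'. 2 \<le> var s' vd \<and> var s' vd \<le> R + 2 \<and>
  (\<forall>i. bits s' i \<longleftrightarrow> bits s i \<and> \<not> (\<exists>v d. 2 \<le> d \<and> d < var s' vd \<and> d * d dvd v \<and> marks v i)) \<and>
  clock s' \<le> clock s + 2 + (\<Sum>d = 2..<var s' vd. square_cost d + 50)"
 show ?case
 proof (rule total_While[where I = ?I and m = "\<lambda>s'. nat (hi - var s' vd)"], goal_cases)
  case 1
  show ?case
   using R by auto
 next
  case (2 s1)
  have e1: "env s1"
   using 2(2) env by (auto simp: frame_def env_def clear_square_def clear_multiples_def)
  note e1' = envD[OF e1]
  define d where "d = var s1 vd"
  have d: "2 \<le> d" "d * d < hi"
   using 2(1,3) e1' by (auto simp: d_def)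
  have b1: "\<And>i. bits s1 i \<longleftrightarrow> bits s i \<and> \<not> (\<exists>v d'. 2 \<le> d' \<and> d' < d \<and> d' * d' dvd v \<and> marks v i)"
   and c1: "clock s1 \<le> clock s + 2 + (\<Sum>d = 2..<d. square_cost d + 50)"
   using 2(1) by (auto simp: d_def)
  have dR: "d < R"
  proof (rule ccontr)
   assume "\<not> d < R"
   then have "R * R \<le> d * d"
    using R by (intro mult_mono) auto
   with d R show False
    by linarith
  qed
  have "1 * d \<le> d * d"
   using d by (intro mult_right_mono) auto
  then have dhi: "d < hi"
   using d by linarith
  let ?s1 = "tick (bsize [V vd *. V vd <. V vhi] + 1) s1"
  have "total (If [V vd <. V vW +. N 1] (Asg vst (V vW)) (Asg vst (N 1)))
    (\<lambda>s'. var s' vst = stride d \<and> bits s' = bits s1 \<and> clock s' \<le> clock s1 + 20) ?s1"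
   using e1' W big R by (intro total_intros) (auto simp: stride_def d_def)
  then show ?case
  proof (rule total_Seq[OF total_conseq], goal_cases)
   case (1 s2)
   have e2: "env s2" "var s2 vd = d"
    using 1(2) e1 by (auto simp: frame_def env_def d_def)
   show ?case
   proof (rule total_Seq, rule total_conseq[OF total_clear_square[OF e2 d(1) _ cop]], goal_cases)
    case 1
    show ?case
     using 1 \<open>var s2 vst = stride d \<and> bits s2 = bits s1 \<and> clock s2 \<le> clock s1 + 20\<close> by blast
   next
    case (2 s3)
    have v3: "var s3 vd = d"
     using 2(2) e2 by (auto simp: frame_def clear_square_def clear_multiples_def)
    have set: "{2..<d + 1} = insert d {2..<d}"
     using d by auto
    have "bits s3 i \<longleftrightarrow> bits s i \<and> \<not> (\<exists>v d'. 2 \<le> d' \<and> d' < d + 1 \<and> d' * d' dvd v \<and> marks v i)" for i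
    proof -
     have "(\<exists>v d'. 2 \<le> d' \<and> d' < d + 1 \<and> d' * d' dvd v \<and> marks v i) \<longleftrightarrow>
       (\<exists>v d'. 2 \<le> d' \<and> d' < d \<and> d' * d' dvd v \<and> marks v i) \<or> (\<exists>v. d * d dvd v \<and> marks v i)"
      unfolding zless_add1_eq using d(1) by blast
     then show ?thesis
      using 2(1) b1[of i] 1(1) by auto
    qed
    moreover have "clock s3 \<le> clock s + 40 + (\<Sum>d = 2..<d. square_cost d + 50) + square_cost d"
     using 2(1) c1 1(1) by simp
    ultimately show ?case
     using v3 d dR dhi big W R
     by (intro total_Asg) (auto simp: set simp flip: d_def)
   qed
  qed
 next
  case (3 s1)
  have e1: "env s1"
   using 3(2) env by (auto simp: frame_def env_def clear_square_def clear_multiples_def)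
  define d where "d = var s1 vd"
  have d: "2 \<le> d" "hi \<le> d * d" "d \<le> R + 2"
   using 3(1,3) envD[OF e1] by (auto simp: d_def)
  have "d' < d" if "2 \<le> d'" "d' * d' dvd v" "marks v i" for d' v i
  proof (rule ccontr)
   assume "\<not> d' < d"
   then have "d * d \<le> d' * d'"
    using d by (intro mult_mono) auto
   moreover have "d' * d' \<le> v"
    using that lo by (intro zdvd_imp_le) (auto simp: marks_def)
   ultimately show False
    using that(3) d by (simp add: marks_def)
  qed
  then have "(\<exists>v d'. 2 \<le> d' \<and> d' < d \<and> d' * d' dvd v \<and> marks v i) \<longleftrightarrow> (\<exists>v d. 2 \<le> d \<and> d * d dvd v \<and> marks v i)" for i
   by blast
  moreover have "(\<Sum>d = 2..<d. square_cost d + 50) \<le> (\<Sum>d = 2..<R + 2. square_cost d + 50)"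
   using d by (intro sum_mono2) auto
  ultimately show ?case
   using 3(1) by (simp flip: d_def)
 next
  case (4 s1)
  then show ?case
   by simp
 qed
qed (use big W R in auto)

lemma sum_stride_le: "(\<Sum>d = 2..<int m + 2. stride d) \<le> W * W + int m"
proof -
 have "(\<Sum>d = 2..<int m + 2. stride d) \<le> (\<Sum>d = 2..<int m + 2. (if d \<le> W then W else 0) + 1)"
  using W by (intro sum_mono) (auto simp: stride_def)
 also have "\<dots> = (\<Sum>d = 2..<int m + 2. if d \<le> W then W else 0) + int m"
  by (simp add: sum.distrib)
 also have "(\<Sum>d = 2..<int m + 2. if d \<le> W then W else 0) \<le> (\<Sum>d \<in> {1..W}. W)"
  using W by (simp only: sum.inter_filter[symmetric] finite_atLeastLessThan_int) (intro sum_mono2, auto)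
 finally show ?thesis
  using W by simp
qed

text \<open>Telescoping with \<open>1 / d^2 \<le> 1 / (d - 1) - 1 / d\<close>. The potential
  \<open>\<psi>\<close> follows \<open>c / (w x)\<close> up to \<open>w\<close> and
  \<open>c / x\<close> beyond; the offset \<open>c / w\<close> in the first range lifts its end to
  the value \<open>c / w\<close> at which the second begins. Since \<open>\<psi>\<close> is
  \<open>2 c / w\<close> at 1, the large squares cost no more than those handled with stride
  \<open>W\<close>.\<close>

lemma sum_square_cost_le:
 "real (\<Sum>d = 2..<int m + 2. square_cost d + 50) \<le>
  1150 * real m + 100 * real_of_int (\<Sum>d = 2..<int m + 2. stride d) + 200 * (real_of_int (A * T) / real_of_int W)"
proof -
 define c w where "c = real_of_int (A * T)" and "w = real_of_int W"
 have c: "0 \<le> c"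
  using A hi by (simp add: c_def)
 have w: "1 \<le> w"
  using W by (simp add: w_def)
 define \<psi> where "\<psi> x = (if x \<le> w then c / w * (1 / x) + c / w else c / x)" for x :: real
 have psi: "real (nat ((A * T) div (d * d * stride d))) \<le> \<psi> (real_of_int d - 1) - \<psi> (real_of_int d)"
  if d: "2 \<le> d" for d
 proof -
  define x where "x = real_of_int d"
  have x: "2 \<le> x"
   using d by (simp add: x_def)
  have "0 \<le> (A * T) div (d * d * stride d)"
   using A hi d stride[of d] by (simp add: pos_imp_zdiv_nonneg_iff)
  then have "real (nat ((A * T) div (d * d * stride d))) = real_of_int ((A * T) div (d * d * stride d))"
   by simp
  also have "\<dots> \<le> c / (x * x * real_of_int (stride d))"
   using real_of_int_div4[of "A * T" "d * d * stride d"] by (simp add: c_def x_def)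
  also have "\<dots> = c / real_of_int (stride d) * (1 / (x * x))"
   by simp
  also have "\<dots> \<le> c / real_of_int (stride d) * (1 / (x - 1) - 1 / x)"
   using x c stride[of d] by (intro mult_left_mono) (auto simp: field_simps)
  also have "\<dots> \<le> \<psi> (x - 1) - \<psi> x"
  proof (cases "d \<le> W")
   case True
   then have "x \<le> w" "real_of_int (stride d) = w"
    by (simp_all add: x_def w_def stride_def)
   then show ?thesis
    by (simp add: \<psi>_def algebra_simps)
  next
   case False
   then have xw: "w < x" "real_of_int (stride d) = 1"
    by (simp_all add: x_def w_def stride_def)
   show ?thesis
   proof (cases "x - 1 \<le> w")
    case True
    then have "d = W + 1"
     using False by (simp add: x_def w_def)
    then have "x - 1 = w"
     by (simp add: x_def w_def)
    then show ?thesis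
     using xw c w by (simp add: \<psi>_def right_diff_distrib)
   next
    case False
    then show ?thesis
     using xw by (simp add: \<psi>_def right_diff_distrib)
   qed
  qed
  finally show ?thesis
   by (simp add: x_def)
 qed
 have "real (\<Sum>d = 2..<int m + 2. square_cost d + 50) \<le>
  1150 * real m + 100 * real_of_int (\<Sum>d = 2..<int m + 2. stride d) + 100 * (\<psi> 1 - \<psi> (real m + 1))"
 proof (induction m)
  case (Suc m)
  have set: "{2..<int m + 3} = insert (int m + 2) {2..<int m + 2}"
   by auto
  have "real (square_cost (int m + 2)) \<le> 1000 + 100 * real_of_int (stride (int m + 2)) +
    100 * (\<psi> (real m + 1) - \<psi> (real m + 2))"
   using psi[of "int m + 2"] stride[of "int m + 2"] by (simp add: square_cost_def add.commute)
  then show ?case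
   using Suc.IH by (simp add: set add.commute)
 qed simp
 moreover have "0 \<le> \<psi> (real m + 1)"
  using c w by (simp add: \<psi>_def)
 moreover have "\<psi> 1 = 2 * (c / w)"
  using w by (simp add: \<psi>_def)
 ultimately show ?thesis
  by (simp add: c_def w_def)
qed

end

lemma pattern_input_nth:
 assumes "length P = k"
 shows "length (pattern_input k P n) = 2 + 2 * k"
  and "pattern_input k P n ! 0 = int n" "pattern_input k P n ! 1 = int k"
  and "i < k \<Longrightarrow> pattern_input k P n ! (2 + 2 * i) = coeff (P ! i) 1"
  and "i < k \<Longrightarrow> pattern_input k P n ! (3 + 2 * i) = coeff (P ! i) 0"
proof -
 have len: "length (concat (map (\<lambda>f. [coeff f 1, coeff f 0]) Q)) = 2 * length Q" for Q :: "int poly list"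
  by (induction Q) auto
 have nth: "concat (map (\<lambda>f. [coeff f 1, coeff f 0]) Q) ! (2 * i) = coeff (Q ! i) 1 \<and>
   concat (map (\<lambda>f. [coeff f 1, coeff f 0]) Q) ! (2 * i + 1) = coeff (Q ! i) 0"
  if "i < length Q" for i and Q :: "int poly list"
  using that
 proof (induction Q arbitrary: i)
  case (Cons f Q)
  then show ?case
   by (cases i) auto
 qed simp
 show "length (pattern_input k P n) = 2 + 2 * k"
  using len[of P] assms by (simp add: pattern_input_def)
 show "pattern_input k P n ! 0 = int n" "pattern_input k P n ! 1 = int k"
  by (simp_all add: pattern_input_def)
 show "pattern_input k P n ! (2 + 2 * i) = coeff (P ! i) 1" if "i < k"
  using nth[of i P] that assms by (simp add: pattern_input_def)
 show "pattern_input k P n ! (3 + 2 * i) = coeff (P ! i) 0" if "i < k"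
  using nth[of i P] that assms by (simp add: pattern_input_def numeral_3_eq_3)
qed

text \<open>As \<open>8 dvd W\<close>, all values of the progression agree with \<open>lo\<close>
  modulo 8 and share its form. A slot is flipped once for each representation of its value, and
  values with a square factor have been cleared, so the parity criterion applies.\<close>

lemma (in segment) sieved_bit:
 assumes cop: "coprime lo W" and W8: "8 dvd W" and lo1: "1 < lo"
  and \<gamma>: "\<gamma> = form_gamma lo" and \<epsilon>: "\<epsilon> = form_epsilon lo"
  and clear: "\<And>j. 0 \<le> j \<Longrightarrow> j < T \<Longrightarrow> \<not> m (nat (q + j))"
  and m': "\<And>i. m' i \<longleftrightarrow> toggled m {p \<in> pts. hits p} slot_of i \<and> \<not> (\<exists>v d. 2 \<le> d \<and> d * d dvd v \<and> marks v i)"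
 shows "0 \<le> j \<Longrightarrow> j < T \<Longrightarrow> m' (nat (q + j)) \<longleftrightarrow> prime (lo + A * j)"
  and "(\<And>j. 0 \<le> j \<Longrightarrow> j < T \<Longrightarrow> i \<noteq> nat (q + j)) \<Longrightarrow> m' i = m i"
proof -
 have q0: "0 \<le> q"
  using address by linarith
 have slot: "slot v = nat (q + j) \<longleftrightarrow> v = lo + A * j" if d: "A dvd v - lo" "lo \<le> v" "0 \<le> j" for v j
 proof -
  obtain t where t: "v - lo = A * t"
   using d(1) by blast
  have t0: "0 \<le> t"
   using t d(2) A zero_le_mult_iff[of A t] by linarith
  have "slot v = nat (q + t)"
   using A by (simp add: slot_def t)
  then have "slot v = nat (q + j) \<longleftrightarrow> t = j"
   using q0 t0 d(3) by auto
  also have "\<dots> \<longleftrightarrow> v = lo + A * j"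
   using t A by auto
  finally show ?thesis .
 qed
 show "m' (nat (q + j)) \<longleftrightarrow> prime (lo + A * j)" if j: "0 \<le> j" "j < T"
 proof -
  define v where "v = lo + A * j"
  have v: "lo \<le> v" "v < hi" "A dvd v - lo"
   using j A hi by (auto simp: v_def)
  have "W dvd v - lo"
   using v(3) A(2) dvd_trans by blast
  then have "v mod W = lo mod W"
   by (simp add: mod_eq_dvd_iff)
  then have copv: "coprime v W"
   using cop by (metis coprime_iff_gcd_eq_1 gcd_red_int gcd.commute)
  have "8 dvd v - lo"
   using \<open>W dvd v - lo\<close> W8 dvd_trans by blast
  then have v8: "v mod 8 = lo mod 8"
   by (simp add: mod_eq_dvd_iff)
  have "odd v"
  proof
   assume "even v"
   moreover have "even W"
    using W8 by (metis dvd_trans even_numeral)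
   ultimately have "is_unit (2 :: int)"
    using copv by (metis coprime_common_divisor)
   then show False
    by simp
  qed
  have "{p \<in> {p \<in> pts. hits p}. slot_of p = nat (q + j)} = reps \<gamma> \<epsilon> v"
  proof (intro equalityI subsetI)
   fix p assume "p \<in> {p \<in> {p \<in> pts. hits p}. slot_of p = nat (q + j)}"
   then show "p \<in> reps \<gamma> \<epsilon> v"
    using slot[of "form' (fst p) (snd p)" j] j
    by (auto simp: points_def hits_def slot_of_def reps_def v_def)
  next
   fix p assume "p \<in> reps \<gamma> \<epsilon> v"
   then show "p \<in> {p \<in> {p \<in> pts. hits p}. slot_of p = nat (q + j)}"
    using slot[OF v(3,1) j(1)] v by (auto simp: points_def hits_def slot_of_def reps_def v_def)
  qed
  then have "toggled m {p \<in> pts. hits p} slot_of (nat (q + j)) \<longleftrightarrow> odd (card (reps \<gamma> \<epsilon> v))"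
   using clear[OF j] by (simp add: toggled_def)
  moreover have "(\<exists>v' d. 2 \<le> d \<and> d * d dvd v' \<and> marks v' (nat (q + j))) \<longleftrightarrow> (\<exists>d\<ge>2. d * d dvd v)"
   using slot j v unfolding marks_def v_def by metis
  moreover have "(\<exists>d\<ge>2. d * d dvd v) \<longleftrightarrow> \<not> squarefree v"
  proof
   assume "\<exists>d\<ge>2. d * d dvd v"
   then obtain d :: int where "2 \<le> d" "d * d dvd v"
    by blast
   then show "\<not> squarefree v"
    unfolding squarefree_def by (intro notI) (auto simp: power2_eq_square dest!: spec[of _ d])
  next
   assume "\<not> squarefree v"
   then obtain d where d: "d\<^sup>2 dvd v" "\<not> is_unit d"
    by (auto simp: squarefree_def)
   have "d \<noteq> 0"
    using d(1) v lo1 by auto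
   with d have "2 \<le> \<bar>d\<bar>" "\<bar>d\<bar> * \<bar>d\<bar> dvd v"
    by (auto simp: power2_eq_square)
   then show "\<exists>d\<ge>2. d * d dvd v"
    by blast
  qed
  moreover have "prime v \<Longrightarrow> squarefree v"
   by (simp add: squarefree_prime)
  moreover have "form_gamma v = \<gamma>" "form_epsilon v = \<epsilon>"
   by (simp_all add: form_gamma_def form_epsilon_def v8 \<gamma> \<epsilon>)
  ultimately show ?thesis
   using m'[of "nat (q + j)"] prime_iff_odd_reps[OF \<open>odd v\<close>] order.strict_trans2[OF lo1 v(1)]
   unfolding v_def[symmetric] by metis
 qed
 show "m' i = m i" if i: "\<And>j. 0 \<le> j \<Longrightarrow> j < T \<Longrightarrow> i \<noteq> nat (q + j)"
 proof -
  have ns: "slot v \<noteq> i" if v: "lo \<le> v" "v < hi" for v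
  proof -
   have "0 \<le> (v - lo) div A" "(v - lo) div A < T"
    using v A hi by (auto simp: pos_imp_zdiv_nonneg_iff mult.commute intro: int_div_lessI)
   then show ?thesis
    using i by (auto simp: slot_def)
  qed
  have "{p \<in> {p \<in> pts. hits p}. slot_of p = i} = {}"
   using ns by (auto simp: points_def slot_of_def)
  then have "toggled m {p \<in> pts. hits p} slot_of i = m i"
   unfolding toggled_def by (simp only: card.empty) simp
  moreover have "\<not> marks v i" for v
   using ns[of v] by (auto simp: marks_def)
  ultimately show ?thesis
   using m'[of i] by blast
 qed
qed

section \<open>Loops over the pattern\<close>

context limits
begin

declare One_nat_def [simp del]

lemma total_Seq_eq: "total (c ;; d) Q = total c (total d Q)"
proof (rule ext)
 fix s
 have "run (c ;; d) s s'' \<longleftrightarrow> (\<exists>s'. run c s s' \<and> run d s' s'')" for s''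
  by (subst run.simps) auto
 then show "total (c ;; d) Q s = total c (total d Q) s"
  unfolding total_def by blast
qed

text \<open>Sequencing associates to the right; regrouping lets a lemma about the first three
  commands apply.\<close>

lemma total_Seq_3: "total (a ;; b ;; c ;; d) Q s \<longleftrightarrow> total (a ;; b ;; c) (total d Q) s"
 by (simp add: total_Seq_eq)

lemma total_Seq_2: "total (a ;; b ;; d) Q s \<longleftrightarrow> total (a ;; b) (total d Q) s"
 by (simp add: total_Seq_eq)

text \<open>A conjunction over the pattern, accumulated in the flag \<open>vok\<close>; shared by
  the residue test, the trial division of a candidate and the report.\<close>

lemma total_all_loop:
 assumes k: "var s vk = int k" "int k < big" and fr: "vk \<notin> assigned c" "vi \<in> assigned c" "vok \<in> assigned c"
  and body: "\<And>s' i. frame c s s' \<Longrightarrow> i < k \<Longrightarrow> var s' vi = int i \<Longrightarrow>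
   total c (\<lambda>s''. var s'' vi = int i + 1 \<and> (var s'' vok = 1 \<longleftrightarrow> var s' vok = 1 \<and> G i) \<and> clock s'' \<le> clock s' + t) s'"
 shows "total (Asg vok (N 1) ;; Asg vi (N 0) ;; While [V vi <. V vk] c)
  (\<lambda>s'. (var s' vok = 1 \<longleftrightarrow> (\<forall>i<k. G i)) \<and> clock s' \<le> clock s + 10 + k * (t + 5)) s"
proof (rule total_Seq, rule total_Asg, goal_cases)
 case 3
 show ?case
 proof (rule total_Seq, rule total_Asg, goal_cases)
  case 3
  let ?I = "\<lambda>s'. \<exists>i\<le>k. var s' vi = int i \<and> (var s' vok = 1 \<longleftrightarrow> (\<forall>i'<i. G i')) \<and> clock s' \<le> clock s + 4 + i * (t + 5)"
  show ?case
  proof (rule total_While[where I = ?I and m = "\<lambda>s'. nat (int k - var s' vi)"], goal_cases)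
   case 1
   show ?case
    by (auto intro!: exI[of _ 0])
  next
   case (2 s1)
   have f: "frame c s (tick 5 s1)"
    using 2(2) fr unfolding frame_def by (auto simp: fun_upd_def split: if_splits)
   have vk: "var s1 vk = int k"
    using f fr k by (auto simp: frame_def)
   obtain i where i: "i \<le> k" "var s1 vi = int i" "var s1 vok = 1 \<longleftrightarrow> (\<forall>i'<i. G i')" "clock s1 \<le> clock s + 4 + i * (t + 5)"
    using 2(1) by blast
   have ik: "i < k"
    using 2(3) i vk by simp
   have t5: "tick (bsize [V vi <. V vk] + 1) s1 = tick 5 s1"
    by simp
   have v: "var (tick 5 s1) vi = int i"
    using i by simp
   show ?case
    unfolding t5
   proof (rule total_conseq[OF body[OF f ik v]], goal_cases)
    case (1 s2)
    have "var s2 vi = int (Suc i)" "var s2 vok = 1 \<longleftrightarrow> (\<forall>i'<Suc i. G i')" "clock s2 \<le> clock s + 4 + Suc i * (t + 5)"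
     using 1 i by (auto simp: less_Suc_eq)
    moreover have "nat (int k - var s2 vi) < nat (int k - var s1 vi)"
     using 1 i ik by simp
    ultimately show ?case
     using ik by (intro conjI exI[of _ "Suc i"]) auto
   qed
  next
   case (3 s1)
   have vk: "var s1 vk = int k"
    using 3(2) fr k by (auto simp: frame_def)
   then show ?case
    using 3(1,3) by auto
  next
   case (4 s1)
   then show ?case
    by simp
  qed
 qed (use k in auto)
qed (use k in auto)

lemma total_trial_division:
 assumes m: "var s vm = m" "2 \<le> m" "m \<le> big"
 shows "total trial_division (\<lambda>s'. (var s' ve = m \<longleftrightarrow> prime m) \<and> clock s' \<le> clock s + 20 + 12 * nat m) s"
 unfolding trial_division_def
proof (rule total_Seq, rule total_Asg, goal_cases)
 case 3
 let ?I = "\<lambda>s'. 2 \<le> var s' ve \<and> var s' ve \<le> m \<and> (\<forall>d. 2 \<le> d \<and> d < var s' ve \<longrightarrow> \<not> d dvd m) \<and>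
  clock s' \<le> clock s + 2 + 12 * nat (var s' ve)"
 show ?case
 proof (rule total_While[where I = ?I and m = "\<lambda>s'. nat (m - var s' ve)"], goal_cases)
  case 1
  show ?case
   using m by auto
 next
  case (2 s1)
  have vm: "var s1 vm = m"
   using 2(2) m by (auto simp: frame_def)
  define e where "e = var s1 ve"
  have e: "2 \<le> e" "e \<le> m" "\<forall>d. 2 \<le> d \<and> d < e \<longrightarrow> \<not> d dvd m" "clock s1 \<le> clock s + 2 + 12 * nat e"
   using 2(1) by (simp_all add: e_def)
  have nd: "\<not> e dvd m"
   using 2(3) vm e(1) by (simp add: e_def dvd_eq_mod_eq_0)
  then have lt: "e < m"
   using e(2) dvd_refl[of m] by (metis order_le_less)
  have nd': "\<forall>d. 2 \<le> d \<and> d < e + 1 \<longrightarrow> \<not> d dvd m"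
  proof (intro allI impI)
   fix d assume d: "2 \<le> d \<and> d < e + 1"
   show "\<not> d dvd m"
   proof (cases "d = e")
    case True
    with nd show ?thesis
     by simp
   next
    case False
    with d have "2 \<le> d \<and> d < e"
     by linarith
    with e(3) show ?thesis
     by blast
   qed
  qed
  have n: "nat (e + 1) = nat e + 1"
   using e by simp
  have "total (incr ve) (\<lambda>s'. var s' ve = e + 1 \<and> clock s' = clock s1 + 11) (tick (bsize [N 0 <. V vm %. V ve] + 1) s1)"
   by (rule total_Asg) (use e(1) lt m in \<open>simp_all flip: e_def\<close>)
  then show ?case
  proof (rule total_conseq, goal_cases)
   case (1 s2)
   have ve2: "var s2 ve = e + 1"
    using 1 by simp
   show ?case
    unfolding ve2 e_def[symmetric] using 1 e(1,4) lt nd' n by simp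
  qed
 next
  case (3 s1)
  have vm: "var s1 vm = m"
   using 3(2) m by (auto simp: frame_def)
  define e where "e = var s1 ve"
  have e: "2 \<le> e" "e \<le> m" "\<forall>d. 2 \<le> d \<and> d < e \<longrightarrow> \<not> d dvd m" "clock s1 \<le> clock s + 2 + 12 * nat e"
   using 3(1) by (simp_all add: e_def)
  have "\<not> 0 < m mod e"
   using 3(3) vm e(1) by (simp add: e_def)
  then have d: "e dvd m"
   using e(1) pos_mod_sign[of e m] by (intro mod_0_imp_dvd) linarith
  have "e = m \<longleftrightarrow> prime m"
  proof
   assume "e = m"
   then show "prime m"
    using e(3) m(2) by (simp add: prime_int_iff')
  next
   assume "prime m"
   then have "e \<notin> {2..<m}"
    using d unfolding prime_int_iff' by blast
   then show "e = m"
    using e(1,2) by simp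
  qed
  moreover have "nat e \<le> nat m"
   using e by simp
  moreover have "clock s1 + 7 \<le> clock s + 20 + 12 * nat m"
   using e(4) calculation(2) by linarith
  ultimately show ?case
   by (simp flip: e_def)
 next
  case (4 s1)
  then show ?case
   by auto
 qed
qed (use m in auto)

end

text \<open>The lower bound 8 on \<open>K\<close> ensures that \<open>K \<le> H\<close> leaves room
  for the smallest wheel.\<close>

locale pattern_search = limits "pattern_input k P n" big l u for k P n big l u +
 fixes K :: int
 assumes pattern: "is_pattern k P"
  and K_ge: "\<And>i. i < k \<Longrightarrow> \<bar>coeff (P ! i) 1\<bar> \<le> K" "\<And>i. i < k \<Longrightarrow> \<bar>coeff (P ! i) 0\<bar> \<le> K" "int k \<le> K" "8 \<le> K"
begin

lemma len: "length P = k" "0 < k"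
 using pattern by (simp_all add: is_pattern_def)

abbreviation "f i x \<equiv> poly (P ! i) x"

lemma degree_1: "i < k \<Longrightarrow> degree (P ! i) = 1 \<and> 0 < lead_coeff (P ! i)"
 using pattern nth_mem[of i P] unfolding is_pattern_def by blast

lemma coeff_pos: "i < k \<Longrightarrow> 1 \<le> coeff (P ! i) 1"
proof -
 assume "i < k"
 then have "degree (P ! i) = 1" "0 < lead_coeff (P ! i)"
  using degree_1 by blast+
 then show ?thesis
  by simp
qed

lemma f_eq: "i < k \<Longrightarrow> f i x = coeff (P ! i) 1 * x + coeff (P ! i) 0"
 using degree_1[of i] by (intro poly_degree_1) blast

lemma input: "length (pattern_input k P n) = 2 + 2 * k"
 "pattern_input k P n ! 0 = int n" "pattern_input k P n ! 1 = int k"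
 "i < k \<Longrightarrow> pattern_input k P n ! (2 + 2 * i) = coeff (P ! i) 1"
 "i < k \<Longrightarrow> pattern_input k P n ! (3 + 2 * i) = coeff (P ! i) 0"
 using pattern_input_nth[OF len(1)] by blast+

lemma total_read_poly:
 assumes "var s vi = int i" "i < k"
 shows "total read_poly (\<lambda>s'. s' = tick 12 (set_var vb (coeff (P ! i) 0) (set_var va (coeff (P ! i) 1) s))) s"
proof -
 have n: "nat (2 + 2 * int i) = 2 + 2 * i" "nat (3 + 2 * int i) = 3 + 2 * i"
  by simp_all
 show ?thesis
  unfolding read_poly_def
  by (intro total_intros) (use assms in \<open>auto simp: input(1) n input(4,5)[OF assms(2), simplified] tick_def set_var_def\<close>)
qed

definition good :: "int \<Rightarrow> bool" where
 "good x \<longleftrightarrow> (\<forall>i<k. prime (f i x) \<and> f i x \<le> int n)"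

text \<open>The first polynomial alone confines \<open>x\<close>: its slope is at least 1, its
  constant term at most \<open>K\<close> in absolute value, and its value lies between 2 and
  \<open>n\<close>.\<close>

lemma good_le:
 assumes "good x"
 shows "x \<le> int n + K" "- K < x"
proof -
 define a b where "a = coeff (P ! 0) 1" and "b = coeff (P ! 0) 0"
 have ab: "1 \<le> a" "a \<le> K" "\<bar>b\<bar> \<le> K"
  using coeff_pos[OF len(2)] K_ge(1,2)[OF len(2)] by (auto simp: a_def b_def)
 have v: "a * x + b \<le> int n" "2 \<le> a * x + b"
  using assms len(2) prime_ge_2_int f_eq[OF len(2), of x] by (auto simp: good_def a_def b_def)
 show "x \<le> int n + K"
 proof (cases "0 \<le> x")
  case True
  then have "1 * x \<le> a * x"
   using ab by (intro mult_right_mono) auto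
  then show ?thesis
   using v ab by linarith
 qed (use K_ge(4) in auto)
 show "- K < x"
 proof (rule ccontr)
  assume x: "\<not> - K < x"
  then have "a * x \<le> 1 * x"
   using ab K_ge(4) by (intro mult_right_mono_neg) auto
  with x v ab show False
   by linarith
 qed
qed

end

section \<open>The sieve\<close>

text \<open>\<open>T\<close> will be \<open>H^8\<close>, and 65536 comes from
  \<open>n < (H + 1)^16 \<le> (2 H)^16 = 2^16 T^2\<close>. Values are at most about
  \<open>65536 K T^2\<close>, and 300 is chosen so that \<open>R^2 = 90000 K^2 T^2\<close> covers
  them together with the overhang of the last segment.\<close>

locale search = pattern_search k P n big l u K for k P n big l u K +
 fixes H W T base R :: int and NN :: nat
 assumes K_le: "K \<le> H"
  and W8: "8 dvd W" and W: "8 \<le> W" "W \<le> H"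
  and T: "H \<le> T" "int n \<le> 65536 * (T * T)"
  and R: "R = 300 * (K * T)"
  and base: "int l \<le> base" "base + int k * T \<le> int u"
  and big: "10 * (R * R + int u + int n) \<le> big"
  and NN: "\<And>\<gamma> \<epsilon> \<rho>. (\<gamma>, \<epsilon>) \<in> forms \<Longrightarrow> coprime \<rho> W \<Longrightarrow> card (reps_mod \<gamma> \<epsilon> \<rho> W) \<le> NN"
begin

lemmas K = K_ge K_le

lemma basic: "1 \<le> T" "1 \<le> K * T" "T \<le> R" "K \<le> R" "W \<le> R" "R \<le> R * R" "0 \<le> K * T" "int k * T \<le> R"
proof -
 show T1: "1 \<le> T"
  using T W by linarith
 have "1 * 1 \<le> K * T"
  using T1 K by (intro mult_mono) auto
 then show "1 \<le> K * T" "0 \<le> K * T"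
  by simp_all
 have "1 * T \<le> K * T" "K * 1 \<le> K * T" "int k * T \<le> K * T"
  using T1 K by (auto intro!: mult_mono)
 then show "T \<le> R" "K \<le> R" "W \<le> R" "int k * T \<le> R"
  using R T1 T W K by linarith+
 then show "R \<le> R * R"
  using T1 by (simp add: mult_le_cancel_left1)
qed

lemma big_bounds: "R * R + 4 * R \<le> big" "R + 4 * R \<le> big" "int u \<le> big" "10 \<le> big" "2 * int n + 4 * R + int u \<le> big"
proof -
 define Q where "Q = R * R"
 have "0 \<le> int u" "0 \<le> int n" "10 * Q + 10 * int u + 10 * int n \<le> big" "R \<le> Q" "1 \<le> R"
  using big basic by (simp_all add: Q_def)
 then have "Q + 4 * R \<le> big \<and> R + 4 * R \<le> big \<and> int u \<le> big \<and> 10 \<le> big \<and> 2 * int n + 4 * R + int u \<le> big"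
  by (intro conjI; linarith)
 then show "R * R + 4 * R \<le> big" "R + 4 * R \<le> big" "int u \<le> big" "10 \<le> big" "2 * int n + 4 * R + int u \<le> big"
  by (simp_all add: Q_def)
qed

lemma big_sum: "10 * (R * R) + 10 * int u + 10 * int n \<le> big" "0 \<le> int u" "0 \<le> int n" "0 \<le> R * R"
 using big by simp_all

text \<open>The lower bound puts every sieved value above \<open>W\<close>, so that a prime value
  cannot divide the wheel. The upper bound covers the whole segment that begins at \<open>x\<close>,
  including the part whose values exceed \<open>n\<close>.\<close>

lemma value_bounds:
 assumes i: "i < k" and x: "W * H \<le> x" "x \<le> int n + K"
 shows "2 * H < f i x" "f i x + coeff (P ! i) 1 * W * T \<le> R * R"
proof -
 define a b where "a = coeff (P ! i) 1" and "b = coeff (P ! i) 0"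
 have ab: "1 \<le> a" "a \<le> K" "\<bar>b\<bar> \<le> K"
  using coeff_pos[OF i] K(1,2)[OF i] by (auto simp: a_def b_def)
 have "8 * H \<le> W * H"
  using W K by (intro mult_right_mono) auto
 then have x8: "8 * H \<le> x"
  using x by linarith
 have "1 * x \<le> a * x"
  using ab x8 K by (intro mult_right_mono) auto
 then show "2 * H < f i x"
  unfolding f_eq[OF i] a_def[symmetric] b_def[symmetric] using ab x8 K by linarith
 have "a * x \<le> K * (65536 * (T * T) + T)"
  using ab x8 x T K by (intro mult_mono) auto
 moreover have "a * W * T \<le> K * T * T"
  using ab W T K basic by (intro mult_mono mult_nonneg_nonneg) auto
 moreover have "K * T \<le> K * (T * T)" "K \<le> K * (T * T)" "K * (T * T) \<le> K * K * (T * T)"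
 proof -
  have T1: "1 \<le> T * T" "T \<le> T * T"
   using basic mult_mono[of 1 T 1 T] by (auto simp: mult_le_cancel_left1)
  have "K * 1 \<le> K * (T * T)"
   using T1 K by (intro mult_left_mono) auto
  moreover have "1 * (K * (T * T)) \<le> K * (K * (T * T))"
   using T1 K by (intro mult_right_mono) auto
  ultimately show "K * T \<le> K * (T * T)" "K \<le> K * (T * T)" "K * (T * T) \<le> K * K * (T * T)"
   using T1 K by (auto intro: mult_left_mono)
 qed
 moreover have "R * R = 90000 * (K * K * (T * T))"
  by (simp add: R)
 moreover have "K * (65536 * (T * T) + T) = 65536 * (K * (T * T)) + K * T" "K * T * T = K * (T * T)"
  by (simp_all add: algebra_simps)
 ultimately show "f i x + coeff (P ! i) 1 * W * T \<le> R * R"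
  unfolding f_eq[OF i] a_def[symmetric] b_def[symmetric] using ab by linarith
qed

text \<open>Counted from 0 upwards, so that the points on one segment are a difference of two counts
  and the costs of consecutive segments telescope.\<close>

definition low_points :: "nat \<Rightarrow> int \<Rightarrow> int \<Rightarrow> (int \<times> int) set" where
 "low_points i r v = {p \<in> points (form_gamma (f i r)) (form_epsilon (f i r)) 0 v.
  W dvd form (form_gamma (f i r)) (form_epsilon (f i r)) (fst p) (snd p) - f i r}"

definition poly_cost :: nat where
 "poly_cost = 500 + 100 * (nat W + 1) * (nat W + 1) + 1000 * (nat (R div W) + 2) * NN + 1250 * nat R +
  100 * (nat W * nat W) + 200 * nat (K * T)"

lemma form_class: "0 \<le> form_gamma v" "1 \<le> form_epsilon v" "(form_gamma v, form_epsilon v) \<in> forms"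
 by (auto simp: form_gamma_def form_epsilon_def forms_def)

lemma f_cong: "x mod W = r mod W \<Longrightarrow> f i x mod W = f i r mod W"
 by (rule poly_mod_cong)

lemma f_cong_8: "x mod W = r mod W \<Longrightarrow> f i x mod 8 = f i r mod 8"
 using f_cong[of x r i] W8 by (metis mod_mod_cancel)

lemma total_sieve_poly:
 assumes i: "var s vi = int i" "i < k" and x: "var s vs = x" "W * H \<le> x" "x \<le> int n + K" "x mod W = r mod W"
  and v: "var s vW = W" "var s vT = T" "var s vbase = base"
  and cop: "coprime (f i r) W"
  and clear: "\<And>j. 0 \<le> j \<Longrightarrow> j < T \<Longrightarrow> \<not> bits s (nat (base + int i * T + j))"
 shows "total sieve_poly (\<lambda>s'.
  (\<forall>j. 0 \<le> j \<and> j < T \<longrightarrow> bits s' (nat (base + int i * T + j)) = prime (f i (x + W * j))) \<and>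
  (\<forall>a. (\<forall>j. 0 \<le> j \<and> j < T \<longrightarrow> a \<noteq> nat (base + int i * T + j)) \<longrightarrow> bits s' a = bits s a) \<and>
  clock s' + 200 * card (low_points i r (f i x)) \<le> clock s + poly_cost + 200 * card (low_points i r (f i (x + W * T)))) s"
proof -
 define a lo A hi q where "a = coeff (P ! i) 1" and "lo = f i x" and "A = a * W" and "hi = lo + A * T"
  and "q = base + int i * T"
 define \<gamma> \<epsilon> where "\<gamma> = form_gamma lo" and "\<epsilon> = form_epsilon lo"
 have a: "1 \<le> a" "a \<le> K"
  using coeff_pos[OF i(2)] K(1)[OF i(2)] by (auto simp: a_def)
 have lo: "2 * H < lo" "hi \<le> R * R"
  using value_bounds[OF i(2) x(2,3)] by (simp_all add: lo_def hi_def A_def a_def)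
 note lob = lo
 have fx: "f i (x + W * j) = lo + A * j" for j
  by (simp add: f_eq[OF i(2)] lo_def A_def a_def algebra_simps)
 have A0: "0 < A" "W dvd A" "A \<le> R"
 proof -
  show "0 < A" "W dvd A"
   using a W by (simp_all add: A_def)
  have "a * W \<le> K * T"
   using a W T by (intro mult_mono) auto
  then show "A \<le> R"
   using R basic by (simp add: A_def)
 qed
 have iT: "0 \<le> int i * T" "int i * T + T \<le> int k * T"
 proof -
  show "0 \<le> int i * T"
   using basic by simp
  have "(int i + 1) * T \<le> int k * T"
   using i(2) basic by (intro mult_right_mono) auto
  then show "int i * T + T \<le> int k * T"
   by (simp add: algebra_simps)
 qed
 have mod: "lo mod W = f i r mod W" "lo mod 8 = f i r mod 8"
  using f_cong[OF x(4)] f_cong_8[OF x(4)] by (simp_all add: lo_def)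
 have ge: "\<gamma> = form_gamma (f i r)" "\<epsilon> = form_epsilon (f i r)"
  by (simp_all add: \<gamma>_def \<epsilon>_def form_gamma_def form_epsilon_def mod(2))
 have coplo: "coprime lo W"
  using cop mod(1) by (metis coprime_iff_gcd_eq_1 gcd_red_int gcd.commute)
 interpret segment "pattern_input k P n" big l u W lo hi A q T \<gamma> \<epsilon> R
 proof unfold_locales
  show "hi + 2 * W \<le> big" "R + 2 * W \<le> big" "int u \<le> big"
   using big_bounds basic lo by linarith+
  show "int l \<le> q" "q + T \<le> int u"
   using base iT by (simp_all add: q_def)
  show "0 < lo" "0 < W" "0 \<le> T" "0 \<le> R"
   using lo K W basic by linarith+
 qed (use A0 form_class[of lo] lo in \<open>auto simp: hi_def \<gamma>_def \<epsilon>_def\<close>)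
 have near: "{p \<in> pts. near p} = low_points i r hi - low_points i r lo"
 proof -
  have "W dvd v - lo \<longleftrightarrow> W dvd v - f i r" for v
   using mod(1) by (metis mod_eq_dvd_iff)
  moreover have "0 \<le> form' y z" if "0 \<le> y" "0 \<le> z" for y z
   using that form_ge(1)[OF form that] zero_le_square[of y] by linarith
  ultimately show ?thesis
   using lob K(4,5) by (auto simp: low_points_def points_def near_def simp flip: ge)
 qed
 have fin: "finite (low_points i r v)" for v
  using finite_points[OF form] unfolding low_points_def ge[symmetric] by simp
 have sub: "low_points i r lo \<subseteq> low_points i r hi"
  using A0 basic by (auto simp: low_points_def points_def hi_def intro: order.strict_trans2)
 have cn: "card {p \<in> pts. near p} + card (low_points i r lo) = card (low_points i r hi)"
  using near fin sub by (simp add: card_Diff_subset card_mono)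
 have sq: "(\<Sum>d = 2..<R + 2. square_cost d + 50) \<le> 1250 * nat R + 100 * (nat W * nat W) + 200 * nat (K * T)"
 proof -
  have e: "int (nat R) = R"
   using basic by simp
  have "real_of_int (\<Sum>d = 2..<R + 2. stride d) \<le> real_of_int (W * W + R)"
   using sum_stride_le[of "nat R", unfolded e] by (simp only: of_int_le_iff)
  also have "\<dots> = real (nat W * nat W) + real (nat R)"
   using W basic by simp
  finally have 1: "real_of_int (\<Sum>d = 2..<R + 2. stride d) \<le> real (nat W * nat W) + real (nat R)" .
  have "real_of_int (A * T) / real_of_int W = real_of_int (a * T)"
   using W by (simp add: A_def)
  also have "\<dots> \<le> real_of_int (K * T)"
   using a basic by (intro of_int_le_iff[THEN iffD2] mult_right_mono) auto
  also have "\<dots> = real (nat (K * T))"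
   using basic by simp
  finally have 2: "real_of_int (A * T) / real_of_int W \<le> real (nat (K * T))" .
  have "real (\<Sum>d = 2..<R + 2. square_cost d + 50) \<le>
   1250 * real (nat R) + 100 * real (nat W * nat W) + 200 * real (nat (K * T))"
   using sum_square_cost_le[of "nat R", unfolded e] 1 2 by linarith
  also have "\<dots> = real (1250 * nat R + 100 * (nat W * nat W) + 200 * nat (K * T))"
   by simp
  finally have "real (\<Sum>d = 2..<R + 2. square_cost d + 50) \<le>
   real (1250 * nat R + 100 * (nat W * nat W) + 200 * nat (K * T))" .
  then show ?thesis
   by (simp only: of_nat_le_iff)
 qed
 have prep: "total (If [V vlo %. N 8 =. N 7] (Asg vg (N 4) ;; Asg vh (N 2))
   (Asg vg (N 0) ;; If [V vlo %. N 8 =. N 3] (Asg vh (N 2)) (Asg vh (N 4))))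
   (\<lambda>s'. var s' vg = \<gamma> \<and> var s' vh = \<epsilon> \<and> bits s' = bits s1 \<and> clock s' \<le> clock s1 + 50) s1"
  if "var s1 vlo = lo" for s1
  by (intro total_intros)
   (use that big_bounds in \<open>auto simp: \<gamma>_def \<epsilon>_def form_gamma_def form_epsilon_def\<close>)
 let ?Q = "\<lambda>s'.
  (\<forall>j. 0 \<le> j \<and> j < T \<longrightarrow> bits s' (nat (q + j)) = prime (lo + A * j)) \<and>
  (\<forall>a. (\<forall>j. 0 \<le> j \<and> j < T \<longrightarrow> a \<noteq> nat (q + j)) \<longrightarrow> bits s' a = bits s a) \<and>
  clock s' + 200 * card (low_points i r lo) \<le> clock s + poly_cost + 200 * card (low_points i r hi)"
 have tail: "total (flip_points ;; clear_squareful) ?Q s1"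
  if e: "env s1" and b: "bits s1 = bits s" and c: "clock s1 \<le> clock s + 200" for s1
 proof (rule total_Seq, rule total_conseq[OF total_flip_points[OF e]], goal_cases)
  case (1 s2)
  have e2: "env s2"
   using 1(2) e by (auto simp: frame_def env_def flip_points_def flip_class_def ascend_def descend_def flip_column_def)
  show ?case
  proof (rule total_conseq[OF total_clear_squareful[OF e2 coplo]], goal_cases)
   case (1 s3)
   have m': "bits s3 i \<longleftrightarrow> toggled (bits s) {p \<in> pts. hits p} slot_of i \<and> \<not> (\<exists>v d. 2 \<le> d \<and> d * d dvd v \<and> marks v i)" for i
    using 1(1) \<open>bits s2 = toggled (bits s1) {p \<in> pts. hits p} slot_of \<and> _\<close> b by auto
   have cl: "\<not> bits s (nat (q + j))" if "0 \<le> j" "j < T" for j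
    using clear[OF that] by (simp add: q_def)
   note sb = sieved_bit[OF coplo W8 _ \<gamma>_def \<epsilon>_def cl m']
   have lo1: "1 < lo"
    using lob K(4,5) by linarith
   have "class_cost * card (reps_mod \<gamma> \<epsilon> lo W) \<le> class_cost * NN"
    using NN[OF form_class(3) coplo] unfolding \<gamma>_def \<epsilon>_def by (rule mult_le_mono2)
   then have "clock s3 + 200 * card (low_points i r lo) \<le> clock s + poly_cost + 200 * card (low_points i r hi)"
   proof -
    have "clock s3 \<le> clock s2 + 20 + (\<Sum>d = 2..<R + 2. square_cost d + 50)"
     using 1(1) by blast
    moreover have "clock s2 \<le> clock s1 + 100 * (nat W + 1) * (nat W + 1) +
      class_cost * card (reps_mod \<gamma> \<epsilon> lo W) + 200 * card {p \<in> pts. near p}"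
     using \<open>_ \<and> clock s2 \<le> _\<close> by blast
    moreover have "poly_cost = 500 + 100 * (nat W + 1) * (nat W + 1) + class_cost * NN + 1250 * nat R +
      100 * (nat W * nat W) + 200 * nat (K * T)"
     by (simp only: poly_cost_def class_cost_def)
    ultimately show ?thesis
     using \<open>class_cost * card (reps_mod \<gamma> \<epsilon> lo W) \<le> class_cost * NN\<close> c sq cn by linarith
   qed
   with sb(1)[OF lo1] sb(2)[OF lo1] show ?case
    by blast
  qed
 qed
 have "total sieve_poly ?Q s"
  unfolding sieve_poly_def
 proof (rule total_Seq, rule total_conseq[OF total_read_poly[OF i]], goal_cases)
  case (1 s1)
  have s1: "var s1 va = a" "var s1 vb = coeff (P ! i) 0" "var s1 vs = x" "var s1 vW = W" "var s1 vT = T"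
    "var s1 vbase = base" "var s1 vi = int i" "bits s1 = bits s" "clock s1 = clock s + 12"
   using 1(1) x v i by (simp_all add: a_def)
  let ?a2 = "Asg vlo (V va *. V vs +. V vb) ;; Asg vA (V va *. V vW) ;; Asg vhi (V vlo +. V vA *. V vT) ;;
   Asg vq (V vbase +. V vi *. V vT)"
  have lo': "a * x + coeff (P ! i) 0 = lo"
   by (simp add: lo_def a_def f_eq[OF i(2)])
  have AT: "0 \<le> A * T"
   using A0 basic by simp
  have bnds: "\<bar>lo\<bar> \<le> big" "\<bar>A\<bar> \<le> big" "\<bar>hi\<bar> \<le> big" "\<bar>q\<bar> \<le> big"
  proof -
   have "0 \<le> lo" "lo \<le> big" "0 \<le> A" "A \<le> big" "0 \<le> hi" "hi \<le> big" "0 \<le> q" "q \<le> big"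
    using AT lob A0 K(4,5) basic big_bounds base iT unfolding hi_def q_def by linarith+
   then show "\<bar>lo\<bar> \<le> big" "\<bar>A\<bar> \<le> big" "\<bar>hi\<bar> \<le> big" "\<bar>q\<bar> \<le> big"
    by simp_all
  qed
  show ?case
  proof (intro total_Seq total_Asg, goal_cases)
   case 9
   show ?case
   proof (rule total_conseq[OF prep], goal_cases)
    case 1
    then show ?case
     using s1 lo' by simp
   next
    case (2 s2)
    have "var s2 vW = W" "var s2 vlo = lo" "var s2 vA = A" "var s2 vhi = hi" "var s2 vq = q" "var s2 vg = \<gamma>" "var s2 vh = \<epsilon>"
     using 2 s1 lo' by (simp_all add: frame_def A_def hi_def q_def)
    then have "env s2"
     unfolding env_def by blast
    then show ?case
     by (rule tail) (use 2 s1 in \<open>auto simp: frame_def\<close>)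
   qed
  qed (simp_all add: s1 lo' bnds flip: A_def hi_def q_def)
 qed
 then show ?thesis
  by (simp add: fx q_def hi_def flip: lo_def)
qed

text \<open>Division with remainder by \<open>W\<close> sends a point to its class, of which there
  are at most \<open>NN\<close>, and to a cell of a grid of side \<open>R div W + 1\<close>; both
  coordinates stay below \<open>R\<close> because the form dominates their squares.\<close>

lemma card_low_points_le:
 assumes cop: "coprime (f i r) W" and v: "v \<le> R * R"
 shows "card (low_points i r v) \<le> NN * ((nat (R div W) + 1) * (nat (R div W) + 1))"
proof -
 define \<gamma> \<epsilon> \<rho> where "\<gamma> = form_gamma (f i r)" and "\<epsilon> = form_epsilon (f i r)" and "\<rho> = f i r"
 have form: "0 \<le> \<gamma>" "1 \<le> \<epsilon>" "(\<gamma>, \<epsilon>) \<in> forms"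
  using form_class[of "f i r"] by (simp_all add: \<gamma>_def \<epsilon>_def)
 let ?D = "{0..R div W}"
 let ?g = "\<lambda>p. ((fst p mod W, snd p mod W), (fst p div W, snd p div W))"
 have W0: "0 < W"
  using W by simp
 have "?g ` low_points i r v \<subseteq> reps_mod \<gamma> \<epsilon> \<rho> W \<times> (?D \<times> ?D)"
 proof (rule image_subsetI)
  fix p assume "p \<in> low_points i r v"
  then have p: "0 \<le> fst p" "0 \<le> snd p" "form \<gamma> \<epsilon> (fst p) (snd p) < v" "W dvd form \<gamma> \<epsilon> (fst p) (snd p) - \<rho>"
   by (auto simp: low_points_def points_def \<gamma>_def \<epsilon>_def \<rho>_def)
  have lt: "z < R" if "0 \<le> z" "z * z \<le> form \<gamma> \<epsilon> (fst p) (snd p)" for z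
  proof (rule ccontr)
   assume "\<not> z < R"
   then have "R * R \<le> z * z"
    using basic by (intro mult_mono) auto
   with that p v show False
    by linarith
  qed
  have "fst p < R" "snd p < R"
   using lt form_ge(1,2)[OF form(1,2) p(1,2)] p by blast+
  then have "fst p div W \<in> ?D" "snd p div W \<in> ?D"
   using p W0 by (auto simp: pos_imp_zdiv_nonneg_iff intro!: zdiv_mono1)
  moreover have "form \<gamma> \<epsilon> (fst p mod W) (snd p mod W) mod W = form \<gamma> \<epsilon> (fst p) (snd p) mod W"
   by (rule form_cong) simp_all
  then have "W dvd form \<gamma> \<epsilon> (fst p mod W) (snd p mod W) - \<rho>"
   using p(4) by (metis mod_eq_dvd_iff)
  then have "(fst p mod W, snd p mod W) \<in> reps_mod \<gamma> \<epsilon> \<rho> W"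
   using W0 by (simp add: reps_mod_def)
  ultimately show "?g p \<in> reps_mod \<gamma> \<epsilon> \<rho> W \<times> (?D \<times> ?D)"
   by simp
 qed
 moreover have "inj_on ?g (low_points i r v)"
  by (rule inj_onI) (metis Pair_inject mult_div_mod_eq prod_eqI)
 ultimately have "card (low_points i r v) \<le> card (reps_mod \<gamma> \<epsilon> \<rho> W \<times> (?D \<times> ?D))"
  by (intro card_inj_on_le) (auto simp: finite_reps_mod)
 also have "\<dots> = card (reps_mod \<gamma> \<epsilon> \<rho> W) * (nat (R div W + 1) * nat (R div W + 1))"
  by (simp add: card_cartesian_product)
 also have "nat (R div W + 1) = nat (R div W) + 1"
  using basic W0 by (simp add: pos_imp_zdiv_nonneg_iff nat_add_distrib)
 also have "card (reps_mod \<gamma> \<epsilon> \<rho> W) * ((nat (R div W) + 1) * (nat (R div W) + 1)) \<le>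
   NN * ((nat (R div W) + 1) * (nat (R div W) + 1))"
  using NN[OF form(3)] cop by (intro mult_right_mono) (auto simp: \<rho>_def)
 finally show ?thesis .
qed

definition env :: "state \<Rightarrow> bool" where
 "env s \<longleftrightarrow> var s vn = int n \<and> var s vk = int k \<and> var s vK = K \<and> var s vH = H \<and> var s vW = W \<and>
  var s vT = T \<and> var s vbase = base"

lemma envD: "env s \<Longrightarrow> var s vn = int n" "env s \<Longrightarrow> var s vk = int k" "env s \<Longrightarrow> var s vK = K"
 "env s \<Longrightarrow> var s vH = H" "env s \<Longrightarrow> var s vW = W" "env s \<Longrightarrow> var s vT = T" "env s \<Longrightarrow> var s vbase = base"
 by (simp_all add: env_def)

abbreviation "slot_at i j \<equiv> nat (base + int i * T + j)"

lemma address_at: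
 assumes "i < k" "0 \<le> j" "j < T"
 shows "int l \<le> base + int i * T + j" "base + int i * T + j < int u"
proof -
 have "(int i + 1) * T \<le> int k * T" "0 \<le> int i * T"
  using assms basic by (auto intro!: mult_right_mono)
 moreover have "(int i + 1) * T = int i * T + T"
  by (simp add: algebra_simps)
 ultimately show "int l \<le> base + int i * T + j" "base + int i * T + j < int u"
  using assms base by linarith+
qed

text \<open>Sieving one polynomial does not disturb the blocks already filled for the
  others.\<close>

lemma address_inj:
 assumes "i < k" "i' < k" "0 \<le> j" "j < T" "0 \<le> j'" "j' < T" "slot_at i j = slot_at i' j'"
 shows "i = i'" "j = j'"
proof -
 have "base + int i * T + j = base + int i' * T + j'"
  using assms address_at[of i j] address_at[of i' j'] by (simp add: eq_nat_nat_iff)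
 then have e: "int i * T + j = int i' * T + j'"
  by simp
 have "(int i * T + j) div T = int i" "(int i' * T + j') div T = int i'"
  using assms basic by simp_all
 with e show "i = i'"
  by simp
 with e show "j = j'"
  by simp
qed

lemma total_clear_bits:
 assumes e: "env s"
 shows "total clear_bits (\<lambda>s'. (\<forall>j. 0 \<le> j \<and> j < int k * T \<longrightarrow> \<not> bits s' (nat (base + j))) \<and>
  clock s' \<le> clock s + 10 + 30 * nat (int k * T)) s"
 unfolding clear_bits_def
proof (rule total_Seq, rule total_Asg, goal_cases)
 case 3
 let ?I = "\<lambda>s'. 0 \<le> var s' vj \<and> var s' vj \<le> int k * T \<and>
  (\<forall>j. 0 \<le> j \<and> j < var s' vj \<longrightarrow> \<not> bits s' (nat (base + j))) \<and> clock s' \<le> clock s + 2 + 30 * nat (var s' vj)"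
 show ?case
 proof (rule total_While[where I = ?I and m = "\<lambda>s'. nat (int k * T - var s' vj)"], goal_cases)
  case 1
  show ?case
   using basic by auto
 next
  case (2 s1)
  have e1: "env s1"
   using 2(2) e by (auto simp: frame_def env_def)
  note e1' = envD[OF e1]
  define j where "j = var s1 vj"
  have j: "0 \<le> j" "j < int k * T"
   using 2(1,3) e1' by (auto simp: j_def)
  have b: "\<forall>j'. 0 \<le> j' \<and> j' < j \<longrightarrow> \<not> bits s1 (nat (base + j'))" and c: "clock s1 \<le> clock s + 2 + 30 * nat j"
   using 2(1) by (auto simp: j_def)
  have b': "\<not> ((bits s1)(nat (base + j) := False)) (nat (base + j'))" if "0 \<le> j'" "j' < j + 1" for j'
   using b that by (cases "j' = j") auto
  have a: "int l \<le> base + j" "base + j < int u" "j + 1 \<le> big"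
   using j base basic big_bounds by linarith+
  have "nat (j + 1) = nat j + 1"
   using j by simp
  then show ?case
   using b' a c j by (intro total_intros) (auto simp: e1' simp flip: j_def)
 next
  case (3 s1)
  have e1: "env s1"
   using 3(2) e by (auto simp: frame_def env_def)
  then have "var s1 vj = int k * T"
   using 3(1,3) envD[OF e1] by auto
  then show ?case
   using 3(1) by auto
 next
  case (4 s1)
  then show ?case
   by simp
 qed
qed (use big_bounds in auto)

lemma total_sieve_polys:
 assumes e: "env s" and x: "var s vs = x" "W * H \<le> x" "x \<le> int n + K" "x mod W = r mod W"
  and cop: "\<And>i. i < k \<Longrightarrow> coprime (f i r) W"
  and clear: "\<And>j. 0 \<le> j \<Longrightarrow> j < int k * T \<Longrightarrow> \<not> bits s (nat (base + j))"
 shows "total (Asg vi (N 0) ;; While [V vi <. V vk] (sieve_poly ;; incr vi)) (\<lambda>s'.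
  (\<forall>i j. i < k \<and> 0 \<le> j \<and> j < T \<longrightarrow> bits s' (slot_at i j) = prime (f i (x + W * j))) \<and>
  clock s' + 200 * (\<Sum>i<k. card (low_points i r (f i x))) \<le>
   clock s + 20 + k * (poly_cost + 20) + 200 * (\<Sum>i<k. card (low_points i r (f i (x + W * T))))) s"
proof (rule total_Seq, rule total_Asg, goal_cases)
 case 3
 let ?I = "\<lambda>s'. \<exists>i\<le>k. var s' vi = int i \<and>
  (\<forall>i' j. i' < k \<and> 0 \<le> j \<and> j < T \<longrightarrow> bits s' (slot_at i' j) = (i' < i \<and> prime (f i' (x + W * j)))) \<and>
  clock s' + 200 * (\<Sum>i<i. card (low_points i r (f i x))) \<le>
   clock s + 2 + i * (poly_cost + 20) + 200 * (\<Sum>i<i. card (low_points i r (f i (x + W * T))))"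
 have frames: "assigned sieve_poly \<inter> {vn, vk, vK, vH, vW, vT, vbase, vs, vi} = {}"
  by (simp add: program_defs)
 show ?case
 proof (rule total_While[where I = ?I and m = "\<lambda>s'. nat (int k - var s' vi)"], goal_cases)
  case 1
  have "\<not> bits s (slot_at i j)" if "i < k" "0 \<le> j" "j < T" for i j
  proof -
   have "(int i + 1) * T \<le> int k * T" "0 \<le> int i * T"
    using that basic by (auto intro!: mult_right_mono)
   then have "0 \<le> int i * T + j" "int i * T + j < int k * T"
    using that by (auto simp: algebra_simps)
   from clear[OF this] show ?thesis
    by (simp add: add.assoc)
  qed
  then show ?case
   by (intro exI[of _ 0]) auto
 next
  case (2 s1)
  have e1: "env s1" "var s1 vs = x"
   using 2(2) e x frames by (auto simp: frame_def env_def)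
  note e1' = envD[OF e1(1)]
  obtain i where i: "i \<le> k" "var s1 vi = int i"
    "\<forall>i' j. i' < k \<and> 0 \<le> j \<and> j < T \<longrightarrow> bits s1 (slot_at i' j) = (i' < i \<and> prime (f i' (x + W * j)))"
    "clock s1 + 200 * (\<Sum>i<i. card (low_points i r (f i x))) \<le>
   clock s + 2 + i * (poly_cost + 20) + 200 * (\<Sum>i<i. card (low_points i r (f i (x + W * T))))"
   using 2(1) by blast
  have ik: "i < k"
   using 2(3) e1' i by simp
  show ?case
  proof (rule total_Seq, rule total_conseq[OF total_sieve_poly[where i = i and x = x and r = r]], goal_cases)
   case (12 s2)
   have v2: "var s2 vi = int i"
    using 12(2) i(2) frames by (auto simp: frame_def)
   have b2: "bits s2 (slot_at i' j) = (i' < Suc i \<and> prime (f i' (x + W * j)))" if "i' < k" "0 \<le> j" "j < T" for i' j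
   proof (cases "i' = i")
    case True
    then show ?thesis
     using 12(1) that by auto
   next
    case False
    then have "\<forall>j'. 0 \<le> j' \<and> j' < T \<longrightarrow> slot_at i' j \<noteq> slot_at i j'"
     using address_inj that ik by blast
    then have "bits s2 (slot_at i' j) = bits s1 (slot_at i' j)"
     using 12(1) by simp
    with i(3) that False show ?thesis
     by auto
   qed
   have c2: "clock s2 + 5 + 200 * (\<Sum>i<Suc i. card (low_points i r (f i x))) \<le>
     clock s + 2 + Suc i * (poly_cost + 20) + 200 * (\<Sum>i<Suc i. card (low_points i r (f i (x + W * T))))"
    using 12(1) i(4) by simp
   show ?case
   proof (rule total_Asg, goal_cases)
    case 3
    show ?case
     by (rule conjI, rule exI[of _ "Suc i"])
      (use v2 b2 c2 ik i(2) in \<open>auto simp del: sum.lessThan_Suc mult_Suc simp: less_Suc_eq_le\<close>)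
   qed (use v2 ik K(3) big_bounds basic in auto)
  qed (use e1 e1' x i ik cop in auto)
 next
  case (3 s1)
  have e1: "env s1"
   using 3(2) e frames by (auto simp: frame_def env_def)
  obtain i where i: "i \<le> k" "var s1 vi = int i"
    "\<forall>i' j. i' < k \<and> 0 \<le> j \<and> j < T \<longrightarrow> bits s1 (slot_at i' j) = (i' < i \<and> prime (f i' (x + W * j)))"
    "clock s1 + 200 * (\<Sum>i<i. card (low_points i r (f i x))) \<le>
   clock s + 2 + i * (poly_cost + 20) + 200 * (\<Sum>i<i. card (low_points i r (f i (x + W * T))))"
   using 3(1) by blast
  have "i = k"
   using 3(3) envD[OF e1] i by simp
  with i show ?case
   by auto
 next
  case (4 s1)
  then show ?case
   by simp
 qed
qed (use big_bounds in auto)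

lemma total_report:
 assumes e: "env s" and x: "var s vs = x" "W * H \<le> x" "x \<le> int n + K"
 shows "total report (\<lambda>s'. set (outs s') = set (outs s) \<union>
   {x + W * j |j. 0 \<le> j \<and> j < T \<and> (\<forall>i<k. bits s (slot_at i j) \<and> f i (x + W * j) \<le> int n)} \<and>
  clock s' \<le> clock s + 20 + nat T * (65 * k + 60)) s"
 unfolding report_def
proof (rule total_Seq, rule total_Asg, goal_cases)
 case 3
 define G where "G j i \<longleftrightarrow> bits s (slot_at i j) \<and> f i (x + W * j) \<le> int n" for j i
 define S where "S j = {x + W * j' |j'. 0 \<le> j' \<and> j' < j \<and> (\<forall>i<k. G j' i)}" for j
 let ?I = "\<lambda>s'. 0 \<le> var s' vj \<and> var s' vj \<le> T \<and> set (outs s') = set (outs s) \<union> S (var s' vj) \<and>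
  clock s' \<le> clock s + 2 + nat (var s' vj) * (65 * k + 60)"
 show ?case
 proof (rule total_While[where I = ?I and m = "\<lambda>s'. nat (T - var s' vj)"], goal_cases)
  case 1
  show ?case
   using basic by (auto simp: S_def)
 next
  case (2 s1)
  have e1: "env s1" "var s1 vs = x" "bits s1 = bits s"
   using 2(2) e x by (auto simp: frame_def env_def read_poly_def)
  note e1' = envD[OF e1(1)]
  define j where "j = var s1 vj"
  have j: "0 \<le> j" "j < T" and o: "set (outs s1) = set (outs s) \<union> S j" and c: "clock s1 \<le> clock s + 2 + nat j * (65 * k + 60)"
   using 2(1,3) e1' by (auto simp: j_def)
  define y where "y = x + W * j"
  have y: "0 \<le> y" "y \<le> big"
  proof -
   have "0 \<le> W * j" "0 \<le> W * H"
    using W j K by simp_all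
   then show "0 \<le> y"
    using x by (simp add: y_def)
   have "W * j \<le> R * R"
    using W j basic by (intro mult_mono) auto
   then show "y \<le> big"
    using x basic(4,6) big_sum
    unfolding y_def by linarith
  qed
  have jb: "j + 1 \<le> big"
   using j basic big_bounds by linarith
  have Sj: "S (j + 1) = S j \<union> (if \<forall>i<k. G j i then {y} else {})"
  proof -
   have "j' < j + 1 \<longleftrightarrow> j' < j \<or> j' = j" for j'
    by auto
   then show ?thesis
    using j by (auto simp: S_def y_def)
  qed
  have nj: "nat (j + 1) = nat j + 1"
   using j by simp
  show ?case
  proof (rule total_Seq, rule total_Asg, goal_cases)
   case 3
   let ?c = "read_poly ;; Get_Bit vt (V vbase +. V vi *. V vT +. V vj) ;;
     If [V vt =. N 1, V va *. V vx +. V vb <. V vn +. N 1] Skip (Asg vok (N 0)) ;; incr vi"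
   have frv: "assigned ?c = {va, vb, vt, vok, vi}"
    by (auto simp: read_poly_def)
   let ?s2 = "tick 6 (set_var vx y (tick 5 s1))"
   have s2: "tick (size_of (V vs +. V vW *. V vj) + 1) (set_var vx (eval (var (tick (bsize [V vj <. V vT] + 1) s1)) (V vs +. V vW *. V vj))
     (tick (bsize [V vj <. V vT] + 1) s1)) = ?s2"
    by (simp add: e1' e1(2) y_def j_def)
   have loop: "total (Asg vok (N 1) ;; Asg vi (N 0) ;; While [V vi <. V vk] ?c)
     (\<lambda>s'. (var s' vok = 1 \<longleftrightarrow> (\<forall>i<k. G j i)) \<and> clock s' \<le> clock ?s2 + 10 + k * (60 + 5)) ?s2"
   proof (rule total_all_loop, goal_cases)
    case 1
    show ?case
     using e1' by simp
   next
    case 2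
    show ?case
     using K(3) basic big_bounds by linarith
   next
    case (6 s3 i)
    have v3: "var s3 vbase = base" "var s3 vT = T" "var s3 vj = j" "var s3 vx = y" "var s3 vn = int n" "bits s3 = bits s" "var s3 vi = int i"
     using 6 e1' e1(3) by (auto simp: frame_def frv read_poly_def j_def)
    have ad: "int l \<le> base + int i * T + j" "base + int i * T + j < int u"
     using address_at[OF 6(2) j] by simp_all
    have fy: "coeff (P ! i) 1 * y + coeff (P ! i) 0 = f i y"
     by (simp add: f_eq[OF 6(2)])
    have ib: "int i + 1 \<le> big"
     using K(3) basic big_bounds 6(2) by linarith
    show ?case
    proof (rule total_Seq, rule total_conseq[OF total_read_poly[OF 6(3,2)]], goal_cases)
     case (1 s4)
     show ?case
      unfolding 1(1)
      by (intro total_intros) (use v3 ad fy ib in \<open>auto simp: G_def y_def[symmetric]\<close>)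
    qed
   qed (auto simp: read_poly_def)
   show ?case
    unfolding s2
   proof (subst total_Seq_3, rule total_conseq[OF loop], goal_cases)
    case (1 s3)
    have v3: "var s3 vj = j" "outs s3 = outs s1" "var s3 vx = y"
     using 1(2) by (auto simp: frame_def frv j_def read_poly_def)
    have c3: "clock s3 \<le> clock s1 + 30 + k * 65"
     using 1(1) by simp
    show ?case
     by (intro total_intros) (use v3 c3 1(1) o Sj c nj j jb in \<open>auto simp: algebra_simps simp flip: j_def\<close>)
   qed
  qed (use e1 e1' y in \<open>auto simp: y_def j_def\<close>)
 next
  case (3 s1)
  have e1: "env s1"
   using 3(2) e by (auto simp: frame_def env_def read_poly_def)
  then have "var s1 vj = T"
   using 3(1,3) envD[OF e1] by auto
  then show ?case
   using 3(1) by (simp add: S_def G_def)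
 next
  case (4 s1)
  then show ?case
   by simp
 qed
qed (use big_bounds in auto)

definition seg_cost :: nat where
 "seg_cost = 60 + 30 * nat (int k * T) + k * (poly_cost + 20) + nat T * (65 * k + 60)"

abbreviation "all_low r x \<equiv> \<Sum>i<k. card (low_points i r (f i x))"

lemma total_sieve_segment:
 assumes e: "env s" and x: "var s vs = x" "W * H \<le> x" "x \<le> int n + K" "x mod W = r mod W"
  and cop: "\<And>i. i < k \<Longrightarrow> coprime (f i r) W"
 shows "total sieve_segment (\<lambda>s'. set (outs s') = set (outs s) \<union> {y. y mod W = r mod W \<and> x \<le> y \<and> y < x + W * T \<and> good y} \<and>
  clock s' + 200 * all_low r x \<le> clock s + seg_cost + 200 * all_low r (x + W * T)) s"
 unfolding sieve_segment_def
proof (rule total_Seq, rule total_conseq[OF total_clear_bits[OF e]], goal_cases)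
 case (1 s1)
 have e1: "env s1" "var s1 vs = x" "outs s1 = outs s"
  using 1(2) e x by (auto simp: frame_def env_def clear_bits_def)
 have cl: "\<And>j. 0 \<le> j \<Longrightarrow> j < int k * T \<Longrightarrow> \<not> bits s1 (nat (base + j))"
  using 1(1) by blast
 have frames: "assigned (Asg vi (N 0) ;; While [V vi <. V vk] (sieve_poly ;; incr vi)) \<inter> {vn, vk, vK, vH, vW, vT, vbase, vs} = {}"
  "\<not> prints (Asg vi (N 0) ;; While [V vi <. V vk] (sieve_poly ;; incr vi))"
  by (simp_all add: program_defs)
 show ?case
 proof (subst total_Seq_2, rule total_conseq[OF total_sieve_polys[OF e1(1,2) x(2-4) cop cl]], goal_cases)
  case (4 s2)
  have e2: "env s2" "var s2 vs = x" "outs s2 = outs s"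
   using 4(2) e1 frames unfolding frame_def env_def by (auto simp del: assigned.simps prints.simps)
  have b2: "bits s2 (slot_at i j) = prime (f i (x + W * j))" if "i < k" "0 \<le> j" "j < T" for i j
   using 4(1) that by blast
  show ?case
  proof (rule total_conseq[OF total_report[OF e2(1,2) x(2,3)]], goal_cases)
   case (1 s3)
   have "{x + W * j |j. 0 \<le> j \<and> j < T \<and> (\<forall>i<k. bits s2 (slot_at i j) \<and> f i (x + W * j) \<le> int n)} =
     {y. y mod W = r mod W \<and> x \<le> y \<and> y < x + W * T \<and> good y}" (is "?L = ?R")
   proof (intro equalityI subsetI)
    fix y assume "y \<in> ?L"
    then obtain j where j: "y = x + W * j" "0 \<le> j" "j < T" "\<forall>i<k. bits s2 (slot_at i j) \<and> f i (x + W * j) \<le> int n"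
     by blast
    then have "good y"
     using b2 by (auto simp: good_def)
    moreover have "0 \<le> W * j" "W * j < W * T"
     using j W by simp_all
    moreover have "y mod W = r mod W"
     using j x(4) by simp
    ultimately show "y \<in> ?R"
     using j by simp
   next
    fix y assume y: "y \<in> ?R"
    then have "W dvd y - x"
     using x(4) by (simp add: mod_eq_dvd_iff[symmetric])
    then obtain j where j: "y = x + W * j"
     by (metis dvdE add_diff_cancel_left' diff_add_cancel add.commute)
    have "0 \<le> W * j" "W * j < W * T"
     using y j by auto
    then have "0 \<le> j" "j < T"
     using W by (auto simp: zero_le_mult_iff mult_less_cancel_left)
    with j y b2 show "y \<in> ?L"
     by (auto simp: good_def)
   qed
   then have "set (outs s3) = set (outs s) \<union> ?R"
    using 1(1) e2 by simp
   moreover have "clock s3 + 200 * all_low r x \<le> clock s + seg_cost + 200 * all_low r (x + W * T)"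
    using 1(1) 4(1) \<open>_ \<and> clock s1 \<le> _\<close> unfolding seg_cost_def by linarith
   ultimately show ?case
    by blast
  qed
 qed auto
qed

text \<open>The fixed cost of a segment times the number of segments, plus the lattice points of the
  whole class, counted once for all segments.\<close>

definition residue_cost :: nat where
 "residue_cost = 50 + (nat ((int n + K) div (W * T)) + 1) * (seg_cost + 30) +
  200 * (k * (NN * ((nat (R div W) + 1) * (nat (R div W) + 1))))"

lemma total_sieve_residue:
 assumes e: "env s" and r: "var s vr = r" "0 \<le> r" "r < W"
  and cop: "\<And>i. i < k \<Longrightarrow> coprime (f i r) W"
 shows "total sieve_residue (\<lambda>s'. set (outs s') = set (outs s) \<union> {y. y mod W = r \<and> r + W * H \<le> y \<and> good y} \<and>
  clock s' \<le> clock s + residue_cost) s"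
 unfolding sieve_residue_def
proof (rule total_Seq, rule total_Asg, goal_cases)
 case 3
 define x0 where "x0 = r + W * H"
 have rW: "r mod W = r"
  using r by simp
 \<comment> \<open>\<open>X c\<close> is where segment \<open>c\<close> begins. The clock invariant
   holds the low-point counts at \<open>x0\<close> and \<open>X c\<close> only, since those in
   between cancel.\<close>
 define X where "X c = x0 + W * T * int c" for c
 have XS: "X (Suc c) = X c + W * T" for c
  by (simp add: X_def algebra_simps)
 have WT: "1 \<le> W * T"
  using W basic mult_mono[of 1 W 1 T] by simp
 have X0: "x0 \<le> X c" "W * H \<le> X c" "X c mod W = r mod W" for c
 proof -
  have "0 \<le> W * T * int c"
   using WT by simp
  then show "x0 \<le> X c" "W * H \<le> X c"
   using r by (simp_all add: X_def x0_def)
  have "X c = r + W * (H + T * int c)"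
   by (simp add: X_def x0_def algebra_simps)
  then show "X c mod W = r mod W"
   by simp
 qed
 have frames: "assigned sieve_segment \<inter> {vn, vk, vK, vH, vW, vT, vbase, vs} = {}"
  by (simp add: program_defs)
 define Y where "Y x = {y. y mod W = r \<and> x0 \<le> y \<and> y < x \<and> good y}" for x
 let ?I = "\<lambda>s'. \<exists>c. var s' vs = X c \<and> (0 < c \<longrightarrow> X (c - 1) \<le> int n + K) \<and> set (outs s') = set (outs s) \<union> Y (X c) \<and>
  clock s' + 200 * all_low r x0 \<le> clock s + 10 + c * (seg_cost + 30) + 200 * all_low r (X c)"
 show ?case
 proof (rule total_While[where I = ?I and m = "\<lambda>s'. nat (int n + K + 1 - var s' vs)"], goal_cases)
  case 1
  show ?case
   using envD[OF e] r by (auto intro!: exI[of _ 0] simp: X_def Y_def x0_def)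
 next
  case (2 s1)
  have e1: "env s1"
   using 2(2) e frames by (auto simp: frame_def env_def)
  note e1' = envD[OF e1]
  obtain c where c: "var s1 vs = X c" "set (outs s1) = set (outs s) \<union> Y (X c)"
    "clock s1 + 200 * all_low r x0 \<le> clock s + 10 + c * (seg_cost + 30) + 200 * all_low r (X c)"
   using 2(1) by blast
  have Xn: "X c \<le> int n + K"
   using 2(3) c e1' by simp
  let ?s = "tick (bsize [V vs <. V vn +. V vK +. N 1] + 1) s1"
  have e1t: "env ?s" "var ?s vs = X c"
   using e1 c by (simp_all add: env_def)
  show ?case
  proof (rule total_Seq, rule total_conseq[OF total_sieve_segment[OF e1t X0(2) Xn X0(3) cop]], goal_cases)
   case (2 s2)
   have e2: "env s2" "var s2 vs = X c"
    using 2(2) e1t frames by (auto simp: frame_def env_def)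
   have "Y (X c) \<union> {y. y mod W = r mod W \<and> X c \<le> y \<and> y < X c + W * T \<and> good y} = Y (X (Suc c))"
    using X0(1)[of c] WT by (auto simp: Y_def XS rW)
   then have o2: "set (outs s2) = set (outs s) \<union> Y (X (Suc c))"
    using 2(1) c(2) by auto
   have bnd: "\<bar>X c + W * T\<bar> \<le> big"
   proof -
    have "W * T \<le> R * R"
     using W basic by (intro mult_mono) auto
    moreover have "0 \<le> W * H"
     using W K by simp
    ultimately have "0 \<le> X c + W * T" "X c + W * T \<le> big"
     using Xn X0(2)[of c] basic(4,6) big_sum WT by linarith+
    then show ?thesis
     by simp
   qed
   have c2: "clock s2 + 10 + 200 * all_low r x0 \<le> clock s + 10 + Suc c * (seg_cost + 30) + 200 * all_low r (X (Suc c))"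
    using 2(1) c(3) by (simp add: XS)
   show ?case
   proof (rule total_Asg, goal_cases)
    case 3
    let ?s3 = "tick 6 (set_var vs (X (Suc c)) s2)"
    have "?I ?s3 \<and> nat (int n + K + 1 - X (Suc c)) < nat (int n + K + 1 - X c)"
     using Xn o2 c2 WT by (intro conjI exI[of _ "Suc c"]) (auto simp: XS)
    then show ?case
     using e2 envD[OF e2(1)] c by (simp add: XS)
   qed (use e2 envD[OF e2(1)] bnd in auto)
  qed auto
 next
  case (3 s1)
  have e1: "env s1"
   using 3(2) e frames by (auto simp: frame_def env_def)
  note e1' = envD[OF e1]
  obtain c where c: "var s1 vs = X c" "0 < c \<longrightarrow> X (c - 1) \<le> int n + K" "set (outs s1) = set (outs s) \<union> Y (X c)"
    "clock s1 + 200 * all_low r x0 \<le> clock s + 10 + c * (seg_cost + 30) + 200 * all_low r (X c)"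
   using 3(1) by blast
  have Xn: "int n + K < X c"
   using 3(3) c e1' by simp
  have "Y (X c) = {y. y mod W = r \<and> r + W * H \<le> y \<and> good y}"
   using Xn good_le(1) by (force simp: Y_def x0_def)
  moreover have "clock s1 + 10 \<le> clock s + residue_cost"
  \<comment> \<open>If no segment was run, the low-point counts on both sides are equal and
    cancel.\<close>
  proof (cases "c = 0")
   case True
   then have "X c = x0"
    by (simp add: X_def)
   then show ?thesis
    using c(4) True by (simp add: residue_cost_def)
  next
   case False
   then obtain c' where c': "c = Suc c'"
    by (cases c) auto
   then have Xc: "X c' \<le> int n + K"
    using c(2) by simp
   have "W * T * int c' \<le> int n + K"
    using Xc X0(2)[of c'] r W K unfolding X_def x0_def by (simp add: algebra_simps) (smt (verit) mult_nonneg_nonneg)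
   then have "int c' \<le> (int n + K) div (W * T)"
    using WT by (intro int_le_divI) (auto simp: mult.commute)
   then have cc: "c \<le> nat ((int n + K) div (W * T)) + 1"
    using c' by linarith
   have "all_low r (X c) \<le> (\<Sum>i<k. NN * ((nat (R div W) + 1) * (nat (R div W) + 1)))"
   proof (rule sum_mono)
    fix i assume "i \<in> {..<k}"
    then have i: "i < k"
     by simp
    have "f i (X c) = f i (X c') + coeff (P ! i) 1 * W * T"
     by (simp add: f_eq[OF i] c' XS algebra_simps)
    then have "f i (X c) \<le> R * R"
     using value_bounds(2)[OF i X0(2) Xc] by simp
    then show "card (low_points i r (f i (X c))) \<le> NN * ((nat (R div W) + 1) * (nat (R div W) + 1))"
     by (rule card_low_points_le[OF cop[OF i]])
   qed
   also have "\<dots> = k * (NN * ((nat (R div W) + 1) * (nat (R div W) + 1)))"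
    by simp
   finally have low: "all_low r (X c) \<le> k * (NN * ((nat (R div W) + 1) * (nat (R div W) + 1)))" .
   have "c * (seg_cost + 30) \<le> (nat ((int n + K) div (W * T)) + 1) * (seg_cost + 30)"
    using cc by (rule mult_right_mono) simp
   then show ?thesis
    using c(4) low unfolding residue_cost_def by linarith
  qed
  ultimately show ?case
   using c(3) by simp
 next
  case (4 s1)
  then show ?case
   by simp
 qed
next
 case 2
 have "W * H \<le> R * R" "0 \<le> W * H"
  using W T K basic by (auto intro!: mult_mono)
 then have "0 \<le> r + W * H" "r + W * H \<le> big"
  using r basic(5,6) big_sum by linarith+
 then show ?case
  using envD[OF e] r by simp
qed auto

lemma total_residue_test:
 assumes e: "env s" and r: "var s vr = r" "0 \<le> r" "r < W"
 shows "total residue_test (\<lambda>s'. (var s' vok = 1 \<longleftrightarrow> (\<forall>i<k. coprime (f i r) W)) \<and>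
  clock s' \<le> clock s + 10 + k * (100 + 30 * nat W + 5)) s"
 unfolding residue_test_def
proof (rule total_all_loop, goal_cases)
 case 1
 show ?case
  using envD[OF e] by simp
next
 case 2
 show ?case
  using K(3) basic big_bounds by linarith
next
 case (6 s1 i)
 have e1: "env s1" "var s1 vr = r"
  using 6(1) e r by (auto simp: frame_def env_def read_poly_def)
 note e1' = envD[OF e1(1)]
 define m where "m = f i r"
 have fm: "coeff (P ! i) 1 * r + coeff (P ! i) 0 = m"
  by (simp add: m_def f_eq[OF 6(2)])
 have mb: "\<bar>m\<bar> \<le> big"
 proof -
  have "coeff (P ! i) 1 * r \<le> K * T" "0 \<le> coeff (P ! i) 1 * r"
   using K(1)[OF 6(2)] coeff_pos[OF 6(2)] r W T K(4) by (auto intro!: mult_mono)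
  then show ?thesis
   using K(2)[OF 6(2)] fm R basic big_bounds by linarith
 qed
 have cop: "coprime m W \<longleftrightarrow> \<not> (\<exists>d. 2 \<le> d \<and> d < W + 1 \<and> d dvd W \<and> d dvd m)"
 proof
  assume "coprime m W"
  show "\<not> (\<exists>d. 2 \<le> d \<and> d < W + 1 \<and> d dvd W \<and> d dvd m)"
  proof
   assume "\<exists>d. 2 \<le> d \<and> d < W + 1 \<and> d dvd W \<and> d dvd m"
   then obtain d where d: "2 \<le> d" "d dvd W" "d dvd m"
    by blast
   then have "is_unit d"
    using \<open>coprime m W\<close> coprime_common_divisor by blast
   with d show False
    by (simp add: zdvd1_eq)
  qed
 next
  assume nd: "\<not> (\<exists>d. 2 \<le> d \<and> d < W + 1 \<and> d dvd W \<and> d dvd m)"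
  have "gcd m W \<le> W" "gcd m W \<noteq> 0" "0 \<le> gcd m W"
   using W zdvd_imp_le[of "gcd m W" W] by auto
  moreover have "\<not> (2 \<le> gcd m W \<and> gcd m W < W + 1)"
   using nd by auto
  ultimately have "gcd m W = 1"
   by linarith
  then show "coprime m W"
   by (simp add: coprime_iff_gcd_eq_1)
 qed
 show ?case
 proof (rule total_Seq, rule total_conseq[OF total_read_poly[OF 6(3,2)]], goal_cases)
  case (1 s2)
  show ?case
  proof (rule total_Seq, rule total_Asg, goal_cases)
   case 3
   show ?case
   proof (rule total_Seq, rule total_Asg, goal_cases)
    case 3
    let ?s3 = "tick 2 (set_var ve 2 (tick 6 (set_var vm m s2)))"
    have s3: "tick (size_of (N 2) + 1) (set_var ve (eval (var (tick (size_of (V va *. V vr +. V vb) + 1) (set_var vm (eval (var s2) (V va *. V vr +. V vb)) s2))) (N 2))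
      (tick (size_of (V va *. V vr +. V vb) + 1) (set_var vm (eval (var s2) (V va *. V vr +. V vb)) s2))) = ?s3"
     using 1(1) e1 fm by simp
    have v3: "var ?s3 vW = W" "var ?s3 vm = m" "var ?s3 vi = int i" "var ?s3 vok = var s1 vok" "clock ?s3 = clock s1 + 20"
     using 1(1) e1' 6(3) by simp_all
    let ?I = "\<lambda>s'. 2 \<le> var s' ve \<and> var s' ve \<le> W + 1 \<and>
     (var s' vok = 1 \<longleftrightarrow> var s1 vok = 1 \<and> \<not> (\<exists>d. 2 \<le> d \<and> d < var s' ve \<and> d dvd W \<and> d dvd m)) \<and>
     clock s' \<le> clock s1 + 20 + 30 * nat (var s' ve - 2)"
    show ?case
     unfolding s3
    proof (rule total_Seq, rule total_While[where I = ?I and m = "\<lambda>s'. nat (W + 1 - var s' ve)"], goal_cases)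
     case 1
     have "\<not> (\<exists>d::int. 2 \<le> d \<and> d < 2 \<and> d dvd W \<and> d dvd m)"
      by auto
     then show ?case
      using v3 W by simp
    next
     case (2 s4)
     have v4: "var s4 vW = W" "var s4 vm = m"
      using 2(2) v3 by (auto simp: frame_def)
     define d where "d = var s4 ve"
     have d: "2 \<le> d" "d < W + 1" "clock s4 \<le> clock s1 + 20 + 30 * nat (d - 2)"
       "var s4 vok = 1 \<longleftrightarrow> var s1 vok = 1 \<and> \<not> (\<exists>d'. 2 \<le> d' \<and> d' < d \<and> d' dvd W \<and> d' dvd m)"
      using 2(1,3) v4 by (simp_all add: d_def)
     have ex: "(\<exists>d'. 2 \<le> d' \<and> d' < d + 1 \<and> d' dvd W \<and> d' dvd m) \<longleftrightarrow>
       (\<exists>d'. 2 \<le> d' \<and> d' < d \<and> d' dvd W \<and> d' dvd m) \<or> W mod d = 0 \<and> m mod d = 0"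
     proof
      assume "\<exists>d'. 2 \<le> d' \<and> d' < d + 1 \<and> d' dvd W \<and> d' dvd m"
      then obtain d' where d': "2 \<le> d'" "d' < d + 1" "d' dvd W" "d' dvd m"
       by blast
      show "(\<exists>d'. 2 \<le> d' \<and> d' < d \<and> d' dvd W \<and> d' dvd m) \<or> W mod d = 0 \<and> m mod d = 0"
      proof (cases "d' = d")
       case True
       then show ?thesis
        using d'(3,4) by simp
      next
       case False
       then have "d' < d"
        using d'(2) by simp
       with d' show ?thesis
        by blast
      qed
     next
      assume "(\<exists>d'. 2 \<le> d' \<and> d' < d \<and> d' dvd W \<and> d' dvd m) \<or> W mod d = 0 \<and> m mod d = 0"
      then show "\<exists>d'. 2 \<le> d' \<and> d' < d + 1 \<and> d' dvd W \<and> d' dvd m"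
      proof (elim disjE exE conjE)
       fix d' assume "2 \<le> d'" "d' < d" "d' dvd W" "d' dvd m"
       then show ?thesis
        by (intro exI[of _ d']) simp
      next
       assume "W mod d = 0" "m mod d = 0"
       then show ?thesis
        using d(1) by (intro exI[of _ d]) (simp add: mod_0_imp_dvd)
      qed
     qed
     have nd: "nat (d + 1 - 2) = nat (d - 2) + 1"
      using d by simp
     have db: "d + 1 \<le> big"
      using d basic big_bounds by linarith
     let ?b = "If [V vW %. V ve =. N 0, V vm %. V ve =. N 0] (Asg vok (N 0)) Skip ;; incr ve"
     have "total ?b (\<lambda>s'. var s' ve = d + 1 \<and> (var s' vok = 1 \<longleftrightarrow> var s4 vok = 1 \<and> \<not> (W mod d = 0 \<and> m mod d = 0)) \<and>
       clock s' \<le> clock s4 + 30) (tick (bsize [V ve <. V vW +. N 1] + 1) s4)"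
      by (intro total_intros) (use v4 d(1) db in \<open>auto simp flip: d_def\<close>)
     then show ?case
     proof (rule total_conseq, goal_cases)
      case (1 s5)
      have "var s5 vok = 1 \<longleftrightarrow> var s1 vok = 1 \<and> \<not> (\<exists>d'. 2 \<le> d' \<and> d' < var s5 ve \<and> d' dvd W \<and> d' dvd m)"
       using 1(1) d(4) ex by simp
      moreover have "clock s5 \<le> clock s1 + 20 + 30 * nat (var s5 ve - 2)"
       using 1(1) d(3) nd by simp
      moreover have "nat (W + 1 - var s5 ve) < nat (W + 1 - var s4 ve)" "2 \<le> var s5 ve" "var s5 ve \<le> W + 1"
       using 1(1) d(1,2) by (auto simp flip: d_def)
      ultimately show ?case
       by blast
     qed
    next
     case (3 s4)
     have v4: "var s4 vW = W" "var s4 vi = int i"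
      using 3(2) v3 by (auto simp: frame_def)
     have ve: "var s4 ve = W + 1"
      using 3(1,3) v4 by simp
     have ok: "var s4 vok = 1 \<longleftrightarrow> var s1 vok = 1 \<and> coprime m W"
      using 3(1) cop unfolding ve by blast
     have "clock s4 \<le> clock s1 + 20 + 30 * nat (W + 1 - 2)"
      using 3(1) unfolding ve by blast
     moreover have "nat (W + 1 - 2) \<le> nat W"
      by simp
     ultimately have c4: "clock s4 \<le> clock s1 + 20 + 30 * nat W"
      by linarith
     have ib: "int i + 1 \<le> big"
      using K(3) basic big_bounds 6(2) by linarith
     show ?case
      by (intro total_intros) (use v4 ok c4 ib in \<open>auto simp: m_def\<close>)
    next
     case (4 s4)
     then show ?case
      by simp
    qed
   qed (use big_bounds in auto)
  qed (use 1(1) e1 fm mb in auto)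
 qed
qed (auto simp: read_poly_def)

definition sieve_cost :: nat where
 "sieve_cost = 100 + nat W * (40 + k * (105 + 30 * nat W)) + card (allowed (set P) W) * residue_cost"

text \<open>A prime value above \<open>W\<close> is coprime to \<open>W\<close>, and coprimality
  depends only on the class of the argument; so a rejected class contains no solution in the sieved
  range.\<close>

lemma no_good_outside_allowed:
 assumes y: "good y" "W * H \<le> y" "y mod W = r" "i < k"
 shows "coprime (f i r) W"
proof -
 have "\<not> f i y dvd W"
 proof
  assume "f i y dvd W"
  then have "f i y \<le> W"
   using W by (intro zdvd_imp_le) auto
  then show False
   using value_bounds(1)[OF y(4,2) good_le(1)[OF y(1)]] W K by linarith
 qed
 moreover have "prime (f i y)"
  using y by (simp add: good_def)
 ultimately have "coprime (f i y) W"
  by (simp add: prime_imp_coprime)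
 moreover have "f i y mod W = f i r mod W"
  using y(3) by (intro f_cong) auto
 ultimately show ?thesis
  by (metis coprime_iff_gcd_eq_1 gcd_red_int gcd.commute)
qed

lemma total_sieve:
 assumes v: "var s vn = int n" "var s vk = int k" "var s vK = K" "var s vH = H" "var s vW = W"
  and T_eq: "T = H ^ 8" and base_eq: "base = 1700 * H * (2 * int k + 2)"
 shows "total sieve (\<lambda>s'. set (outs s') = set (outs s) \<union> {y. y mod W + W * H \<le> y \<and> good y} \<and>
  clock s' \<le> clock s + sieve_cost) s"
proof -
 have H1: "1 \<le> H"
  using W by simp
 have T_le: "H * H \<le> T" "H * H * (H * H) \<le> T" and T_eq': "H * H * (H * H) * (H * H * (H * H)) = T"
 proof -
  have "H ^ 2 \<le> H ^ 8" "H ^ 4 \<le> H ^ 8"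
   using H1 by (auto intro: power_increasing)
  then show "H * H \<le> T" "H * H * (H * H) \<le> T" "H * H * (H * H) * (H * H * (H * H)) = T"
   by (simp_all add: T_eq power2_eq_square power4_eq_xxxx power_numeral_even mult.assoc)
 qed
 have bb: "0 \<le> base" "base \<le> int u"
 proof -
  show "0 \<le> base"
   using H1 by (simp add: base_eq)
  have "0 \<le> int k * T"
   using basic by simp
  then show "base \<le> int u"
   using base(2) by linarith
 qed
 define A where "A r = {r' \<in> allowed (set P) W. r' < r}" for r
 have allowed: "r \<in> allowed (set P) W \<longleftrightarrow> (\<forall>i<k. coprime (f i r) W)" if "0 \<le> r" "r < W" for r
  using that len(1) by (auto simp: allowed_def all_set_conv_all_nth)
 have AS: "card (A (r + 1)) = card (A r) + (if \<forall>i<k. coprime (f i r) W then 1 else 0)" if "0 \<le> r" "r < W" for r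
 proof -
  have "A (r + 1) = A r \<union> (if \<forall>i<k. coprime (f i r) W then {r} else {})"
   using allowed[OF that] by (auto simp: A_def order_le_less)
  moreover have "r \<notin> A r" "finite (A r)"
   using finite_allowed by (auto simp: A_def)
  ultimately show ?thesis
   by simp
 qed
 define Y where "Y r = {y. y mod W < r \<and> y mod W + W * H \<le> y \<and> good y}" for r
 have YS: "Y (r + 1) = Y r \<union> {y. y mod W = r \<and> r + W * H \<le> y \<and> good y}" for r
  by (auto simp: Y_def order_le_less)
 have YN: "{y. y mod W = r \<and> r + W * H \<le> y \<and> good y} = {}" if "0 \<le> r" "\<not> (\<forall>i<k. coprime (f i r) W)" for r
 proof (rule ccontr)
  assume "{y. y mod W = r \<and> r + W * H \<le> y \<and> good y} \<noteq> {}"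
  then obtain y where "y mod W = r" "r + W * H \<le> y" "good y"
   by blast
  with that no_good_outside_allowed[of y r] show False
   by auto
 qed
 have frames: "assigned residue_test \<inter> {vn, vk, vK, vH, vW, vT, vbase, vr} = {}" "\<not> prints residue_test"
  "assigned sieve_residue \<inter> {vn, vk, vK, vH, vW, vT, vbase, vr} = {}"
  by (simp_all add: program_defs)
 define t1 where "t1 = 40 + k * (105 + 30 * nat W)"
 have loop: "total (While [V vr <. V vW] (residue_test ;; If [V vok =. N 1] sieve_residue Skip ;; incr vr))
   (\<lambda>s'. set (outs s') = set (outs s) \<union> {y. y mod W + W * H \<le> y \<and> good y} \<and> clock s' \<le> clock s + sieve_cost) s0"
  if e: "env s0" "var s0 vr = 0" "outs s0 = outs s" "clock s0 \<le> clock s + 50" for s0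
 proof -
  let ?I = "\<lambda>s'. 0 \<le> var s' vr \<and> var s' vr \<le> W \<and> set (outs s') = set (outs s) \<union> Y (var s' vr) \<and>
   clock s' \<le> clock s + 50 + nat (var s' vr) * t1 + card (A (var s' vr)) * residue_cost"
  show ?thesis
  proof (rule total_While[where I = ?I and m = "\<lambda>s'. nat (W - var s' vr)"], goal_cases)
   case 1
   have "\<not> y mod W < 0" for y
    using pos_mod_sign[of W y] W by linarith
   then have "Y 0 = {}"
    by (simp add: Y_def)
   then show ?case
    using e W by simp
  next
   case (2 s1)
   have e1: "env (tick 5 s1)"
    using 2(2) e frames by (auto simp: frame_def env_def)
   note e1' = envD[OF e1]
   define r where "r = var s1 vr"
   have r: "0 \<le> r" "r < W" "set (outs s1) = set (outs s) \<union> Y r"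
     "clock s1 \<le> clock s + 50 + nat r * t1 + card (A r) * residue_cost"
    using 2(1,3) e1' by (auto simp: r_def)
   have vr: "var (tick 5 s1) vr = r"
    by (simp add: r_def)
   have nr: "nat (r + 1) = nat r + 1"
    using r by simp
   have rb: "r + 1 \<le> big"
    using r basic big_bounds by linarith
   have t5: "tick (bsize [V vr <. V vW] + 1) s1 = tick 5 s1"
    by simp
   let ?J = "\<lambda>s'. (0 \<le> var s' vr \<and> var s' vr \<le> W \<and> set (outs s') = set (outs s) \<union> Y (var s' vr) \<and>
    clock s' \<le> clock s + 50 + nat (var s' vr) * t1 + card (A (var s' vr)) * residue_cost) \<and>
    nat (W - var s' vr) < nat (W - var s1 vr)"
   have fin: "total (incr vr) ?J s3" if "var s3 vr = r" "set (outs s3) = set (outs s) \<union> Y (r + 1)"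
     "clock s3 + 4 \<le> clock s + 50 + nat (r + 1) * t1 + card (A (r + 1)) * residue_cost" for s3
    by (rule total_Asg) (use that r(1,2) rb in \<open>auto simp flip: r_def\<close>)
   show ?case
    unfolding t5
   proof (rule total_Seq, rule total_conseq[OF total_residue_test[OF e1 vr r(1,2)]], goal_cases)
    case (1 s2)
    have e2: "env (tick 5 s2)" "var (tick 5 s2) vr = r" "outs s2 = outs s1"
     using 1(2) e1 vr frames by (auto simp: frame_def env_def)
    have c2: "clock s2 \<le> clock s1 + 20 + k * (105 + 30 * nat W)"
     using 1(1) by simp
    have b5: "bsize [V vok =. N 1] + 1 = 5"
     by simp
    show ?case
    proof (rule total_Seq, rule total_If, goal_cases)
     case 1
     then show ?case
      by simp
    next
     case 2
     then have cop: "\<forall>i<k. coprime (f i r) W"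
      using \<open>_ \<and> clock s2 \<le> _\<close> by simp
     then have cA: "card (A (r + 1)) = card (A r) + 1"
      using AS[OF r(1,2)] by simp
     show ?case
      unfolding b5
     proof (rule total_conseq[OF total_sieve_residue[OF e2(1,2) r(1,2)]], goal_cases)
      case (1 i)
      then show ?case
       using cop by blast
     next
      case (2 s3)
      show ?case
      proof (rule fin, goal_cases)
       case 1
       show ?case
        using 2(2) e2 frames by (auto simp: frame_def)
      next
       case 2
       show ?case
        using \<open>set (outs s3) = _ \<and> _\<close> e2 r(3) YS[of r] by auto
      next
       case 3
       have "clock s3 \<le> clock s2 + 5 + residue_cost"
        using 2(1) by simp
       then show ?case
        using r(4) c2 unfolding cA nr t1_def by (simp add: algebra_simps)
      qed
     qed
    next
     case 3
     then have ncop: "\<not> (\<forall>i<k. coprime (f i r) W)"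
      using \<open>_ \<and> clock s2 \<le> _\<close> by simp
     then have cA: "card (A (r + 1)) = card (A r)"
      using AS[OF r(1,2)] by simp
     show ?case
      unfolding b5
     proof (rule total_Skip, rule fin, goal_cases)
      case 1
      then show ?case
       using e2 by simp
     next
      case 2
      then show ?case
       using e2 r(3) YS[of r] YN[OF r(1) ncop] by simp
     next
      case 3
      show ?case
       using r(4) c2 unfolding cA nr t1_def by (simp add: algebra_simps)
     qed
    qed
   qed
  next
   case (3 s1)
   have e1: "env s1"
    using 3(2) e frames by (auto simp: frame_def env_def)
   have vr: "var s1 vr = W"
    using 3(1,3) envD[OF e1] by auto
   have "Y W = {y. y mod W + W * H \<le> y \<and> good y}"
    using W by (auto simp: Y_def)
   moreover have "A W = allowed (set P) W"
    by (auto simp: A_def allowed_def)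
   ultimately show ?case
    using 3(1) unfolding vr by (simp add: sieve_cost_def t1_def)
  next
   case (4 s1)
   then show ?case
    by simp
  qed
 qed
 have abs: "\<bar>H * H\<bar> \<le> big" "\<bar>H * H * (H * H)\<bar> \<le> big" "\<bar>T\<bar> \<le> big" "\<bar>base\<bar> \<le> big" "0 \<le> big"
  using T_le basic big_bounds bb H1 by auto
 show ?thesis
  unfolding sieve_def
 proof (rule total_Seq, rule total_Asg, goal_cases)
  case 3
  show ?case
  proof (rule total_Seq, rule total_Asg, goal_cases)
   case 3
   show ?case
   proof (rule total_Seq, rule total_Asg, goal_cases)
    case 3
    show ?case
    proof (rule total_Seq, rule total_Asg, goal_cases)
     case 3
     show ?case
     proof (rule total_Seq, rule total_Asg, goal_cases)
      case 3
      show ?case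
       by (rule loop, unfold env_def) (use v T_eq' base_eq in simp_all)
     qed (use abs in auto)
    qed (use v abs in \<open>auto simp: base_eq\<close>)
   qed (use v abs T_eq' in auto)
  qed (use v abs in auto)
 qed (use v abs in auto)
qed

end

section \<open>Parameters and trial division\<close>

text \<open>Taken from the input with 0 in place of \<open>n\<close> and from index 2 on, so that it
  depends on the pattern alone and may enter the constant of the time bound.\<close>

definition pattern_bound :: "nat \<Rightarrow> int poly list \<Rightarrow> int" where
 "pattern_bound k P = Max (insert 8 (insert (int k) ((\<lambda>j. \<bar>pattern_input k P 0 ! j\<bar>) ` {2..<2 + 2 * k})))"

lemma pattern_input_ge_2: "2 \<le> j \<Longrightarrow> pattern_input k P n ! j = pattern_input k P 0 ! j"
 by (cases j) (auto simp: pattern_input_def nth_Cons split: nat.splits)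

lemma pattern_bound_ge:
 "8 \<le> pattern_bound k P" "int k \<le> pattern_bound k P"
 "2 \<le> j \<Longrightarrow> j < 2 + 2 * k \<Longrightarrow> \<bar>pattern_input k P 0 ! j\<bar> \<le> pattern_bound k P"
 unfolding pattern_bound_def
 by (rule Max_ge, simp, simp) (rule Max_ge, simp, simp, rule Max_ge, simp, rule insertI2, rule insertI2, rule imageI, simp)

lemma wheel_3: "wheel 3 = 8"
proof -
 have "wheel_primes 3 = {}"
  by (auto simp: wheel_primes_def)
 then show ?thesis
  by (simp add: wheel_def)
qed

lemma wheel_Suc:
 assumes "3 \<le> d"
 shows "wheel (Suc d) = (if prime d then wheel d * int d else wheel d)"
proof (cases "prime d")
 case True
 then have "wheel_primes (Suc d) = insert d (wheel_primes d)"
  using assms by (auto simp: wheel_primes_def less_Suc_eq)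
 moreover have "d \<notin> wheel_primes d"
  by (simp add: wheel_primes_def)
 ultimately show ?thesis
  using True by (simp add: wheel_def)
next
 case False
 then have "wheel_primes (Suc d) = wheel_primes d"
  by (auto simp: wheel_primes_def less_Suc_eq)
 with False show ?thesis
  by (simp add: wheel_def)
qed

lemma wheel_ge_8: "8 \<le> wheel d"
proof -
 have "0 < (\<Prod>p\<in>wheel_primes d. int p)"
  by (rule prod_pos) (auto simp: wheel_primes_def)
 then show ?thesis
  by (simp add: wheel_def)
qed

text \<open>\<open>H\<close> is the integer 16th root of \<open>n\<close>. The bounds on
  \<open>big\<close> cover the next 16th power, which the root search computes before it stops, and
  the values met by trial division.\<close>

locale front = pattern_search k P n big l u "pattern_bound k P" for k P n big l u +
 fixes H :: int
 assumes H: "0 \<le> H" "H ^ 16 \<le> int n" "int n < (H + 1) ^ 16"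
  and front_big: "(H + 1) ^ 16 \<le> big" "100 * (pattern_bound k P * (int n + 2 * pattern_bound k P + 2)) \<le> big"
begin

abbreviation "K \<equiv> pattern_bound k P"

lemma K_big: "10 * K + int n + 100 \<le> big" "K * (int n + 2 * K + 2) \<le> big"
proof -
 define q where "q = K * (int n + 2 * K + 2)"
 have "8 * (int n + 2 * K + 2) \<le> q"
  unfolding q_def using K_ge(4) by (intro mult_right_mono) auto
 then have "8 * int n + 16 * K + 16 \<le> q"
  by (simp add: distrib_left)
 moreover have "0 \<le> int n" "100 * q \<le> big"
  using front_big(2) by (simp_all add: q_def)
 ultimately have "10 * K + int n + 100 \<le> big" "q \<le> big"
  using K_ge(4) by linarith+
 then show "10 * K + int n + 100 \<le> big" "K * (int n + 2 * K + 2) \<le> big"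
  by (simp_all add: q_def)
qed

lemma H_le: "H \<le> int n" "H + 1 \<le> big"
proof -
 have "H ^ 1 \<le> H ^ 16" if "1 \<le> H"
  using that by (intro power_increasing) auto
 then show "H \<le> int n"
  using H by (cases "1 \<le> H") auto
 then show "H + 1 \<le> big"
  using K_big K_ge(4) by linarith
qed

lemma total_find_bound:
 assumes "var s vk = int k"
 shows "total find_bound (\<lambda>s'. var s' vK = K \<and> clock s' \<le> clock s + 200 + 80 * k) s"
proof -
 define g where "g j = \<bar>pattern_input k P n ! j\<bar>" for j
 define M where "M j = Max (insert 8 (insert (int k) (g ` {2..<j})))" for j :: nat
 have g0: "g j = \<bar>pattern_input k P 0 ! j\<bar>" if "2 \<le> j" for j
  using pattern_input_ge_2[OF that, of k P n] by (simp add: g_def)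
 have MK: "M (2 + 2 * k) = K"
  unfolding M_def pattern_bound_def using g0 by (intro arg_cong[where f = Max]) force
 have M2: "M 2 = max 8 (int k)"
  by (simp add: M_def)
 have MS: "M (Suc j) = max (M j) (g j)" if "2 \<le> j" for j
 proof -
  have "insert 8 (insert (int k) (g ` {2..<Suc j})) = insert (g j) (insert 8 (insert (int k) (g ` {2..<j})))"
   using that by (auto simp: atLeastLessThanSuc)
  then show ?thesis
   unfolding M_def by (simp add: max.commute)
 qed
 have g_le: "g j \<le> big" if "2 \<le> j" "j < 2 + 2 * k" for j
  using pattern_bound_ge(3)[OF that, of P] g0[OF that(1)] K_big K_ge(4) by linarith
 have kb: "int k \<le> big" "2 * int k + 3 \<le> big"
  using K_ge(3,4) K_big by linarith+
 let ?b = "Input vc (V vj) ;; If [V vc <. N 0] (Asg vc (N 0 -. V vc)) Skip ;;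
    If [V vK <. V vc] (Asg vK (V vc)) Skip ;; incr vj"
 have loop: "total (While [V vj <. N 2 +. N 2 *. V vk] ?b) (\<lambda>s'. var s' vK = K \<and> clock s' \<le> clock s + 200 + 80 * k) s0"
  if e: "var s0 vk = int k" "var s0 vK = M 2" "var s0 vj = 2" "clock s0 \<le> clock s + 50" for s0
 proof (rule total_While[where I = "\<lambda>s'. \<exists>j. 2 \<le> j \<and> j \<le> 2 + 2 * k \<and> var s' vj = int j \<and> var s' vK = M j \<and>
   clock s' \<le> clock s + 50 + 40 * (j - 2)" and m = "\<lambda>s'. nat (2 + 2 * int k - var s' vj)"], goal_cases)
  case 1
  show ?case
   using e by (intro exI[of _ 2]) auto
 next
  case (2 s1)
  have vk: "var s1 vk = int k"
   using 2(2) e by (auto simp: frame_def)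
  obtain j where j: "2 \<le> j" "j \<le> 2 + 2 * k" "var s1 vj = int j" "var s1 vK = M j" "clock s1 \<le> clock s + 50 + 40 * (j - 2)"
   using 2(1) by blast
  have jk: "j < 2 + 2 * k"
   using 2(3) j vk by simp
  have gj: "\<bar>pattern_input k P n ! j\<bar> \<le> big"
   using g_le[OF j(1) jk] by (simp add: g_def)
  have "total ?b (\<lambda>s'. var s' vj = int j + 1 \<and> var s' vK = max (M j) (g j) \<and> clock s' \<le> clock s1 + 40)
    (tick (bsize [V vj <. N 2 +. N 2 *. V vk] + 1) s1)"
   by (intro total_intros) (use j(3,4) jk gj input(1) kb in \<open>auto simp: g_def max_def\<close>)
  then show ?case
  proof (rule total_conseq, goal_cases)
   case (1 s2)
   have "clock s2 \<le> clock s + 50 + 40 * (Suc j - 2)"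
   proof -
    have "Suc j - 2 = Suc (j - 2)"
     using j(1) by simp
    then show ?thesis
     using 1(1) j(5) by simp
   qed
   then show ?case
    using 1(1) j(1,3) jk MS[OF j(1)] by (intro conjI exI[of _ "Suc j"]) auto
  qed
 next
  case (3 s1)
  have vk: "var s1 vk = int k"
   using 3(2) e by (auto simp: frame_def)
  obtain j where j: "2 \<le> j" "j \<le> 2 + 2 * k" "var s1 vj = int j" "var s1 vK = M j" "clock s1 \<le> clock s + 50 + 40 * (j - 2)"
   using 3(1) by blast
  have "j = 2 + 2 * k"
   using 3(3) j vk by simp
  then show ?case
   using j MK by simp
 next
  case (4 s1)
  then show ?case
   by simp
 qed
 show ?thesis
  unfolding find_bound_def
  by (intro total_Seq total_Asg total_If total_Skip loop) (use assms kb K_big K_ge(4) in \<open>auto simp: M2\<close>)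
qed

lemma total_power_16:
 assumes "var s vH = h" "0 \<le> h" "(h + 1) ^ 16 \<le> big"
 shows "total power_16 (\<lambda>s'. var s' vp = (h + 1) ^ 16 \<and> clock s' \<le> clock s + 20) s"
proof -
 define x where "x = h + 1"
 have x1: "1 \<le> x"
  using assms by (simp add: x_def)
 have p: "x ^ a \<le> x ^ 16" if "a \<le> 16" for a
  using x1 that by (rule power_increasing[rotated])
 have e: "x * x = x ^ 2" "x ^ 2 * x ^ 2 = x ^ 4" "x ^ 4 * x ^ 4 = x ^ 8" "x ^ 8 * x ^ 8 = x ^ 16"
  by (simp_all flip: power_add power2_eq_square)
 have b: "\<bar>x\<bar> \<le> big" "\<bar>x ^ 2\<bar> \<le> big" "\<bar>x ^ 4\<bar> \<le> big" "\<bar>x ^ 8\<bar> \<le> big" "\<bar>x ^ 16\<bar> \<le> big"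
  using p[of 1] p[of 2] p[of 4] p[of 8] x1 assms(3) by (auto simp flip: x_def)
 show ?thesis
  unfolding power_16_def
  by (intro total_Seq total_Asg) (use assms(1) b in \<open>simp_all add: e flip: x_def\<close>)
qed

lemma total_find_root:
 assumes vn: "var s vn = int n"
 shows "total find_root (\<lambda>s'. var s' vH = H \<and> clock s' \<le> clock s + 100 + 40 * nat H) s"
 unfolding find_root_def
proof (rule total_Seq, rule total_Asg, goal_cases)
 case 3
 have one: "(0 + 1 :: int) ^ 16 \<le> big"
  using K_big K_ge(4) by simp
 show ?case
 proof (rule total_Seq, rule total_conseq[OF total_power_16[where h = 0]], goal_cases)
  case 3
  show ?case
   using one .
 next
  case (4 s1)
  have s1: "var s1 vn = int n" "var s1 vH = 0" "var s1 vp = (0 + 1) ^ 16" "clock s1 \<le> clock s + 30"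
   using 4 vn by (auto simp: frame_def power_16_def)
  show ?case
  proof (rule total_While[where I = "\<lambda>s'. \<exists>h. 0 \<le> h \<and> h \<le> H \<and> var s' vH = h \<and> var s' vp = (h + 1) ^ 16 \<and>
    clock s' \<le> clock s + 30 + 40 * nat h" and m = "\<lambda>s'. nat (H - var s' vH)"], goal_cases)
   case 1
   show ?case
    using s1 H by (intro exI[of _ 0]) auto
  next
   case (2 s2)
   have v2: "var s2 vn = int n"
    using 2(2) s1 by (auto simp: frame_def power_16_def)
   obtain h where h: "0 \<le> h" "h \<le> H" "var s2 vH = h" "var s2 vp = (h + 1) ^ 16" "clock s2 \<le> clock s + 30 + 40 * nat h"
    using 2(1) by blast
   have hn: "(h + 1) ^ 16 \<le> int n"
    using 2(3) v2 h by simp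
   have hH: "h + 1 \<le> H"
   proof (rule ccontr)
    assume "\<not> h + 1 \<le> H"
    then have "(H + 1) ^ 16 \<le> (h + 1) ^ 16"
     using h H by (intro power_mono) auto
    with hn H show False
     by linarith
   qed
   then have pb: "(h + 1 + 1) ^ 16 \<le> big"
    using front_big(1) h power_mono[of "h + 1 + 1" "H + 1" 16] by linarith
   have nh: "nat (h + 1) = nat h + 1"
    using h by simp
   show ?case
   proof (rule total_Seq, rule total_Asg, goal_cases)
    case 3
    show ?case
    proof (rule total_conseq[OF total_power_16[OF _ _ pb]], goal_cases)
     case (3 s3)
     have "var s3 vH = h + 1"
      using 3(2) h by (auto simp: frame_def power_16_def)
     then show ?case
      using 3(1) h hH nh by (intro conjI exI[of _ "h + 1"]) auto
    qed (use h in auto)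
   qed (use h hH H_le in auto)
  next
   case (3 s2)
   have v2: "var s2 vn = int n"
    using 3(2) s1 by (auto simp: frame_def power_16_def)
   obtain h where h: "0 \<le> h" "h \<le> H" "var s2 vH = h" "var s2 vp = (h + 1) ^ 16" "clock s2 \<le> clock s + 30 + 40 * nat h"
    using 3(1) by blast
   have hn: "int n < (h + 1) ^ 16"
    using 3(3) v2 h by simp
   have "h = H"
   proof (rule ccontr)
    assume "h \<noteq> H"
    then have "(h + 1) ^ 16 \<le> H ^ 16"
     using h H by (intro power_mono) auto
    with hn H show False
     by linarith
   qed
   then show ?case
    using h by simp
  next
   case (4 s2)
   then show ?case
    by simp
  qed
 qed auto
qed (use K_big K_ge(4) in auto)

lemma total_find_wheel:
 assumes vH: "var s vH = H" "8 \<le> H"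
 shows "total find_wheel (\<lambda>s'. (\<exists>d\<ge>3. var s' vW = wheel d \<and> wheel d \<le> H \<and> H < wheel d * int d) \<and>
  clock s' \<le> clock s + 100 + nat H * (100 + 12 * nat H)) s"
proof -
 let ?b = "Asg vm (V vd) ;; trial_division ;; If [V ve =. V vd] (Asg vW (V vW *. V vd)) Skip ;; incr vd"
 define t where "t = 100 + 12 * nat H"
 have loop: "total (While [V vW *. V vd <. V vH +. N 1] ?b) (\<lambda>s'. (\<exists>d\<ge>3. var s' vW = wheel d \<and> wheel d \<le> H \<and> H < wheel d * int d) \<and>
  clock s' \<le> clock s + 100 + nat H * t) s0"
  if e: "var s0 vH = H" "var s0 vW = 8" "var s0 vd = 3" "clock s0 \<le> clock s + 20" for s0
 proof (rule total_While[where I = "\<lambda>s'. \<exists>d. 3 \<le> d \<and> int d \<le> H + 1 \<and> var s' vd = int d \<and> var s' vW = wheel d \<and> wheel d \<le> H \<and>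
   clock s' \<le> clock s + 20 + (d - 3) * t" and m = "\<lambda>s'. nat (H + 1 - var s' vd)"], goal_cases)
  case 1
  show ?case
   using e vH wheel_3 by (intro exI[of _ 3]) auto
 next
  case (2 s1)
  have v1: "var s1 vH = H"
   using 2(2) e by (auto simp: frame_def trial_division_def)
  obtain d where d: "3 \<le> d" "int d \<le> H + 1" "var s1 vd = int d" "var s1 vW = wheel d" "wheel d \<le> H" "clock s1 \<le> clock s + 20 + (d - 3) * t"
   using 2(1) by blast
  have dH: "wheel d * int d \<le> H"
   using 2(3) d v1 by simp
  have "8 * int d \<le> wheel d * int d"
   using wheel_ge_8 by (intro mult_right_mono) auto
  then have d8: "8 * int d \<le> H"
   using dH by linarith
  have pd: "prime (int d) \<longleftrightarrow> prime d"
   by simp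
  have "total ?b (\<lambda>s'. var s' vd = int d + 1 \<and> var s' vW = wheel (Suc d) \<and> clock s' \<le> clock s1 + t)
    (tick (bsize [V vW *. V vd <. V vH +. N 1] + 1) s1)"
  proof (rule total_Seq, rule total_Asg, goal_cases)
   case 3
   show ?case
   proof (rule total_Seq, rule total_conseq[OF total_trial_division[where m = "int d"]], goal_cases)
    case (4 s2)
    have v2: "var s2 vd = int d" "var s2 vW = wheel d" "var s2 ve = int d \<longleftrightarrow> prime d"
     using 4 d pd by (auto simp: frame_def trial_division_def)
    have "clock s2 \<le> clock s1 + 40 + 12 * d"
     using 4(1) by simp
    moreover have "12 * d \<le> 12 * nat H"
     using d8 by linarith
    ultimately have c2: "clock s2 + 40 \<le> clock s1 + t"
     unfolding t_def by linarith
    have ab: "\<bar>wheel d * int d\<bar> \<le> big" "int d + 1 \<le> big"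
     using dH d8 H_le H wheel_pos[of d] by (auto simp: abs_mult)
    show ?case
     by (intro total_intros) (use v2 c2 ab wheel_Suc[OF d(1)] in auto)
   qed (use d d8 H_le in auto)
  qed (use d d8 H_le in auto)
  then show ?case
  proof (rule total_conseq, goal_cases)
   case (1 s2)
   have "wheel (Suc d) \<le> H"
    using wheel_Suc[OF d(1)] dH d(5) by simp
   moreover have "clock s2 \<le> clock s + 20 + (Suc d - 3) * t"
   proof -
    have "Suc d - 3 = Suc (d - 3)"
     using d(1) by simp
    then show ?thesis
     using 1(1) d(6) by simp
   qed
   ultimately show ?case
    using 1(1) d d8 by (intro conjI exI[of _ "Suc d"]) auto
  qed
 next
  case (3 s1)
  have v1: "var s1 vH = H"
   using 3(2) e by (auto simp: frame_def trial_division_def)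
  obtain d where d: "3 \<le> d" "int d \<le> H + 1" "var s1 vd = int d" "var s1 vW = wheel d" "wheel d \<le> H" "clock s1 \<le> clock s + 20 + (d - 3) * t"
   using 3(1) by blast
  have "H < wheel d * int d"
   using 3(3) d v1 by simp
  moreover have "(d - 3) * t \<le> nat H * t"
   using d(1,2) by (intro mult_right_mono) linarith+
  then have "clock s1 + 20 \<le> clock s + 100 + nat H * t"
   using d(6) by linarith
  ultimately show ?case
   using d(1,4,5) by auto
 next
  case (4 s1)
  then show ?case
   by simp
 qed
 show ?thesis
  unfolding find_wheel_def
  by (intro total_Seq total_Asg loop[unfolded t_def]) (use vH K_big K_ge(4) in auto)
qed

lemma total_naive_test:
 assumes v: "var s vn = int n" "var s vk = int k" "var s vx = x"
  and M: "\<And>i. i < k \<Longrightarrow> \<bar>f i x\<bar> \<le> M" "M \<le> big"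
 shows "total naive_test (\<lambda>s'. (var s' vok = 1 \<longleftrightarrow> good x) \<and> clock s' \<le> clock s + 10 + k * (12 * nat M + 100 + 5)) s"
 unfolding naive_test_def good_def
proof (rule total_all_loop, goal_cases)
 case 1
 show ?case
  using v by simp
next
 case 2
 show ?case
  using K_ge(3,4) K_big by linarith
next
 case (6 s1 i)
 have v1: "var s1 vn = int n" "var s1 vx = x"
  using 6(1) v by (auto simp: frame_def read_poly_def trial_division_def)
 define m where "m = f i x"
 have fm: "coeff (P ! i) 1 * x + coeff (P ! i) 0 = m"
  by (simp add: m_def f_eq[OF 6(2)])
 have m: "\<bar>m\<bar> \<le> M"
  using M(1)[OF 6(2)] by (simp add: m_def)
 have ib: "int i + 1 \<le> big"
  using K_ge(3,4) K_big 6(2) by linarith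
 show ?case
 proof (rule total_Seq, rule total_conseq[OF total_read_poly[OF 6(3,2)]], goal_cases)
  case (1 s2)
  show ?case
  proof (rule total_Seq, rule total_Asg, goal_cases)
   case 3
   let ?s3 = "tick 6 (set_var vm m s2)"
   have s3: "tick (size_of (V va *. V vx +. V vb) + 1) (set_var vm (eval (var s2) (V va *. V vx +. V vb)) s2) = ?s3"
    using 1(1) v1 fm by simp
   have v3: "var ?s3 vn = int n" "var ?s3 vm = m" "var ?s3 vi = int i" "var ?s3 vok = var s1 vok" "clock ?s3 = clock s1 + 18"
    using 1(1) v1 6(3) by simp_all
   let ?c = "If [N 1 <. V vm, V vm <. V vn +. N 1]
     (trial_division ;; If [V ve =. V vm] Skip (Asg vok (N 0))) (Asg vok (N 0))"
   have "total ?c (\<lambda>s'. var s' vi = int i \<and> (var s' vok = 1 \<longleftrightarrow> var s1 vok = 1 \<and> prime m \<and> m \<le> int n) \<and>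
     clock s' \<le> clock s1 + 80 + 12 * nat M) ?s3"
   proof (rule total_If, goal_cases)
    case 1
    show ?case
     by simp
   next
    case 2
    then have m2: "2 \<le> m" "m \<le> int n"
     using v3 by simp_all
    show ?case
    proof (rule total_Seq, rule total_conseq[OF total_trial_division[where m = m]], goal_cases)
     case (4 s4)
     have v4: "var s4 vi = int i" "var s4 vok = var s1 vok" "var s4 vm = m"
      using 4(2) v3 by (auto simp: frame_def trial_division_def)
     have "clock s4 \<le> clock s1 + 50 + 12 * nat m"
      using 4(1) v3(5) by simp
     moreover have "nat m \<le> nat M"
      using m by simp
     ultimately have c4: "clock s4 \<le> clock s1 + 50 + 12 * nat M"
      by linarith
     show ?case
      by (intro total_intros) (use v4 c4 4(1) m2 K_big K_ge(4) in auto)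
    qed (use v3 m2 m M(2) in auto)
   next
    case 3
    then have "\<not> (prime m \<and> m \<le> int n)"
     using v3 prime_ge_2_int[of m] by auto
    then show ?case
     by (intro total_intros) (use v3 K_big K_ge(4) in auto)
   qed
   then show ?case
    unfolding s3
   proof (rule total_Seq[OF total_conseq], goal_cases)
    case (1 s4)
    then show ?case
     by (intro total_intros) (use ib in \<open>auto simp: m_def\<close>)
   qed
  qed (use 1(1) v1 fm m M(2) in auto)
 qed
qed (auto simp: read_poly_def trial_division_def)

lemma total_naive_search:
 assumes v: "var s vn = int n" "var s vk = int k" "var s vK = K" "var s vX = X"
  and X: "- K \<le> X" "X + 1 \<le> big"
  and M: "\<And>i x. i < k \<Longrightarrow> - K \<le> x \<Longrightarrow> x \<le> X \<Longrightarrow> \<bar>f i x\<bar> \<le> M" "M \<le> big"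
 shows "total naive_search (\<lambda>s'. set (outs s') = set (outs s) \<union> {x. x \<le> X \<and> good x} \<and>
  clock s' \<le> clock s + 20 + nat (X + K + 1) * (50 + k * (12 * nat M + 105))) s"
 unfolding naive_search_def
proof (rule total_Seq, rule total_Asg, goal_cases)
 case 3
 define t where "t = 50 + k * (12 * nat M + 105)"
 define Y where "Y y = {x. x < y \<and> good x}" for y
 have frames: "assigned naive_test \<inter> {vn, vk, vK, vX, vx} = {}" "\<not> prints naive_test"
  by (simp_all add: program_defs)
 let ?I = "\<lambda>s'. - K \<le> var s' vx \<and> var s' vx \<le> X + 1 \<and> set (outs s') = set (outs s) \<union> Y (var s' vx) \<and>
  clock s' \<le> clock s + 4 + nat (var s' vx + K) * t"
 show ?case
 proof (rule total_While[where I = ?I and m = "\<lambda>s'. nat (X + 1 - var s' vx)"], goal_cases)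
  case 1
  have "Y (- K) = {}"
   using good_le(2) by (force simp: Y_def)
  then show ?case
   using v X by simp
 next
  case (2 s1)
  have v1: "var s1 vn = int n" "var s1 vk = int k" "var s1 vX = X"
   using 2(2) v frames by (auto simp: frame_def)
  define y where "y = var s1 vx"
  have y: "- K \<le> y" "y \<le> X" "set (outs s1) = set (outs s) \<union> Y y" "clock s1 \<le> clock s + 4 + nat (y + K) * t"
   using 2(1,3) v1 by (auto simp: y_def)
  have My: "\<And>i. i < k \<Longrightarrow> \<bar>f i y\<bar> \<le> M"
   using M(1) y by blast
  have YS: "Y (y + 1) = Y y \<union> (if good y then {y} else {})"
   by (auto simp: Y_def order_le_less)
  have ny: "nat (y + 1 + K) = nat (y + K) + 1"
   using y by simp
  show ?case
  proof (rule total_Seq, rule total_conseq[OF total_naive_test[where x = y and M = M]], goal_cases)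
   case (6 s2)
   have v2: "var s2 vx = y" "outs s2 = outs s1"
    using 6(2) frames by (auto simp: frame_def y_def)
   have c2: "clock s2 + 32 \<le> clock s1 + t"
   proof -
    have "clock s2 \<le> clock s1 + 7 + 10 + k * (12 * nat M + 100 + 5)"
     using 6(1) by simp
    then show ?thesis
     unfolding t_def by (simp add: algebra_simps)
   qed
   have yb: "\<bar>y + 1\<bar> \<le> big"
    using y X K_big K_ge(4) by linarith
   have "total (If [V vok =. N 1] (Print (V vx)) Skip ;; incr vx)
    (\<lambda>s'. var s' vx = y + 1 \<and> set (outs s') = set (outs s1) \<union> (if good y then {y} else {}) \<and> clock s' \<le> clock s1 + t) s2"
    by (intro total_intros) (use v2 c2 6(1) yb in auto)
   then show ?case
   proof (rule total_conseq, goal_cases)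
    case (1 s3)
    have "clock s3 \<le> clock s + 4 + nat (y + 1 + K) * t"
     unfolding ny add_mult_distrib using 1(1) y(4) by linarith
    moreover have "set (outs s3) = set (outs s) \<union> Y (y + 1)"
     using 1(1) y(3) YS by auto
    ultimately show ?case
     using 1(1) y(1,2) by (auto simp flip: y_def)
   qed
  qed (use v1 My M(2) in \<open>auto simp: y_def\<close>)
 next
  case (3 s1)
  have v1: "var s1 vX = X"
   using 3(2) v frames by (auto simp: frame_def)
  have vx: "var s1 vx = X + 1"
   using 3(1,3) v1 by auto
  have "Y (X + 1) = {x. x \<le> X \<and> good x}" "nat (X + 1 + K) = nat (X + K + 1)"
   by (auto simp: Y_def algebra_simps)
  then show ?case
   using 3(1) unfolding vx by (simp add: t_def)
 next
  case (4 s1)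
  then show ?case
   by simp
 qed
qed (use v K_big K_ge(4) in auto)

lemma pattern_primes_eq: "pattern_primes P n = {x. good x}"
proof -
 have "set P \<noteq> {}"
  using len by auto
 then have "pattern_primes P n = {x. \<forall>g\<in>set P. prime (poly g x) \<and> poly g x \<le> int n}"
  by (auto simp: pattern_primes_def)
 also have "\<dots> = {x. good x}"
  using len(1) by (simp add: good_def all_set_conv_all_nth)
 finally show ?thesis .
qed

end

section \<open>Growth\<close>

text \<open>The crude \<open>d^d\<close> is good enough: after two logarithms it changes the
  estimate only by a constant factor.\<close>

lemma wheel_le:
 assumes "3 \<le> d"
 shows "wheel d \<le> 8 * int d ^ d"
 using assms
proof (induction d rule: nat_induct_at_least)
 case base
 then show ?case
  by (simp add: wheel_3)
next
 case (Suc d)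
 have "wheel (Suc d) \<le> wheel d * int d"
 proof -
  have "wheel d * 1 \<le> wheel d * int d"
   using Suc wheel_pos[of d] by (intro mult_left_mono) auto
  then show ?thesis
   using wheel_Suc[OF Suc(1)] by simp
 qed
 also have "\<dots> \<le> 8 * int d ^ d * int d"
  using Suc by (intro mult_right_mono) auto
 also have "\<dots> = 8 * int d ^ Suc d"
  by simp
 also have "\<dots> \<le> 8 * int (Suc d) ^ Suc d"
  by (intro mult_left_mono power_mono) auto
 finally show ?case .
qed

text \<open>\<open>exp 1 < 3\<close> follows from \<open>exp (- 1 / 8) \<ge> 7 / 8\<close>, since
  \<open>(7 / 8)^8\<close> exceeds 1/3; hence \<open>ln (ln n)\<close> is positive from
  \<open>n = 3\<close> on.\<close>

lemma one_less_ln: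
 assumes "3 \<le> n"
 shows "1 < ln (real n)"
proof -
 have "1 + (- 1 / 8) \<le> exp (- 1 / 8 :: real)"
  by (rule exp_ge_add_one_self)
 then have "(7 / 8) ^ 8 \<le> exp (- 1 / 8 :: real) ^ 8"
  by (intro power_mono) auto
 also have "\<dots> = exp (- 1)"
  by (simp flip: exp_of_nat_mult)
 finally have "(7 / 8) ^ 8 \<le> exp (- 1 :: real)" .
 then have "(7 / 8) ^ 8 * exp 1 \<le> exp (- 1) * exp (1 :: real)"
  by (intro mult_right_mono) auto
 then have "(7 / 8) ^ 8 * exp 1 \<le> (1 :: real)"
  by (simp flip: exp_add)
 then have "exp 1 < (3 :: real)"
  by (simp add: power_divide field_simps)
 then have "exp 1 < real n"
  using assms by linarith
 then have "ln (exp 1) < ln (real n)"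
  using assms by (subst ln_less_cancel_iff) auto
 then show ?thesis
  by simp
qed

lemma ln_ln_pos: "3 \<le> n \<Longrightarrow> 0 < ln (ln (real n))"
 using one_less_ln by simp

text \<open>With \<open>y = ln (ln n)\<close>, the power \<open>(y / (2 k))^k\<close> is at most
  \<open>exp (y / 2) = sqrt (ln n)\<close>. This lets terms of order \<open>sqrt n\<close>, such as
  the set-up time, be absorbed into the final bound.\<close>

lemma ln_ln_power_le:
 assumes "3 \<le> n" "0 < k"
 shows "ln (ln (real n)) ^ k \<le> (2 * real k) ^ k * sqrt (real n)"
proof -
 define y where "y = ln (ln (real n))"
 have y: "0 < y"
  using ln_ln_pos[OF assms(1)] by (simp add: y_def)
 have ln: "1 < ln (real n)"
  using one_less_ln[OF assms(1)] .
 have "(y / 2 / real k) ^ k \<le> (1 + y / 2 / real k) ^ k"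
  using y assms by (intro power_mono) auto
 also have "\<dots> \<le> exp (y / 2)"
  using y assms by (intro exp_ge_one_plus_x_over_n_power_n) auto
 also have "exp (y / 2) = sqrt (exp y)"
  by (rule real_sqrt_unique[symmetric]) (simp_all add: power2_eq_square flip: exp_add)
 also have "exp y = ln (real n)"
  using ln by (simp add: y_def)
 also have "sqrt (ln (real n)) \<le> sqrt (real n)"
  using ln_le_minus_one[of "real n"] assms by simp
 finally have "(y / 2 / real k) ^ k \<le> sqrt (real n)" .
 then have le: "(2 * real k) ^ k * (y / 2 / real k) ^ k \<le> (2 * real k) ^ k * sqrt (real n)"
  by (intro mult_left_mono) auto
 have eq: "(2 * real k) ^ k * (y / 2 / real k) ^ k = y ^ k"
 proof -
  have "2 * real k * (y / 2 / real k) = y"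
   using assms by simp
  then show ?thesis
   by (metis power_mult_distrib)
 qed
 show ?thesis
  using le unfolding eq unfolding y_def .
qed

text \<open>\<open>n\<close> is at most \<open>(8 d^(d + 1))^16\<close>, so \<open>ln n\<close> is
  at most \<open>48 d^2\<close>. As \<open>48 \<le> 3^4 \<le> d^4\<close>, this is at most
  \<open>d^6\<close>, and a second logarithm gives the factor 6.\<close>

lemma ln_ln_le:
 assumes d: "3 \<le> d" and H: "H < wheel d * int d" "0 \<le> H" "int n < (H + 1) ^ 16" and n: "3 \<le> n"
 shows "ln (ln (real n)) \<le> 6 * ln (real d)"
proof -
 have "wheel d * int d \<le> 8 * int d ^ d * int d"
  using wheel_le[OF d] by (intro mult_right_mono) auto
 moreover have "8 * int d ^ d * int d = 8 * int d ^ Suc d"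
  by simp
 ultimately have "H + 1 \<le> 8 * int d ^ Suc d"
  using H(1) by linarith
 then have "(H + 1) ^ 16 \<le> (8 * int d ^ Suc d) ^ 16"
  using H by (intro power_mono) auto
 then have "int n \<le> (8 * int d ^ Suc d) ^ 16"
  using H by linarith
 then have "real_of_int (int n) \<le> real_of_int ((8 * int d ^ Suc d) ^ 16)"
  by (simp only: of_int_le_iff)
 then have "real n \<le> (8 * real d ^ Suc d) ^ 16"
  by simp
 then have "ln (real n) \<le> ln ((8 * real d ^ Suc d) ^ 16)"
  using n d by (subst ln_le_cancel_iff) auto
 also have "\<dots> = 16 * (ln 8 + real (Suc d) * ln (real d))"
 proof -
  have d0: "0 < real d" "0 < real d ^ Suc d"
   using d by simp_all
  have "ln ((8 * real d ^ Suc d) ^ 16) = real 16 * ln (8 * real d ^ Suc d)"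
   by (rule ln_realpow)
  moreover have "ln (8 * real d ^ Suc d) = ln 8 + ln (real d ^ Suc d)"
   using d0 by (simp add: ln_mult del: power_Suc)
  moreover have "ln (real d ^ Suc d) = real (Suc d) * ln (real d)"
   by (rule ln_realpow)
  ultimately show ?thesis
   by (simp only: of_nat_numeral)
 qed
 also have "\<dots> \<le> 16 * (7 + real (Suc d) * real d)"
  using ln_le_minus_one[of "8 :: real"] ln_le_minus_one[of "real d"] d
  by (intro mult_left_mono add_mono) auto
 also have "\<dots> \<le> 48 * real d ^ 2"
 proof -
  define q where "q = real d * real d"
  have "3 * real d \<le> q" "3 \<le> real d"
   unfolding q_def using d by (auto intro!: mult_right_mono)
  moreover have e: "real (Suc d) * real d = q + real d" "real d ^ 2 = q"
   by (simp_all add: q_def algebra_simps power2_eq_square)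
  ultimately show ?thesis
   unfolding e distrib_left by linarith
 qed
 also have "\<dots> \<le> real d ^ 4 * real d ^ 2"
 proof -
  have "(3 :: real) ^ 4 \<le> real d ^ 4"
   using d by (intro power_mono) auto
  then show ?thesis
   by (intro mult_right_mono) auto
 qed
 also have "\<dots> = real d ^ 6"
  by (simp flip: power_add)
 finally have "ln (real n) \<le> real d ^ 6" .
 then have "ln (ln (real n)) \<le> ln (real d ^ 6)"
  using one_less_ln[OF n] d by (subst ln_le_cancel_iff) auto
 also have "\<dots> = 6 * ln (real d)"
  using d by (simp add: ln_realpow)
 finally show ?thesis .
qed

text \<open>The finitely many \<open>n\<close> below the threshold are absorbed by the largest
  quotient \<open>t n / g n\<close>, so that the bound starts at 3, where \<open>g\<close> becomes
  positive.\<close>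

lemma absorb_finite:
 fixes t :: "nat \<Rightarrow> real" and g :: "nat \<Rightarrow> real"
 assumes "\<And>n. N0 \<le> n \<Longrightarrow> t n \<le> C * g n" and pos: "\<And>n. 3 \<le> n \<Longrightarrow> 0 < g n"
 shows "\<exists>C. \<forall>n\<ge>3. t n \<le> C * g n"
proof -
 define C' where "C' = Max (insert C ((\<lambda>n. t n / g n) ` {3..N0}))"
 have "t n \<le> C' * g n" if n: "3 \<le> n" for n
 proof (cases "N0 \<le> n")
  case True
  have "C \<le> C'"
   unfolding C'_def by (rule Max_ge) auto
  then have "C * g n \<le> C' * g n"
   using pos[OF n] by (intro mult_right_mono) auto
  with assms(1)[OF True] show ?thesis
   by linarith
 next
  case False
  then have "t n / g n \<le> C'"
   unfolding C'_def using n by (intro Max_ge) auto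
  then show ?thesis
   using pos[OF n] by (simp add: pos_divide_le_eq)
 qed
 then show ?thesis
  by blast
qed

text \<open>Distinct linear polynomials are distinct pairs of coefficients, so \<open>k\<close> is
  polynomial in \<open>n\<close>. As \<open>k\<close> is itself an input integer, this keeps the
  word size of order \<open>log n\<close>.\<close>

lemma card_linear_polys:
 assumes P: "is_pattern k P" and n: "\<forall>g\<in>set P. \<forall>i. \<bar>coeff g i\<bar> \<le> int n" "1 \<le> n"
 shows "k \<le> 9 * n ^ 2"
proof -
 let ?g = "\<lambda>g. (coeff g 0, coeff g 1)"
 have d1: "degree g = 1" if "g \<in> set P" for g
  using P that by (simp add: is_pattern_def)
 have "inj_on ?g (set P)"
 proof (rule inj_onI)
  fix g h assume gh: "g \<in> set P" "h \<in> set P" "?g g = ?g h"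
  have "coeff g i = coeff h i" for i
  proof (cases "i \<le> 1")
   case True
   then have "i = 0 \<or> i = 1"
    by linarith
   then show ?thesis
    using gh(3) by auto
  next
   case False
   then show ?thesis
    using d1[OF gh(1)] d1[OF gh(2)] by (simp add: coeff_eq_0)
  qed
  then show "g = h"
   by (rule poly_eqI)
 qed
 moreover have "?g ` set P \<subseteq> {- int n..int n} \<times> {- int n..int n}"
 proof (rule image_subsetI)
  fix g assume "g \<in> set P"
  then have "\<bar>coeff g 0\<bar> \<le> int n" "\<bar>coeff g 1\<bar> \<le> int n"
   using n(1) by blast+
  then show "?g g \<in> {- int n..int n} \<times> {- int n..int n}"
   unfolding mem_Times_iff fst_conv snd_conv atLeastAtMost_iff by linarith
 qed
 ultimately have "card (set P) \<le> card ({- int n..int n} \<times> {- int n..int n})"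
  by (intro card_inj_on_le) auto
 also have "\<dots> = (2 * n + 1) * (2 * n + 1)"
  by (simp add: card_cartesian_product nat_add_distrib nat_mult_distrib)
 also have "\<dots> \<le> (3 * n) * (3 * n)"
  using n by (intro mult_mono) auto
 also have "\<dots> = 9 * n ^ 2"
  by (simp add: power2_eq_square)
 finally show ?thesis
  using P by (simp add: is_pattern_def distinct_card)
qed

text \<open>The exponent is logarithmic in \<open>n\<close>; the weak form by \<open>sqrt n\<close>
  suffices because the input and the registers share the space budget
  \<open>k * sqrt n\<close>.\<close>

lemma log_le_sqrt:
 assumes "2 ^ m \<le> 9 * n ^ 2" "1 \<le> n"
 shows "real (Suc m) \<le> 9 * sqrt (real n)"
proof -
 have s1: "1 \<le> sqrt (real n)"
  using assms by simp
 have "ln (1 / 2 :: real) \<le> 1 / 2 - 1"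
  by (rule ln_le_minus_one) simp
 then have ln2: "1 / 2 \<le> ln (2 :: real)"
  by (simp add: ln_div)
 have "real (2 ^ m) \<le> real (9 * n ^ 2)"
  using assms(1) by (simp only: of_nat_le_iff)
 also have "\<dots> = (3 * sqrt (real n) ^ 2) ^ 2"
  by (simp add: power_mult_distrib)
 finally have "(2 :: real) ^ m \<le> (3 * sqrt (real n) ^ 2) ^ 2"
  by simp
 then have "ln ((2 :: real) ^ m) \<le> ln ((3 * sqrt (real n) ^ 2) ^ 2)"
  using assms by (subst ln_le_cancel_iff) auto
 also have "\<dots> = 2 * (ln 3 + 2 * ln (sqrt (real n)))"
 proof -
  have s0: "0 < sqrt (real n)"
   using s1 by linarith
  have "ln ((3 * sqrt (real n) ^ 2) ^ 2) = real 2 * ln (3 * sqrt (real n) ^ 2)"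
   by (rule ln_realpow)
  moreover have "ln (3 * sqrt (real n) ^ 2) = ln 3 + ln (sqrt (real n) ^ 2)"
   using s0 by (simp add: ln_mult)
  moreover have "ln (sqrt (real n) ^ 2) = real 2 * ln (sqrt (real n))"
   by (rule ln_realpow)
  ultimately show ?thesis
   by (simp only: of_nat_numeral)
 qed
 also have "\<dots> \<le> 2 * (2 + 2 * (sqrt (real n) - 1))"
  using ln_le_minus_one[of "3 :: real"] ln_le_minus_one[of "sqrt (real n)"] s1
  by (intro mult_left_mono add_mono) auto
 finally have "real m * ln 2 \<le> 4 * sqrt (real n)"
  by (simp add: ln_realpow)
 moreover have "real m * (1 / 2) \<le> real m * ln 2"
  using ln2 by (intro mult_left_mono) auto
 ultimately have "real m \<le> 8 * sqrt (real n)"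
  by linarith
 then show ?thesis
  using s1 unfolding of_nat_Suc by linarith
qed

text \<open>The sieve's cost asks for one bound for all polynomials of the pattern, while the
  density estimate speaks of the count for one residue; a maximum that is attained meets
  both.\<close>

lemma max_reps_mod:
 assumes "0 < W"
 shows "\<exists>NN. (\<forall>\<gamma> \<epsilon> \<rho>. (\<gamma>, \<epsilon>) \<in> forms \<longrightarrow> coprime \<rho> W \<longrightarrow> card (reps_mod \<gamma> \<epsilon> \<rho> W) \<le> NN) \<and>
  (\<exists>\<gamma> \<epsilon> \<rho>. (\<gamma>, \<epsilon>) \<in> forms \<and> coprime \<rho> W \<and> NN = card (reps_mod \<gamma> \<epsilon> \<rho> W))"
proof -
 define S where "S = {card (reps_mod \<gamma> \<epsilon> \<rho> W) |\<gamma> \<epsilon> \<rho>. (\<gamma>, \<epsilon>) \<in> forms \<and> coprime \<rho> W}"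
 have "card (reps_mod \<gamma> \<epsilon> \<rho> W) \<le> card ({0..<W} \<times> {0..<W})" for \<gamma> \<epsilon> \<rho>
  by (rule card_mono) (auto simp: reps_mod_def)
 then have "S \<subseteq> {..card ({0..<W} \<times> {0..<W})}"
  by (auto simp: S_def)
 then have fin: "finite S"
  using finite_subset by blast
 have "(0, 4) \<in> forms" "coprime 1 W"
  by (simp_all add: forms_def)
 then have "card (reps_mod 0 4 1 W) \<in> S"
  unfolding S_def by blast
 then have ne: "S \<noteq> {}"
  by blast
 have "Max S \<in> S"
  using fin ne by (rule Max_in)
 moreover have "c \<le> Max S" if "c \<in> S" for c
  using fin that by (rule Max_ge)
 ultimately show ?thesis
  by (intro exI[of _ "Max S"]) (auto simp: S_def)
qed

text \<open>An admissible class has about \<open>n / (W T)\<close> segments, each of cost of order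
  \<open>K^2 T (1 + NN / W)\<close>. \<open>W^2 \<le> T\<close> hides the passes over all classes
  modulo \<open>W\<close>, and \<open>T^2 \<le> n\<close> the rounding. What remains carries the
  factor that the density theorem bounds.\<close>

lemma (in search) sieve_cost_le:
 assumes T_eq: "T = H ^ 8" and H16: "H ^ 16 \<le> int n"
 shows "real sieve_cost \<le> 300 * (of_int K * of_int T) +
  100000000 * (of_int K ^ 3 * (real n * (real (card (allowed (set P) W)) / of_int W * (1 + real NN / of_int W))))"
proof -
 define kk h w t rr N m a where "kk = real_of_int K" and "h = real_of_int H" and "w = real_of_int W"
  and "t = real_of_int T" and "rr = real_of_int R" and "N = real NN" and "m = real n"
  and "a = real (card (allowed (set P) W))"
 note defs = kk_def h_def w_def t_def rr_def N_def m_def a_def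
 have b: "8 \<le> kk" "kk \<le> h" "8 \<le> w" "w \<le> h" "h \<le> t" "real k \<le> kk"
  using K W T by (simp_all add: defs)
 have b0: "0 \<le> N" "0 \<le> a" "1 \<le> t"
  using b by (simp_all add: defs)
 have ww: "w * w \<le> t"
 proof -
  have "W * W \<le> H * H"
   using W by (intro mult_mono) auto
  also have "\<dots> = H ^ 2"
   by (simp add: power2_eq_square)
  also have "\<dots> \<le> T"
   unfolding T_eq using W by (intro power_increasing) auto
  finally have "real_of_int (W * W) \<le> real_of_int T"
   by (simp only: of_int_le_iff)
  then show ?thesis
   by (simp add: defs)
 qed
 have tt: "t * t \<le> m"
 proof -
  have "T * T = H ^ 16"
   by (simp add: T_eq flip: power_add)
  then have "real_of_int (T * T) \<le> real_of_int (int n)"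
   using H16 by (simp only: of_int_le_iff)
  then show ?thesis
   by (simp add: defs)
 qed
 have tm: "t \<le> m"
 proof -
  have "1 * t \<le> t * t"
   using b0 by (intro mult_right_mono) auto
  then show ?thesis
   using tt by linarith
 qed
 define kt where "kt = kk * t"
 have rr: "rr = 300 * kt"
  by (simp add: defs R kt_def)
 have kt: "t \<le> kt" "1 \<le> kt" "kk \<le> kt" "w \<le> rr"
 proof -
  have "1 * t \<le> kk * t" "kk * 1 \<le> kk * t"
   using b b0 by (auto intro!: mult_mono)
  then show "t \<le> kt" "1 \<le> kt" "kk \<le> kt" "w \<le> rr"
   using b b0 unfolding rr kt_def by linarith+
 qed
 define q where "q = real (nat (R div W))"
 have q: "0 \<le> q" "q \<le> rr / w"
 proof -
  have "0 \<le> R div W"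
   using basic W by (simp add: pos_imp_zdiv_nonneg_iff)
  then have "q = real_of_int (R div W)"
   by (simp add: q_def)
  also have "\<dots> \<le> rr / w"
   unfolding defs by (rule real_of_int_div4)
  finally show "q \<le> rr / w" .
 qed (simp add: q_def)
 have one: "1 \<le> rr / w"
  using kt b by simp
 define y where "y = kt * (N / w)"
 have y0: "0 \<le> y"
  using kt b b0 by (simp add: y_def)
 define Z where "Z = 1 + N / w"
 have Z: "1 \<le> Z" "N / w \<le> Z"
  using b b0 by (simp_all add: Z_def)
 have conv: "real (nat W) = w" "real (nat R) = rr" "real (nat (K * T)) = kt" "real (nat T) = t" "real (nat (int k * T)) = real k * t"
  using W basic by (simp_all add: defs kt_def)
 have pc: "real poly_cost \<le> 1000000 * (kt * Z)"
 proof -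
  have "real poly_cost = 500 + 100 * ((w + 1) * (w + 1)) + 1000 * ((q + 2) * N) + 1250 * rr + 100 * (w * w) + 200 * kt"
   unfolding poly_cost_def of_nat_add of_nat_mult of_nat_1 of_nat_numeral conv q_def[symmetric] N_def[symmetric]
   by (simp add: algebra_simps)
  moreover have "(w + 1) * (w + 1) = w * w + 2 * w + 1"
   by (simp add: algebra_simps)
  moreover have "(q + 2) * N \<le> (3 * (rr / w)) * N"
   using q one b0 by (intro mult_right_mono) auto
  moreover have "(3 * (rr / w)) * N = 900 * y"
   by (simp add: rr y_def)
  moreover have "kt * Z = kt + y"
   by (simp add: Z_def y_def algebra_simps)
  ultimately show ?thesis
   using ww b b0 kt y0 rr by linarith
 qed
 define v where "v = kk * (kt * Z)"
 have v: "kt \<le> v" "kt * Z \<le> v"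
 proof -
  have ktZ: "kt * 1 \<le> kt * Z"
   using kt Z by (intro mult_left_mono) auto
  then have "1 * (kt * Z) \<le> kk * (kt * Z)"
   using b kt by (intro mult_right_mono) auto
  then show "kt \<le> v" "kt * Z \<le> v"
   using ktZ by (simp_all add: v_def)
 qed
 have sg: "real seg_cost \<le> 2000000 * v"
 proof -
  have "real seg_cost = 60 + 30 * (real k * t) + real k * (real poly_cost + 20) + t * (65 * real k + 60)"
   unfolding seg_cost_def of_nat_add of_nat_mult of_nat_numeral conv by simp
  moreover have "real k * t \<le> kt"
   unfolding kt_def using b b0 by (intro mult_right_mono) auto
  moreover have "real k * (real poly_cost + 20) \<le> kk * (1000000 * (kt * Z) + 20)"
   using b pc by (intro mult_mono) auto
  moreover have "kk * (1000000 * (kt * Z) + 20) = 1000000 * v + 20 * kk"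
   by (simp add: v_def algebra_simps)
  moreover have "t * (65 * real k + 60) = 65 * (real k * t) + 60 * t"
   by (simp add: algebra_simps)
  ultimately show ?thesis
   using kt v by linarith
 qed
 define c where "c = real (nat ((int n + K) div (W * T)) + 1)"
 have wt: "1 \<le> w * t" "w * t \<le> m"
 proof -
  show "1 \<le> w * t"
   using b b0 mult_mono[of 1 w 1 t] by simp
  have "w * t \<le> t * t"
   using b b0 by (intro mult_right_mono) auto
  then show "w * t \<le> m"
   using tt by linarith
 qed
 \<comment> \<open>One part each for \<open>n\<close>, for \<open>K \<le> n\<close> and for the last
   incomplete segment.\<close>
 have c: "c \<le> 3 * (m / (w * t))"
 proof -
  have "0 \<le> (int n + K) div (W * T)"
   using K W basic by (intro pos_imp_zdiv_nonneg_iff[THEN iffD2] mult_pos_pos) auto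
  then have "c = real_of_int ((int n + K) div (W * T)) + 1"
   by (simp add: c_def)
  also have "\<dots> \<le> (m + kk) / (w * t) + 1"
   using real_of_int_div4[of "int n + K" "W * T"] by (simp add: defs)
  also have "\<dots> \<le> (m + m) / (w * t) + m / (w * t)"
  proof (intro add_mono divide_right_mono)
   show "kk \<le> m"
    using b tm by linarith
   show "1 \<le> m / (w * t)"
    using wt by simp
  qed (use wt in auto)
  also have "\<dots> = 3 * (m / (w * t))"
   by (simp add: field_simps)
  finally show ?thesis .
 qed
 define U where "U = kk ^ 3 * (m / w * Z)"
 have mw: "1 \<le> m / w"
  using b tm by simp
 have k3: "1 \<le> kk ^ 3" "kk ^ 2 \<le> kk ^ 3"
  using b by (auto intro!: one_le_power power_increasing)
 have mZ: "1 \<le> m / w * Z"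
  using mult_mono[of 1 "m / w" 1 Z] mw Z by simp
 have U1: "1 \<le> U" "kk ^ 2 * (m / w * Z) \<le> U"
 proof -
  have "1 * 1 \<le> kk ^ 3 * (m / w * Z)"
   by (rule mult_mono) (use mZ k3 in linarith)+
  then show "1 \<le> U"
   unfolding U_def by linarith
  show "kk ^ 2 * (m / w * Z) \<le> U"
   unfolding U_def by (rule mult_right_mono) (use mZ k3 in linarith)+
 qed
 have rs: "real residue_cost \<le> 100000000 * U"
 proof -
  have "real residue_cost = 50 + c * (real seg_cost + 30) + 200 * (real k * (N * ((q + 1) * (q + 1))))"
   unfolding residue_cost_def by (simp add: c_def q_def N_def)
  moreover have "c * (real seg_cost + 30) \<le> 3 * (m / (w * t)) * (3000000 * v)"
  proof (rule mult_mono)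
   show "real seg_cost + 30 \<le> 3000000 * v"
    using sg v kt by linarith
   show "0 \<le> 3 * (m / (w * t))"
    using c by (simp add: c_def)
  qed (use c in auto)
  moreover have "3 * (m / (w * t)) * (3000000 * v) = 9000000 * (kk ^ 2 * (m / w * Z))"
  proof -
   have "w \<noteq> 0" "t \<noteq> 0"
    using b b0 by auto
   then show ?thesis
    by (simp add: v_def kt_def power2_eq_square field_simps)
  qed
  moreover have "real k * (N * ((q + 1) * (q + 1))) \<le> 360000 * U"
  proof -
   \<comment> \<open>Both \<open>q\<close> and 1 are at most \<open>rr / w\<close>;
     \<open>(2 * 300)^2\<close> is the 360000 below.\<close>
   have "(q + 1) * (q + 1) \<le> (2 * (rr / w)) * (2 * (rr / w))"
    using q one by (intro mult_mono) auto
   also have "\<dots> = 360000 * (kk ^ 2 * (t * t) / (w * w))"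
    by (simp add: rr kt_def power2_eq_square field_simps)
   also have "\<dots> \<le> 360000 * (kk ^ 2 * m / (w * w))"
    using tt b by (intro mult_left_mono divide_right_mono) auto
   finally have F: "(q + 1) * (q + 1) \<le> 360000 * (kk ^ 2 * m / (w * w))" .
   have NF: "N * ((q + 1) * (q + 1)) \<le> N * (360000 * (kk ^ 2 * m / (w * w)))"
    using F b0(1) by (rule mult_left_mono)
   have "real k * (N * ((q + 1) * (q + 1))) \<le> kk * (N * (360000 * (kk ^ 2 * m / (w * w))))"
    by (rule mult_mono[OF b(6) NF]) (use b b0 q in auto)
   also have "\<dots> = 360000 * (kk ^ 3 * (m / w * (N / w)))"
    by (simp add: power2_eq_square power3_eq_cube divide_inverse ac_simps)
   also have "\<dots> \<le> 360000 * (kk ^ 3 * (m / w * Z))"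
    using Z k3 mw b by (intro mult_left_mono) auto
   finally show ?thesis
    by (simp add: U_def)
  qed
  ultimately show ?thesis
   using U1 by linarith
 qed
 have "real sieve_cost = 100 + w * (40 + real k * (105 + 30 * w)) + a * real residue_cost"
  unfolding sieve_cost_def of_nat_add of_nat_mult of_nat_numeral conv a_def[symmetric] by simp
 moreover have "w * (40 + real k * (105 + 30 * w)) \<le> 175 * kt"
 proof -
  have "w * (40 + real k * (105 + 30 * w)) = 40 * w + 105 * (real k * w) + 30 * (real k * (w * w))"
   by (simp add: algebra_simps)
  moreover have "real k * w \<le> kt" "real k * (w * w) \<le> kt"
   unfolding kt_def using b b0 ww by (auto intro!: mult_mono)
  ultimately show ?thesis
   using kt b by linarith
 qed
 moreover have "a * real residue_cost \<le> a * (100000000 * U)"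
  using rs b0 by (intro mult_left_mono) auto
 moreover have "a * (100000000 * U) = 100000000 * (kk ^ 3 * (m * (a / w * (1 + N / w))))"
  by (simp add: U_def Z_def divide_inverse ac_simps)
 ultimately have "real sieve_cost \<le> 300 * kt + 100000000 * (kk ^ 3 * (m * (a / w * (1 + N / w))))"
  using kt by linarith
 then show ?thesis
  by (simp add: defs kt_def)
qed

section \<open>Correctness and running time of the complete program\<close>

definition time_bound :: "int \<Rightarrow> int poly list \<Rightarrow> nat \<Rightarrow> int \<Rightarrow> nat \<Rightarrow> real \<Rightarrow> bool" where
 "time_bound K P n H d t \<longleftrightarrow> (\<exists>\<gamma> \<epsilon> \<rho>. (\<gamma>, \<epsilon>) \<in> forms \<and> coprime \<rho> (wheel d) \<and>
  t \<le> 2000 * (of_int K ^ 2 * of_int (H ^ 8)) + 100000000 * (of_int K ^ 3 * (real n * (real (card (allowed (set P) (wheel d))) / of_int (wheel d) *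
   (1 + real (card (reps_mod \<gamma> \<epsilon> \<rho> (wheel d))) / of_int (wheel d))))))"

context front
begin

lemma total_prefix:
 assumes "\<And>s'. var s' vn = int n \<Longrightarrow> var s' vk = int k \<Longrightarrow> var s' vK = K \<Longrightarrow> var s' vH = H \<Longrightarrow> outs s' = outs s \<Longrightarrow>
  clock s' \<le> clock s + 320 + 80 * k + 40 * nat H \<Longrightarrow> total d Q s'"
 shows "total (Input vn (N 0) ;; Input vk (N 1) ;; find_bound ;; find_root ;; d) Q s"
proof (rule total_Seq, rule total_Input, goal_cases)
 case 4
 show ?case
 proof (rule total_Seq, rule total_Input, goal_cases)
  case 4
  show ?case
  proof (rule total_Seq, rule total_conseq[OF total_find_bound], goal_cases)
   case 1
   show ?case
    using input input(3)[unfolded One_nat_def] by simp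
  next
   case (2 s1)
   have s1: "var s1 vn = int n" "var s1 vk = int k" "var s1 vK = K" "outs s1 = outs s" "clock s1 \<le> clock s + 204 + 80 * k"
    using 2 input input(3)[unfolded One_nat_def] by (auto simp: frame_def find_bound_def)
   show ?case
   proof (rule total_Seq, rule total_conseq[OF total_find_root[OF s1(1)]], goal_cases)
    case (1 s2)
    show ?case
    proof (rule assms)
     show "var s2 vn = int n" "var s2 vk = int k" "var s2 vK = K" "outs s2 = outs s"
      using 1(2) s1 by (simp_all add: frame_def find_root_def power_16_def)
     show "var s2 vH = H" "clock s2 \<le> clock s + 320 + 80 * k + 40 * nat H"
      using 1(1) s1(5) by simp_all
    qed
   qed
  qed
 qed (use input in auto)
qed (use input in auto)

lemma f_abs_le:
 assumes "i < k" "\<bar>x\<bar> \<le> X"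
 shows "\<bar>f i x\<bar> \<le> K * (X + 1)"
proof -
 have "\<bar>f i x\<bar> \<le> \<bar>coeff (P ! i) 1\<bar> * \<bar>x\<bar> + \<bar>coeff (P ! i) 0\<bar>"
  unfolding f_eq[OF assms(1)] by (metis abs_mult abs_triangle_ineq)
 also have "\<dots> \<le> K * X + K"
  using K_ge(1,2)[OF assms(1)] K_ge(4) assms(2) by (intro add_mono mult_mono) auto
 finally show ?thesis
  by (simp add: algebra_simps)
qed

text \<open>Only correctness is claimed: for a fixed pattern \<open>H < K\<close> leaves finitely
  many \<open>n\<close>, whose times go into the constant.\<close>

lemma total_main_small:
 assumes "H < K" "outs s = []"
 shows "total main (\<lambda>s'. set (outs s') = pattern_primes P n) s"
 unfolding main_def
proof (rule total_prefix, rule total_Seq, rule total_If, goal_cases)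
 case (2 s1)
 show ?case
 proof (rule total_Seq, rule total_Asg, goal_cases)
  case 3
  show ?case
  proof (rule total_Asg, goal_cases)
   case 3
   show ?case
   proof (rule total_Seq, rule total_conseq[OF total_naive_search[where X = "int n + K" and M = "K * (int n + 2 * K + 2)"]], goal_cases)
    case (7 i x)
    then have "\<bar>f i x\<bar> \<le> K * (int n + K + 1)"
     by (intro f_abs_le) auto
    also have "\<dots> \<le> K * (int n + 2 * K + 2)"
     using K_ge(4) by (intro mult_left_mono) auto
    finally show ?case .
   next
    case (9 s2)
    have "{x. x \<le> int n + K \<and> good x} = pattern_primes P n"
     using good_le(1) pattern_primes_eq by auto
    then have o2: "set (outs s2) = pattern_primes P n"
     using 9(1) 2 assms by simp
    have v2: "var s2 vW = 0"
     using 9(2) by (auto simp: frame_def program_defs)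
    show ?case
    proof (rule total_If, goal_cases)
     case 1
     show ?case
      by simp
    next
     case 2
     then have False
      using v2 by simp
     then show ?case ..
    next
     case 3
     show ?case
      by (rule total_Skip) (simp only: tick_simps o2)
    qed
   qed (use 2 K_big K_ge(4) in auto)
  qed (use 2 K_big K_ge(4) in auto)
 qed (use K_big K_ge(4) in auto)
qed (use assms in auto)

text \<open>Trial division treats about \<open>H^2\<close> arguments, with \<open>k\<close> values
  of size about \<open>K H^2\<close> each, hence time of order \<open>K^2 H^4\<close>; the bound by
  \<open>H^8\<close>, at most \<open>sqrt n\<close>, is generous.\<close>

lemma setup_cost_le:
 assumes W: "8 \<le> W" "W \<le> H" and KH: "K \<le> H"
  and c: "c \<le> 600 + 80 * k + 40 * nat H + nat H * (100 + 12 * nat H) +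
   nat (W * H + W + K + 1) * (50 + k * (12 * nat (K * (W * H + W + 1)) + 105))"
 shows "real c \<le> 1700 * (of_int K ^ 2 * of_int (H ^ 8))"
proof -
 define kk h w where "kk = real_of_int K" and "h = real_of_int H" and "w = real_of_int W"
 have b: "8 \<le> kk" "kk \<le> h" "8 \<le> w" "w \<le> h" "real k \<le> kk"
  using K_ge KH W by (simp_all add: kk_def h_def w_def)
 have WH: "0 \<le> W * H"
  using W by simp
 have KX: "0 \<le> K * (W * H + W + 1)"
  using WH W K_ge(4) by (intro mult_nonneg_nonneg) auto
 have conv: "real (nat H) = h" "real (nat (W * H + W + K + 1)) = w * h + w + kk + 1" "real (nat (K * (W * H + W + 1))) = kk * (w * h + w + 1)"
  using W K_ge(4) WH KX by (simp_all add: h_def w_def kk_def)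
 define s where "s = h ^ 2"
 have s: "h \<le> s" "1 \<le> s" "w * h \<le> s" "1 \<le> kk ^ 2" "kk \<le> kk ^ 2"
 proof -
  have "1 * h \<le> h * h" "w * h \<le> h * h"
   using b by (auto intro!: mult_right_mono)
  then show "h \<le> s" "w * h \<le> s" "1 \<le> s"
   unfolding s_def power2_eq_square using b by linarith+
  have "1 * kk \<le> kk * kk"
   using b by (intro mult_right_mono) auto
  then show "1 \<le> kk ^ 2" "kk \<le> kk ^ 2"
   unfolding power2_eq_square using b by linarith+
 qed
 define v where "v = kk ^ 2 * s"
 have v: "kk ^ 2 \<le> v" "s \<le> v"
  using mult_mono[of "kk ^ 2" "kk ^ 2" 1 s] mult_mono[of 1 "kk ^ 2" s s] s by (simp_all add: v_def)
 have "real c \<le> 600 + 80 * real k + 40 * h + h * (100 + 12 * h) + (w * h + w + kk + 1) * (50 + real k * (12 * (kk * (w * h + w + 1)) + 105))"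
 proof -
  have "real c \<le> real (600 + 80 * k + 40 * nat H + nat H * (100 + 12 * nat H) +
   nat (W * H + W + K + 1) * (50 + k * (12 * nat (K * (W * H + W + 1)) + 105)))"
   using c by (simp only: of_nat_le_iff)
  also have "\<dots> = 600 + 80 * real k + 40 * h + h * (100 + 12 * h) + (w * h + w + kk + 1) * (50 + real k * (12 * (kk * (w * h + w + 1)) + 105))"
   unfolding of_nat_add of_nat_mult of_nat_numeral conv by simp
  finally show ?thesis .
 qed
 also have "(w * h + w + kk + 1) * (50 + real k * (12 * (kk * (w * h + w + 1)) + 105)) \<le> (4 * s) * (200 * v)"
 proof (rule mult_mono)
  show "w * h + w + kk + 1 \<le> 4 * s"
   using s b by linarith
  have "real k * (12 * (kk * (w * h + w + 1)) + 105) \<le> kk * (12 * (kk * (3 * s)) + 105)"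
   using s b by (intro mult_mono add_mono) auto
  also have "\<dots> = 36 * v + 105 * kk"
   by (simp add: v_def power2_eq_square algebra_simps)
  finally show "50 + real k * (12 * (kk * (w * h + w + 1)) + 105) \<le> 200 * v"
   using s v b by linarith
  show "0 \<le> 4 * s" "0 \<le> 50 + real k * (12 * (kk * (w * h + w + 1)) + 105)"
   using s b by auto
 qed
 also have "h * (100 + 12 * h) = 100 * h + 12 * s"
  by (simp add: s_def power2_eq_square algebra_simps)
 finally have "real c \<le> 600 + 80 * real k + 40 * h + (100 * h + 12 * s) + 800 * (s * v)"
  by (simp add: mult.commute mult.left_commute)
 moreover have "v \<le> s * v"
  using mult_mono[of 1 s v v] s v by simp
 moreover have "s * v \<le> kk ^ 2 * h ^ 8"
 proof -
  have "s * v = kk ^ 2 * h ^ 4"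
   by (simp add: s_def v_def flip: power_add)
  also have "\<dots> \<le> kk ^ 2 * h ^ 8"
   using b by (intro mult_left_mono power_increasing) auto
  finally show ?thesis .
 qed
 ultimately have "real c \<le> 1700 * (kk ^ 2 * h ^ 8)"
  using s v b by linarith
 then show ?thesis
  by (simp add: kk_def h_def)
qed

lemma total_main_large:
 assumes KH: "K \<le> H" and s0: "outs s = []" "clock s = 0"
  and base: "int l \<le> 1700 * H * (2 * int k + 2)" "1700 * H * (2 * int k + 2) + int k * H ^ 8 \<le> int u"
  and big: "10 * (300 * (K * H ^ 8) * (300 * (K * H ^ 8)) + int u + int n) \<le> big"
 shows "total main (\<lambda>s'. set (outs s') = pattern_primes P n \<and>
  (\<exists>d\<ge>3. wheel d \<le> H \<and> H < wheel d * int d \<and> time_bound K P n H d (real (clock s')))) s"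
 unfolding main_def
proof (rule total_prefix, rule total_Seq, rule total_If, goal_cases)
 case (3 s1)
 have H8: "8 \<le> H"
  using KH K_ge(4) by linarith
 show ?case
 proof (rule total_Seq, rule total_conseq[OF total_find_wheel], goal_cases)
  case (3 s2)
  then obtain d where d: "3 \<le> d" "var s2 vW = wheel d" "wheel d \<le> H" "H < wheel d * int d"
   by blast
  define W where "W = wheel d"
  have Wd: "8 \<le> W" "W \<le> H" "0 < W" "8 dvd W"
   using wheel_ge_8[of d] d by (simp_all add: W_def wheel_def)
  have s2: "var s2 vn = int n" "var s2 vk = int k" "var s2 vK = K" "var s2 vH = H" "var s2 vW = W" "outs s2 = []"
    "clock s2 \<le> 500 + 80 * k + 40 * nat H + nat H * (100 + 12 * nat H)"
   using 3 \<open>var s1 vn = int n\<close> \<open>var s1 vk = int k\<close> \<open>var s1 vK = K\<close> \<open>var s1 vH = H\<close> \<open>outs s1 = outs s\<close> \<open>clock s1 \<le> _\<close> d s0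
   by (auto simp: frame_def find_wheel_def trial_division_def W_def)
  obtain NN where NNf: "\<And>\<gamma> \<epsilon> \<rho>. (\<gamma>, \<epsilon>) \<in> forms \<Longrightarrow> coprime \<rho> W \<Longrightarrow> card (reps_mod \<gamma> \<epsilon> \<rho> W) \<le> NN"
    "\<exists>\<gamma> \<epsilon> \<rho>. (\<gamma>, \<epsilon>) \<in> forms \<and> coprime \<rho> W \<and> NN = card (reps_mod \<gamma> \<epsilon> \<rho> W)"
   using max_reps_mod[OF Wd(3)] by blast
  have HT: "H \<le> H ^ 8"
   using H8 power_increasing[of 1 8 H] by simp
  have nT: "int n \<le> 65536 * (H ^ 8 * H ^ 8)"
  proof -
   have "(H + 1) ^ 16 \<le> (2 * H) ^ 16"
    using H8 by (intro power_mono) auto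
   also have "\<dots> = 65536 * (H ^ 8 * H ^ 8)"
    by (simp add: power_mult_distrib flip: power_add)
   finally show ?thesis
    using H(3) by linarith
  qed
  interpret search k P n big l u K H W "H ^ 8" "1700 * H * (2 * int k + 2)" "300 * (K * H ^ 8)" NN
   by unfold_locales (use KH Wd HT nT base big NNf(1) in auto)
  define X where "X = W * H + W"
  have WH: "W * 1 \<le> W * H" "W * H \<le> H * H" "8 * H \<le> W * H"
   using Wd H8 by (auto intro!: mult_left_mono mult_right_mono)
  have HH: "H * H \<le> H ^ 8"
   using H8 power_increasing[of 2 8 H] by (simp add: power2_eq_square)
  have X: "K \<le> X" "X \<le> 2 * H ^ 8" "0 \<le> X"
   using WH HH Wd H8 KH unfolding X_def by linarith+
  have Xb: "- K \<le> X" "X + 1 \<le> big"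
   using X big_bounds basic K_ge(4) by linarith+
  have M: "K * (X + 1) \<le> big"
  proof -
   have "K * (X + 1) \<le> K * (3 * H ^ 8)"
    using X basic K_ge(4) by (intro mult_left_mono) auto
   also have "\<dots> \<le> 300 * (K * H ^ 8)"
    using basic by simp
   finally show ?thesis
    using big_bounds basic by linarith
  qed
  show ?case
  proof (rule total_Asg, goal_cases)
   case 3
   show ?case
   proof (rule total_Seq, rule total_conseq[OF total_naive_search[where X = X and M = "K * (X + 1)"]], goal_cases)
    case (7 i x)
    then show ?case
     using X by (intro f_abs_le) auto
   next
    case (9 s3)
    have s3: "var s3 vn = int n" "var s3 vk = int k" "var s3 vK = K" "var s3 vH = H" "var s3 vW = W"
     using 9(2) s2 by (auto simp: frame_def program_defs)
    have o3: "set (outs s3) = {x. x \<le> X \<and> good x}"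
     using 9(1) s2 by simp
    have "clock s3 \<le> clock s2 + 26 + nat (X + K + 1) * (50 + k * (12 * nat (K * (X + 1)) + 105))"
     using 9(1) by simp
    then have c3: "real (clock s3 + 5) \<le> 1700 * (of_int K ^ 2 * of_int (H ^ 8))"
     using s2(7) by (intro setup_cost_le[OF Wd(1,2) KH]) (simp add: X_def)
    show ?case
    proof (rule total_If, goal_cases)
     case 2
     show ?case
     proof (rule total_conseq[OF total_sieve], goal_cases)
      case (8 s4)
      \<comment> \<open>The two searches overlap; every \<open>y > W * H + W\<close> is past the
        start of its own class, so nothing is missed.\<close>
      have "{x. x \<le> X \<and> good x} \<union> {y. y mod W + W * H \<le> y \<and> good y} = pattern_primes P n"
      proof -
       have "y mod W + W * H \<le> y" if "\<not> y \<le> X" for y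
        using that pos_mod_bound[OF Wd(3), of y] unfolding X_def by linarith
       then show ?thesis
        using pattern_primes_eq by auto
      qed
      then have "set (outs s4) = pattern_primes P n"
       using 8(1) o3 by simp
      moreover have "time_bound K P n H d (real (clock s4))"
      proof -
       have "real (clock s4) \<le> real (clock s3 + 5) + real sieve_cost"
        using 8(1) by simp
       also have "\<dots> \<le> 2000 * (of_int K ^ 2 * of_int (H ^ 8)) +
         100000000 * (of_int K ^ 3 * (real n * (real (card (allowed (set P) W)) / of_int W * (1 + real NN / of_int W))))"
       proof -
        have "of_int K * of_int (H ^ 8) \<le> real_of_int K ^ 2 * of_int (H ^ 8)"
         using K_ge(4) H8 by (intro mult_right_mono) (auto simp: power2_eq_square mult_le_cancel_left1)
        then show ?thesis
         using c3 sieve_cost_le[OF refl H(2)] by linarith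
       qed
       finally show ?thesis
        using NNf(2) unfolding time_bound_def W_def by blast
      qed
      ultimately show ?case
       using d by blast
     qed (use s3 in auto)
    next
     case 3
     then show ?case
      using s3 Wd by simp
    qed auto
   qed (use s2 Xb M in \<open>simp_all add: X_def\<close>)
  next
   case 2
   have "X \<le> big"
    using X big_bounds basic by linarith
   then show ?case
    using s2 X by (simp add: X_def)
  qed auto
 qed (use 3 H8 in auto)
qed (use KH in auto)

end

text \<open>Variables get 20 powers of \<open>B\<close>. Products of three variables and the few
  sums around them, as in the form and in the clearing of squares, reach little more than 60, so 80
  is enough.\<close>

lemma small_main: "small 20 80 main"
 by (simp add: program_defs floorlog_small)

section \<open>From the structured program to the machine\<close>

definition solver :: program where
 "solver = code 0 main @ [Halt]"

text \<open>The \<open>H\<close> and \<open>d\<close> of the run are kept inside, so that the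
  asymptotic estimate becomes a statement free of the machine. Nothing is said about
  \<open>t\<close> while \<open>H\<close> is below the pattern bound.\<close>

definition time_ok :: "nat \<Rightarrow> int poly list \<Rightarrow> nat \<Rightarrow> nat \<Rightarrow> bool" where
 "time_ok k P n t \<longleftrightarrow> (\<exists>H. 0 \<le> H \<and> H ^ 16 \<le> int n \<and> int n < (H + 1) ^ 16 \<and>
  (pattern_bound k P \<le> H \<longrightarrow>
   (\<exists>d\<ge>3. wheel d \<le> H \<and> H < wheel d * int d \<and> time_bound (pattern_bound k P) P n H d (real t))))"

lemma time_bound_mono: "time_bound K P n H d t \<Longrightarrow> t' \<le> t \<Longrightarrow> time_bound K P n H d t'"
 unfolding time_bound_def using order_trans[of t' t] by blast

lemma root_16_exists: "\<exists>h :: nat. h ^ 16 \<le> n \<and> n < (h + 1) ^ 16"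
proof -
 define h where "h = (GREATEST h :: nat. h ^ 16 \<le> n)"
 have b: "y \<le> n" if "y ^ 16 \<le> n" for y :: nat
 proof (cases "y = 0")
  case False
  then have "y \<le> y ^ 16"
   by (intro self_le_power) auto
  with that show ?thesis
   by linarith
 qed simp
 have "h ^ 16 \<le> n"
  unfolding h_def by (rule GreatestI_nat[where k = 0 and b = n]) (use b in auto)
 moreover have "\<not> (h + 1) ^ 16 \<le> n"
 proof
  assume "(h + 1) ^ 16 \<le> n"
  then have "h + 1 \<le> h"
   unfolding h_def using b by (intro Greatest_le_nat[where b = n]) auto
  then show False
   by simp
 qed
 ultimately show ?thesis
  by (intro exI[of _ h]) simp
qed

text \<open>\<open>B = 2^M\<close> with \<open>M\<close> the largest binary length of an input;
  intermediate values stay within \<open>B^80\<close>, that is \<open>80 * M\<close> bits, against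
  words of \<open>100 * M\<close> bits. The space claim concerns coefficients up to
  \<open>n\<close>, where \<open>M\<close> is logarithmic in \<open>n\<close>.\<close>

lemma solver_correct:
 assumes P: "is_pattern k P" and w: "w = word_size 100 (pattern_input k P n)"
 shows "\<exists>t s. halts w solver (pattern_input k P n) t s \<and> set (out s) = pattern_primes P n \<and> time_ok k P n t \<and>
  (1 \<le> n \<and> (\<forall>g\<in>set P. \<forall>i. \<bar>coeff g i\<bar> \<le> int n) \<longrightarrow>
   real (used s) \<le> 7000 * (real k * sqrt (real n)) \<and> real w \<le> 900 * sqrt (real n))"
proof -
 define xs where "xs = pattern_input k P n"
 define M where "M = Max ((\<lambda>v. floorlog 2 (nat \<bar>v\<bar>)) ` set xs)"
 define B :: int where "B = 2 ^ M"
 define K where "K = pattern_bound k P"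
 have len: "length P = k" "0 < k"
  using P by (simp_all add: is_pattern_def)
 note nth = pattern_input_nth[OF len(1)]
 have wM: "w = 100 * M"
  by (simp add: w word_size_def M_def xs_def)
 have mem: "int n \<in> set xs" "int k \<in> set xs"
  by (simp_all add: xs_def pattern_input_def)
 have lenxs: "length xs = 2 + 2 * k"
  using nth(1) by (simp add: xs_def)
 have xs_cases: "x = int n \<or> \<bar>x\<bar> \<le> K" if x_in: "x \<in> set xs" for x
 proof -
  have "\<exists>j. j < 2 + 2 * k \<and> x = xs ! j"
   using x_in unfolding in_set_conv_nth lenxs by blast
  then obtain j where j: "j < 2 + 2 * k" "x = xs ! j"
   by blast
  consider "j = 0" | "j = 1" | "2 \<le> j"
   by linarith
  then show ?thesis
  proof cases
   case 1
   then show ?thesis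
    using j nth(2) by (simp add: xs_def)
  next
   case 2
   then have "x = int k"
    using j nth(3)[of n] by (simp only: xs_def)
   then show ?thesis
    using pattern_bound_ge(2)[of k P] by (simp add: K_def)
  next
   case 3
   then have "x = pattern_input k P 0 ! j"
    using j pattern_input_ge_2[of j k P n] by (simp only: xs_def)
   then show ?thesis
    using pattern_bound_ge(3)[OF 3 j(1), of P] by (simp add: K_def)
  qed
 qed
 have xB: "\<bar>x\<bar> < B" if "x \<in> set xs" for x
 proof -
  have "floorlog 2 (nat \<bar>x\<bar>) \<le> M"
   unfolding M_def using that by (intro Max_ge) auto
  then have "nat \<bar>x\<bar> < 2 ^ M"
   by (rule floorlog_leD) simp
  then have "int (nat \<bar>x\<bar>) < int (2 ^ M)"
   by (simp only: of_nat_less_iff)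
  then show ?thesis
   by (simp add: B_def)
 qed
 have M1: "1 \<le> M"
 proof (rule ccontr)
  assume "\<not> 1 \<le> M"
  then have "B = 1"
   by (simp add: B_def)
  then show False
   using xB[OF mem(2)] len by simp
 qed
 obtain x where x: "x \<in> set xs" "2 ^ (M - 1) \<le> nat \<bar>x\<bar>"
 proof -
  have "M \<in> (\<lambda>v. floorlog 2 (nat \<bar>v\<bar>)) ` set xs"
   unfolding M_def using mem by (intro Max_in) auto
  then obtain x where x: "x \<in> set xs" "M = floorlog 2 (nat \<bar>x\<bar>)"
   by blast
  then have "0 < nat \<bar>x\<bar>"
   using M1 by (cases "nat \<bar>x\<bar> = 0") (auto simp: floorlog_def)
  then have "2 ^ (M - 1) \<le> nat \<bar>x\<bar>"
   using floorlog_bounds[of "nat \<bar>x\<bar>" 2] x by simp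
  with x that show thesis
   by blast
 qed
 have B2: "2 \<le> B"
  using power_increasing[OF M1, of "2 :: int"] by (simp add: B_def)
 have nB: "int n < B" "int k < B"
  using xB[OF mem(1)] xB[OF mem(2)] by simp_all
 \<comment> \<open>The factor 4 accounts for the constant 8 in \<open>pattern_bound\<close> when all
   inputs are tiny and \<open>B\<close> is only 2.\<close>
 have K4: "K \<le> 4 * B"
 proof -
  have "\<bar>pattern_input k P 0 ! j\<bar> \<le> 4 * B" if "2 \<le> j" "j < 2 + 2 * k" for j
  proof -
   have "xs ! j \<in> set xs"
    using that lenxs by simp
   then have "\<bar>pattern_input k P 0 ! j\<bar> < B"
    using xB[of "xs ! j"] pattern_input_ge_2[OF that(1), of k P n] by (simp add: xs_def)
   then show ?thesis
    using B2 by linarith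
  qed
  then show ?thesis
   unfolding K_def pattern_bound_def using B2 nB by (intro Max.boundedI) auto
 qed
 have K8: "8 \<le> K" "int k \<le> K"
  using pattern_bound_ge by (simp_all add: K_def)
 obtain h where h: "h ^ 16 \<le> n" "n < (h + 1) ^ 16"
  using root_16_exists by blast
 define H where "H = int h"
 have H: "0 \<le> H" "H ^ 16 \<le> int n" "int n < (H + 1) ^ 16"
 proof -
  have "int (h ^ 16) \<le> int n" "int n < int ((h + 1) ^ 16)"
   using h by (simp_all only: of_nat_le_iff of_nat_less_iff)
  then show "H ^ 16 \<le> int n" "int n < (H + 1) ^ 16"
   by (simp_all add: H_def add.commute)
 qed (simp add: H_def)
 have pow: "2 ^ a \<le> B ^ a" for a
  using B2 by (intro power_mono) auto
 have BI: "B ^ a \<le> B ^ 20" if "a \<le> 20" for a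
  using B2 that by (intro power_increasing) auto
 have b1: "(H + 1) ^ 16 \<le> B ^ 20"
 proof (cases "H = 0")
  case True
  then show ?thesis
   using BI[of 0] by simp
 next
  case False
  then have "(H + 1) ^ 16 \<le> (2 * H) ^ 16"
   using H by (intro power_mono) auto
  also have "\<dots> = 2 ^ 16 * H ^ 16"
   by (rule power_mult_distrib)
  also have "\<dots> \<le> B ^ 16 * B"
   using pow[of 16] H nB B2 by (intro mult_mono) auto
  also have "\<dots> = B ^ (16 + 1)"
   by (simp only: power_add power_one_right)
  also have "\<dots> \<le> B ^ 20"
   by (rule BI) simp
  finally show ?thesis .
 qed
 have b2: "100 * (K * (int n + 2 * K + 2)) \<le> B ^ 20"
 proof -
  have "K * (int n + 2 * K + 2) \<le> (4 * B) * (10 * B)"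
   using K4 K8 nB B2 by (intro mult_mono) auto
  then have "100 * (K * (int n + 2 * K + 2)) \<le> 4000 * (B * B)"
   by simp
  also have "\<dots> \<le> B ^ 12 * (B * B)"
   using pow[of 12] B2 by (intro mult_right_mono) auto
  also have "\<dots> = B ^ 14"
   by (simp flip: power_add power2_eq_square)
  finally show ?thesis
   using BI[of 14] by simp
 qed
 have front: "front k P n (B ^ 20) H"
 proof (unfold_locales)
  show "is_pattern k P" "0 \<le> H" "H ^ 16 \<le> int n" "int n < (H + 1) ^ 16" "(H + 1) ^ 16 \<le> B ^ 20"
   "100 * (pattern_bound k P * (int n + 2 * pattern_bound k P + 2)) \<le> B ^ 20"
   "int k \<le> pattern_bound k P" "8 \<le> pattern_bound k P"
   using P H b1 b2 K8 by (simp_all add: K_def)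
  fix i assume i: "i < k"
  have "\<bar>pattern_input k P 0 ! (2 + 2 * i)\<bar> \<le> pattern_bound k P"
   using i by (intro pattern_bound_ge(3)) linarith+
  then show "\<bar>coeff (P ! i) 1\<bar> \<le> pattern_bound k P"
   unfolding nth(4)[OF i] .
  have "\<bar>pattern_input k P 0 ! (3 + 2 * i)\<bar> \<le> pattern_bound k P"
   using i by (intro pattern_bound_ge(3)) linarith+
  then show "\<bar>coeff (P ! i) 0\<bar> \<le> pattern_bound k P"
   unfolding nth(5)[OF i] .
 qed
 have fits: "Defs.fits w v" if "\<bar>v\<bar> \<le> B ^ 80" for v
 proof -
  have "B ^ 80 = 2 ^ (M * 80)"
   by (simp add: B_def flip: power_mult)
  also have "\<dots> < (2 :: int) ^ (w - 1)"
   using M1 wM by (intro power_strict_increasing) auto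
  finally show ?thesis
   using that unfolding Defs.fits_def by linarith
 qed
 have ram: "ram (pattern_input k P n) (B ^ 20) l w B 20 80" if "w * length xs \<le> l" for l
 proof (unfold_locales)
  show "2 \<le> B" "B ^ 20 \<le> B ^ 20" "1 \<le> B ^ 20" "(20 :: nat) \<le> 80" "0 < w"
   using B2 BI[of 0] M1 wM by simp_all
  show "\<bar>x\<bar> \<le> B ^ 20" if "x \<in> set (pattern_input k P n)" for x
   using xB[of x] BI[of 1] that by (simp add: xs_def)
  show "Defs.fits w v" if "\<bar>v\<bar> \<le> B ^ 80" for v
   using fits that .
  show "w * length (pattern_input k P n) \<le> l"
   using that by (simp add: xs_def)
 qed
 define l where "l = w * length xs"
 have k1: "1 \<le> real k"
  using len by simp
 have space: "real l \<le> 3600 * (real k * sqrt (real n)) \<and> real w \<le> 900 * sqrt (real n)"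
  if n: "1 \<le> n" and c: "\<forall>g\<in>set P. \<forall>i. \<bar>coeff g i\<bar> \<le> int n"
 proof -
  have k9: "k \<le> 9 * n ^ 2"
   using card_linear_polys[OF P c n] .
  have n9: "n \<le> 9 * n ^ 2"
   using n by (simp add: power2_eq_square)
  have "nat \<bar>x\<bar> \<le> 9 * n ^ 2"
  proof -
   have "x = int n \<or> x = int k \<or> (\<exists>g\<in>set P. x = coeff g 1 \<or> x = coeff g 0)"
    using x(1) by (auto simp: xs_def pattern_input_def)
   then have "nat \<bar>x\<bar> \<le> n \<or> nat \<bar>x\<bar> \<le> k"
    using c by (auto simp: nat_le_iff)
   then show ?thesis
    using k9 n9 by linarith
  qed
  then have "2 ^ (M - 1) \<le> 9 * n ^ 2"
   using x(2) by linarith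
  from log_le_sqrt[OF this n] have Ms: "real M \<le> 9 * sqrt (real n)"
   using M1 by simp
  then have ws: "real w \<le> 900 * sqrt (real n)"
   by (simp add: wM)
  have "real l = real w * (2 + 2 * real k)"
   by (simp add: l_def lenxs algebra_simps)
  also have "\<dots> \<le> (900 * sqrt (real n)) * (4 * real k)"
   using ws k1 by (intro mult_mono) auto
  also have "\<dots> = 3600 * (real k * sqrt (real n))"
   by (simp add: algebra_simps)
  finally show ?thesis
   using ws by blast
 qed
 show ?thesis
 proof (cases "H < K")
  case True
  interpret F: front k P n "B ^ 20" l l H
   by (rule front)
  interpret R: ram "pattern_input k P n" "B ^ 20" l l w B 20 80
   by (rule ram) (simp add: l_def)
  have "F.total main (\<lambda>s'. set (outs s') = pattern_primes P n)
    \<lparr>var = \<lambda>_. 0, bits = mem (init w (pattern_input k P n)), outs = [], clock = 0\<rparr>"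
   using True by (intro F.total_main_small) (simp_all add: K_def)
  note ex = R.total_halts[OF this small_main]
  obtain t m and s :: state where h: "halts w (code 0 main @ [Halt]) (pattern_input k P n) t m \<and> set (outs s) = pattern_primes P n \<and>
    out m = outs s \<and> t \<le> clock s \<and> used m \<le> max l l"
   using ex by (elim exE) (rule that, assumption)
  note h2 = conjunct2[OF h] and h3 = conjunct2[OF conjunct2[OF h]]
  have tm: "halts w solver (pattern_input k P n) t m" "set (out m) = pattern_primes P n" "used m \<le> l"
   unfolding solver_def using conjunct1[OF h] conjunct1[OF h2] conjunct1[OF h3] conjunct2[OF conjunct2[OF h3]]
   by (simp_all only: max.idem)
  have "time_ok k P n t"
   unfolding time_ok_def using True H by (intro exI[of _ H]) (auto simp: K_def)
  moreover have "real (used m) \<le> 7000 * (real k * sqrt (real n)) \<and> real w \<le> 900 * sqrt (real n)"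
   if "1 \<le> n" "\<forall>g\<in>set P. \<forall>i. \<bar>coeff g i\<bar> \<le> int n"
  proof -
   have "0 \<le> real k * sqrt (real n)" "real (used m) \<le> real l"
    using tm by simp_all
   then show ?thesis
    using space[OF that] by linarith
  qed
  ultimately show ?thesis
   using tm(1,2) by (intro exI[of _ t] exI[of _ m]) (simp | blast)
 next
  case False
  then have KH: "K \<le> H"
   by simp
  have H8: "8 \<le> H"
   using KH K8 by linarith
  have HP: "H ^ a \<le> int n" if "a \<le> 16" for a
  proof -
   have "H ^ a \<le> H ^ 16"
    using H8 that by (intro power_increasing) auto
   then show ?thesis
    using H(2) by linarith
  qed
  define u where "u = nat (1700 * H * (2 * int k + 2) + int k * H ^ 8)"
  have u: "int u = 1700 * H * (2 * int k + 2) + int k * H ^ 8"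
   using H8 by (simp add: u_def)
  have "nat \<bar>x\<bar> \<le> n"
   using xs_cases[OF x(1)] KH HP[of 1] by (auto simp: nat_le_iff)
  then have "2 ^ (M - 1) \<le> n"
   using x(2) by linarith
  also have "n < (h + 1) ^ 16"
   by (rule h)
  \<comment> \<open>The crude \<open>h + 1 \<le> 2 ^ h\<close> bounds the binary length of the input
    by \<open>17 * h\<close>; this is the 17 in \<open>1700 = 100 * 17\<close>.\<close>
  also have "(h + 1) ^ 16 \<le> (2 ^ h) ^ 16"
  proof (rule power_mono)
   have "h < 2 ^ h"
    by (rule less_exp)
   then show "h + 1 \<le> 2 ^ h"
    by linarith
  qed simp
  also have "\<dots> = (2 :: nat) ^ (h * 16)"
   by (simp flip: power_mult)
  finally have "M - 1 < h * 16"
   by simp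
  then have M16: "M \<le> 17 * h"
   by linarith
  have l_le: "int l \<le> 1700 * H * (2 * int k + 2)"
  proof -
   have "l = 100 * M * (2 + 2 * k)"
    by (simp add: l_def lenxs wM algebra_simps)
   also have "\<dots> \<le> 100 * (17 * h) * (2 + 2 * k)"
    using M16 by (intro mult_right_mono mult_left_mono) auto
   finally have "int l \<le> int (100 * (17 * h) * (2 + 2 * k))"
    by (simp only: of_nat_le_iff)
   also have "\<dots> = 1700 * H * (2 * int k + 2)"
    by (simp add: H_def algebra_simps)
   finally show ?thesis .
  qed
  have kH: "int k \<le> H"
   using K8 KH by linarith
  have big: "10 * (300 * (K * H ^ 8) * (300 * (K * H ^ 8)) + int u + int n) \<le> B ^ 20"
  proof -
   define m where "m = int n"
   \<comment> \<open>In this case \<open>n\<close> is at least \<open>8^16\<close>, so one factor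
     \<open>n\<close> absorbs all numerical constants.\<close>
   have m1: "1000000 \<le> m"
   proof -
    have "(8 :: int) ^ 16 \<le> H ^ 16"
     using H8 by (intro power_mono) auto
    then show ?thesis
     using H(2) by (simp add: m_def)
   qed
   have "K * K \<le> H ^ 2"
    unfolding power2_eq_square using KH K8 by (intro mult_mono) auto
   then have "K * K \<le> m"
    using HP[of 2] unfolding m_def by simp
   moreover have "H ^ 8 * H ^ 8 \<le> m"
    using H(2) by (simp add: m_def flip: power_add)
   ultimately have KKm: "K * K * (H ^ 8 * H ^ 8) \<le> m * m"
    by (rule mult_mono) (use H8 m1 in auto)
   have eq: "300 * (a * b) * (300 * (a * b)) = 90000 * (a * a * (b * b))" for a b :: int
    by simp
   have 1: "300 * (K * H ^ 8) * (300 * (K * H ^ 8)) \<le> 90000 * (m * m)"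
    unfolding eq using KKm by (rule mult_left_mono) simp
   have 2: "int u \<le> 6801 * m"
   proof -
    have "1700 * H * (2 * int k + 2) \<le> 1700 * H * (4 * H)"
     using kH H8 by (intro mult_left_mono) auto
    also have "\<dots> = 6800 * H ^ 2"
     by (simp add: power2_eq_square)
    also have "\<dots> \<le> 6800 * m"
     using HP[of 2] by (simp add: m_def)
    finally have "1700 * H * (2 * int k + 2) \<le> 6800 * m" .
    moreover have "int k * H ^ 8 \<le> H * H ^ 8"
     using kH H8 by (intro mult_right_mono) auto
    moreover have "H * H ^ 8 \<le> m"
     using HP[of "1 + 8"] unfolding power_add power_one_right m_def by simp
    ultimately show ?thesis
     using u by linarith
   qed
   have mm: "m \<le> m * m"
    using m1 by (simp add: mult_le_cancel_left1)
   have "300 * (K * H ^ 8) * (300 * (K * H ^ 8)) + int u + int n \<le> 96802 * (m * m)"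
   proof -
    have "int u \<le> 6801 * (m * m)" "int n \<le> m * m"
     using 2 mm unfolding m_def by linarith+
    with 1 show ?thesis
     by linarith
   qed
   then have "10 * (300 * (K * H ^ 8) * (300 * (K * H ^ 8)) + int u + int n) \<le> 10 * (96802 * (m * m))"
    by (rule mult_left_mono) simp
   also have "\<dots> \<le> 1000000 * (m * m)"
    using mm m1 by linarith
   also have "\<dots> \<le> m * (m * m)"
    using m1 by (intro mult_right_mono) auto
   also have "\<dots> = m ^ 3"
    by (simp add: power3_eq_cube)
   also have "\<dots> \<le> B ^ 3"
    using nB m1 by (intro power_mono) (auto simp: m_def)
   also have "\<dots> \<le> B ^ 20"
    by (rule BI) simp
   finally show ?thesis .
  qed
  interpret F: front k P n "B ^ 20" l u H
   by (rule front)
  interpret R: ram "pattern_input k P n" "B ^ 20" l u w B 20 80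
   by (rule ram) (simp add: l_def)
  have "F.total main (\<lambda>s'. set (outs s') = pattern_primes P n \<and>
    (\<exists>d\<ge>3. wheel d \<le> H \<and> H < wheel d * int d \<and> time_bound (pattern_bound k P) P n H d (real (clock s'))))
    \<lparr>var = \<lambda>_. 0, bits = mem (init w (pattern_input k P n)), outs = [], clock = 0\<rparr>"
  proof (rule F.total_main_large)
   show "pattern_bound k P \<le> H"
    using KH by (simp only: K_def)
   show "int l \<le> 1700 * H * (2 * int k + 2)"
    by (rule l_le)
   show "1700 * H * (2 * int k + 2) + int k * H ^ 8 \<le> int u"
    unfolding u by (rule order_refl)
   show "10 * (300 * (pattern_bound k P * H ^ 8) * (300 * (pattern_bound k P * H ^ 8)) + int u + int n) \<le> B ^ 20"
    using big unfolding K_def .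
  qed simp_all
  note ex = R.total_halts[OF this small_main]
  obtain t m and s :: state where h: "halts w (code 0 main @ [Halt]) (pattern_input k P n) t m \<and> (set (outs s) = pattern_primes P n \<and>
    (\<exists>d\<ge>3. wheel d \<le> H \<and> H < wheel d * int d \<and> time_bound (pattern_bound k P) P n H d (real (clock s)))) \<and>
    out m = outs s \<and> t \<le> clock s \<and> used m \<le> max l u"
   using ex by (elim exE) (rule that, assumption)
  note h2 = conjunct1[OF conjunct2[OF h]] and h3 = conjunct2[OF conjunct2[OF h]]
  obtain d where d: "3 \<le> d" "wheel d \<le> H" "H < wheel d * int d" "time_bound (pattern_bound k P) P n H d (real (clock s))"
   using conjunct2[OF h2] by (elim exE conjE) (rule that; assumption)
  have "halts w solver (pattern_input k P n) t m" "set (out m) = pattern_primes P n" "used m \<le> max l u" "t \<le> clock s"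
   unfolding solver_def using conjunct1[OF h] conjunct1[OF h2] conjunct1[OF h3] conjunct2[OF h3] by (simp_all only:)
  note tm = this d
  have "time_bound (pattern_bound k P) P n H d (real t)"
   using time_bound_mono[OF tm(8)] tm(4) by simp
  then have "time_ok k P n t"
   unfolding time_ok_def using tm H by (intro exI[of _ H]) auto
  moreover have "real (used m) \<le> 7000 * (real k * sqrt (real n)) \<and> real w \<le> 900 * sqrt (real n)"
   if "1 \<le> n" "\<forall>g\<in>set P. \<forall>i. \<bar>coeff g i\<bar> \<le> int n"
  proof -
   have T: "real_of_int (H ^ 8) \<le> sqrt (real n)"
   proof (rule real_le_rsqrt)
    have "(H ^ 8) ^ 2 = H ^ 16"
     by (simp flip: power_mult)
    then have "real_of_int ((H ^ 8) ^ 2) \<le> real_of_int (int n)"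
     using H(2) by (simp only: of_int_le_iff)
    then show "(real_of_int (H ^ 8))\<^sup>2 \<le> real n"
     by simp
   qed
   have "H ^ 1 \<le> H ^ 8"
    using H8 by (intro power_increasing) auto
   then have "real_of_int H \<le> real_of_int (H ^ 8)"
    by (simp only: of_int_le_iff power_one_right)
   then have HT: "real_of_int H \<le> sqrt (real n)"
    using T by linarith
   have "real u = real_of_int (int u)"
    by simp
   also have "\<dots> = 1700 * real_of_int H * (2 * real k + 2) + real k * real_of_int (H ^ 8)"
    unfolding u by simp
   also have "\<dots> \<le> 1700 * sqrt (real n) * (4 * real k) + real k * sqrt (real n)"
    using HT T H8 k1 by (intro add_mono mult_mono) auto
   also have "\<dots> = 6801 * (real k * sqrt (real n))"
    by simp
   finally have "real u \<le> 6801 * (real k * sqrt (real n))" .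
   moreover have "0 \<le> real k * sqrt (real n)" "real (used m) \<le> max (real l) (real u)"
    using tm(3) by (simp_all add: le_max_iff_disj)
   ultimately show ?thesis
    using space[OF that] by linarith
  qed
  ultimately show ?thesis
   using tm(1,2) by (intro exI[of _ t] exI[of _ m]) (simp | blast)
 qed
qed

text \<open>Beyond a threshold depending on the pattern, \<open>H\<close> reaches the pattern bound
  and \<open>d\<close> the threshold of the density theorem. The residue \<open>\<rho>\<close>
  supplied by \<open>time_bound\<close> is coprime to the wheel, so that theorem applies, and
  \<open>ln (ln n) \<le> 6 * ln d\<close> trades \<open>(ln d)^k\<close> for the required power at
  the price of \<open>6^k\<close>.\<close>

lemma time_ok_growth:
 assumes P: "is_pattern k P"
 shows "\<exists>C N0. \<forall>n t. N0 \<le> n \<longrightarrow> time_ok k P n t \<longrightarrow> real t \<le> C * (real n / ln (ln (real n)) ^ k)"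
proof -
 define K where "K = real_of_int (pattern_bound k P)"
 have K8: "8 \<le> K"
  using pattern_bound_ge(1)[of k P] by (simp add: K_def)
 have Pk: "finite (set P)" "set P \<noteq> {}" "card (set P) = k" "0 < k"
  using P by (auto simp: is_pattern_def distinct_card)
 have lin: "degree f = 1 \<and> 0 < coeff f 1" if "f \<in> set P" for f
 proof -
  have "degree f = 1" "0 < lead_coeff f"
   using P that unfolding is_pattern_def by blast+
  then show ?thesis
   by simp
 qed
 have "\<exists>C\<ge>0. \<exists>y0\<ge>3. \<forall>y\<ge>y0.
  real (card (allowed (set P) (wheel y))) \<le> C * real_of_int (wheel y) / ln (real y) ^ card (set P) \<and>
  (\<forall>\<gamma> \<epsilon> \<rho>. (\<gamma>, \<epsilon>) \<in> forms \<longrightarrow> coprime \<rho> (wheel y) \<longrightarrow>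
   real (card (allowed (set P) (wheel y))) * real (card (reps_mod \<gamma> \<epsilon> \<rho> (wheel y)))
    \<le> C * real_of_int (wheel y) * real_of_int (wheel y) / ln (real y) ^ card (set P))"
  by (rule wheel_density) (fact Pk(1), fact Pk(2), rule lin)
 note density = this[unfolded Pk(3)]
 obtain C y where C: "0 \<le> C" "3 \<le> y" and dens: "\<And>d. y \<le> d \<Longrightarrow>
   real (card (allowed (set P) (wheel d))) \<le> C * real_of_int (wheel d) / ln (real d) ^ k \<and>
   (\<forall>\<gamma> \<epsilon> \<rho>. (\<gamma>, \<epsilon>) \<in> forms \<longrightarrow> coprime \<rho> (wheel d) \<longrightarrow>
    real (card (allowed (set P) (wheel d))) * real (card (reps_mod \<gamma> \<epsilon> \<rho> (wheel d))) \<le>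
    C * real_of_int (wheel d) * real_of_int (wheel d) / ln (real d) ^ k)"
  using density by blast
 \<comment> \<open>The two powers are the values of \<open>n\<close> from which \<open>H\<close>
   cannot lie below the pattern bound and \<open>d\<close> cannot lie below
   \<open>y\<close>.\<close>
 define N0 where "N0 = 3 + nat (pattern_bound k P ^ 16) + nat ((8 * int y ^ y * int y) ^ 16)"
 define c2 where "c2 = (2 * real k) ^ k"
 define D where "D = 2000 * K ^ 2 * c2 + 200000000 * K ^ 3 * C * 6 ^ k"
 have "real t \<le> D * (real n / ln (ln (real n)) ^ k)" if n: "N0 \<le> n" and t: "time_ok k P n t" for n t
 proof -
  obtain H where H: "0 \<le> H" "H ^ 16 \<le> int n" "int n < (H + 1) ^ 16"
    "pattern_bound k P \<le> H \<longrightarrow> (\<exists>d\<ge>3. wheel d \<le> H \<and> H < wheel d * int d \<and> time_bound (pattern_bound k P) P n H d (real t))"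
   using t unfolding time_ok_def by blast
  have n3: "3 \<le> n"
   using n by (simp add: N0_def)
  have np: "pattern_bound k P ^ 16 \<le> int n" "(8 * int y ^ y * int y) ^ 16 \<le> int n"
  proof -
   have "nat (pattern_bound k P ^ 16) \<le> n" "nat ((8 * int y ^ y * int y) ^ 16) \<le> n"
    using n unfolding N0_def by linarith+
   then show "pattern_bound k P ^ 16 \<le> int n" "(8 * int y ^ y * int y) ^ 16 \<le> int n"
    unfolding nat_le_iff .
  qed
  have "pattern_bound k P \<le> H"
  proof (rule ccontr)
   assume "\<not> pattern_bound k P \<le> H"
   then have "(H + 1) ^ 16 \<le> pattern_bound k P ^ 16"
    using H(1) by (intro power_mono) auto
   with np H(3) show False
    by linarith
  qed
  then obtain d where d: "3 \<le> d" "wheel d \<le> H" "H < wheel d * int d" "time_bound (pattern_bound k P) P n H d (real t)"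
   using H(4) by blast
  have yd: "y \<le> d"
  proof (rule ccontr)
   assume "\<not> y \<le> d"
   then have dy: "d \<le> y"
    by simp
   have "wheel d * int d \<le> 8 * int d ^ d * int d"
    using wheel_le[OF d(1)] by (intro mult_right_mono) auto
   also have "\<dots> \<le> 8 * int y ^ y * int y"
   proof -
    have "int d ^ d \<le> int y ^ d"
     using dy by (intro power_mono) auto
    also have "\<dots> \<le> int y ^ y"
     using dy C(2) by (intro power_increasing) auto
    finally show ?thesis
     using dy by (intro mult_mono) auto
   qed
   finally have "H + 1 \<le> 8 * int y ^ y * int y"
    using d(3) by linarith
   then have "(H + 1) ^ 16 \<le> (8 * int y ^ y * int y) ^ 16"
    using H(1) by (intro power_mono) auto
   with np H(3) show False
    by linarith
  qed
  define W where "W = real_of_int (wheel d)"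
  define A where "A = real (card (allowed (set P) (wheel d)))"
  have W: "0 < W"
   using wheel_pos[of d] by (simp add: W_def)
  obtain \<gamma> \<epsilon> \<rho> where g: "(\<gamma>, \<epsilon>) \<in> forms" "coprime \<rho> (wheel d)"
    "real t \<le> 2000 * (K ^ 2 * of_int (H ^ 8)) + 100000000 * (K ^ 3 * (real n * (A / W * (1 + real (card (reps_mod \<gamma> \<epsilon> \<rho> (wheel d))) / W))))"
   using d(4) unfolding time_bound_def K_def A_def W_def by blast
  define N where "N = real (card (reps_mod \<gamma> \<epsilon> \<rho> (wheel d)))"
  define L where "L = ln (real d) ^ k"
  define LL where "LL = ln (ln (real n)) ^ k"
  have ld: "0 < ln (real d)"
   using d(1) by simp
  have L: "0 < L"
   using ld by (simp add: L_def)
  have LL: "0 < LL"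
   using ln_ln_pos[OF n3] by (simp add: LL_def)
  have LL_le: "LL \<le> 6 ^ k * L"
  proof -
   have "LL \<le> (6 * ln (real d)) ^ k"
    unfolding LL_def using ln_ln_le[OF d(1,3) H(1,3) n3] ln_ln_pos[OF n3] by (intro power_mono) auto
   then show ?thesis
    by (simp add: L_def power_mult_distrib)
  qed
  have A: "A \<le> C * W / L" "A * N \<le> C * W * W / L"
   using dens[OF yd] g(1,2) unfolding A_def W_def N_def L_def by blast+
  have "A / W * (1 + N / W) = A / W + A * N / (W * W)"
   by (simp only: distrib_left mult_1_right times_divide_times_eq)
  also have "\<dots> \<le> C / L + C / L"
  proof (rule add_mono)
   have "A / W \<le> C * W / L / W"
    using A(1) W by (intro divide_right_mono) auto
   also have "\<dots> = C / L"
    using W by simp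
   finally show "A / W \<le> C / L" .
   have "A * N / (W * W) \<le> C * W * W / L / (W * W)"
    using A(2) W by (intro divide_right_mono) auto
   also have "\<dots> = C / L"
    using W by simp
   finally show "A * N / (W * W) \<le> C / L" .
  qed
  also have "\<dots> = 2 * (C / L)"
   by simp
  also have "\<dots> \<le> 2 * (C * 6 ^ k / LL)"
  proof -
   have "LL / 6 ^ k \<le> L"
    using LL_le by (simp add: pos_divide_le_eq mult.commute)
   then have "C / L \<le> C / (LL / 6 ^ k)"
    using C(1) L LL by (intro divide_left_mono) auto
   then show ?thesis
    by simp
  qed
  finally have main: "A / W * (1 + N / W) \<le> 2 * (C * 6 ^ k / LL)" .
  have T: "real_of_int (H ^ 8) \<le> sqrt (real n)"
  proof (rule real_le_rsqrt)
   have "(H ^ 8) ^ 2 = H ^ 16"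
    by (simp flip: power_mult)
   then have "real_of_int ((H ^ 8) ^ 2) \<le> real_of_int (int n)"
    using H(2) by (simp only: of_int_le_iff)
   then show "(real_of_int (H ^ 8))\<^sup>2 \<le> real n"
    by simp
  qed
  have sq: "sqrt (real n) \<le> c2 * (real n / LL)"
  proof -
   have "sqrt (real n) * LL \<le> sqrt (real n) * (c2 * sqrt (real n))"
    unfolding LL_def c2_def by (intro mult_left_mono ln_ln_power_le n3 Pk(4)) simp
   also have "\<dots> = c2 * (sqrt (real n) * sqrt (real n))"
    by (simp only: mult.left_commute)
   also have "\<dots> = c2 * real n"
    by simp
   finally show ?thesis
    by (simp add: pos_le_divide_eq[OF LL])
  qed
  have T2: "real_of_int (H ^ 8) \<le> c2 * (real n / LL)"
   using T sq by linarith
  have x1: "K ^ 2 * real_of_int (H ^ 8) \<le> K ^ 2 * (c2 * (real n / LL))"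
   using T2 by (rule mult_left_mono) simp
  have "real n * (A / W * (1 + N / W)) \<le> real n * (2 * (C * 6 ^ k / LL))"
   using main by (rule mult_left_mono) simp
  then have x2: "K ^ 3 * (real n * (A / W * (1 + N / W))) \<le> K ^ 3 * (real n * (2 * (C * 6 ^ k / LL)))"
   by (rule mult_left_mono) (use K8 in simp)
  have "real t \<le> 2000 * (K ^ 2 * of_int (H ^ 8)) + 100000000 * (K ^ 3 * (real n * (A / W * (1 + N / W))))"
   using g(3) by (simp only: N_def)
  also have "\<dots> \<le> 2000 * (K ^ 2 * (c2 * (real n / LL))) + 100000000 * (K ^ 3 * (real n * (2 * (C * 6 ^ k / LL))))"
   by (rule add_mono) (rule mult_left_mono[OF x1], simp, rule mult_left_mono[OF x2], simp)
  also have "\<dots> = D * (real n / LL)"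
   by (simp add: D_def divide_inverse algebra_simps)
  finally show ?thesis
   by (simp add: LL_def)
 qed
 then show ?thesis
  by blast
qed

theorem theorem1p2:
 "\<exists>(p :: program) (c :: nat) (C\<^sub>T :: int poly list \<Rightarrow> real) (C\<^sub>S :: real). 2 \<le> c \<and>
  (\<forall>(k :: nat) (P :: int poly list) (n :: nat). is_pattern k P \<longrightarrow>
   (let xs = pattern_input k P n; w = word_size c xs in
    \<exists>t s. halts w p xs t s \<and>
     set (out s) = pattern_primes P n \<and>
     (3 \<le> n \<longrightarrow> real t \<le> C\<^sub>T P * (real n / ln (ln (real n)) ^ k)) \<and>
     (1 \<le> n \<and> (\<forall>f\<in>set P. \<forall>i. \<bar>coeff f i\<bar> \<le> int n) \<longrightarrow>
      real (space_bits w p s) \<le> C\<^sub>S * (real k * sqrt (real n)))))"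
proof -
 define good where "good P n t s \<longleftrightarrow> (let k = length P; xs = pattern_input k P n; w = word_size 100 xs in
  halts w solver xs t s \<and> set (out s) = pattern_primes P n \<and> time_ok k P n t \<and>
  (1 \<le> n \<and> (\<forall>g\<in>set P. \<forall>i. \<bar>coeff g i\<bar> \<le> int n) \<longrightarrow>
   real (used s) \<le> 7000 * (real k * sqrt (real n)) \<and> real w \<le> 900 * sqrt (real n)))" for P n t s
 \<comment> \<open>The number of steps comes existentially for each input; choosing one makes it a
   function of \<open>n\<close>, to which the absorption of finitely many \<open>n\<close>
   applies.\<close>
 define tf where "tf P n = (SOME t. \<exists>s. good P n t s)" for P n
 define g where "g k n = real n / ln (ln (real n)) ^ k" for k n
 \<comment> \<open>The constant is chosen for the pattern alone, with \<open>k\<close> recovered as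
   its length.\<close>
 define CT where "CT P = (SOME C. \<forall>n\<ge>3. real (tf P n) \<le> C * g (length P) n)" for P
 \<comment> \<open>The program is fixed, so the registers take a constant number of words, each of
   at most \<open>900 * sqrt n\<close> bits under the hypothesis of the space claim.\<close>
 define r where "r = real (card (\<Union> (registers ` set solver)))"
 have lenP: "length P = k" if "is_pattern k P" for k P
  using that by (simp add: is_pattern_def)
 have tf: "\<exists>s. good P n (tf P n) s" if P: "is_pattern k P" for k P n
 proof -
  have "\<exists>t s. good P n t s"
   using solver_correct[OF P refl, of n] lenP[OF P] by (simp add: good_def Let_def)
  then show ?thesis
   unfolding tf_def by (rule someI_ex)
 qed
 have CT: "\<forall>n\<ge>3. real (tf P n) \<le> CT P * g k n" if P: "is_pattern k P" for k P
 proof -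
  obtain C N0 where C: "\<And>n t. N0 \<le> n \<Longrightarrow> time_ok k P n t \<Longrightarrow> real t \<le> C * g k n"
   using time_ok_growth[OF P] unfolding g_def by blast
  have "time_ok k P n (tf P n)" for n
   using tf[OF P, of n] lenP[OF P] by (auto simp: good_def Let_def)
  then have "\<exists>C. \<forall>n\<ge>3. real (tf P n) \<le> C * g k n"
   by (intro absorb_finite[where ?N0.0 = N0 and C = C and t = "\<lambda>n. real (tf P n)" and g = "g k"] C)
    (auto simp: g_def intro!: divide_pos_pos zero_less_power ln_ln_pos)
  then have "\<exists>C. \<forall>n\<ge>3. real (tf P n) \<le> C * g (length P) n"
   by (simp add: lenP[OF P])
  then have "\<forall>n\<ge>3. real (tf P n) \<le> CT P * g (length P) n"
   unfolding CT_def by (rule someI_ex)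
  then show ?thesis
   by (simp add: lenP[OF P])
 qed
 have "let xs = pattern_input k P n; w = word_size 100 xs in
    \<exists>t s. halts w solver xs t s \<and> set (out s) = pattern_primes P n \<and>
     (3 \<le> n \<longrightarrow> real t \<le> CT P * (real n / ln (ln (real n)) ^ k)) \<and>
     (1 \<le> n \<and> (\<forall>f\<in>set P. \<forall>i. \<bar>coeff f i\<bar> \<le> int n) \<longrightarrow>
      real (space_bits w solver s) \<le> (7000 + 900 * r) * (real k * sqrt (real n)))" if P: "is_pattern k P" for k P n
 proof -
  define w where "w = word_size 100 (pattern_input k P n)"
  obtain s where s: "halts w solver (pattern_input k P n) (tf P n) s" "set (out s) = pattern_primes P n"
    "1 \<le> n \<and> (\<forall>g\<in>set P. \<forall>i. \<bar>coeff g i\<bar> \<le> int n) \<longrightarrow>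
     real (used s) \<le> 7000 * (real k * sqrt (real n)) \<and> real w \<le> 900 * sqrt (real n)"
   using tf[OF P, of n] lenP[OF P] by (auto simp: good_def Let_def w_def)
  have "real (space_bits w solver s) \<le> (7000 + 900 * r) * (real k * sqrt (real n))"
   if "1 \<le> n \<and> (\<forall>f\<in>set P. \<forall>i. \<bar>coeff f i\<bar> \<le> int n)"
  proof -
   have u: "real (used s) \<le> 7000 * (real k * sqrt (real n))" "real w \<le> 900 * sqrt (real n)"
    using s(3) that by blast+
   have "1 \<le> real k"
    using P by (simp add: is_pattern_def)
   then have "1 * sqrt (real n) \<le> real k * sqrt (real n)"
    by (intro mult_right_mono) auto
   then have "real w \<le> 900 * (real k * sqrt (real n))"
    using u(2) by linarith
   then have "real w * r \<le> 900 * (real k * sqrt (real n)) * r"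
    by (rule mult_right_mono) (simp add: r_def)
   moreover have "real (space_bits w solver s) = real (used s) + real w * r"
    by (simp add: space_bits_def r_def)
   moreover have "(7000 + 900 * r) * (real k * sqrt (real n)) = 7000 * (real k * sqrt (real n)) + 900 * (real k * sqrt (real n)) * r"
    by (simp add: algebra_simps)
   ultimately show ?thesis
    using u(1) by linarith
  qed
  moreover have "3 \<le> n \<longrightarrow> real (tf P n) \<le> CT P * (real n / ln (ln (real n)) ^ k)"
   using CT[OF P] by (simp add: g_def)
  ultimately show ?thesis
   unfolding Let_def w_def[symmetric] using s(1,2) by blast
 qed
 then show ?thesis
  by (intro exI[of _ solver] exI[of _ "100 :: nat"] exI[of _ CT] exI[of _ "7000 + 900 * r"]) auto
qed

end
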